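(* Let $k$ be a field. If $\Lambda$ is a Frobenius $k$-algebra with a Nakayama automorphism $\nu$, and $B$ is a finitely generated $\Lambda$-$\Lambda$-bimodule, then there are isomorphisms of vector spaces $$\widehat{\mathrm{HH}}_n(\Lambda,B) \cong \widehat{\mathrm{Tor}}^{\Lambda^{e}}_{-(n+1)}\left(\Lambda, {}_{\nu^{-1}}D(B)_1\right),$$ $$\widehat{\mathrm{HH}}^n(\Lambda,B) \cong \widehat{\mathrm{Ext}}_{\Lambda^{e}}^{-(n+1)}\left(B, {}_{\nu^2}\Lambda_1\right)$$ for all $n\in\mathbb{Z}$. In particular, there are isomorphisms $$\widehat{\mathrm{HH}}_n(\Lambda,\Lambda) \cong \widehat{\mathrm{HH}}_{-(n+1)}(\Lambda,\Lambda),$$ $$\widehat{\mathrm{HH}}^n(\Lambda,\Lambda) \cong \widehat{\mathrm{HH}}^{-(n+1)}\left(\Lambda, {}_{\nu^2}\Lambda_1\right)$$ for all $n\in\mathbb{Z}$.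
   Context: $D(-)=\mathrm{Hom}_k(-,k)$. A finite dimensional $k$-algebra $\Lambda$ is Frobenius if there is an isomorphism $\phi\colon\Lambda\to D(\Lambda)$ of left $\Lambda$-modules; the corresponding Nakayama automorphism $\nu$ is the $k$-algebra automorphism of $\Lambda$ defined by $\phi(1)(\lambda x)=\phi(1)(\nu(x)\lambda)$ for all $\lambda,x\in\Lambda$. For automorphisms $f,g$ of $\Lambda$ and a bimodule $B$, ${}_fB_g$ is the bimodule with underlying space $B$ and actions $\lambda\cdot b\cdot\lambda'=f(\lambda)\,b\,g(\lambda')$; a subscript $1$ denotes the identity automorphism. $\Lambda^e=\Lambda\otimes_k\Lambda^{op}$; a bimodule $B$ is a left $\Lambda^e$-module via $(\lambda\otimes\lambda')b=\lambda b\lambda'$ and a right $\Lambda^e$-module via $b(\lambda\otimes\lambda')=\lambda'b\lambda$. If $\Lambda$ is Frobenius, then $\Lambda^e$ is Frobenius, in particular selfinjective. Over a finite dimensional selfinjective algebra $\Gamma$, every finitely generated left module $M$ has a complete resolution: an acyclic complex $\mathbb{T}$ of finitely generated projective modules, indexed by $\mathbb{Z}$, such that $\mathrm{Hom}_\Gamma(\mathbb{T},\Gamma)$ is acyclic and such that there are a projective resolution $\mathbb{P}$ of $M$ and a chain map $f\colon\mathbb{T}\to\mathbb{P}$ with $f_n$ bijective for $n\ge 0$. For $n\in\mathbb{Z}$ one sets $\widehat{\mathrm{Ext}}^n_\Gamma(M,N)=H^n(\mathrm{Hom}_\Gamma(\mathbb{T},N))$ for left modules $N$ and $\widehat{\mathrm{Tor}}^\Gamma_n(N,M)=H_n(N\otimes_\Gamma\mathbb{T})$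 for right modules $N$. The Tate-Hochschild groups are $\widehat{\mathrm{HH}}^n(\Lambda,B)=\widehat{\mathrm{Ext}}^n_{\Lambda^e}(\Lambda,B)$ and $\widehat{\mathrm{HH}}_n(\Lambda,B)=\widehat{\mathrm{Tor}}^{\Lambda^e}_n(B,\Lambda)$. *)

theory Defs
  imports "HOL-Algebra.Module" "HOL-Algebra.QuotRing" "HOL-Library.FuncSet"
begin

section \<open>Modules over arbitrary rings\<close>

text \<open>
  The locale \<^locale>\<open>module\<close> of the library requires a commutative ring of scalars, so left modules
  over an arbitrary ring are introduced here, on the same record type.  As everywhere in
  HOL-Algebra, the fields \<open>mult\<close> and \<open>one\<close> of a module carry no information.
\<close>

locale lmodule = R?: ring R + M?: abelian_group M for R (structure) and M (structure) +
  assumes smult_closed: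
      "\<lbrakk>a \<in> carrier R; x \<in> carrier M\<rbrakk> \<Longrightarrow> a \<odot>\<^bsub>M\<^esub> x \<in> carrier M"
    and smult_l_distr:
      "\<lbrakk>a \<in> carrier R; b \<in> carrier R; x \<in> carrier M\<rbrakk> \<Longrightarrow>
       (a \<oplus> b) \<odot>\<^bsub>M\<^esub> x = a \<odot>\<^bsub>M\<^esub> x \<oplus>\<^bsub>M\<^esub> b \<odot>\<^bsub>M\<^esub> x"
    and smult_r_distr:
      "\<lbrakk>a \<in> carrier R; x \<in> carrier M; y \<in> carrier M\<rbrakk> \<Longrightarrow>
       a \<odot>\<^bsub>M\<^esub> (x \<oplus>\<^bsub>M\<^esub> y) = a \<odot>\<^bsub>M\<^esub> x \<oplus>\<^bsub>M\<^esub> a \<odot>\<^bsub>M\<^esub> y"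
    and smult_assoc1:
      "\<lbrakk>a \<in> carrier R; b \<in> carrier R; x \<in> carrier M\<rbrakk> \<Longrightarrow>
       (a \<otimes> b) \<odot>\<^bsub>M\<^esub> x = a \<odot>\<^bsub>M\<^esub> (b \<odot>\<^bsub>M\<^esub> x)"
    and smult_one: "x \<in> carrier M \<Longrightarrow> \<one> \<odot>\<^bsub>M\<^esub> x = x"

definition with_smult :: "('m, 'z) ring_scheme \<Rightarrow> ('r \<Rightarrow> 'm \<Rightarrow> 'm) \<Rightarrow> ('r, 'm) module" where
  "with_smult M act =
     \<lparr>carrier = carrier M, mult = mult M, one = one M, zero = zero M, add = add M, smult = act\<rparr>"

definition self_module :: "('r, 'z) ring_scheme \<Rightarrow> ('r, 'r) module" where
  "self_module R = with_smult R (mult R)"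

definition lin_map ::
    "('r, 'y) ring_scheme \<Rightarrow> ('r, 'm, 'z) module_scheme \<Rightarrow> ('r, 'n, 'w) module_scheme
      \<Rightarrow> ('m \<Rightarrow> 'n) \<Rightarrow> bool" where
  "lin_map R M N h \<longleftrightarrow>
     h \<in> carrier M \<rightarrow> carrier N \<and>
     (\<forall>x\<in>carrier M. \<forall>y\<in>carrier M. h (x \<oplus>\<^bsub>M\<^esub> y) = h x \<oplus>\<^bsub>N\<^esub> h y) \<and>
     (\<forall>r\<in>carrier R. \<forall>x\<in>carrier M. h (r \<odot>\<^bsub>M\<^esub> x) = r \<odot>\<^bsub>N\<^esub> h x)"

definition lin_iso ::
    "('r, 'y) ring_scheme \<Rightarrow> ('r, 'm, 'z) module_scheme \<Rightarrow> ('r, 'n, 'w) module_scheme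
      \<Rightarrow> ('m \<Rightarrow> 'n) \<Rightarrow> bool" where
  "lin_iso R M N h \<longleftrightarrow> lin_map R M N h \<and> bij_betw h (carrier M) (carrier N)"

definition isomorphic ::
    "('r, 'y) ring_scheme \<Rightarrow> ('r, 'm, 'z) module_scheme \<Rightarrow> ('r, 'n, 'w) module_scheme \<Rightarrow> bool" where
  "isomorphic R M N \<longleftrightarrow> (\<exists>h. lin_iso R M N h)"

definition fin_gen :: "('r, 'y) ring_scheme \<Rightarrow> ('r, 'm, 'z) module_scheme \<Rightarrow> bool" where
  "fin_gen R M \<longleftrightarrow>
     (\<exists>S. finite S \<and> S \<subseteq> carrier M \<and>
        (\<forall>x\<in>carrier M. \<exists>c \<in> S \<rightarrow> carrier R. x = (\<Oplus>\<^bsub>M\<^esub>s\<in>S. c s \<odot>\<^bsub>M\<^esub> s)))"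

definition free_module :: "('r, 'y) ring_scheme \<Rightarrow> 's set \<Rightarrow> ('r, 's \<Rightarrow> 'r) module" where
  "free_module R S =
     \<lparr>carrier = {p. (\<forall>s. p s \<in> carrier R) \<and> (\<forall>s. s \<notin> S \<longrightarrow> p s = \<zero>\<^bsub>R\<^esub>) \<and> finite {s. p s \<noteq> \<zero>\<^bsub>R\<^esub>}},
      mult = undefined, one = undefined,
      zero = (\<lambda>s. \<zero>\<^bsub>R\<^esub>),
      add = (\<lambda>p q s. p s \<oplus>\<^bsub>R\<^esub> q s),
      smult = (\<lambda>r p s. r \<otimes>\<^bsub>R\<^esub> p s)\<rparr>"

definition basis_elt :: "('r, 'y) ring_scheme \<Rightarrow> 's \<Rightarrow> ('s \<Rightarrow> 'r)" where
  "basis_elt R s = (\<lambda>t. if t = s then \<one>\<^bsub>R\<^esub> else \<zero>\<^bsub>R\<^esub>)"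

text \<open>
  Projective means direct summand of a free module.  A projective module \<open>P\<close> is in particular a
  direct summand of the free module on its own carrier, so it is no restriction that the index set
  of the free module lives in the type of the elements of \<open>P\<close>.
\<close>

definition projective :: "('r, 'y) ring_scheme \<Rightarrow> ('r, 'm) module \<Rightarrow> bool" where
  "projective R P \<longleftrightarrow>
     lmodule R P \<and>
     (\<exists>(S :: 'm set) i p. lin_map R P (free_module R S) i \<and> lin_map R (free_module R S) P p \<and>
        (\<forall>x\<in>carrier P. p (i x) = x))"

definition quot_module :: "('r, 'm, 'z) module_scheme \<Rightarrow> 'm set \<Rightarrow> ('r, 'm set) module" where
  "quot_module V W =
     \<lparr>carrier = a_rcosets\<^bsub>V\<^esub> W,
      mult = undefined, one = undefined,
      zero = W,
      add = (\<lambda>X Y. X <+>\<^bsub>V\<^esub> Y),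
      smult = (\<lambda>r X. \<Union>x\<in>X. W +>\<^bsub>V\<^esub> (r \<odot>\<^bsub>V\<^esub> x))\<rparr>"

text \<open>
  A module over a \<open>K\<close>-algebra \<open>\<Gamma>\<close> is a vector space via \<open>c m = (c 1) m\<close>.  For a central \<open>c 1\<close> this
  makes sense for right modules as well.
\<close>

definition scal :: "('k, 'g, 'y) module_scheme \<Rightarrow> ('g, 'm, 'z) module_scheme \<Rightarrow> 'k \<Rightarrow> 'm \<Rightarrow> 'm" where
  "scal \<Gamma> M c x = (c \<odot>\<^bsub>\<Gamma>\<^esub> \<one>\<^bsub>\<Gamma>\<^esub>) \<odot>\<^bsub>M\<^esub> x"

definition hom_space ::
    "('k, 'g, 'y) module_scheme \<Rightarrow> ('g, 'm, 'z) module_scheme \<Rightarrow> ('g, 'n, 'w) module_scheme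
      \<Rightarrow> ('k, 'm \<Rightarrow> 'n) module" where
  "hom_space \<Gamma> M N =
     \<lparr>carrier = {h \<in> extensional (carrier M). lin_map \<Gamma> M N h},
      mult = undefined, one = undefined,
      zero = (\<lambda>x\<in>carrier M. \<zero>\<^bsub>N\<^esub>),
      add = (\<lambda>f g. \<lambda>x\<in>carrier M. f x \<oplus>\<^bsub>N\<^esub> g x),
      smult = (\<lambda>c f. \<lambda>x\<in>carrier M. scal \<Gamma> N c (f x))\<rparr>"


section \<open>Tensor products\<close>

text \<open>
  Right modules use the same record type as left modules: for a right module \<open>N\<close>, the term
  \<open>smult N \<gamma> x\<close> denotes \<open>x \<gamma>\<close>.  The tensor product of a right module \<open>N\<close> and a left module \<open>M\<close>
  over a \<open>K\<close>-algebra \<open>\<Gamma>\<close> is the free vector space on \<open>N \<times> M\<close> modulo the subspace generated by the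
  usual relations.
\<close>

definition tensor_rels ::
    "('k, 'y) ring_scheme \<Rightarrow> ('k, 'g, 'x) module_scheme \<Rightarrow> ('g, 'n, 'z) module_scheme
      \<Rightarrow> ('g, 'm, 'w) module_scheme \<Rightarrow> ('n \<times> 'm \<Rightarrow> 'k) set" where
  "tensor_rels K \<Gamma> N M =
    (let F = free_module K (carrier N \<times> carrier M); e = basis_elt K in
       {e (x \<oplus>\<^bsub>N\<^esub> x', y) \<ominus>\<^bsub>F\<^esub> (e (x, y) \<oplus>\<^bsub>F\<^esub> e (x', y)) | x x' y.
          x \<in> carrier N \<and> x' \<in> carrier N \<and> y \<in> carrier M} \<union>
       {e (x, y \<oplus>\<^bsub>M\<^esub> y') \<ominus>\<^bsub>F\<^esub> (e (x, y) \<oplus>\<^bsub>F\<^esub> e (x, y')) | x y y'.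
          x \<in> carrier N \<and> y \<in> carrier M \<and> y' \<in> carrier M} \<union>
       {e (scal \<Gamma> N c x, y) \<ominus>\<^bsub>F\<^esub> c \<odot>\<^bsub>F\<^esub> e (x, y) | c x y.
          c \<in> carrier K \<and> x \<in> carrier N \<and> y \<in> carrier M} \<union>
       {e (g \<odot>\<^bsub>N\<^esub> x, y) \<ominus>\<^bsub>F\<^esub> e (x, g \<odot>\<^bsub>M\<^esub> y) | g x y.
          g \<in> carrier \<Gamma> \<and> x \<in> carrier N \<and> y \<in> carrier M})"

definition tensor_ker ::
    "('k, 'y) ring_scheme \<Rightarrow> ('k, 'g, 'x) module_scheme \<Rightarrow> ('g, 'n, 'z) module_scheme
      \<Rightarrow> ('g, 'm, 'w) module_scheme \<Rightarrow> ('n \<times> 'm \<Rightarrow> 'k) set" where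
  "tensor_ker K \<Gamma> N M =
     \<Inter>{W. submodule W K (free_module K (carrier N \<times> carrier M)) \<and> tensor_rels K \<Gamma> N M \<subseteq> W}"

definition tensor ::
    "('k, 'y) ring_scheme \<Rightarrow> ('k, 'g, 'x) module_scheme \<Rightarrow> ('g, 'n, 'z) module_scheme
      \<Rightarrow> ('g, 'm, 'w) module_scheme \<Rightarrow> ('k, ('n \<times> 'm \<Rightarrow> 'k) set) module" where
  "tensor K \<Gamma> N M =
     quot_module (free_module K (carrier N \<times> carrier M)) (tensor_ker K \<Gamma> N M)"

definition pure_tensor ::
    "('k, 'y) ring_scheme \<Rightarrow> ('k, 'g, 'x) module_scheme \<Rightarrow> ('g, 'n, 'z) module_scheme
      \<Rightarrow> ('g, 'm, 'w) module_scheme \<Rightarrow> 'n \<Rightarrow> 'm \<Rightarrow> ('n \<times> 'm \<Rightarrow> 'k) set" where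
  "pure_tensor K \<Gamma> N M x y =
     tensor_ker K \<Gamma> N M +>\<^bsub>free_module K (carrier N \<times> carrier M)\<^esub> basis_elt K (x, y)"

text \<open>
  The linear map on a tensor product with \<open>x \<otimes> y \<mapsto> f (x, y)\<close>, for a bilinear balanced \<open>f\<close> with
  values in the vector space \<open>V\<close>: the value on a coset is computed on any of its representatives.
\<close>

definition tensor_lift ::
    "('k, 'y) ring_scheme \<Rightarrow> ('k, 'v, 'z) module_scheme \<Rightarrow> ('n \<times> 'm \<Rightarrow> 'v)
      \<Rightarrow> ('n \<times> 'm \<Rightarrow> 'k) set \<Rightarrow> 'v" where
  "tensor_lift K V f X =
     (let p = (SOME p. p \<in> X) in \<Oplus>\<^bsub>V\<^esub>u\<in>{u. p u \<noteq> \<zero>\<^bsub>K\<^esub>}. p u \<odot>\<^bsub>V\<^esub> f u)"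


section \<open>Algebras and bimodules\<close>

locale k_algebra = K?: field K + A?: ring A + module K A for K (structure) and A (structure) +
  assumes smult_mult_left:
      "\<lbrakk>c \<in> carrier K; x \<in> carrier A; y \<in> carrier A\<rbrakk> \<Longrightarrow>
       (c \<odot>\<^bsub>A\<^esub> x) \<otimes>\<^bsub>A\<^esub> y = c \<odot>\<^bsub>A\<^esub> (x \<otimes>\<^bsub>A\<^esub> y)"
    and smult_mult_right:
      "\<lbrakk>c \<in> carrier K; x \<in> carrier A; y \<in> carrier A\<rbrakk> \<Longrightarrow>
       x \<otimes>\<^bsub>A\<^esub> (c \<odot>\<^bsub>A\<^esub> y) = c \<odot>\<^bsub>A\<^esub> (x \<otimes>\<^bsub>A\<^esub> y)"

record ('k, 'a, 'b) bimod = "('k, 'b) module" +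
  lact :: "'a \<Rightarrow> 'b \<Rightarrow> 'b"
  ract :: "'b \<Rightarrow> 'a \<Rightarrow> 'b"

locale bimodule = k_algebra K A + B?: module K B
  for K (structure) and A (structure) and B (structure) +
  assumes lact_lin: "a \<in> carrier A \<Longrightarrow> lin_map K B B (lact B a)"
    and lact_add:
      "\<lbrakk>a \<in> carrier A; a' \<in> carrier A; b \<in> carrier B\<rbrakk> \<Longrightarrow>
       lact B (a \<oplus>\<^bsub>A\<^esub> a') b = lact B a b \<oplus>\<^bsub>B\<^esub> lact B a' b"
    and lact_smult:
      "\<lbrakk>c \<in> carrier K; a \<in> carrier A; b \<in> carrier B\<rbrakk> \<Longrightarrow>
       lact B (c \<odot>\<^bsub>A\<^esub> a) b = c \<odot>\<^bsub>B\<^esub> lact B a b"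
    and lact_mult:
      "\<lbrakk>a \<in> carrier A; a' \<in> carrier A; b \<in> carrier B\<rbrakk> \<Longrightarrow>
       lact B (a \<otimes>\<^bsub>A\<^esub> a') b = lact B a (lact B a' b)"
    and lact_one: "b \<in> carrier B \<Longrightarrow> lact B \<one>\<^bsub>A\<^esub> b = b"
    and ract_lin: "a \<in> carrier A \<Longrightarrow> lin_map K B B (\<lambda>b. ract B b a)"
    and ract_add:
      "\<lbrakk>a \<in> carrier A; a' \<in> carrier A; b \<in> carrier B\<rbrakk> \<Longrightarrow>
       ract B b (a \<oplus>\<^bsub>A\<^esub> a') = ract B b a \<oplus>\<^bsub>B\<^esub> ract B b a'"
    and ract_smult:
      "\<lbrakk>c \<in> carrier K; a \<in> carrier A; b \<in> carrier B\<rbrakk> \<Longrightarrow>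
       ract B b (c \<odot>\<^bsub>A\<^esub> a) = c \<odot>\<^bsub>B\<^esub> ract B b a"
    and ract_mult:
      "\<lbrakk>a \<in> carrier A; a' \<in> carrier A; b \<in> carrier B\<rbrakk> \<Longrightarrow>
       ract B b (a \<otimes>\<^bsub>A\<^esub> a') = ract B (ract B b a) a'"
    and ract_one: "b \<in> carrier B \<Longrightarrow> ract B b \<one>\<^bsub>A\<^esub> = b"
    and lact_ract:
      "\<lbrakk>a \<in> carrier A; a' \<in> carrier A; b \<in> carrier B\<rbrakk> \<Longrightarrow>
       ract B (lact B a b) a' = lact B a (ract B b a')"

definition regular :: "('k, 'a) module \<Rightarrow> ('k, 'a, 'a) bimod" where
  "regular A = module.extend A (bimod.fields (mult A) (mult A))"

text \<open>\<open>D(B) = Hom\<^sub>K(B, K)\<close> with \<open>(a f)(b) = f (b a)\<close> and \<open>(f a)(b) = f (a b)\<close>.\<close>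

definition dual :: "'k ring \<Rightarrow> ('k, 'a, 'b) bimod \<Rightarrow> ('k, 'a, 'b \<Rightarrow> 'k) bimod" where
  "dual K B =
     module.extend (hom_space (self_module K) B (self_module K))
       (bimod.fields (\<lambda>a f. \<lambda>b\<in>carrier B. f (ract B b a)) (\<lambda>f a. \<lambda>b\<in>carrier B. f (lact B a b)))"

definition twist :: "('a \<Rightarrow> 'a) \<Rightarrow> ('a \<Rightarrow> 'a) \<Rightarrow> ('k, 'a, 'b) bimod \<Rightarrow> ('k, 'a, 'b) bimod" where
  "twist f g B = B\<lparr>lact := \<lambda>a b. lact B (f a) b, ract := \<lambda>b a. ract B b (g a)\<rparr>"

definition left_module :: "('k, 'a, 'b) bimod \<Rightarrow> ('a, 'b) module" where
  "left_module B = with_smult B (lact B)"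


section \<open>The enveloping algebra\<close>

type_synonym ('k, 'a) env_elt = "('a \<times> 'a \<Rightarrow> 'k) set"

text \<open>
  \<open>\<Lambda> \<otimes>\<^sub>K \<Lambda>\<^sup>o\<^sup>p\<close>, with \<open>(a \<otimes> b) (c \<otimes> d) = a c \<otimes> d b\<close>, the product in the second factor being written
  in \<open>\<Lambda>\<close>.
\<close>

abbreviation env_space :: "'k ring \<Rightarrow> ('k, 'a) module \<Rightarrow> ('k, ('k, 'a) env_elt) module" where
  "env_space K A \<equiv> tensor K (self_module K) A A"

abbreviation env_pure :: "'k ring \<Rightarrow> ('k, 'a) module \<Rightarrow> 'a \<Rightarrow> 'a \<Rightarrow> ('k, 'a) env_elt" where
  "env_pure K A \<equiv> pure_tensor K (self_module K) A A"

definition env :: "'k ring \<Rightarrow> ('k, 'a) module \<Rightarrow> ('k, ('k, 'a) env_elt) module" where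
  "env K A =
     (env_space K A)
       \<lparr>mult := \<lambda>X Y.
          tensor_lift K (env_space K A)
            (\<lambda>(a, b). tensor_lift K (env_space K A)
               (\<lambda>(c, d). env_pure K A (a \<otimes>\<^bsub>A\<^esub> c) (d \<otimes>\<^bsub>A\<^esub> b)) Y) X,
        one := env_pure K A \<one>\<^bsub>A\<^esub> \<one>\<^bsub>A\<^esub>\<rparr>"

text \<open>A bimodule as a left module, \<open>(a \<otimes> a') b = a b a'\<close>, and as a right module,
  \<open>b (a \<otimes> a') = a' b a\<close>, over the enveloping algebra.\<close>

definition env_left :: "'k ring \<Rightarrow> ('k, 'a, 'b) bimod \<Rightarrow> (('k, 'a) env_elt, 'b) module" where
  "env_left K B = with_smult B (\<lambda>X b. tensor_lift K B (\<lambda>(a, a'). ract B (lact B a b) a') X)"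

definition env_right :: "'k ring \<Rightarrow> ('k, 'a, 'b) bimod \<Rightarrow> (('k, 'a) env_elt, 'b) module" where
  "env_right K B = with_smult B (\<lambda>X b. tensor_lift K B (\<lambda>(a, a'). ract B (lact B a' b) a) X)"

definition fin_gen_bimodule :: "'k ring \<Rightarrow> ('k, 'a) module \<Rightarrow> ('k, 'a, 'b) bimod \<Rightarrow> bool" where
  "fin_gen_bimodule K A B \<longleftrightarrow> bimodule K A B \<and> fin_gen (env K A) (env_left K B)"


section \<open>Frobenius algebras\<close>

definition frobenius_iso :: "'k ring \<Rightarrow> ('k, 'a) module \<Rightarrow> ('a \<Rightarrow> ('a \<Rightarrow> 'k)) \<Rightarrow> bool" where
  "frobenius_iso K A \<phi> \<longleftrightarrow>
     lin_iso A (left_module (regular A)) (left_module (dual K (regular A))) \<phi>"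

definition frobenius_algebra :: "'k ring \<Rightarrow> ('k, 'a) module \<Rightarrow> bool" where
  "frobenius_algebra K A \<longleftrightarrow> k_algebra K A \<and> fin_gen K A \<and> (\<exists>\<phi>. frobenius_iso K A \<phi>)"

definition algebra_aut :: "'k ring \<Rightarrow> ('k, 'a) module \<Rightarrow> ('a \<Rightarrow> 'a) \<Rightarrow> bool" where
  "algebra_aut K A \<nu> \<longleftrightarrow> \<nu> \<in> ring_iso A A \<and> lin_map K A A \<nu>"

definition nakayama_automorphism :: "'k ring \<Rightarrow> ('k, 'a) module \<Rightarrow> ('a \<Rightarrow> 'a) \<Rightarrow> bool" where
  "nakayama_automorphism K A \<nu> \<longleftrightarrow>
     algebra_aut K A \<nu> \<and>
     (\<exists>\<phi>. frobenius_iso K A \<phi> \<and>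
        (\<forall>l\<in>carrier A. \<forall>x\<in>carrier A. \<phi> \<one>\<^bsub>A\<^esub> (l \<otimes>\<^bsub>A\<^esub> x) = \<phi> \<one>\<^bsub>A\<^esub> (\<nu> x \<otimes>\<^bsub>A\<^esub> l)))"


section \<open>Complexes\<close>

text \<open>The differential \<open>bd C n\<close> goes from degree \<open>n\<close> to degree \<open>n - 1\<close>.\<close>

record ('r, 'm) cplx =
  obj :: "int \<Rightarrow> ('r, 'm) module"
  bd :: "int \<Rightarrow> 'm \<Rightarrow> 'm"

definition chain_complex :: "('r, 'y) ring_scheme \<Rightarrow> ('r, 'm) cplx \<Rightarrow> bool" where
  "chain_complex R C \<longleftrightarrow>
     (\<forall>n. lmodule R (obj C n) \<and> lin_map R (obj C n) (obj C (n - 1)) (bd C n) \<and>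
        (\<forall>x\<in>carrier (obj C (n + 1)). bd C n (bd C (n + 1) x) = \<zero>\<^bsub>obj C (n - 1)\<^esub>))"

definition exact_at :: "('r, 'm) cplx \<Rightarrow> int \<Rightarrow> bool" where
  "exact_at C n \<longleftrightarrow>
     a_kernel (obj C n) (obj C (n - 1)) (bd C n) = bd C (n + 1) ` carrier (obj C (n + 1))"

text \<open>Homology at \<open>V\<close> of \<open>U \<rightarrow> V \<rightarrow> W\<close>.\<close>

definition homology ::
    "('k, 'u, 'x) module_scheme \<Rightarrow> ('u \<Rightarrow> 'v) \<Rightarrow> ('k, 'v) module \<Rightarrow> ('v \<Rightarrow> 'w)
      \<Rightarrow> ('k, 'w, 'y) module_scheme \<Rightarrow> ('k, 'v set) module" where
  "homology U f V g W = quot_module (V\<lparr>carrier := a_kernel V W g\<rparr>) (f ` carrier U)"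

text \<open>The cochain complex \<open>Hom(T, N)\<close>, with coboundary \<open>h \<mapsto> h \<circ> bd\<close> from degree \<open>n\<close> to \<open>n + 1\<close>.\<close>

definition hom_obj :: "('k, 'g) module \<Rightarrow> ('g, 't) cplx \<Rightarrow> ('g, 'n) module \<Rightarrow> int
    \<Rightarrow> ('k, 't \<Rightarrow> 'n) module" where
  "hom_obj \<Gamma> T N n = hom_space \<Gamma> (obj T n) N"

definition hom_cobd :: "('g, 't) cplx \<Rightarrow> int \<Rightarrow> ('t \<Rightarrow> 'n) \<Rightarrow> ('t \<Rightarrow> 'n)" where
  "hom_cobd T n h = compose (carrier (obj T (n + 1))) h (bd T (n + 1))"

text \<open>The chain complex \<open>N \<otimes> T\<close>, with boundary \<open>x \<otimes> t \<mapsto> x \<otimes> bd t\<close>.\<close>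

definition tensor_obj :: "'k ring \<Rightarrow> ('k, 'g) module \<Rightarrow> ('g, 'n) module \<Rightarrow> ('g, 't) cplx \<Rightarrow> int
    \<Rightarrow> ('k, ('n \<times> 't \<Rightarrow> 'k) set) module" where
  "tensor_obj K \<Gamma> N T n = tensor K \<Gamma> N (obj T n)"

definition tensor_bd :: "'k ring \<Rightarrow> ('k, 'g) module \<Rightarrow> ('g, 'n) module \<Rightarrow> ('g, 't) cplx \<Rightarrow> int
    \<Rightarrow> ('n \<times> 't \<Rightarrow> 'k) set \<Rightarrow> ('n \<times> 't \<Rightarrow> 'k) set" where
  "tensor_bd K \<Gamma> N T n X =
     tensor_lift K (tensor_obj K \<Gamma> N T (n - 1))
       (\<lambda>(x, t). pure_tensor K \<Gamma> N (obj T (n - 1)) x (bd T n t)) X"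

definition proj_resolution ::
    "('r, 'y) ring_scheme \<Rightarrow> ('r, 'm) module \<Rightarrow> ('r, 'p) cplx \<Rightarrow> ('p \<Rightarrow> 'm) \<Rightarrow> bool" where
  "proj_resolution R M P \<epsilon> \<longleftrightarrow>
     chain_complex R P \<and> (\<forall>n. projective R (obj P n)) \<and>
     (\<forall>n<0. carrier (obj P n) = {\<zero>\<^bsub>obj P n\<^esub>}) \<and>
     (\<forall>n>0. exact_at P n) \<and>
     lin_map R (obj P 0) M \<epsilon> \<and> \<epsilon> ` carrier (obj P 0) = carrier M \<and>
     a_kernel (obj P 0) M \<epsilon> = bd P 1 ` carrier (obj P 1)"

definition chain_map ::
    "('r, 'y) ring_scheme \<Rightarrow> ('r, 't) cplx \<Rightarrow> ('r, 'p) cplx \<Rightarrow> (int \<Rightarrow> 't \<Rightarrow> 'p) \<Rightarrow> bool" where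
  "chain_map R T P f \<longleftrightarrow>
     (\<forall>n. lin_map R (obj T n) (obj P n) (f n) \<and>
        (\<forall>x\<in>carrier (obj T n). f (n - 1) (bd T n x) = bd P n (f n x)))"

text \<open>
  A complete resolution of a module over a \<open>K\<close>-algebra.  As \<open>f n\<close> is bijective for \<open>n \<ge> 0\<close>, it is no
  restriction that the elements of the projective resolution \<open>P\<close> have the same type as those of
  \<open>T\<close>.
\<close>

definition complete_resolution ::
    "('k, 'g) module \<Rightarrow> ('g, 'm) module \<Rightarrow> ('g, 't) cplx \<Rightarrow> bool" where
  "complete_resolution \<Gamma> M T \<longleftrightarrow>
     chain_complex \<Gamma> T \<and>
     (\<forall>n. projective \<Gamma> (obj T n) \<and> fin_gen \<Gamma> (obj T n)) \<and>
     (\<forall>n. exact_at T n) \<and>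
     (\<forall>n. a_kernel (hom_obj \<Gamma> T (self_module \<Gamma>) n) (hom_obj \<Gamma> T (self_module \<Gamma>) (n + 1))
             (hom_cobd T n)
          = hom_cobd T (n - 1) ` carrier (hom_obj \<Gamma> T (self_module \<Gamma>) (n - 1))) \<and>
     (\<exists>(P :: ('g, 't) cplx) \<epsilon> f.
        proj_resolution \<Gamma> M P \<epsilon> \<and> chain_map \<Gamma> T P f \<and>
        (\<forall>n\<ge>0. bij_betw (f n) (carrier (obj T n)) (carrier (obj P n))))"


section \<open>Tate and Tate-Hochschild (co)homology\<close>

text \<open>
  The groups \<open>Ext\<^sup>n(M, N)\<close> and \<open>Tor\<^sub>n(N, M)\<close> are defined by a complete resolution \<open>T\<close> of \<open>M\<close>, on which
  they depend only up to isomorphism.  The choice of \<open>T\<close> is kept explicit here, in place of the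
  argument \<open>M\<close>; a statement about the groups is a statement about all complete resolutions.
\<close>

definition tate_Ext :: "('k, 'g) module \<Rightarrow> int \<Rightarrow> ('g, 't) cplx \<Rightarrow> ('g, 'n) module
    \<Rightarrow> ('k, ('t \<Rightarrow> 'n) set) module" where
  "tate_Ext \<Gamma> n T N =
     homology (hom_obj \<Gamma> T N (n - 1)) (hom_cobd T (n - 1)) (hom_obj \<Gamma> T N n)
       (hom_cobd T n) (hom_obj \<Gamma> T N (n + 1))"

definition tate_Tor :: "'k ring \<Rightarrow> ('k, 'g) module \<Rightarrow> int \<Rightarrow> ('g, 'n) module \<Rightarrow> ('g, 't) cplx
    \<Rightarrow> ('k, ('n \<times> 't \<Rightarrow> 'k) set set) module" where
  "tate_Tor K \<Gamma> n N T =
     homology (tensor_obj K \<Gamma> N T (n + 1)) (tensor_bd K \<Gamma> N T (n + 1)) (tensor_obj K \<Gamma> N T n)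
       (tensor_bd K \<Gamma> N T n) (tensor_obj K \<Gamma> N T (n - 1))"

text \<open>In the following two definitions \<open>T\<close> is to be a complete resolution of the bimodule \<open>\<Lambda>\<close>.\<close>

definition HH_upper :: "'k ring \<Rightarrow> ('k, 'a) module \<Rightarrow> int \<Rightarrow> (('k, 'a) env_elt, 't) cplx
    \<Rightarrow> ('k, 'a, 'b) bimod \<Rightarrow> ('k, ('t \<Rightarrow> 'b) set) module" where
  "HH_upper K A n T B = tate_Ext (env K A) n T (env_left K B)"

definition HH_lower :: "'k ring \<Rightarrow> ('k, 'a) module \<Rightarrow> int \<Rightarrow> (('k, 'a) env_elt, 't) cplx
    \<Rightarrow> ('k, 'a, 'b) bimod \<Rightarrow> ('k, ('b \<times> 't \<Rightarrow> 'k) set set) module" where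
  "HH_lower K A n T B = tate_Tor K (env K A) n (env_right K B) T"

definition bimod_complete_resolution ::
    "'k ring \<Rightarrow> ('k, 'a) module \<Rightarrow> ('k, 'a, 'b) bimod \<Rightarrow> (('k, 'a) env_elt, 't) cplx \<Rightarrow> bool" where
  "bimod_complete_resolution K A B T \<longleftrightarrow> complete_resolution (env K A) (env_left K B) T"

end

theory Submission
  imports Defs
begin

text \<open>
  A Frobenius form \<open>t\<close> on an algebra \<open>\<Gamma>\<close> with Nakayama automorphism \<open>\<mu>\<close> turns the trace pairing of
  homomorphisms into a duality between \<open>Hom(P, N)\<close> and \<open>Hom(N, \<mu>P)\<close> for finitely generated projective
  \<open>P\<close>, where \<open>\<mu>P\<close> is \<open>P\<close> twisted by \<open>\<mu>\<close>.  For a complete resolution \<open>T\<close> of \<open>M\<close> it makes \<open>Ext\<^sup>n(M, N)\<close>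
  dual to the homology of \<open>Hom(N, \<mu>T)\<close>.  Balancing \<open>Hom(S, \<mu>T)\<close>, for a complete resolution \<open>S\<close> of \<open>N\<close>,
  identifies the latter with \<open>Ext\<close> of \<open>N\<close> into \<open>\<mu>M\<close> in degree \<open>-(n+1)\<close>: this is Tate duality.  Over the
  enveloping algebra, where the Nakayama automorphism is \<open>\<nu> \<otimes> \<nu>\<^sup>-\<^sup>1\<close>, it gives the statement on
  cohomology, since \<open>\<nu>\<^sup>-\<^sup>1\<close> identifies \<open>\<Lambda>\<close> with left action twisted by \<open>\<nu>\<^sup>2\<close> with \<open>\<Lambda>\<close> twisted by
  \<open>\<nu> \<otimes> \<nu>\<^sup>-\<^sup>1\<close>.  The statement on homology follows because \<open>Tor\<^sub>n(B, M)\<close> is dual to \<open>Ext\<^sup>n(M, D(B))\<close>, and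
  \<open>D(\<Lambda>)\<close> is \<open>\<Lambda>\<close> with right action twisted by \<open>\<nu>\<^sup>-\<^sup>1\<close>.
\<close>

section \<open>Linear algebra\<close>

text \<open>Only isomorphisms of vector spaces are claimed, so no natural map has to be produced:
  two finite-dimensional spaces in a nondegenerate pairing are isomorphic. Every duality is
  therefore carried by an explicit pairing, and finite dual bases supply the finite dimensionality
  as well. A Frobenius form is symmetric only up to its Nakayama automorphism, so a trace is cyclic
  only if one of the two maps is semilinear; this is what puts the twist on \<open>T\<close>. The
  resolutions \<open>T\<close> and \<open>S\<close> are arbitrary and their elements may have
  different types. They are never compared with each other: both enter the one bicomplex of maps
  from \<open>S\<close> to twisted \<open>T\<close>, whose exact rows and columns allow moves along
  diagonals without total complexes or homotopies. The degree -(n+1) is read off from the two edges.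
  The augmentation of \<open>S\<close> gives the position (0, n). The twisted \<open>M\<close> sits
  inside degree -1 of the twisted \<open>T\<close>, as the image of the boundary that leaves degree
  0. Moving the second coordinate from n to -1 subtracts n+1, and the first coordinate
  follows.\<close>

declare (in lmodule) smult_closed [simp, intro] smult_one [simp]

context lmodule
begin

lemma smult_l_null [simp]:
  assumes x: "x \<in> carrier M" shows "\<zero> \<odot>\<^bsub>M\<^esub> x = \<zero>\<^bsub>M\<^esub>"
proof -
  have "\<zero> \<odot>\<^bsub>M\<^esub> x = \<zero> \<odot>\<^bsub>M\<^esub> x \<oplus>\<^bsub>M\<^esub> \<zero> \<odot>\<^bsub>M\<^esub> x"
    using smult_l_distr[of \<zero> \<zero> x] x by simp
  then show ?thesis using x by (metis M.add.r_cancel_one' smult_closed R.zero_closed)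
qed

lemma smult_r_null [simp]:
  assumes a: "a \<in> carrier R" shows "a \<odot>\<^bsub>M\<^esub> \<zero>\<^bsub>M\<^esub> = \<zero>\<^bsub>M\<^esub>"
proof -
  have "a \<odot>\<^bsub>M\<^esub> \<zero>\<^bsub>M\<^esub> = a \<odot>\<^bsub>M\<^esub> \<zero>\<^bsub>M\<^esub> \<oplus>\<^bsub>M\<^esub> a \<odot>\<^bsub>M\<^esub> \<zero>\<^bsub>M\<^esub>"
    using smult_r_distr[of a "\<zero>\<^bsub>M\<^esub>" "\<zero>\<^bsub>M\<^esub>"] a by simp
  then show ?thesis using a by (metis M.add.r_cancel_one' smult_closed M.zero_closed)
qed

lemma smult_l_minus:
  assumes "a \<in> carrier R" "x \<in> carrier M" shows "(\<ominus> a) \<odot>\<^bsub>M\<^esub> x = \<ominus>\<^bsub>M\<^esub> (a \<odot>\<^bsub>M\<^esub> x)"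
  using assms smult_l_distr[of "\<ominus> a" a x] by (intro M.minus_equality [symmetric]) (auto simp: R.l_neg)

lemma smult_r_minus:
  assumes "a \<in> carrier R" "x \<in> carrier M" shows "a \<odot>\<^bsub>M\<^esub> (\<ominus>\<^bsub>M\<^esub> x) = \<ominus>\<^bsub>M\<^esub> (a \<odot>\<^bsub>M\<^esub> x)"
  using assms smult_r_distr[of a "\<ominus>\<^bsub>M\<^esub> x" x] by (intro M.minus_equality [symmetric]) (auto simp: M.l_neg)

lemma diff_eq_zero: "\<lbrakk>x \<in> carrier M; y \<in> carrier M\<rbrakk> \<Longrightarrow> x \<ominus>\<^bsub>M\<^esub> y = \<zero>\<^bsub>M\<^esub> \<longleftrightarrow> x = y"
  by (metis M.minus_eq M.r_neg M.minus_equality M.minus_minus M.a_inv_closed)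

lemma diff_add_cancel: "\<lbrakk>x \<in> carrier M; y \<in> carrier M\<rbrakk> \<Longrightarrow> (x \<ominus>\<^bsub>M\<^esub> y) \<oplus>\<^bsub>M\<^esub> y = x"
  by (simp add: M.minus_eq M.a_assoc M.l_neg)

end

section \<open>Linear maps, finite sums and changes of the scalar action\<close>

lemma lin_mapI:
  assumes "\<And>x. x \<in> carrier M \<Longrightarrow> h x \<in> carrier N"
    and "\<And>x y. \<lbrakk>x \<in> carrier M; y \<in> carrier M\<rbrakk> \<Longrightarrow> h (x \<oplus>\<^bsub>M\<^esub> y) = h x \<oplus>\<^bsub>N\<^esub> h y"
    and "\<And>r x. \<lbrakk>r \<in> carrier R; x \<in> carrier M\<rbrakk> \<Longrightarrow> h (r \<odot>\<^bsub>M\<^esub> x) = r \<odot>\<^bsub>N\<^esub> h x"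
  shows "lin_map R M N h"
  using assms by (auto simp: lin_map_def)

lemma lin_map_closed: "\<lbrakk>lin_map R M N h; x \<in> carrier M\<rbrakk> \<Longrightarrow> h x \<in> carrier N"
  by (auto simp: lin_map_def)

lemma lin_map_add:
  "\<lbrakk>lin_map R M N h; x \<in> carrier M; y \<in> carrier M\<rbrakk> \<Longrightarrow> h (x \<oplus>\<^bsub>M\<^esub> y) = h x \<oplus>\<^bsub>N\<^esub> h y"
  by (auto simp: lin_map_def)

lemma lin_map_smult:
  "\<lbrakk>lin_map R M N h; r \<in> carrier R; x \<in> carrier M\<rbrakk> \<Longrightarrow> h (r \<odot>\<^bsub>M\<^esub> x) = r \<odot>\<^bsub>N\<^esub> h x"
  by (auto simp: lin_map_def)

lemma lin_map_comp:
  "\<lbrakk>lin_map R M N g; lin_map R N P h\<rbrakk> \<Longrightarrow> lin_map R M P (\<lambda>x. h (g x))"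
  by (auto simp: lin_map_def Pi_iff)

lemma lin_map_cong:
  assumes "lmodule R M" "\<And>x. x \<in> carrier M \<Longrightarrow> f x = g x"
  shows "lin_map R M N f \<longleftrightarrow> lin_map R M N g"
proof -
  interpret lmodule R M by fact
  show ?thesis using assms(2) by (auto simp: lin_map_def Pi_iff)
qed

lemma lin_map_zero:
  assumes "lmodule R M" "lmodule R N" "lin_map R M N h"
  shows "h \<zero>\<^bsub>M\<^esub> = \<zero>\<^bsub>N\<^esub>"
proof -
  interpret M: lmodule R M by fact
  interpret N: lmodule R N by fact
  have "h \<zero>\<^bsub>M\<^esub> \<oplus>\<^bsub>N\<^esub> h \<zero>\<^bsub>M\<^esub> = h \<zero>\<^bsub>M\<^esub>"
    using lin_map_add[OF assms(3), of "\<zero>\<^bsub>M\<^esub>" "\<zero>\<^bsub>M\<^esub>"] by simp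
  then show ?thesis using lin_map_closed[OF assms(3), of "\<zero>\<^bsub>M\<^esub>"] by simp
qed

lemma lin_map_minus:
  assumes "lmodule R M" "lmodule R N" "lin_map R M N h" "x \<in> carrier M"
  shows "h (\<ominus>\<^bsub>M\<^esub> x) = \<ominus>\<^bsub>N\<^esub> h x"
proof -
  interpret M: lmodule R M by fact
  interpret N: lmodule R N by fact
  have "h (\<ominus>\<^bsub>M\<^esub> x) \<oplus>\<^bsub>N\<^esub> h x = \<zero>\<^bsub>N\<^esub>"
    using assms lin_map_add[OF assms(3), of "\<ominus>\<^bsub>M\<^esub> x" x] lin_map_zero[OF assms(1-3)]
    by (simp add: M.M.l_neg)
  then show ?thesis using assms lin_map_closed[OF assms(3)] by (intro N.M.minus_equality [symmetric]) auto
qed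

lemma lin_map_diff:
  assumes "lmodule R M" "lmodule R N" "lin_map R M N h" "x \<in> carrier M" "y \<in> carrier M"
  shows "h (x \<ominus>\<^bsub>M\<^esub> y) = h x \<ominus>\<^bsub>N\<^esub> h y"
proof -
  interpret M: lmodule R M by fact
  interpret N: lmodule R N by fact
  show ?thesis using assms by (simp add: a_minus_def lin_map_add lin_map_minus)
qed

lemma lin_map_finsum:
  assumes "lmodule R M" "lmodule R N" "lin_map R M N h" "f \<in> A \<rightarrow> carrier M"
  shows "h (\<Oplus>\<^bsub>M\<^esub>i\<in>A. f i) = (\<Oplus>\<^bsub>N\<^esub>i\<in>A. h (f i))"
proof -
  interpret M: lmodule R M by fact
  interpret N: lmodule R N by fact
  show ?thesis using assms(4)
  proof (induction A rule: infinite_finite_induct)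
    case (infinite A)
    then show ?case using lin_map_zero[OF assms(1-3)] by (simp add: M.M.finsum_infinite N.M.finsum_infinite)
  next
    case empty
    then show ?case using lin_map_zero[OF assms(1-3)] by simp
  next
    case (insert x F)
    then have "f x \<in> carrier M" "f \<in> F \<rightarrow> carrier M" by auto
    moreover from this have "(\<lambda>i. h (f i)) \<in> F \<rightarrow> carrier N" "h (f x) \<in> carrier N"
      using lin_map_closed[OF assms(3)] by (auto simp: Pi_iff)
    ultimately show ?case using insert lin_map_add[OF assms(3)] by simp
  qed
qed

lemma (in lmodule) lin_map_smult_const:
  assumes "x \<in> carrier M" shows "lin_map R (self_module R) M (\<lambda>r. r \<odot>\<^bsub>M\<^esub> x)"
  using assms by (intro lin_mapI) (auto simp: self_module_def with_smult_def smult_l_distr smult_assoc1)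

lemma with_smult_simps [simp]:
  "carrier (with_smult M act) = carrier M" "zero (with_smult M act) = zero M"
  "add (with_smult M act) = add M" "smult (with_smult M act) = act"
  "one (with_smult M act) = one M" "mult (with_smult M act) = mult M"
  by (simp_all add: with_smult_def)

lemma a_inv_with_smult [simp]: "a_inv (with_smult M act) = a_inv M"
  by (rule ext) (simp add: a_inv_def m_inv_def)

lemma a_minus_with_smult [simp]: "x \<ominus>\<^bsub>with_smult M act\<^esub> y = x \<ominus>\<^bsub>M\<^esub> y"
  by (simp add: a_minus_def)

text \<open>Sums see only the additive part of a record. Several records below share an additive
  group and differ in their scalars or in the action, and sums have to pass between them.\<close>

lemma finsum_cong_record:
  assumes "carrier M = carrier N" "zero M = zero N" "add M = add N"
  shows "finsum M = finsum N"
proof -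
  have "add M = add N" using assms by blast
  with assms show ?thesis unfolding finsum_def finprod_def by (simp cong: if_cong)
qed

lemma finsum_with_smult [simp]: "finsum (with_smult M act) = finsum M"
  by (rule finsum_cong_record) simp_all

lemma self_module_simps [simp]:
  "carrier (self_module R) = carrier R" "zero (self_module R) = zero R"
  "add (self_module R) = add R" "smult (self_module R) = mult R" "one (self_module R) = one R"
  "a_inv (self_module R) = a_inv R" "finsum (self_module R) = finsum R"
  by (simp_all add: self_module_def)

lemma abelian_group_cong_record:
  assumes "abelian_group M" "carrier M = carrier N" "zero M = zero N" "add M = add N"
  shows "abelian_group N"
proof -
  interpret abelian_group M by fact
  show ?thesis
  proof (rule abelian_groupI)
    fix x assume "x \<in> carrier N"
    then show "\<exists>y\<in>carrier N. y \<oplus>\<^bsub>N\<^esub> x = \<zero>\<^bsub>N\<^esub>"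
      by (auto intro!: bexI[of _ "\<ominus>\<^bsub>M\<^esub> x"] simp: l_neg simp flip: assms(2-4))
  qed (auto simp flip: assms(2-4) simp: a_ac)
qed

lemma abelian_group_with_smult: "abelian_group M \<Longrightarrow> abelian_group (with_smult M act)"
  by (erule abelian_group_cong_record) simp_all

lemma lmodule_self_module: "ring R \<Longrightarrow> lmodule R (self_module R)"
proof -
  assume "ring R"
  then interpret ring R .
  have "abelian_group (self_module R)"
    unfolding self_module_def by (rule abelian_group_with_smult) unfold_locales
  then show ?thesis
    by (intro lmodule.intro lmodule_axioms.intro) (auto simp: l_distr r_distr m_assoc ring_axioms)
qed

lemma (in lmodule) finsum_smult:
  assumes "a \<in> carrier R" "f \<in> A \<rightarrow> carrier M"
  shows "a \<odot>\<^bsub>M\<^esub> (\<Oplus>\<^bsub>M\<^esub>i\<in>A. f i) = (\<Oplus>\<^bsub>M\<^esub>i\<in>A. a \<odot>\<^bsub>M\<^esub> f i)"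
  using assms(2)
proof (induction A rule: infinite_finite_induct)
  case (infinite A)
  then show ?case using assms by (simp add: M.finsum_infinite)
next
  case (insert x F)
  then show ?case using assms(1) by (simp add: Pi_iff smult_r_distr)
qed (use assms in simp)

lemma (in lmodule) finsum_smult_left:
  assumes "x \<in> carrier M" "f \<in> A \<rightarrow> carrier R"
  shows "(\<Oplus>\<^bsub>R\<^esub>i\<in>A. f i) \<odot>\<^bsub>M\<^esub> x = (\<Oplus>\<^bsub>M\<^esub>i\<in>A. f i \<odot>\<^bsub>M\<^esub> x)"
  using lin_map_finsum[OF lmodule_self_module[OF R.ring_axioms] lmodule_axioms lin_map_smult_const[OF assms(1)], of f A]
    assms(2) by simp

lemma (in abelian_group) finsum_swap:
  assumes "finite A" "finite B" "\<And>i j. i \<in> A \<Longrightarrow> j \<in> B \<Longrightarrow> f i j \<in> carrier G"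
  shows "(\<Oplus>i\<in>A. \<Oplus>j\<in>B. f i j) = (\<Oplus>j\<in>B. \<Oplus>i\<in>A. f i j)"
  using assms(1,3)
proof (induction A rule: finite_induct)
  case empty
  show ?case by simp
next
  case (insert x F)
  have "(\<Oplus>j\<in>B. \<Oplus>i\<in>insert x F. f i j) = (\<Oplus>j\<in>B. f x j \<oplus> (\<Oplus>i\<in>F. f i j))"
    using insert by (intro finsum_cong' finsum_insert refl) auto
  also have "\<dots> = (\<Oplus>j\<in>B. f x j) \<oplus> (\<Oplus>j\<in>B. \<Oplus>i\<in>F. f i j)"
    using insert by (intro finsum_addf) (auto simp: Pi_iff)
  also have "\<dots> = (\<Oplus>i\<in>insert x F. \<Oplus>j\<in>B. f i j)"
    using insert by (subst finsum_insert) (auto simp: Pi_iff)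
  finally show ?case by simp
qed

lemma (in abelian_group) finsum_delta:
  assumes "finite A" "i \<in> A" "f \<in> A \<rightarrow> carrier G" "\<And>j. j \<in> A \<Longrightarrow> j \<noteq> i \<Longrightarrow> f j = \<zero>"
  shows "finsum G f A = f i"
proof -
  have "finsum G f A = finsum G (\<lambda>j. if i = j then f j else \<zero>) A"
    using assms by (intro finsum_cong') auto
  then show ?thesis using finsum_singleton[OF assms(2,1,3)] by simp
qed

subsection \<open>Submodules and quotients\<close>

text \<open>The locale \<open>submodule\<close> demands an additive subgroup; closure under
  negatives comes from -a = (-1) a.\<close>

lemma submoduleI':
  assumes "lmodule R V" "H \<subseteq> carrier V" "\<zero>\<^bsub>V\<^esub> \<in> H"
    "\<And>a b. \<lbrakk>a \<in> H; b \<in> H\<rbrakk> \<Longrightarrow> a \<oplus>\<^bsub>V\<^esub> b \<in> H"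
    "\<And>a x. \<lbrakk>a \<in> carrier R; x \<in> H\<rbrakk> \<Longrightarrow> a \<odot>\<^bsub>V\<^esub> x \<in> H"
  shows "submodule H R V"
proof -
  interpret lmodule R V by fact
  have "\<ominus>\<^bsub>V\<^esub> a \<in> H" if "a \<in> H" for a
    using smult_l_minus[of "\<one>\<^bsub>R\<^esub>" a] assms(5)[of "\<ominus>\<^bsub>R\<^esub> \<one>\<^bsub>R\<^esub>" a] that assms(2) by auto
  then show ?thesis using assms
    by (intro submodule.intro subgroup.intro submodule_axioms.intro) (auto simp: a_inv_def)
qed

lemma submoduleD:
  assumes "lmodule R V" "submodule W R V"
  shows submodule_subset: "W \<subseteq> carrier V" and submodule_zero: "\<zero>\<^bsub>V\<^esub> \<in> W"
    and submodule_add: "\<And>x y. \<lbrakk>x \<in> W; y \<in> W\<rbrakk> \<Longrightarrow> x \<oplus>\<^bsub>V\<^esub> y \<in> W"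
    and submodule_smult: "\<And>r x. \<lbrakk>r \<in> carrier R; x \<in> W\<rbrakk> \<Longrightarrow> r \<odot>\<^bsub>V\<^esub> x \<in> W"
    and submodule_minus: "\<And>x. x \<in> W \<Longrightarrow> \<ominus>\<^bsub>V\<^esub> x \<in> W"
    and submodule_diff: "\<And>x y. \<lbrakk>x \<in> W; y \<in> W\<rbrakk> \<Longrightarrow> x \<ominus>\<^bsub>V\<^esub> y \<in> W"
proof -
  interpret lmodule R V by fact
  interpret W: submodule W R V by fact
  show "W \<subseteq> carrier V" using W.subset by simp
  show "\<zero>\<^bsub>V\<^esub> \<in> W" using W.one_closed by simp
  show add: "\<And>x y. \<lbrakk>x \<in> W; y \<in> W\<rbrakk> \<Longrightarrow> x \<oplus>\<^bsub>V\<^esub> y \<in> W" using W.m_closed by simp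
  show "\<And>r x. \<lbrakk>r \<in> carrier R; x \<in> W\<rbrakk> \<Longrightarrow> r \<odot>\<^bsub>V\<^esub> x \<in> W" by (rule W.smult_closed)
  show min: "\<And>x. x \<in> W \<Longrightarrow> \<ominus>\<^bsub>V\<^esub> x \<in> W" using W.m_inv_closed by (simp add: a_inv_def)
  show "\<And>x y. \<lbrakk>x \<in> W; y \<in> W\<rbrakk> \<Longrightarrow> x \<ominus>\<^bsub>V\<^esub> y \<in> W" by (simp add: a_minus_def add min)
qed

lemma submodule_finsum:
  assumes "lmodule R V" "submodule W R V" "f \<in> A \<rightarrow> W"
  shows "(\<Oplus>\<^bsub>V\<^esub>i\<in>A. f i) \<in> W"
proof -
  interpret lmodule R V by fact
  note S = submoduleD[OF assms(1,2)]
  show ?thesis using assms(3)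
  proof (induction A rule: infinite_finite_induct)
    case (infinite A) then show ?case using S by (simp add: M.finsum_infinite)
  next
    case empty then show ?case using S by simp
  next
    case (insert x F)
    then have "f x \<in> carrier V" "f \<in> F \<rightarrow> carrier V" using S(1) by auto
    then show ?case using insert S by simp
  qed
qed

lemma lmodule_submodule:
  assumes "lmodule R V" "submodule W R V"
  shows "lmodule R (V\<lparr>carrier := W\<rparr>)"
proof -
  interpret lmodule R V by fact
  note S = submoduleD[OF assms]
  have "abelian_group (V\<lparr>carrier := W\<rparr>)"
  proof (rule abelian_groupI)
    fix x assume "x \<in> carrier (V\<lparr>carrier := W\<rparr>)"
    then show "\<exists>y\<in>carrier (V\<lparr>carrier := W\<rparr>). y \<oplus>\<^bsub>V\<lparr>carrier := W\<rparr>\<^esub> x = \<zero>\<^bsub>V\<lparr>carrier := W\<rparr>\<^esub>"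
      using S by (auto intro!: bexI[of _ "\<ominus>\<^bsub>V\<^esub> x"] simp: M.l_neg subset_iff)
  qed (use S in \<open>auto simp: M.a_ac subset_iff\<close>)
  then show ?thesis using S
    by (intro lmodule.intro lmodule_axioms.intro)
      (auto simp: R.ring_axioms smult_l_distr smult_r_distr smult_assoc1 subset_iff)
qed

lemma submodule_kernel:
  assumes "lmodule R V" "lmodule R W" "lin_map R V W g"
  shows "submodule (a_kernel V W g) R V"
proof -
  interpret V: lmodule R V by fact
  interpret W: lmodule R W by fact
  show ?thesis
    by (rule submoduleI'[OF assms(1)])
      (auto simp: a_kernel_def' lin_map_zero[OF assms] lin_map_add[OF assms(3)] lin_map_smult[OF assms(3)])
qed

lemma submodule_image:
  assumes "lmodule R U" "lmodule R V" "lin_map R U V f"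
  shows "submodule (f ` carrier U) R V"
proof -
  interpret U: lmodule R U by fact
  interpret V: lmodule R V by fact
  show ?thesis
  proof (rule submoduleI'[OF assms(2)])
    show "\<zero>\<^bsub>V\<^esub> \<in> f ` carrier U" using lin_map_zero[OF assms] by force
  next
    fix a b assume "a \<in> f ` carrier U" "b \<in> f ` carrier U"
    then obtain x y where "x \<in> carrier U" "y \<in> carrier U" "a = f x" "b = f y" by auto
    then show "a \<oplus>\<^bsub>V\<^esub> b \<in> f ` carrier U"
      using lin_map_add[OF assms(3)] by (intro image_eqI[of _ _ "x \<oplus>\<^bsub>U\<^esub> y"]) auto
  next
    fix r a assume "r \<in> carrier R" "a \<in> f ` carrier U"
    then obtain x where "x \<in> carrier U" "a = f x" by auto
    then show "r \<odot>\<^bsub>V\<^esub> a \<in> f ` carrier U"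
      using lin_map_smult[OF assms(3)] \<open>r \<in> carrier R\<close> by (intro image_eqI[of _ _ "r \<odot>\<^bsub>U\<^esub> x"]) auto
  qed (use lin_map_closed[OF assms(3)] in auto)
qed

lemma submodule_restrict:
  assumes "lmodule R V" "submodule W R V" "submodule W' R V" "W \<subseteq> W'"
  shows "submodule W R (V\<lparr>carrier := W'\<rparr>)"
  using submoduleD[OF assms(1,2)] assms(4)
  by (intro submoduleI'[OF lmodule_submodule[OF assms(1,3)]]) auto

context
  fixes R :: "('r, 'y) ring_scheme" and V :: "('r, 'm, 'z) module_scheme" and W :: "'m set"
  assumes V: "lmodule R V" and W: "submodule W R V"
begin

interpretation lmodule R V by (rule V)

lemma submodule_abelian_subgroup: "abelian_subgroup W V"
  using W by (intro abelian_subgroupI3 additive_subgroupI submodule.axioms(1)[OF W]) unfold_locales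

interpretation W: abelian_subgroup W V by (rule submodule_abelian_subgroup)

lemma coset_eq_iff: "\<lbrakk>a \<in> carrier V; b \<in> carrier V\<rbrakk> \<Longrightarrow> W +>\<^bsub>V\<^esub> a = W +>\<^bsub>V\<^esub> b \<longleftrightarrow> a \<ominus>\<^bsub>V\<^esub> b \<in> W"
  using W.a_rcos_module[of b a] W.a_repr_independence' W.a_rcos_self by (metis a_minus_def)

lemma carrier_quot: "carrier (quot_module V W) = (\<lambda>a. W +>\<^bsub>V\<^esub> a) ` carrier V"
  by (auto simp: quot_module_def A_RCOSETS_def')

lemma add_quot: "\<lbrakk>a \<in> carrier V; b \<in> carrier V\<rbrakk> \<Longrightarrow>
    (W +>\<^bsub>V\<^esub> a) \<oplus>\<^bsub>quot_module V W\<^esub> (W +>\<^bsub>V\<^esub> b) = W +>\<^bsub>V\<^esub> (a \<oplus>\<^bsub>V\<^esub> b)"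
  by (simp add: quot_module_def W.a_rcos_sum)

lemma smult_quot:
  assumes "r \<in> carrier R" "a \<in> carrier V"
  shows "r \<odot>\<^bsub>quot_module V W\<^esub> (W +>\<^bsub>V\<^esub> a) = W +>\<^bsub>V\<^esub> (r \<odot>\<^bsub>V\<^esub> a)"
proof -
  note S = submoduleD[OF V W]
  have *: "W +>\<^bsub>V\<^esub> (r \<odot>\<^bsub>V\<^esub> x) = W +>\<^bsub>V\<^esub> (r \<odot>\<^bsub>V\<^esub> a)" if x: "x \<in> W +>\<^bsub>V\<^esub> a" for x
  proof -
    obtain w where w: "w \<in> W" "x = w \<oplus>\<^bsub>V\<^esub> a" using x by (auto simp: a_r_coset_def')
    then have "w \<in> carrier V" using S by auto
    then have "r \<odot>\<^bsub>V\<^esub> x \<ominus>\<^bsub>V\<^esub> r \<odot>\<^bsub>V\<^esub> a = r \<odot>\<^bsub>V\<^esub> w"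
      using assms w by (simp add: smult_r_distr a_minus_def M.a_assoc M.r_neg)
    then show ?thesis using S assms w \<open>w \<in> carrier V\<close> by (subst coset_eq_iff) auto
  qed
  have "a \<in> W +>\<^bsub>V\<^esub> a" using W.a_rcos_self assms by simp
  then have "(\<Union>x\<in>W +>\<^bsub>V\<^esub> a. W +>\<^bsub>V\<^esub> (r \<odot>\<^bsub>V\<^esub> x)) = W +>\<^bsub>V\<^esub> (r \<odot>\<^bsub>V\<^esub> a)"
    using * by (intro UN_constant_eq ballI)
  then show ?thesis unfolding quot_module_def by simp
qed

lemma zero_quot: "\<zero>\<^bsub>quot_module V W\<^esub> = W +>\<^bsub>V\<^esub> \<zero>\<^bsub>V\<^esub>"
  using submodule_subset[OF V W] by (simp add: quot_module_def)

lemma lmodule_quot: "lmodule R (quot_module V W)"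
proof -
  let ?Q = "quot_module V W"
  have "abelian_group ?Q"
  proof (rule abelian_groupI)
    fix x assume "x \<in> carrier ?Q"
    then obtain a where "a \<in> carrier V" "x = W +>\<^bsub>V\<^esub> a" by (auto simp: carrier_quot)
    then show "\<exists>y\<in>carrier ?Q. y \<oplus>\<^bsub>?Q\<^esub> x = \<zero>\<^bsub>?Q\<^esub>"
      by (intro bexI[of _ "W +>\<^bsub>V\<^esub> (\<ominus>\<^bsub>V\<^esub> a)"]) (auto simp: carrier_quot add_quot zero_quot M.l_neg)
  qed (auto simp: carrier_quot add_quot zero_quot M.a_ac)
  then show ?thesis
    by (intro lmodule.intro lmodule_axioms.intro)
      (auto simp: R.ring_axioms carrier_quot add_quot smult_quot smult_l_distr smult_r_distr smult_assoc1)
qed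

lemma lin_map_proj: "lin_map R V (quot_module V W) (\<lambda>a. W +>\<^bsub>V\<^esub> a)"
  by (intro lin_mapI) (auto simp: carrier_quot add_quot smult_quot)

end

text \<open>A linear relation can stand in for a map. If it is total on both sides and matches the
  two subspaces, it becomes single-valued and injective on the quotients. This suits constructions
  by lifting, where a choice is made whose effect disappears only modulo the subspace.\<close>

lemma corr_isomorphic:
  fixes V :: "('r, 'v, 'x) module_scheme" and V' :: "('r, 'w, 'y) module_scheme"
    and rel :: "'v \<Rightarrow> 'w \<Rightarrow> bool"
  assumes V: "lmodule R V" and V': "lmodule R V'"
    and N: "submodule N R V" and N': "submodule N' R V'"
    and tot: "\<And>z. z \<in> carrier V \<Longrightarrow> \<exists>z'\<in>carrier V'. rel z z'"
    and tot': "\<And>z'. z' \<in> carrier V' \<Longrightarrow> \<exists>z\<in>carrier V. rel z z'"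
    and add: "\<And>y z y' z'. \<lbrakk>y \<in> carrier V; z \<in> carrier V; y' \<in> carrier V'; z' \<in> carrier V'; rel y y'; rel z z'\<rbrakk>
      \<Longrightarrow> rel (y \<oplus>\<^bsub>V\<^esub> z) (y' \<oplus>\<^bsub>V'\<^esub> z')"
    and smult: "\<And>r z z'. \<lbrakk>r \<in> carrier R; z \<in> carrier V; z' \<in> carrier V'; rel z z'\<rbrakk>
      \<Longrightarrow> rel (r \<odot>\<^bsub>V\<^esub> z) (r \<odot>\<^bsub>V'\<^esub> z')"
    and iff: "\<And>z z'. \<lbrakk>z \<in> carrier V; z' \<in> carrier V'; rel z z'\<rbrakk> \<Longrightarrow> z \<in> N \<longleftrightarrow> z' \<in> N'"
  shows "isomorphic R (quot_module V N) (quot_module V' N')"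
proof -
  interpret V: lmodule R V by fact
  interpret V': lmodule R V' by fact
  define c where "c = (\<lambda>z. N +>\<^bsub>V\<^esub> z)"
  define c' where "c' = (\<lambda>z. N' +>\<^bsub>V'\<^esub> z)"
  have diff: "rel (y \<ominus>\<^bsub>V\<^esub> z) (y' \<ominus>\<^bsub>V'\<^esub> z')"
    if "y \<in> carrier V" "z \<in> carrier V" "y' \<in> carrier V'" "z' \<in> carrier V'" "rel y y'" "rel z z'" for y z y' z'
  proof -
    have m: "\<ominus>\<^bsub>R\<^esub> \<one>\<^bsub>R\<^esub> \<in> carrier R" by simp
    have "rel (\<ominus>\<^bsub>V\<^esub> z) (\<ominus>\<^bsub>V'\<^esub> z')"
      using smult[OF m _ _ that(6)] that V.smult_l_minus[of "\<one>\<^bsub>R\<^esub>" z] V'.smult_l_minus[of "\<one>\<^bsub>R\<^esub>" z'] by simp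
    then show ?thesis using add[OF that(1) _ that(3) _ that(5)] that by (simp add: a_minus_def)
  qed
  \<comment> \<open>One equivalence serves twice: from left to right it makes the induced map well
    defined, from right to left it makes it injective.\<close>
  have key: "c y = c z \<longleftrightarrow> c' y' = c' z'"
    if "y \<in> carrier V" "z \<in> carrier V" "y' \<in> carrier V'" "z' \<in> carrier V'" "rel y y'" "rel z z'" for y z y' z'
    unfolding c_def c'_def
    using that iff[OF _ _ diff[OF that]] by (simp add: coset_eq_iff[OF V N] coset_eq_iff[OF V' N'])
  define P where "P = (\<lambda>X Y. \<exists>z z'. z \<in> carrier V \<and> z' \<in> carrier V' \<and> rel z z' \<and> X = c z \<and> Y = c' z')"
  define h where "h = (\<lambda>X. SOME Y. P X Y)"
  have h: "h (c z) = c' z'" if "z \<in> carrier V" "z' \<in> carrier V'" "rel z z'" for z z'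
  proof -
    have "P (c z) (c' z')" using that by (auto simp: P_def)
    then have "P (c z) (h (c z))" unfolding h_def by (rule someI)
    then obtain y y' where "y \<in> carrier V" "y' \<in> carrier V'" "rel y y'" "c z = c y" "h (c z) = c' y'"
      by (auto simp: P_def)
    with key[of z y z' y'] that show ?thesis by simp
  qed
  have Q: "carrier (quot_module V N) = c ` carrier V" "carrier (quot_module V' N') = c' ` carrier V'"
    unfolding c_def c'_def by (simp_all add: carrier_quot[OF V N] carrier_quot[OF V' N'])
  have aQ: "c a \<oplus>\<^bsub>quot_module V N\<^esub> c b = c (a \<oplus>\<^bsub>V\<^esub> b)" if "a \<in> carrier V" "b \<in> carrier V" for a b
    using that unfolding c_def by (rule add_quot[OF V N])
  have aQ': "c' a \<oplus>\<^bsub>quot_module V' N'\<^esub> c' b = c' (a \<oplus>\<^bsub>V'\<^esub> b)" if "a \<in> carrier V'" "b \<in> carrier V'" for a b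
    using that unfolding c'_def by (rule add_quot[OF V' N'])
  have sQ: "r \<odot>\<^bsub>quot_module V N\<^esub> c b = c (r \<odot>\<^bsub>V\<^esub> b)" if "r \<in> carrier R" "b \<in> carrier V" for r b
    using that unfolding c_def by (rule smult_quot[OF V N])
  have sQ': "r \<odot>\<^bsub>quot_module V' N'\<^esub> c' b = c' (r \<odot>\<^bsub>V'\<^esub> b)" if "r \<in> carrier R" "b \<in> carrier V'" for r b
    using that unfolding c'_def by (rule smult_quot[OF V' N'])
  have "lin_iso R (quot_module V N) (quot_module V' N') h"
    unfolding lin_iso_def
  proof
    show "lin_map R (quot_module V N) (quot_module V' N') h"
    proof (rule lin_mapI)
      fix X assume "X \<in> carrier (quot_module V N)"
      then obtain z where z: "z \<in> carrier V" "X = c z" by (auto simp: Q)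
      obtain z' where "z' \<in> carrier V'" "rel z z'" using tot[OF z(1)] by auto
      then show "h X \<in> carrier (quot_module V' N')" using z h by (auto simp: Q)
    next
      fix X Y assume "X \<in> carrier (quot_module V N)" "Y \<in> carrier (quot_module V N)"
      then obtain y z where z: "z \<in> carrier V" "X = c z" "y \<in> carrier V" "Y = c y" by (auto simp: Q)
      obtain z' y' where z': "z' \<in> carrier V'" "rel z z'" "y' \<in> carrier V'" "rel y y'"
        using tot[OF z(1)] tot[OF z(3)] by auto
      show "h (X \<oplus>\<^bsub>quot_module V N\<^esub> Y) = h X \<oplus>\<^bsub>quot_module V' N'\<^esub> h Y"
        using z z' add[of z y z' y'] by (simp add: aQ aQ' h[of _ "z' \<oplus>\<^bsub>V'\<^esub> y'"] h[of z z'] h[of y y'])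
    next
      fix r X assume r: "r \<in> carrier R" and "X \<in> carrier (quot_module V N)"
      then obtain z where z: "z \<in> carrier V" "X = c z" by (auto simp: Q)
      obtain z' where z': "z' \<in> carrier V'" "rel z z'" using tot[OF z(1)] by auto
      show "h (r \<odot>\<^bsub>quot_module V N\<^esub> X) = r \<odot>\<^bsub>quot_module V' N'\<^esub> h X"
        using z z' r smult[of r z z'] by (simp add: sQ sQ' h[of _ "r \<odot>\<^bsub>V'\<^esub> z'"] h[of z z'])
    qed
    show "bij_betw h (carrier (quot_module V N)) (carrier (quot_module V' N'))"
      unfolding bij_betw_def
    proof
      show "inj_on h (carrier (quot_module V N))"
      proof (rule inj_onI)
        fix X Y assume "X \<in> carrier (quot_module V N)" "Y \<in> carrier (quot_module V N)" and eq: "h X = h Y"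
        then obtain y z where z: "z \<in> carrier V" "X = c z" "y \<in> carrier V" "Y = c y" by (auto simp: Q)
        obtain z' y' where z': "z' \<in> carrier V'" "rel z z'" "y' \<in> carrier V'" "rel y y'"
          using tot[OF z(1)] tot[OF z(3)] by auto
        show "X = Y" using z z' eq key[of z y z' y'] by (simp add: h[of z z'] h[of y y'])
      qed
      show "h ` carrier (quot_module V N) = carrier (quot_module V' N')"
      proof (intro Set.set_eqI iffI)
        fix Y assume "Y \<in> h ` carrier (quot_module V N)"
        then obtain z where z: "z \<in> carrier V" "Y = h (c z)" by (auto simp: Q)
        obtain z' where "z' \<in> carrier V'" "rel z z'" using tot[OF z(1)] by auto
        then show "Y \<in> carrier (quot_module V' N')" using z h by (auto simp: Q)
      next
        fix Y assume "Y \<in> carrier (quot_module V' N')"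
        then obtain z' where z': "z' \<in> carrier V'" "Y = c' z'" by (auto simp: Q)
        obtain z where "z \<in> carrier V" "rel z z'" using tot'[OF z'(1)] by auto
        then show "Y \<in> h ` carrier (quot_module V N)" using z' h by (force simp: Q)
      qed
    qed
  qed
  then show ?thesis unfolding isomorphic_def by blast
qed

lemma isomorphic_trans:
  "\<lbrakk>isomorphic R M N; isomorphic R N P\<rbrakk> \<Longrightarrow> isomorphic R M P"
  unfolding isomorphic_def lin_iso_def
  by (blast intro: lin_map_comp bij_betw_trans [unfolded comp_def])

lemma isomorphic_sym:
  assumes "lmodule R M" "lmodule R N" "isomorphic R M N" shows "isomorphic R N M"
proof -
  interpret M: lmodule R M by fact
  interpret N: lmodule R N by fact
  obtain h where h: "lin_map R M N h" "bij_betw h (carrier M) (carrier N)"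
    using assms(3) by (auto simp: isomorphic_def lin_iso_def)
  define g where "g = inv_into (carrier M) h"
  have g: "g y \<in> carrier M" "h (g y) = y" if "y \<in> carrier N" for y
    using that h(2) unfolding g_def by (auto simp: bij_betw_def intro: inv_into_into f_inv_into_f)
  have inj: "x = y" if "h x = h y" "x \<in> carrier M" "y \<in> carrier M" for x y
    using that h(2) by (auto simp: bij_betw_def inj_on_def)
  have "lin_map R N M g"
    by (rule lin_mapI; (rule inj)?) (auto simp: g lin_map_add[OF h(1)] lin_map_smult[OF h(1)])
  moreover have "bij_betw g (carrier N) (carrier M)"
    unfolding g_def by (rule bij_betw_inv_into) (rule h(2))
  ultimately show ?thesis unfolding isomorphic_def lin_iso_def by blast
qed

subsection \<open>Finite-dimensional vector spaces\<close>

abbreviation functional :: "('k, 'y) ring_scheme \<Rightarrow> ('k, 'v, 'z) module_scheme \<Rightarrow> ('v \<Rightarrow> 'k) \<Rightarrow> bool" where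
  "functional K V l \<equiv> lin_map K V (self_module K) l"

lemma (in abelian_group) minus_eq_zero_iff: "\<lbrakk>x \<in> carrier G; y \<in> carrier G\<rbrakk> \<Longrightarrow> x \<ominus> y = \<zero> \<longleftrightarrow> x = y"
  by (metis minus_eq r_neg minus_equality minus_minus a_inv_closed)

lemma a_minus_self_module [simp]: "x \<ominus>\<^bsub>self_module R\<^esub> y = x \<ominus>\<^bsub>R\<^esub> y"
  by (simp add: a_minus_def)

text \<open>The index set \<open>J\<close> is a minimal subset of \<open>L\<close> with the same common kernel.\<close>

lemma coord:
  fixes V :: "('k, 'v, 'z) module_scheme" and l :: "'i \<Rightarrow> 'v \<Rightarrow> 'k"
  assumes K: "field K" and V: "lmodule K V" and L: "finite L"
    and l: "\<forall>i\<in>L. functional K V (l i)"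
  shows "\<exists>J e. J \<subseteq> L \<and> (\<forall>j\<in>J. e j \<in> carrier V) \<and>
    (\<forall>i\<in>J. \<forall>j\<in>J. l i (e j) = (if i = j then \<one>\<^bsub>K\<^esub> else \<zero>\<^bsub>K\<^esub>)) \<and>
    (\<forall>v\<in>carrier V. (\<forall>j\<in>J. l j v = \<zero>\<^bsub>K\<^esub>) \<longrightarrow> (\<forall>i\<in>L. l i v = \<zero>\<^bsub>K\<^esub>))"
proof -
  interpret K: field K by fact
  interpret V: lmodule K V by fact
  define good where "good = (\<lambda>J. J \<subseteq> L \<and>
    (\<forall>v\<in>carrier V. (\<forall>j\<in>J. l j v = \<zero>\<^bsub>K\<^esub>) \<longrightarrow> (\<forall>i\<in>L. l i v = \<zero>\<^bsub>K\<^esub>)))"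
  have "good L" by (simp add: good_def)
  then obtain J where J: "good J" "\<And>J'. good J' \<Longrightarrow> card J \<le> card J'"
    using ex_has_least_nat[of good L card] by blast
  have JL: "J \<subseteq> L" using J(1) by (simp add: good_def)
  have fin: "finite J" using finite_subset[OF JL L] .
  \<comment> \<open>By minimality, dropping \<open>j\<close> enlarges the common kernel. A vector of
    the larger kernel that \<open>L\<close> still detects must be detected by \<open>l j\<close>,
    and its rescaling is dual to \<open>l j\<close> within \<open>J\<close>.\<close>
  have "\<exists>x\<in>carrier V. \<forall>i\<in>J. l i x = (if i = j then \<one>\<^bsub>K\<^esub> else \<zero>\<^bsub>K\<^esub>)" if j: "j \<in> J" for j
  proof -
    have "card (J - {j}) < card J" using j fin by (meson card_Diff1_less)
    then have "\<not> good (J - {j})" using J(2)[of "J - {j}"] by linarith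
    then obtain v where v: "v \<in> carrier V" "\<forall>i\<in>J - {j}. l i v = \<zero>\<^bsub>K\<^esub>" "\<exists>i\<in>L. l i v \<noteq> \<zero>\<^bsub>K\<^esub>"
      using JL by (auto simp: good_def)
    then have nz: "l j v \<noteq> \<zero>\<^bsub>K\<^esub>" using J(1) by (auto simp: good_def)
    have c: "l j v \<in> carrier K" using lin_map_closed[OF l[rule_format, of j] v(1)] j JL by auto
    have i: "inv\<^bsub>K\<^esub> (l j v) \<in> carrier K" "inv\<^bsub>K\<^esub> (l j v) \<otimes>\<^bsub>K\<^esub> l j v = \<one>\<^bsub>K\<^esub>"
      using c nz by (auto simp: K.field_Units)
    have "l i' (inv\<^bsub>K\<^esub> (l j v) \<odot>\<^bsub>V\<^esub> v) = inv\<^bsub>K\<^esub> (l j v) \<otimes>\<^bsub>K\<^esub> l i' v" if "i' \<in> J" for i'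
      using lin_map_smult[OF l[rule_format] i(1) v(1), of i'] that JL by auto
    then show ?thesis using i v by (intro bexI[of _ "inv\<^bsub>K\<^esub> (l j v) \<odot>\<^bsub>V\<^esub> v"]) auto
  qed
  then obtain e where e: "\<And>j. j \<in> J \<Longrightarrow> e j \<in> carrier V"
      "\<And>i j. \<lbrakk>i \<in> J; j \<in> J\<rbrakk> \<Longrightarrow> l i (e j) = (if i = j then \<one>\<^bsub>K\<^esub> else \<zero>\<^bsub>K\<^esub>)"
    by metis
  show ?thesis
    using JL e J(1) by (intro exI[of _ J] exI[of _ e]) (auto simp: good_def)
qed

text \<open>All expansions in dual families below are verified with this extraction of a single
  coefficient.\<close>

lemma functional_sum_delta:
  assumes K: "field K" and V: "lmodule K V" and J: "finite J" and i: "i \<in> J"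
    and l: "functional K V l"
    and e: "\<And>j. j \<in> J \<Longrightarrow> e j \<in> carrier V"
    and d: "\<And>j. j \<in> J \<Longrightarrow> l (e j) = (if i = j then \<one>\<^bsub>K\<^esub> else \<zero>\<^bsub>K\<^esub>)"
    and c: "\<And>j. j \<in> J \<Longrightarrow> c j \<in> carrier K"
  shows "l (\<Oplus>\<^bsub>V\<^esub>j\<in>J. c j \<odot>\<^bsub>V\<^esub> e j) = c i"
proof -
  interpret K: field K by fact
  interpret V: lmodule K V by fact
  have "l (\<Oplus>\<^bsub>V\<^esub>j\<in>J. c j \<odot>\<^bsub>V\<^esub> e j) = (\<Oplus>\<^bsub>K\<^esub>j\<in>J. l (c j \<odot>\<^bsub>V\<^esub> e j))"
    using lin_map_finsum[OF V lmodule_self_module[OF K.ring_axioms] l, of "\<lambda>j. c j \<odot>\<^bsub>V\<^esub> e j" J] e c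
    by (auto simp: Pi_iff)
  also have "\<dots> = (\<Oplus>\<^bsub>K\<^esub>j\<in>J. if i = j then c j else \<zero>\<^bsub>K\<^esub>)"
    using c e d by (intro K.finsum_cong') (auto simp: lin_map_smult[OF l])
  also have "\<dots> = c i" using J i c by (intro K.finsum_singleton) auto
  finally show ?thesis .
qed

section \<open>Pairings and dual bases\<close>

definition bilin :: "('k, 'y) ring_scheme \<Rightarrow> ('k, 'v, 'z) module_scheme \<Rightarrow> ('k, 'w, 'x) module_scheme
    \<Rightarrow> ('v \<Rightarrow> 'w \<Rightarrow> 'k) \<Rightarrow> bool" where
  "bilin K V W \<beta> \<longleftrightarrow> (\<forall>x\<in>carrier V. functional K W (\<beta> x)) \<and> (\<forall>y\<in>carrier W. functional K V (\<lambda>x. \<beta> x y))"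

lemma bilin_sym: "bilin K V W \<beta> \<Longrightarrow> bilin K W V (\<lambda>y x. \<beta> x y)"
  by (auto simp: bilin_def)

lemma bilinD:
  assumes "bilin K V W \<beta>"
  shows "x \<in> carrier V \<Longrightarrow> functional K W (\<beta> x)" "y \<in> carrier W \<Longrightarrow> functional K V (\<lambda>x. \<beta> x y)"
  using assms by (auto simp: bilin_def)

text \<open>A perfect pairing of finite-dimensional spaces with explicit dual families. Besides the
  Kronecker relations it asks that each family detect zero in the opposite space; expansions then
  follow, and the notion is symmetric in the two spaces.\<close>

definition dual_bases :: "('k, 'y) ring_scheme \<Rightarrow> ('k, 'v, 'z) module_scheme \<Rightarrow> ('k, 'w, 'x) module_scheme
    \<Rightarrow> ('v \<Rightarrow> 'w \<Rightarrow> 'k) \<Rightarrow> 'i set \<Rightarrow> ('i \<Rightarrow> 'v) \<Rightarrow> ('i \<Rightarrow> 'w) \<Rightarrow> bool" where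
  "dual_bases K V W \<beta> I v w \<longleftrightarrow> bilin K V W \<beta> \<and> finite I \<and> v \<in> I \<rightarrow> carrier V \<and> w \<in> I \<rightarrow> carrier W \<and>
     (\<forall>i\<in>I. \<forall>j\<in>I. \<beta> (v i) (w j) = (if i = j then \<one>\<^bsub>K\<^esub> else \<zero>\<^bsub>K\<^esub>)) \<and>
     (\<forall>x\<in>carrier V. (\<forall>i\<in>I. \<beta> x (w i) = \<zero>\<^bsub>K\<^esub>) \<longrightarrow> x = \<zero>\<^bsub>V\<^esub>) \<and>
     (\<forall>y\<in>carrier W. (\<forall>i\<in>I. \<beta> (v i) y = \<zero>\<^bsub>K\<^esub>) \<longrightarrow> y = \<zero>\<^bsub>W\<^esub>)"

lemma dual_bases_sym: "dual_bases K V W \<beta> I v w \<Longrightarrow> dual_bases K W V (\<lambda>y x. \<beta> x y) I w v"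
  by (auto simp: dual_bases_def bilin_sym)

text \<open>The difference of the two sides pairs to zero with every \<open>w i\<close>, and these
  detect zero in \<open>V\<close>.\<close>

lemma dual_bases_expand:
  assumes K: "field K" and V: "lmodule K V" and D: "dual_bases K V W \<beta> I v w" and x: "x \<in> carrier V"
  shows "x = (\<Oplus>\<^bsub>V\<^esub>i\<in>I. \<beta> x (w i) \<odot>\<^bsub>V\<^esub> v i)"
proof -
  interpret K: field K by fact
  interpret V: lmodule K V by fact
  have f: "functional K V (\<lambda>x. \<beta> x (w i))" if "i \<in> I" for i
    using D that by (auto simp: dual_bases_def bilin_def Pi_iff)
  have c: "\<beta> x (w i) \<in> carrier K" if "i \<in> I" for i using lin_map_closed[OF f[OF that] x] by simp
  define s where "s = (\<Oplus>\<^bsub>V\<^esub>i\<in>I. \<beta> x (w i) \<odot>\<^bsub>V\<^esub> v i)"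
  have s: "s \<in> carrier V" unfolding s_def using D c by (intro V.M.finsum_closed) (auto simp: dual_bases_def Pi_iff)
  have "\<beta> (x \<ominus>\<^bsub>V\<^esub> s) (w i) = \<zero>\<^bsub>K\<^esub>" if i: "i \<in> I" for i
  proof -
    have "\<beta> s (w i) = \<beta> x (w i)" unfolding s_def
      using D c i by (intro functional_sum_delta[OF K V _ i f[OF i]]) (auto simp: dual_bases_def Pi_iff)
    then show ?thesis
      using lin_map_diff[OF V lmodule_self_module[OF K.ring_axioms] f[OF i] x s] c[OF i]
      by (simp add: a_minus_def K.r_neg)
  qed
  then have "x \<ominus>\<^bsub>V\<^esub> s = \<zero>\<^bsub>V\<^esub>" using D x s by (simp add: dual_bases_def)
  then show ?thesis using x s V.diff_eq_zero unfolding s_def by simp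
qed

text \<open>Finite dimensionality of both spaces is obtained here: if a finite \<open>L\<close>
  separates \<open>V\<close> and \<open>V\<close> separates \<open>W\<close>, then
  \<open>coord\<close> thins \<open>L\<close> to a subset that is a basis of \<open>W\<close>, with
  dual vectors in \<open>V\<close>.\<close>

lemma dual_bases_exist:
  fixes V :: "('k, 'v, 'z) module_scheme" and W :: "('k, 'w, 'x) module_scheme"
  assumes K: "field K" and V: "lmodule K V" and W: "lmodule K W" and b: "bilin K V W \<beta>"
    and L: "finite L" "L \<subseteq> carrier W"
    and sepL: "\<And>x. \<lbrakk>x \<in> carrier V; \<And>y. y \<in> L \<Longrightarrow> \<beta> x y = \<zero>\<^bsub>K\<^esub>\<rbrakk> \<Longrightarrow> x = \<zero>\<^bsub>V\<^esub>"
    and sep: "\<And>y. \<lbrakk>y \<in> carrier W; \<And>x. x \<in> carrier V \<Longrightarrow> \<beta> x y = \<zero>\<^bsub>K\<^esub>\<rbrakk> \<Longrightarrow> y = \<zero>\<^bsub>W\<^esub>"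
  obtains J e where "J \<subseteq> L" "dual_bases K V W \<beta> J e (\<lambda>y. y)"
proof -
  interpret K: field K by fact
  interpret V: lmodule K V by fact
  interpret W: lmodule K W by fact
  have bV: "functional K V (\<lambda>x. \<beta> x y)" if "y \<in> carrier W" for y using b that by (auto simp: bilin_def)
  have bW: "functional K W (\<beta> x)" if "x \<in> carrier V" for x using b that by (auto simp: bilin_def)
  have fL: "functional K V (\<lambda>x. \<beta> x y)" if "y \<in> L" for y using bV L(2) that by auto
  obtain J e where J0: "J \<subseteq> L" "\<forall>j\<in>J. e j \<in> carrier V"
    "\<forall>i\<in>J. \<forall>j\<in>J. \<beta> (e j) i = (if i = j then \<one>\<^bsub>K\<^esub> else \<zero>\<^bsub>K\<^esub>)"
    "\<forall>v\<in>carrier V. (\<forall>j\<in>J. \<beta> v j = \<zero>\<^bsub>K\<^esub>) \<longrightarrow> (\<forall>i\<in>L. \<beta> v i = \<zero>\<^bsub>K\<^esub>)"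
    using coord[OF K V L(1), of "\<lambda>y x. \<beta> x y"] fL by blast
  have J: "J \<subseteq> L" "\<And>j. j \<in> J \<Longrightarrow> e j \<in> carrier V"
    "\<And>i j. \<lbrakk>i \<in> J; j \<in> J\<rbrakk> \<Longrightarrow> \<beta> (e j) i = (if i = j then \<one>\<^bsub>K\<^esub> else \<zero>\<^bsub>K\<^esub>)"
    "\<And>v i. \<lbrakk>v \<in> carrier V; \<And>j. j \<in> J \<Longrightarrow> \<beta> v j = \<zero>\<^bsub>K\<^esub>; i \<in> L\<rbrakk> \<Longrightarrow> \<beta> v i = \<zero>\<^bsub>K\<^esub>"
    using J0 by auto
  have JW: "j \<in> carrier W" if "j \<in> J" for j using that J(1) L(2) by auto
  have fJ: "finite J" using finite_subset[OF J(1) L(1)] .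
  have s1: "x = \<zero>\<^bsub>V\<^esub>" if x: "x \<in> carrier V" "\<And>j. j \<in> J \<Longrightarrow> \<beta> x j = \<zero>\<^bsub>K\<^esub>" for x
    by (rule sepL[OF x(1)]) (rule J(4)[OF x])
  \<comment> \<open>Every \<open>x\<close> equals the combination \<open>s\<close> of the vectors
    \<open>e j\<close>, so a \<open>y\<close> orthogonal to all \<open>e j\<close> is orthogonal to
    the whole of \<open>V\<close>.\<close>
  have s2: "y = \<zero>\<^bsub>W\<^esub>" if y: "y \<in> carrier W" "\<And>j. j \<in> J \<Longrightarrow> \<beta> (e j) y = \<zero>\<^bsub>K\<^esub>" for y
  proof (rule sep[OF y(1)])
    fix x assume x: "x \<in> carrier V"
    have c: "\<beta> x j \<in> carrier K" if "j \<in> J" for j using lin_map_closed[OF bV[OF JW[OF that]] x] by simp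
    define s where "s = (\<Oplus>\<^bsub>V\<^esub>j\<in>J. \<beta> x j \<odot>\<^bsub>V\<^esub> e j)"
    have s: "s \<in> carrier V" unfolding s_def using J(2) c by (intro V.M.finsum_closed) auto
    have "\<beta> (x \<ominus>\<^bsub>V\<^esub> s) i = \<zero>\<^bsub>K\<^esub>" if i: "i \<in> J" for i
    proof -
      have "\<beta> s i = \<beta> x i" unfolding s_def
        by (rule functional_sum_delta[OF K V fJ i bV[OF JW[OF i]]]) (use J(2,3) c i in auto)
      then show ?thesis
        using lin_map_diff[OF V lmodule_self_module[OF K.ring_axioms] bV[OF JW[OF i]] x s] c[OF i]
        by (simp add: a_minus_def K.r_neg)
    qed
    then have "x = s" using s1[of "x \<ominus>\<^bsub>V\<^esub> s"] x s V.diff_eq_zero by simp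
    moreover have "\<beta> s y = (\<Oplus>\<^bsub>K\<^esub>j\<in>J. \<beta> (\<beta> x j \<odot>\<^bsub>V\<^esub> e j) y)" unfolding s_def
      using lin_map_finsum[OF V lmodule_self_module[OF K.ring_axioms] bV[OF y(1)], of "\<lambda>j. \<beta> x j \<odot>\<^bsub>V\<^esub> e j" J]
        J(2) c by (auto simp: Pi_iff)
    moreover have "\<dots> = \<zero>\<^bsub>K\<^esub>"
      using J(2) c y by (intro K.add.finprod_one_eqI) (auto simp: lin_map_smult[OF bV[OF y(1)]])
    ultimately show "\<beta> x y = \<zero>\<^bsub>K\<^esub>" by simp
  qed
  have "\<forall>x\<in>carrier V. (\<forall>j\<in>J. \<beta> x j = \<zero>\<^bsub>K\<^esub>) \<longrightarrow> x = \<zero>\<^bsub>V\<^esub>" using s1 by blast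
  moreover have "\<forall>y\<in>carrier W. (\<forall>j\<in>J. \<beta> (e j) y = \<zero>\<^bsub>K\<^esub>) \<longrightarrow> y = \<zero>\<^bsub>W\<^esub>" using s2 by blast
  ultimately have "dual_bases K V W \<beta> J e (\<lambda>y. y)"
    using J(2,3) fJ JW b unfolding dual_bases_def by (intro conjI) auto
  then show thesis by (rule that[OF J(1)])
qed

text \<open>Separation of a vector from a subspace by a functional that is represented by an element
  of \<open>W\<close>. Coordinates chosen among the \<open>w i\<close>, with dual vectors inside
  \<open>Y\<close>, give a projection onto \<open>Y\<close>; some coordinate tells \<open>x\<close>
  from its projection.\<close>

lemma dual_bases_separate:
  assumes K: "field K" and V: "lmodule K V" and W: "lmodule K W" and D: "dual_bases K V W \<beta> I v w"
    and Y: "submodule Y K V" and x: "x \<in> carrier V" "x \<notin> Y"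
  obtains y where "y \<in> carrier W" "\<And>z. z \<in> Y \<Longrightarrow> \<beta> z y = \<zero>\<^bsub>K\<^esub>" "\<beta> x y \<noteq> \<zero>\<^bsub>K\<^esub>"
proof -
  interpret K: field K by fact
  interpret V: lmodule K V by fact
  interpret W: lmodule K W by fact
  note SK = lmodule_self_module[OF K.ring_axioms]
  have b: "bilin K V W \<beta>" and fI: "finite I" and v: "\<And>i. i \<in> I \<Longrightarrow> v i \<in> carrier V"
    and w: "\<And>i. i \<in> I \<Longrightarrow> w i \<in> carrier W"
    using D by (auto simp: dual_bases_def Pi_iff)
  note bV = bilinD(2)[OF b] and bW = bilinD(1)[OF b]
  note S = submoduleD[OF V Y]
  have VY: "lmodule K (V\<lparr>carrier := Y\<rparr>)" by (rule lmodule_submodule[OF V Y])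
  have fY: "functional K (V\<lparr>carrier := Y\<rparr>) (\<lambda>z. \<beta> z (w i))" if "i \<in> I" for i
    using bV[OF w[OF that]] S(1) by (auto simp: lin_map_def subset_iff)
  obtain J e where J0: "J \<subseteq> I" "\<forall>j\<in>J. e j \<in> carrier (V\<lparr>carrier := Y\<rparr>)"
    "\<forall>i\<in>J. \<forall>j\<in>J. \<beta> (e j) (w i) = (if i = j then \<one>\<^bsub>K\<^esub> else \<zero>\<^bsub>K\<^esub>)"
    "\<forall>z\<in>carrier (V\<lparr>carrier := Y\<rparr>). (\<forall>j\<in>J. \<beta> z (w j) = \<zero>\<^bsub>K\<^esub>) \<longrightarrow> (\<forall>i\<in>I. \<beta> z (w i) = \<zero>\<^bsub>K\<^esub>)"
    using coord[OF K VY fI, of "\<lambda>i z. \<beta> z (w i)"] fY by blast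
  have J: "J \<subseteq> I" "\<And>j. j \<in> J \<Longrightarrow> e j \<in> Y"
    "\<And>i j. \<lbrakk>i \<in> J; j \<in> J\<rbrakk> \<Longrightarrow> \<beta> (e j) (w i) = (if i = j then \<one>\<^bsub>K\<^esub> else \<zero>\<^bsub>K\<^esub>)"
    "\<And>z i. \<lbrakk>z \<in> Y; \<And>j. j \<in> J \<Longrightarrow> \<beta> z (w j) = \<zero>\<^bsub>K\<^esub>; i \<in> I\<rbrakk> \<Longrightarrow> \<beta> z (w i) = \<zero>\<^bsub>K\<^esub>"
    using J0 by auto
  have JI: "j \<in> I" if "j \<in> J" for j using that J(1) by auto
  have eV: "e j \<in> carrier V" if "j \<in> J" for j using J(2)[OF that] S by auto
  have fJ: "finite J" using finite_subset[OF J(1) fI] .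
  have c: "\<beta> z (w j) \<in> carrier K" if "j \<in> I" "z \<in> carrier V" for j z
    using lin_map_closed[OF bV[OF w[OF that(1)]] that(2)] by simp
  \<comment> \<open>The projection onto \<open>Y\<close>: it reads off the coordinates indexed by
    \<open>J\<close> and recombines them with the dual vectors in \<open>Y\<close>.\<close>
  define s where "s = (\<lambda>z. \<Oplus>\<^bsub>V\<^esub>j\<in>J. \<beta> z (w j) \<odot>\<^bsub>V\<^esub> e j)"
  have s: "s z \<in> Y" if "z \<in> carrier V" for z
    unfolding s_def by (rule submodule_finsum[OF V Y]) (auto simp: J c JI S that)
  have sV: "s z \<in> carrier V" if "z \<in> carrier V" for z using s[OF that] S by auto
  have sY: "s z = z" if z: "z \<in> Y" for z
  proof -
    have zV: "z \<in> carrier V" using z S by auto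
    have "\<beta> (z \<ominus>\<^bsub>V\<^esub> s z) (w i) = \<zero>\<^bsub>K\<^esub>" if i: "i \<in> J" for i
    proof -
      have "\<beta> (s z) (w i) = \<beta> z (w i)" unfolding s_def
        by (rule functional_sum_delta[OF K V fJ i bV[OF w[OF JI[OF i]]]]) (use J(2,3) c i JI eV zV in auto)
      then show ?thesis
        using lin_map_diff[OF V SK bV[OF w[OF JI[OF i]]] zV sV[OF zV]] c[OF JI[OF i] zV]
        by (simp add: a_minus_def K.r_neg)
    qed
    then have "\<beta> (z \<ominus>\<^bsub>V\<^esub> s z) (w i) = \<zero>\<^bsub>K\<^esub>" if "i \<in> I" for i
      using J(4)[of "z \<ominus>\<^bsub>V\<^esub> s z" i] that S z s[OF zV] by auto
    then have "z \<ominus>\<^bsub>V\<^esub> s z = \<zero>\<^bsub>V\<^esub>" using D zV sV[OF zV] by (simp add: dual_bases_def)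
    then show ?thesis using zV sV[OF zV] V.diff_eq_zero by simp
  qed
  have "\<exists>i\<in>I. \<beta> x (w i) \<noteq> \<beta> (s x) (w i)"
  proof (rule ccontr)
    assume "\<not> ?thesis"
    then have "\<beta> (x \<ominus>\<^bsub>V\<^esub> s x) (w i) = \<zero>\<^bsub>K\<^esub>" if i: "i \<in> I" for i
      using lin_map_diff[OF V SK bV[OF w[OF i]] x(1) sV[OF x(1)]] c[OF i sV[OF x(1)]] i
      by (simp add: a_minus_def K.r_neg)
    then have "x \<ominus>\<^bsub>V\<^esub> s x = \<zero>\<^bsub>V\<^esub>" using D x sV[OF x(1)] by (simp add: dual_bases_def)
    then show False using x s[OF x(1)] sV[OF x(1)] V.diff_eq_zero by metis
  qed
  then obtain i where i: "i \<in> I" "\<beta> x (w i) \<noteq> \<beta> (s x) (w i)" by blast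
  \<comment> \<open>\<open>u\<close> is the adjoint of the projection applied to \<open>w i\<close>:
    pairing \<open>z\<close> with \<open>u\<close> is pairing \<open>s z\<close> with
    \<open>w i\<close>. Hence the difference of \<open>w i\<close> and \<open>u\<close> vanishes on
    \<open>Y\<close> but not at \<open>x\<close>.\<close>
  define u where "u = (\<Oplus>\<^bsub>W\<^esub>j\<in>J. \<beta> (e j) (w i) \<odot>\<^bsub>W\<^esub> w j)"
  have uterm: "(\<lambda>j. \<beta> (e j) (w i) \<odot>\<^bsub>W\<^esub> w j) \<in> J \<rightarrow> carrier W" using c[OF i(1) eV] w JI by auto
  have u: "u \<in> carrier W" unfolding u_def by (rule W.M.finsum_closed[OF uterm])
  have bu: "\<beta> z u = \<beta> (s z) (w i)" if z: "z \<in> carrier V" for z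
  proof -
    have "\<beta> z u = (\<Oplus>\<^bsub>K\<^esub>j\<in>J. \<beta> z (\<beta> (e j) (w i) \<odot>\<^bsub>W\<^esub> w j))"
      unfolding u_def using lin_map_finsum[OF W SK bW[OF z] uterm] by simp
    also have "\<dots> = (\<Oplus>\<^bsub>K\<^esub>j\<in>J. \<beta> (\<beta> z (w j) \<odot>\<^bsub>V\<^esub> e j) (w i))"
      using c z eV JI i w
      by (intro K.finsum_cong') (auto simp: lin_map_smult[OF bV[OF w[OF i(1)]]] lin_map_smult[OF bW[OF z]] K.m_comm)
    also have "\<dots> = \<beta> (s z) (w i)" unfolding s_def
      using lin_map_finsum[OF V SK bV[OF w[OF i(1)]], of "\<lambda>j. \<beta> z (w j) \<odot>\<^bsub>V\<^esub> e j" J] c z eV JI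
      by (auto simp: Pi_iff)
    finally show ?thesis .
  qed
  have bdiff: "\<beta> z (w i \<ominus>\<^bsub>W\<^esub> u) = \<beta> z (w i) \<ominus>\<^bsub>K\<^esub> \<beta> (s z) (w i)" if z: "z \<in> carrier V" for z
    using lin_map_diff[OF W SK bW[OF z] w[OF i(1)] u] bu[OF z] by (simp add: a_minus_def)
  show thesis
  proof (rule that[of "w i \<ominus>\<^bsub>W\<^esub> u"])
    show "w i \<ominus>\<^bsub>W\<^esub> u \<in> carrier W" using w i u by simp
    fix z assume z: "z \<in> Y"
    then have "z \<in> carrier V" using S by auto
    then show "\<beta> z (w i \<ominus>\<^bsub>W\<^esub> u) = \<zero>\<^bsub>K\<^esub>" using bdiff sY[OF z] c[OF i(1)] by (simp add: a_minus_def K.r_neg)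
  next
    show "\<beta> x (w i \<ominus>\<^bsub>W\<^esub> u) \<noteq> \<zero>\<^bsub>K\<^esub>"
      using bdiff[OF x(1)] i c[OF i(1) x(1)] c[OF i(1) sV[OF x(1)]] by (simp add: K.minus_eq_zero_iff)
  qed
qed

text \<open>Modulo \<open>N\<close> and \<open>M\<close> the pairing becomes perfect. The
  isomorphism is made from coordinates: \<open>J\<close>, cut out of \<open>F\<close>, indexes dual
  bases of the two quotients, and elements with equal coordinates are matched.\<close>

lemma pairing_quot_isomorphic:
  assumes K: "field K" and V: "lmodule K V" and W: "lmodule K W" and b: "bilin K V W \<beta>"
    and F: "finite F" "F \<subseteq> carrier W"
    and N: "submodule N K V" and M: "submodule M K W"
    and radN: "\<And>x y. \<lbrakk>x \<in> N; y \<in> carrier W\<rbrakk> \<Longrightarrow> \<beta> x y = \<zero>\<^bsub>K\<^esub>"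
    and FN: "\<And>x. \<lbrakk>x \<in> carrier V; \<And>y. y \<in> F \<Longrightarrow> \<beta> x y = \<zero>\<^bsub>K\<^esub>\<rbrakk> \<Longrightarrow> x \<in> N"
    and radM: "\<And>y. y \<in> carrier W \<Longrightarrow> y \<in> M \<longleftrightarrow> (\<forall>x\<in>carrier V. \<beta> x y = \<zero>\<^bsub>K\<^esub>)"
  shows "isomorphic K (quot_module V N) (quot_module W M)"
proof -
  interpret K: field K by fact
  interpret V: lmodule K V by fact
  interpret W: lmodule K W by fact
  note SK = lmodule_self_module[OF K.ring_axioms]
  note bV = bilinD(2)[OF b] and bW = bilinD(1)[OF b]
  have fF: "functional K V (\<lambda>x. \<beta> x y)" if "y \<in> F" for y using bV F(2) that by auto
  obtain J e where J0: "J \<subseteq> F" "\<forall>j\<in>J. e j \<in> carrier V"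
    "\<forall>i\<in>J. \<forall>j\<in>J. \<beta> (e j) i = (if i = j then \<one>\<^bsub>K\<^esub> else \<zero>\<^bsub>K\<^esub>)"
    "\<forall>v\<in>carrier V. (\<forall>j\<in>J. \<beta> v j = \<zero>\<^bsub>K\<^esub>) \<longrightarrow> (\<forall>i\<in>F. \<beta> v i = \<zero>\<^bsub>K\<^esub>)"
    using coord[OF K V F(1), of "\<lambda>y x. \<beta> x y"] fF by blast
  have J: "J \<subseteq> F" "\<And>j. j \<in> J \<Longrightarrow> e j \<in> carrier V"
    "\<And>i j. \<lbrakk>i \<in> J; j \<in> J\<rbrakk> \<Longrightarrow> \<beta> (e j) i = (if i = j then \<one>\<^bsub>K\<^esub> else \<zero>\<^bsub>K\<^esub>)"
    "\<And>v i. \<lbrakk>v \<in> carrier V; \<And>j. j \<in> J \<Longrightarrow> \<beta> v j = \<zero>\<^bsub>K\<^esub>; i \<in> F\<rbrakk> \<Longrightarrow> \<beta> v i = \<zero>\<^bsub>K\<^esub>"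
    using J0 by auto
  have JW: "j \<in> carrier W" if "j \<in> J" for j using that J(1) F(2) by auto
  have fJ: "finite J" using finite_subset[OF J(1) F(1)] .
  have c: "\<beta> x y \<in> carrier K" if "x \<in> carrier V" "y \<in> carrier W" for x y
    using lin_map_closed[OF bV[OF that(2)] that(1)] by simp
  note NV = submodule_subset[OF V N]
  have N_iff: "x \<in> N \<longleftrightarrow> (\<forall>j\<in>J. \<beta> x j = \<zero>\<^bsub>K\<^esub>)" if "x \<in> carrier V" for x
    using radN[of x] FN[OF that] J(4)[OF that] JW by blast
  \<comment> \<open>Subtracting from \<open>x\<close> its combination \<open>s\<close> of the
    \<open>e j\<close> leaves an element of \<open>N\<close>, on which every \<open>y\<close>
    vanishes. Testing \<open>y\<close> on the \<open>e j\<close> is therefore the same as testing it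
    on \<open>V\<close>.\<close>
  have M_iff: "y \<in> M \<longleftrightarrow> (\<forall>j\<in>J. \<beta> (e j) y = \<zero>\<^bsub>K\<^esub>)" if y: "y \<in> carrier W" for y
  proof
    assume "y \<in> M" then show "\<forall>j\<in>J. \<beta> (e j) y = \<zero>\<^bsub>K\<^esub>" using radM[OF y] J(2) by blast
  next
    assume z: "\<forall>j\<in>J. \<beta> (e j) y = \<zero>\<^bsub>K\<^esub>"
    have "\<beta> x y = \<zero>\<^bsub>K\<^esub>" if x: "x \<in> carrier V" for x
    proof -
      define s where "s = (\<Oplus>\<^bsub>V\<^esub>j\<in>J. \<beta> x j \<odot>\<^bsub>V\<^esub> e j)"
      have s: "s \<in> carrier V" unfolding s_def using J(2) c JW x by (intro V.M.finsum_closed) auto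
      have "\<beta> (x \<ominus>\<^bsub>V\<^esub> s) i = \<zero>\<^bsub>K\<^esub>" if i: "i \<in> J" for i
      proof -
        have "\<beta> s i = \<beta> x i" unfolding s_def
          by (rule functional_sum_delta[OF K V fJ i bV[OF JW[OF i]]]) (use J(2,3) c i JW x in auto)
        then show ?thesis
          using lin_map_diff[OF V SK bV[OF JW[OF i]] x s] c[OF x JW[OF i]]
          by (simp add: a_minus_def K.r_neg)
      qed
      then have "x \<ominus>\<^bsub>V\<^esub> s \<in> N" using N_iff x s by simp
      then have "\<beta> (x \<ominus>\<^bsub>V\<^esub> s) y = \<zero>\<^bsub>K\<^esub>" by (rule radN[OF _ y])
      then have "\<beta> x y = \<beta> s y"
        using lin_map_diff[OF V SK bV[OF y] x s] c[OF x y] c[OF s y] by (simp add: K.minus_eq_zero_iff)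
      moreover have "\<beta> s y = (\<Oplus>\<^bsub>K\<^esub>j\<in>J. \<beta> (\<beta> x j \<odot>\<^bsub>V\<^esub> e j) y)" unfolding s_def
        using lin_map_finsum[OF V SK bV[OF y(1)], of "\<lambda>j. \<beta> x j \<odot>\<^bsub>V\<^esub> e j" J]
          J(2) c JW x by (auto simp: Pi_iff)
      moreover have "\<dots> = \<zero>\<^bsub>K\<^esub>"
        using J(2) c JW x z by (intro K.add.finprod_one_eqI) (auto simp: lin_map_smult[OF bV[OF y(1)]])
      ultimately show ?thesis by simp
    qed
    then show "y \<in> M" using radM[OF y] by blast
  qed
  show ?thesis
  proof (rule corr_isomorphic[OF V W N M, where rel = "\<lambda>x y. \<forall>j\<in>J. \<beta> x j = \<beta> (e j) y"])
    fix x assume x: "x \<in> carrier V"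
    define y where "y = (\<Oplus>\<^bsub>W\<^esub>j\<in>J. \<beta> x j \<odot>\<^bsub>W\<^esub> j)"
    have "y \<in> carrier W" unfolding y_def using J(2) c JW x by (intro W.M.finsum_closed) auto
    moreover have "\<beta> (e i) y = \<beta> x i" if i: "i \<in> J" for i unfolding y_def
      by (rule functional_sum_delta[OF K W fJ i bW[OF J(2)[OF i]]]) (use J(2,3) c i JW x in auto)
    ultimately show "\<exists>y\<in>carrier W. \<forall>j\<in>J. \<beta> x j = \<beta> (e j) y" by (intro bexI[of _ y]) auto
  next
    fix y assume y: "y \<in> carrier W"
    define x where "x = (\<Oplus>\<^bsub>V\<^esub>j\<in>J. \<beta> (e j) y \<odot>\<^bsub>V\<^esub> e j)"
    have "x \<in> carrier V" unfolding x_def using J(2) c JW y by (intro V.M.finsum_closed) auto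
    moreover have "\<beta> x i = \<beta> (e i) y" if i: "i \<in> J" for i unfolding x_def
      by (rule functional_sum_delta[OF K V fJ i bV[OF JW[OF i]]]) (use J(2,3) c i JW y in auto)
    ultimately show "\<exists>x\<in>carrier V. \<forall>j\<in>J. \<beta> x j = \<beta> (e j) y" by (intro bexI[of _ x]) auto
  next
    fix y z y' z'
    assume *: "y \<in> carrier V" "z \<in> carrier V" "y' \<in> carrier W" "z' \<in> carrier W"
      "\<forall>j\<in>J. \<beta> y j = \<beta> (e j) y'" "\<forall>j\<in>J. \<beta> z j = \<beta> (e j) z'"
    show "\<forall>j\<in>J. \<beta> (y \<oplus>\<^bsub>V\<^esub> z) j = \<beta> (e j) (y' \<oplus>\<^bsub>W\<^esub> z')"
      using * lin_map_add[OF bV[OF JW]] lin_map_add[OF bW[OF J(2)]] by simp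
  next
    fix r z z'
    assume *: "r \<in> carrier K" "z \<in> carrier V" "z' \<in> carrier W" "\<forall>j\<in>J. \<beta> z j = \<beta> (e j) z'"
    show "\<forall>j\<in>J. \<beta> (r \<odot>\<^bsub>V\<^esub> z) j = \<beta> (e j) (r \<odot>\<^bsub>W\<^esub> z')"
      using * lin_map_smult[OF bV[OF JW]] lin_map_smult[OF bW[OF J(2)]] by simp
  next
    fix z z'
    assume "z \<in> carrier V" "z' \<in> carrier W" "\<forall>j\<in>J. \<beta> z j = \<beta> (e j) z'"
    then show "z \<in> N \<longleftrightarrow> z' \<in> M" by (simp add: N_iff M_iff)
  qed
qed

section \<open>Pairings between complexes and their homology\<close>

lemma homology_submodules:
  assumes "lmodule K U" "lmodule K V" "lmodule K W" "lin_map K U V f" "lin_map K V W g"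
    "\<forall>u\<in>carrier U. g (f u) = \<zero>\<^bsub>W\<^esub>"
  shows "submodule (a_kernel V W g) K V" "lmodule K (V\<lparr>carrier := a_kernel V W g\<rparr>)"
    "submodule (f ` carrier U) K (V\<lparr>carrier := a_kernel V W g\<rparr>)"
proof -
  show 1: "submodule (a_kernel V W g) K V" by (rule submodule_kernel[OF assms(2,3,5)])
  show "lmodule K (V\<lparr>carrier := a_kernel V W g\<rparr>)" by (rule lmodule_submodule[OF assms(2) 1])
  show "submodule (f ` carrier U) K (V\<lparr>carrier := a_kernel V W g\<rparr>)"
    using assms(6) lin_map_closed[OF assms(4)]
    by (intro submodule_restrict[OF assms(2) submodule_image[OF assms(1,2,4)] 1]) (auto simp: a_kernel_def')
qed

lemma lmodule_homology:
  assumes "lmodule K U" "lmodule K V" "lmodule K W" "lin_map K U V f" "lin_map K V W g"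
    "\<forall>u\<in>carrier U. g (f u) = \<zero>\<^bsub>W\<^esub>"
  shows "lmodule K (homology U f V g W)"
  unfolding homology_def using homology_submodules[OF assms] by (intro lmodule_quot)

text \<open>
  The pairing descends to a nondegenerate one between the two homology spaces: a cycle orthogonal
  to all cycles on the other side is a boundary, because otherwise some functional separates it
  from the boundaries, and adjointness makes the element representing this functional a cycle.
\<close>

lemma pairing_homology_isomorphic:
  fixes U :: "('k, 'u, 'a) module_scheme" and V :: "('k, 'v) module" and W :: "('k, 'w, 'b) module_scheme"
    and U' :: "('k, 'uu, 'c) module_scheme" and V' :: "('k, 'vv) module" and W' :: "('k, 'ww, 'd) module_scheme"
  assumes K: "field K"
    and U: "lmodule K U" and V: "lmodule K V" and W: "lmodule K W"
    and f: "lin_map K U V f" and g: "lin_map K V W g"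
    and gf: "\<forall>u\<in>carrier U. g (f u) = \<zero>\<^bsub>W\<^esub>"
    and U': "lmodule K U'" and V': "lmodule K V'" and W': "lmodule K W'"
    and f': "lin_map K V' U' f'" and g': "lin_map K W' V' g'"
    and fg': "\<forall>u\<in>carrier W'. f' (g' u) = \<zero>\<^bsub>U'\<^esub>"
    and D: "dual_bases K V V' \<beta> I v w"
    and adjU: "\<And>u y. \<lbrakk>u \<in> carrier U; y \<in> carrier V'\<rbrakk> \<Longrightarrow> \<beta> (f u) y = \<beta>U u (f' y)"
    and zU: "\<And>u. u \<in> carrier U \<Longrightarrow> \<beta>U u \<zero>\<^bsub>U'\<^esub> = \<zero>\<^bsub>K\<^esub>"
    and sepU: "\<And>y. \<lbrakk>y \<in> carrier U'; \<And>u. u \<in> carrier U \<Longrightarrow> \<beta>U u y = \<zero>\<^bsub>K\<^esub>\<rbrakk> \<Longrightarrow> y = \<zero>\<^bsub>U'\<^esub>"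
    and adjW: "\<And>x y. \<lbrakk>x \<in> carrier V; y \<in> carrier W'\<rbrakk> \<Longrightarrow> \<beta> x (g' y) = \<beta>W (g x) y"
    and zW: "\<And>y. y \<in> carrier W' \<Longrightarrow> \<beta>W \<zero>\<^bsub>W\<^esub> y = \<zero>\<^bsub>K\<^esub>"
    and sepW: "\<And>x. \<lbrakk>x \<in> carrier W; \<And>y. y \<in> carrier W' \<Longrightarrow> \<beta>W x y = \<zero>\<^bsub>K\<^esub>\<rbrakk> \<Longrightarrow> x = \<zero>\<^bsub>W\<^esub>"
  shows "isomorphic K (homology U f V g W) (homology W' g' V' f' U')"
proof -
  interpret K: field K by fact
  interpret V: lmodule K V by fact
  interpret V': lmodule K V' by fact
  note SK = lmodule_self_module[OF K.ring_axioms]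
  define Z where "Z = a_kernel V W g"
  define Z' where "Z' = a_kernel V' U' f'"
  note H = homology_submodules[OF U V W f g gf, folded Z_def]
  note H' = homology_submodules[OF W' V' U' g' f' fg', folded Z'_def]
  have Z_iff: "x \<in> Z \<longleftrightarrow> x \<in> carrier V \<and> g x = \<zero>\<^bsub>W\<^esub>" for x by (auto simp: Z_def a_kernel_def')
  have Z'_iff: "x \<in> Z' \<longleftrightarrow> x \<in> carrier V' \<and> f' x = \<zero>\<^bsub>U'\<^esub>" for x by (auto simp: Z'_def a_kernel_def')
  have b: "bilin K V V' \<beta>" and fI: "finite I" and v: "\<And>i. i \<in> I \<Longrightarrow> v i \<in> carrier V"
    and w: "\<And>i. i \<in> I \<Longrightarrow> w i \<in> carrier V'"
    using D by (auto simp: dual_bases_def Pi_iff)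
  note bV = bilinD(2)[OF b] and bW = bilinD(1)[OF b]
  have c: "\<beta> x y \<in> carrier K" if "x \<in> carrier V" "y \<in> carrier V'" for x y
    using lin_map_closed[OF bV[OF that(2)] that(1)] by simp
  have bZ: "bilin K (V\<lparr>carrier := Z\<rparr>) (V'\<lparr>carrier := Z'\<rparr>) \<beta>"
    using b by (auto simp: bilin_def lin_map_def Z_iff Z'_iff Pi_iff)
  have im: "f u \<in> carrier V" if "u \<in> carrier U" for u using lin_map_closed[OF f that] .
  have im': "g' u \<in> carrier V'" if "u \<in> carrier W'" for u using lin_map_closed[OF g' that] .
  have rad: "\<beta> x y = \<zero>\<^bsub>K\<^esub>" if "x \<in> f ` carrier U" "y \<in> Z'" for x y
    using that adjU zU by (auto simp: Z'_iff)
  have rad': "\<beta> x y = \<zero>\<^bsub>K\<^esub>" if "x \<in> Z" "y \<in> g' ` carrier W'" for x y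
    using that adjW zW by (auto simp: Z_iff)
  have sep: "x \<in> f ` carrier U" if x: "x \<in> Z" "\<And>y. y \<in> Z' \<Longrightarrow> \<beta> x y = \<zero>\<^bsub>K\<^esub>" for x
  proof (rule ccontr)
    assume "x \<notin> f ` carrier U"
    moreover have "x \<in> carrier V" using x by (simp add: Z_iff)
    ultimately obtain y where y: "y \<in> carrier V'" "\<And>z. z \<in> f ` carrier U \<Longrightarrow> \<beta> z y = \<zero>\<^bsub>K\<^esub>" "\<beta> x y \<noteq> \<zero>\<^bsub>K\<^esub>"
      using dual_bases_separate[OF K V V' D submodule_image[OF U V f]] by metis
    have "f' y = \<zero>\<^bsub>U'\<^esub>"
      by (rule sepU[OF lin_map_closed[OF f' y(1)]]) (use adjU[OF _ y(1)] y(2) in force)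
    then show False using x(2)[of y] y by (simp add: Z'_iff)
  qed
  have sep': "y \<in> g' ` carrier W'" if y: "y \<in> Z'" "\<And>x. x \<in> Z \<Longrightarrow> \<beta> x y = \<zero>\<^bsub>K\<^esub>" for y
  proof (rule ccontr)
    assume "y \<notin> g' ` carrier W'"
    moreover have "y \<in> carrier V'" using y by (simp add: Z'_iff)
    ultimately obtain x where x: "x \<in> carrier V" "\<And>z. z \<in> g' ` carrier W' \<Longrightarrow> \<beta> x z = \<zero>\<^bsub>K\<^esub>" "\<beta> x y \<noteq> \<zero>\<^bsub>K\<^esub>"
      using dual_bases_separate[OF K V' V dual_bases_sym[OF D] submodule_image[OF W' V' g']] by metis
    have "g x = \<zero>\<^bsub>W\<^esub>"
      by (rule sepW[OF lin_map_closed[OF g x(1)]]) (use adjW[OF x(1)] x(2) in force)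
    then show False using y(2)[of x] x by (simp add: Z_iff)
  qed
  have fZ: "functional K (V'\<lparr>carrier := Z'\<rparr>) (\<beta> (v i))" if "i \<in> I" for i
    using bW[OF v[OF that]] by (auto simp: lin_map_def Z'_iff)
  obtain J e where J0: "J \<subseteq> I" "\<forall>j\<in>J. e j \<in> carrier (V'\<lparr>carrier := Z'\<rparr>)"
    "\<forall>i\<in>J. \<forall>j\<in>J. \<beta> (v i) (e j) = (if i = j then \<one>\<^bsub>K\<^esub> else \<zero>\<^bsub>K\<^esub>)"
    "\<forall>z\<in>carrier (V'\<lparr>carrier := Z'\<rparr>). (\<forall>j\<in>J. \<beta> (v j) z = \<zero>\<^bsub>K\<^esub>) \<longrightarrow> (\<forall>i\<in>I. \<beta> (v i) z = \<zero>\<^bsub>K\<^esub>)"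
    using coord[OF K H'(2) fI, of "\<lambda>i. \<beta> (v i)"] fZ by blast
  have J: "J \<subseteq> I" "\<And>j. j \<in> J \<Longrightarrow> e j \<in> Z'"
    "\<And>i j. \<lbrakk>i \<in> J; j \<in> J\<rbrakk> \<Longrightarrow> \<beta> (v i) (e j) = (if i = j then \<one>\<^bsub>K\<^esub> else \<zero>\<^bsub>K\<^esub>)"
    "\<And>z i. \<lbrakk>z \<in> Z'; \<And>j. j \<in> J \<Longrightarrow> \<beta> (v j) z = \<zero>\<^bsub>K\<^esub>; i \<in> I\<rbrakk> \<Longrightarrow> \<beta> (v i) z = \<zero>\<^bsub>K\<^esub>"
    using J0 by auto
  have fJ: "finite J" using finite_subset[OF J(1) fI] .
  have JI: "j \<in> I" if "j \<in> J" for j using that J(1) by auto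
  have eV: "e j \<in> carrier V'" if "j \<in> J" for j using J(2)[OF that] by (simp add: Z'_iff)
  \<comment> \<open>A cycle \<open>y\<close> in \<open>Z'\<close> is the combination of the
    \<open>e j\<close> with coefficients \<open>\<beta> (v j) y\<close>. Orthogonality to the
    finitely many \<open>e j\<close> thus gives orthogonality to all of \<open>Z'\<close>, which
    provides the finite test set for the quotient.\<close>
  have fin: "x \<in> f ` carrier U" if x: "x \<in> Z" "\<And>y. y \<in> e ` J \<Longrightarrow> \<beta> x y = \<zero>\<^bsub>K\<^esub>" for x
  proof (rule sep[OF x(1)])
    fix y assume y: "y \<in> Z'"
    have yV: "y \<in> carrier V'" and xV: "x \<in> carrier V" using x y by (auto simp: Z_iff Z'_iff)
    define s where "s = (\<Oplus>\<^bsub>V'\<^esub>j\<in>J. \<beta> (v j) y \<odot>\<^bsub>V'\<^esub> e j)"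
    have sZ: "s \<in> Z'" unfolding s_def
      by (rule submodule_finsum[OF V' H'(1)]) (use submoduleD[OF V' H'(1)] J c v JI yV in auto)
    have s: "s \<in> carrier V'" using sZ by (simp add: Z'_iff)
    have "\<beta> (v i) (y \<ominus>\<^bsub>V'\<^esub> s) = \<zero>\<^bsub>K\<^esub>" if i: "i \<in> J" for i
    proof -
      have "\<beta> (v i) s = \<beta> (v i) y" unfolding s_def
        by (rule functional_sum_delta[OF K V' fJ i bW[OF v[OF JI[OF i]]]]) (use J(2,3) c i JI yV v eV in auto)
      then show ?thesis
        using lin_map_diff[OF V' SK bW[OF v[OF JI[OF i]]] yV s] c[OF v[OF JI[OF i]] yV]
        by (simp add: a_minus_def K.r_neg)
    qed
    then have "\<beta> (v i) (y \<ominus>\<^bsub>V'\<^esub> s) = \<zero>\<^bsub>K\<^esub>" if "i \<in> I" for i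
      using J(4)[of "y \<ominus>\<^bsub>V'\<^esub> s" i] that submodule_diff[OF V' H'(1) y sZ] by auto
    then have "y \<ominus>\<^bsub>V'\<^esub> s = \<zero>\<^bsub>V'\<^esub>" using D yV s by (simp add: dual_bases_def)
    then have "y = s" using yV s V'.diff_eq_zero by simp
    moreover have "\<beta> x s = (\<Oplus>\<^bsub>K\<^esub>j\<in>J. \<beta> x (\<beta> (v j) y \<odot>\<^bsub>V'\<^esub> e j))" unfolding s_def
      using lin_map_finsum[OF V' SK bW[OF xV], of "\<lambda>j. \<beta> (v j) y \<odot>\<^bsub>V'\<^esub> e j" J] c v JI yV eV by (auto simp: Pi_iff)
    moreover have "\<dots> = \<zero>\<^bsub>K\<^esub>"
      using x(2) c v JI yV eV by (intro K.add.finprod_one_eqI) (auto simp: lin_map_smult[OF bW[OF xV]])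
    ultimately show "\<beta> x y = \<zero>\<^bsub>K\<^esub>" by simp
  qed
  show ?thesis
    unfolding homology_def Z_def[symmetric] Z'_def[symmetric]
    by (rule pairing_quot_isomorphic[OF K H(2) H'(2) bZ, where F = "e ` J"])
      (use H H' fJ J rad fin rad' sep' in \<open>auto simp: Z_iff Z'_iff\<close>)
qed

text \<open>A generating set of least size is linearly independent, hence a basis, and
  \<open>l s\<close> is the coordinate at \<open>s\<close>.\<close>

lemma fin_gen_functionals:
  assumes K: "field K" and V: "lmodule K V" and fg: "fin_gen K V"
  obtains S and l where "finite S" "S \<subseteq> carrier V" "\<And>s. s \<in> S \<Longrightarrow> functional K V (l s)"
    "\<And>x. x \<in> carrier V \<Longrightarrow> x = (\<Oplus>\<^bsub>V\<^esub>s\<in>S. l s x \<odot>\<^bsub>V\<^esub> s)"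
proof -
  interpret K: field K by fact
  interpret V: lmodule K V by fact
  define gen where "gen = (\<lambda>S. finite S \<and> S \<subseteq> carrier V \<and>
    (\<forall>x\<in>carrier V. \<exists>c\<in>S \<rightarrow> carrier K. x = (\<Oplus>\<^bsub>V\<^esub>s\<in>S. c s \<odot>\<^bsub>V\<^esub> s)))"
  obtain S0 where "gen S0" using fg by (auto simp: fin_gen_def gen_def)
  then obtain S where S: "gen S" "\<And>S'. gen S' \<Longrightarrow> card S \<le> card S'"
    using ex_has_least_nat[of gen S0 card] by blast
  have fS: "finite S" and SV: "S \<subseteq> carrier V" using S(1) by (auto simp: gen_def)
  define sm where "sm = (\<lambda>c. \<Oplus>\<^bsub>V\<^esub>s\<in>S. c s \<odot>\<^bsub>V\<^esub> s)"
  have smc: "sm c \<in> carrier V" if "c \<in> S \<rightarrow> carrier K" for c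
    unfolding sm_def using that SV by (intro V.M.finsum_closed) auto
  have sm_add: "sm (\<lambda>s. c s \<oplus>\<^bsub>K\<^esub> d s) = sm c \<oplus>\<^bsub>V\<^esub> sm d" if "c \<in> S \<rightarrow> carrier K" "d \<in> S \<rightarrow> carrier K" for c d
  proof -
    have "sm (\<lambda>s. c s \<oplus>\<^bsub>K\<^esub> d s) = (\<Oplus>\<^bsub>V\<^esub>s\<in>S. c s \<odot>\<^bsub>V\<^esub> s \<oplus>\<^bsub>V\<^esub> d s \<odot>\<^bsub>V\<^esub> s)" unfolding sm_def
      using that SV by (intro V.M.finsum_cong') (auto simp: V.smult_l_distr Pi_iff)
    also have "\<dots> = sm c \<oplus>\<^bsub>V\<^esub> sm d" unfolding sm_def
      using that SV by (intro V.M.finsum_addf) auto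
    finally show ?thesis .
  qed
  have sm_smult: "sm (\<lambda>s. r \<otimes>\<^bsub>K\<^esub> c s) = r \<odot>\<^bsub>V\<^esub> sm c" if "c \<in> S \<rightarrow> carrier K" "r \<in> carrier K" for c r
  proof -
    have "sm (\<lambda>s. r \<otimes>\<^bsub>K\<^esub> c s) = (\<Oplus>\<^bsub>V\<^esub>s\<in>S. r \<odot>\<^bsub>V\<^esub> (c s \<odot>\<^bsub>V\<^esub> s))" unfolding sm_def
      using that SV by (intro V.M.finsum_cong') (auto simp: V.smult_assoc1 Pi_iff)
    then show ?thesis using that SV unfolding sm_def by (subst V.finsum_smult) auto
  qed
  have ex: "\<exists>c\<in>S \<rightarrow> carrier K. x = sm c" if "x \<in> carrier V" for x
    using S(1) that by (auto simp: gen_def sm_def)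
  have indep: "c t = \<zero>\<^bsub>K\<^esub>" if c: "c \<in> S \<rightarrow> carrier K" "sm c = \<zero>\<^bsub>V\<^esub>" and t: "t \<in> S" for c t
  proof (rule ccontr)
    assume nz: "c t \<noteq> \<zero>\<^bsub>K\<^esub>"
    have ct: "c t \<in> carrier K" using c t by auto
    \<comment> \<open>\<open>r\<close> is chosen so that \<open>r\<close> times \<open>c t\<close>
      is -1. Adding the relation \<open>c\<close>, scaled by \<open>d t\<close> times
      \<open>r\<close>, to the coefficients \<open>d\<close> then cancels the coefficient at
      \<open>t\<close>.\<close>
    define r where "r = \<ominus>\<^bsub>K\<^esub> (inv\<^bsub>K\<^esub> (c t))"
    have r: "r \<in> carrier K" "r \<otimes>\<^bsub>K\<^esub> c t = \<ominus>\<^bsub>K\<^esub> \<one>\<^bsub>K\<^esub>"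
      using ct nz by (auto simp: r_def K.field_Units K.l_minus)
    have "gen (S - {t})"
      unfolding gen_def
    proof (intro conjI ballI)
      fix x assume x: "x \<in> carrier V"
      then obtain d where d: "d \<in> S \<rightarrow> carrier K" "x = sm d" using ex by blast
      define d' where "d' = (\<lambda>s. d s \<oplus>\<^bsub>K\<^esub> (d t \<otimes>\<^bsub>K\<^esub> r) \<otimes>\<^bsub>K\<^esub> c s)"
      have dt: "d t \<in> carrier K" using d t by auto
      have cr: "(\<lambda>s. (d t \<otimes>\<^bsub>K\<^esub> r) \<otimes>\<^bsub>K\<^esub> c s) \<in> S \<rightarrow> carrier K" using c r dt by auto
      have "sm d' = x"
        unfolding d'_def using sm_add[OF d(1) cr] sm_smult[OF c(1), of "d t \<otimes>\<^bsub>K\<^esub> r"] dt r c d x by simp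
      moreover have d'c: "d' \<in> S \<rightarrow> carrier K" using cr d by (auto simp: d'_def)
      moreover have "d' t = \<zero>\<^bsub>K\<^esub>"
        using dt r ct by (simp add: d'_def K.m_assoc K.r_minus K.r_neg)
      moreover have "sm d' = (\<Oplus>\<^bsub>V\<^esub>s\<in>insert t (S - {t}). d' s \<odot>\<^bsub>V\<^esub> s)"
        unfolding sm_def using t by (simp add: insert_absorb)
      moreover have "\<dots> = d' t \<odot>\<^bsub>V\<^esub> t \<oplus>\<^bsub>V\<^esub> (\<Oplus>\<^bsub>V\<^esub>s\<in>S - {t}. d' s \<odot>\<^bsub>V\<^esub> s)"
        using fS SV t d'c by (intro V.M.finsum_insert) auto
      moreover have "(\<Oplus>\<^bsub>V\<^esub>s\<in>S - {t}. d' s \<odot>\<^bsub>V\<^esub> s) \<in> carrier V"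
        using SV d'c by (intro V.M.finsum_closed) auto
      ultimately have "x = (\<Oplus>\<^bsub>V\<^esub>s\<in>S - {t}. d' s \<odot>\<^bsub>V\<^esub> s)" using t SV by (auto simp: subset_iff)
      then show "\<exists>c\<in>S - {t} \<rightarrow> carrier K. x = (\<Oplus>\<^bsub>V\<^esub>s\<in>S - {t}. c s \<odot>\<^bsub>V\<^esub> s)"
        using d'c by (intro bexI[of _ d']) auto
    qed (use fS SV in auto)
    then have "card S \<le> card (S - {t})" by (rule S(2))
    then show False using fS t by (metis card_Diff1_less not_le)
  qed
  \<comment> \<open>The coefficients are picked by choice; their uniqueness, which comes from
    independence, is what makes them linear in the vector.\<close>
  define l where "l = (\<lambda>s x. (SOME c. c \<in> S \<rightarrow> carrier K \<and> x = sm c) s)"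
  have l: "(\<lambda>s. l s x) \<in> S \<rightarrow> carrier K" "x = sm (\<lambda>s. l s x)" if "x \<in> carrier V" for x
    using someI_ex[of "\<lambda>c. c \<in> S \<rightarrow> carrier K \<and> x = sm c"] ex[OF that] unfolding l_def by auto
  have uniq: "l s x = c s" if "x \<in> carrier V" "c \<in> S \<rightarrow> carrier K" "x = sm c" "s \<in> S" for s x c
  proof -
    define m where "m = \<ominus>\<^bsub>K\<^esub> \<one>\<^bsub>K\<^esub>"
    have m: "m \<in> carrier K" by (simp add: m_def)
    have mc: "(\<lambda>s. m \<otimes>\<^bsub>K\<^esub> c s) \<in> S \<rightarrow> carrier K" using that m by auto
    have "sm (\<lambda>s. l s x \<oplus>\<^bsub>K\<^esub> m \<otimes>\<^bsub>K\<^esub> c s) = sm (\<lambda>s. l s x) \<oplus>\<^bsub>V\<^esub> m \<odot>\<^bsub>V\<^esub> sm c"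
      using sm_add[OF l(1)[OF that(1)] mc] sm_smult[OF that(2) m] by simp
    also have "\<dots> = \<zero>\<^bsub>V\<^esub>"
      using l(2)[OF that(1)] that(1,3) V.smult_l_minus[of "\<one>\<^bsub>K\<^esub>" x] by (simp add: m_def V.M.r_neg)
    finally have "l s x \<oplus>\<^bsub>K\<^esub> m \<otimes>\<^bsub>K\<^esub> c s = \<zero>\<^bsub>K\<^esub>"
      using l(1)[OF that(1)] mc by (intro indep[where c = "\<lambda>s. l s x \<oplus>\<^bsub>K\<^esub> m \<otimes>\<^bsub>K\<^esub> c s" and t = s] that(4)) auto
    moreover have "l s x \<in> carrier K" "c s \<in> carrier K" using l(1)[OF that(1)] that by auto
    ultimately show ?thesis using K.minus_eq_zero_iff[of "l s x" "c s"] by (simp add: m_def K.l_minus a_minus_def)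
  qed
  show thesis
  proof (rule that[OF fS SV])
    fix s assume s: "s \<in> S"
    show "functional K V (l s)"
    proof (rule lin_mapI)
      fix x assume "x \<in> carrier V" then show "l s x \<in> carrier (self_module K)" using l(1) s by auto
    next
      fix x y assume xy: "x \<in> carrier V" "y \<in> carrier V"
      show "l s (x \<oplus>\<^bsub>V\<^esub> y) = l s x \<oplus>\<^bsub>self_module K\<^esub> l s y"
        using uniq[of "x \<oplus>\<^bsub>V\<^esub> y" "\<lambda>s. l s x \<oplus>\<^bsub>K\<^esub> l s y" s] xy s l(1)[OF xy(1)] l(1)[OF xy(2)]
          trans[OF arg_cong2[where f = "add V", OF l(2)[OF xy(1)] l(2)[OF xy(2)]]
            sm_add[OF l(1)[OF xy(1)] l(1)[OF xy(2)], symmetric]] V.M.a_closed[OF xy]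
        unfolding Pi_iff by simp
    next
      fix r x assume rx: "r \<in> carrier K" "x \<in> carrier V"
      show "l s (r \<odot>\<^bsub>V\<^esub> x) = r \<odot>\<^bsub>self_module K\<^esub> l s x"
        using uniq[of "r \<odot>\<^bsub>V\<^esub> x" "\<lambda>s. r \<otimes>\<^bsub>K\<^esub> l s x" s] rx s l(1)[OF rx(2)]
          trans[OF arg_cong[where f = "smult V r", OF l(2)[OF rx(2)]] sm_smult[OF l(1)[OF rx(2)] rx(1), symmetric]] V.smult_closed[OF rx]
        unfolding Pi_iff by simp
    qed
  next
    fix x assume "x \<in> carrier V"
    then show "x = (\<Oplus>\<^bsub>V\<^esub>s\<in>S. l s x \<odot>\<^bsub>V\<^esub> s)" by (rule l(2)[unfolded sm_def])
  qed
qed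

text \<open>The linear combinations of \<open>S\<close> themselves form a submodule. Finite
  generation can then be shown by closure arguments instead of exhibited coefficients.\<close>

lemma fin_genI:
  assumes M: "lmodule R M" and S: "finite S" "S \<subseteq> carrier M"
    and gen: "\<And>W. \<lbrakk>submodule W R M; S \<subseteq> W\<rbrakk> \<Longrightarrow> carrier M \<subseteq> W"
  shows "fin_gen R M"
proof -
  interpret lmodule R M by fact
  define sm where "sm = (\<lambda>c. \<Oplus>\<^bsub>M\<^esub>s\<in>S. c s \<odot>\<^bsub>M\<^esub> s)"
  define W where "W = {x. \<exists>c\<in>S \<rightarrow> carrier R. x = sm c}"
  have "submodule W R M"
  proof (rule submoduleI'[OF M])
    show "W \<subseteq> carrier M" using S by (auto simp: W_def sm_def intro!: M.finsum_closed)
    have "sm (\<lambda>s. \<zero>\<^bsub>R\<^esub>) = \<zero>\<^bsub>M\<^esub>" unfolding sm_def using S by (intro M.add.finprod_one_eqI) auto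
    then show "\<zero>\<^bsub>M\<^esub> \<in> W" unfolding W_def using R.zero_closed by (auto intro!: bexI[of _ "\<lambda>s. \<zero>\<^bsub>R\<^esub>"])
  next
    fix a b assume "a \<in> W" "b \<in> W"
    then obtain c d where c: "c \<in> S \<rightarrow> carrier R" "d \<in> S \<rightarrow> carrier R" "a = sm c" "b = sm d"
      by (auto simp: W_def)
    have "a \<oplus>\<^bsub>M\<^esub> b = (\<Oplus>\<^bsub>M\<^esub>s\<in>S. c s \<odot>\<^bsub>M\<^esub> s \<oplus>\<^bsub>M\<^esub> d s \<odot>\<^bsub>M\<^esub> s)" unfolding c(3,4) sm_def
      using c(1,2) S by (intro M.finsum_addf [symmetric]) auto
    also have "\<dots> = sm (\<lambda>s. c s \<oplus>\<^bsub>R\<^esub> d s)" unfolding sm_def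
      using c(1,2) S by (intro M.finsum_cong') (auto simp: smult_l_distr Pi_iff)
    finally show "a \<oplus>\<^bsub>M\<^esub> b \<in> W" unfolding W_def using c(1,2) by (auto intro!: bexI[of _ "\<lambda>s. c s \<oplus>\<^bsub>R\<^esub> d s"])
  next
    fix r a assume r: "r \<in> carrier R" and "a \<in> W"
    then obtain c where c: "c \<in> S \<rightarrow> carrier R" "a = sm c" by (auto simp: W_def)
    have "r \<odot>\<^bsub>M\<^esub> a = (\<Oplus>\<^bsub>M\<^esub>s\<in>S. r \<odot>\<^bsub>M\<^esub> (c s \<odot>\<^bsub>M\<^esub> s))" unfolding c(2) sm_def
      using c(1) S r by (intro finsum_smult) auto
    also have "\<dots> = sm (\<lambda>s. r \<otimes>\<^bsub>R\<^esub> c s)" unfolding sm_def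
      using c(1) S r by (intro M.finsum_cong') (auto simp: smult_assoc1 Pi_iff)
    finally show "r \<odot>\<^bsub>M\<^esub> a \<in> W" unfolding W_def using c(1) r by (auto intro!: bexI[of _ "\<lambda>s. r \<otimes>\<^bsub>R\<^esub> c s"])
  qed
  moreover have "S \<subseteq> W"
  proof
    fix t assume t: "t \<in> S"
    define c where "c = (\<lambda>s. if s = t then \<one>\<^bsub>R\<^esub> else \<zero>\<^bsub>R\<^esub>)"
    have "sm c = c t \<odot>\<^bsub>M\<^esub> t" unfolding sm_def
      using S t by (intro M.finsum_delta) (auto simp: c_def)
    then have "t = sm c" using S t by (auto simp: c_def)
    moreover have "c \<in> S \<rightarrow> carrier R" by (auto simp: c_def)
    ultimately show "t \<in> W" unfolding W_def by blast
  qed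
  ultimately have "carrier M \<subseteq> W" by (rule gen)
  then show ?thesis unfolding fin_gen_def W_def sm_def using S by blast
qed

lemma dual_bases_fin_gen:
  assumes K: "field K" and V: "lmodule K V" and D: "dual_bases K V W \<beta> I v w"
  shows "fin_gen K V"
proof (rule fin_genI[OF V])
  interpret lmodule K V by fact
  have b: "bilin K V W \<beta>" and v: "\<And>i. i \<in> I \<Longrightarrow> v i \<in> carrier V" and w: "\<And>i. i \<in> I \<Longrightarrow> w i \<in> carrier W"
    using D by (auto simp: dual_bases_def Pi_iff)
  show "finite (v ` I)" "v ` I \<subseteq> carrier V" using D by (auto simp: dual_bases_def)
  fix Y assume Y: "submodule Y K V" and vY: "v ` I \<subseteq> Y"
  show "carrier V \<subseteq> Y"
  proof
    fix x assume x: "x \<in> carrier V"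
    have "\<beta> x (w i) \<in> carrier K" if "i \<in> I" for i
      using lin_map_closed[OF bilinD(2)[OF b w[OF that]] x] by simp
    then have "(\<Oplus>\<^bsub>V\<^esub>i\<in>I. \<beta> x (w i) \<odot>\<^bsub>V\<^esub> v i) \<in> Y"
      using vY by (intro submodule_finsum[OF V Y]) (auto intro!: submodule_smult[OF V Y])
    then show "x \<in> Y" using dual_bases_expand[OF K V D x] by simp
  qed
qed

section \<open>Modules over an algebra\<close>

definition kmod :: "('k, 'g, 'y) module_scheme \<Rightarrow> ('g, 'm, 'z) module_scheme \<Rightarrow> ('k, 'm) module" where
  "kmod \<Gamma> M = with_smult M (scal \<Gamma> M)"

text \<open>Restriction of scalars along \<open>s\<close>. Carrier, zero and addition are untouched,
  so one function can be linear between several twists, and semilinearity over \<open>s\<close> is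
  linearity into \<open>rtwist s\<close>.\<close>

definition rtwist :: "('g \<Rightarrow> 'g) \<Rightarrow> ('g, 'm, 'z) module_scheme \<Rightarrow> ('g, 'm) module" where
  "rtwist s M = with_smult M (\<lambda>r. smult M (s r))"

lemma kmod_simps [simp]:
  "carrier (kmod \<Gamma> M) = carrier M" "zero (kmod \<Gamma> M) = zero M" "add (kmod \<Gamma> M) = add M"
  "smult (kmod \<Gamma> M) = scal \<Gamma> M" "finsum (kmod \<Gamma> M) = finsum M" "a_inv (kmod \<Gamma> M) = a_inv M"
  by (simp_all add: kmod_def)

lemma rtwist_simps [simp]:
  "carrier (rtwist s M) = carrier M" "zero (rtwist s M) = zero M" "add (rtwist s M) = add M"
  "r \<odot>\<^bsub>rtwist s M\<^esub> x = s r \<odot>\<^bsub>M\<^esub> x" "finsum (rtwist s M) = finsum M" "a_inv (rtwist s M) = a_inv M"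
  by (simp_all add: rtwist_def)

lemma hom_space_simps [simp]:
  "carrier (hom_space \<Gamma> M N) = {h \<in> extensional (carrier M). lin_map \<Gamma> M N h}"
  "zero (hom_space \<Gamma> M N) = (\<lambda>x\<in>carrier M. \<zero>\<^bsub>N\<^esub>)"
  "add (hom_space \<Gamma> M N) = (\<lambda>f g. \<lambda>x\<in>carrier M. f x \<oplus>\<^bsub>N\<^esub> g x)"
  "smult (hom_space \<Gamma> M N) = (\<lambda>c f. \<lambda>x\<in>carrier M. scal \<Gamma> N c (f x))"
  by (simp_all add: hom_space_def)

lemma hom_space_eqI:
  assumes "f \<in> carrier (hom_space \<Gamma> M N)" "g \<in> carrier (hom_space \<Gamma> M N)"
    "\<And>x. x \<in> carrier M \<Longrightarrow> f x = g x"
  shows "f = g"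
  using assms by (auto intro: extensionalityI)

lemma hom_spaceI: "lmodule \<Gamma> M \<Longrightarrow> lin_map \<Gamma> M N f \<Longrightarrow> restrict f (carrier M) \<in> carrier (hom_space \<Gamma> M N)"
  using lin_map_cong[of \<Gamma> M f "restrict f (carrier M)" N] by simp

lemma (in lmodule) lmodule_rtwist:
  assumes "s \<in> ring_hom R R"
  shows "lmodule R (rtwist s M)"
proof -
  have "abelian_group (rtwist s M)"
    unfolding rtwist_def by (rule abelian_group_with_smult) unfold_locales
  then show ?thesis
    using ring_hom_closed[OF assms] ring_hom_mult[OF assms] ring_hom_add[OF assms] ring_hom_one[OF assms]
    by (intro lmodule.intro lmodule_axioms.intro)
      (auto simp: R.ring_axioms smult_l_distr smult_r_distr smult_assoc1)
qed

lemma lin_map_rtwist: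
  assumes "lin_map R M N h" "s \<in> ring_hom R R"
  shows "lin_map R (rtwist s M) (rtwist s N) h"
  using assms ring_hom_closed[OF assms(2)] by (auto simp: lin_map_def)

section \<open>Underlying vector spaces and spaces of homomorphisms\<close>

context k_algebra
begin

lemma lmodule_K: "lmodule K A"
  by (intro lmodule.intro lmodule_axioms.intro)
    (auto simp: K.ring_axioms A.is_abelian_group smult_l_distr smult_r_distr smult_assoc1)

lemma smult_one_mult [simp]: "\<lbrakk>c \<in> carrier K; a \<in> carrier A\<rbrakk> \<Longrightarrow> (c \<odot>\<^bsub>A\<^esub> \<one>\<^bsub>A\<^esub>) \<otimes>\<^bsub>A\<^esub> a = c \<odot>\<^bsub>A\<^esub> a"
  by (simp add: smult_mult_left)

lemma mult_smult_one [simp]: "\<lbrakk>c \<in> carrier K; a \<in> carrier A\<rbrakk> \<Longrightarrow> a \<otimes>\<^bsub>A\<^esub> (c \<odot>\<^bsub>A\<^esub> \<one>\<^bsub>A\<^esub>) = c \<odot>\<^bsub>A\<^esub> a"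
  by (simp add: smult_mult_right)

lemma scal_lin_map:
  "\<lbrakk>lin_map A M N h; c \<in> carrier K; x \<in> carrier M\<rbrakk> \<Longrightarrow> h (scal A M c x) = scal A N c (h x)"
  by (simp add: scal_def lin_map_smult)

lemma scal_self_module: "\<lbrakk>c \<in> carrier K; x \<in> carrier A\<rbrakk> \<Longrightarrow> scal A (self_module A) c x = c \<odot>\<^bsub>A\<^esub> x"
  by (simp add: scal_def)

lemma lmodule_self: "lmodule A (self_module A)"
  by (rule lmodule_self_module[OF A.ring_axioms])

context
  fixes N :: "('c, 'n, 'z) module_scheme"
  assumes N: "lmodule A N"
begin

interpretation N: lmodule A N by (rule N)

lemma scal_closed [simp, intro]: "\<lbrakk>c \<in> carrier K; x \<in> carrier N\<rbrakk> \<Longrightarrow> scal A N c x \<in> carrier N"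
  by (simp add: scal_def)

lemma scal_smult: "\<lbrakk>c \<in> carrier K; r \<in> carrier A; x \<in> carrier N\<rbrakk> \<Longrightarrow> scal A N c (r \<odot>\<^bsub>N\<^esub> x) = r \<odot>\<^bsub>N\<^esub> scal A N c x"
  by (simp add: scal_def flip: N.smult_assoc1)

lemma smult_scal: "\<lbrakk>c \<in> carrier K; r \<in> carrier A; x \<in> carrier N\<rbrakk> \<Longrightarrow> (c \<odot>\<^bsub>A\<^esub> r) \<odot>\<^bsub>N\<^esub> x = scal A N c (r \<odot>\<^bsub>N\<^esub> x)"
  by (simp add: scal_def flip: N.smult_assoc1)

lemma lmodule_kmod: "lmodule K (kmod A N)"
proof -
  have "abelian_group (kmod A N)"
    unfolding kmod_def by (rule abelian_group_with_smult) unfold_locales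
  moreover have "scal A N (a \<otimes> b) x = scal A N a (scal A N b x)"
    if "a \<in> carrier K" "b \<in> carrier K" "x \<in> carrier N" for a b x
    using that smult_scal[of a "b \<odot>\<^bsub>A\<^esub> \<one>\<^bsub>A\<^esub>" x] by (simp add: smult_assoc1 scal_def)
  ultimately show ?thesis
    by (intro lmodule.intro lmodule_axioms.intro)
      (auto simp: K.ring_axioms scal_def smult_l_distr N.smult_l_distr N.smult_r_distr)
qed

text \<open>Scalar multiples of a linear map are again linear because the scalars act centrally,
  which is \<open>scal_smult\<close>.\<close>

lemma lmodule_hom_space:
  fixes M :: "('c, 'm, 'w) module_scheme"
  assumes M: "lmodule A M"
  shows "lmodule K (hom_space A M N)"
proof -
  interpret M: lmodule A M by (rule M)
  interpret kN: lmodule K "kmod A N" by (rule lmodule_kmod)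
  let ?H = "hom_space A M N"
  have cl: "h x \<in> carrier N" if "lin_map A M N h" "x \<in> carrier M" for h x
    using lin_map_closed[OF that] .
  have kN: "\<And>a b y. \<lbrakk>a \<in> carrier K; b \<in> carrier K; y \<in> carrier N\<rbrakk> \<Longrightarrow>
      scal A N (a \<oplus> b) y = scal A N a y \<oplus>\<^bsub>N\<^esub> scal A N b y"
    "\<And>a y z. \<lbrakk>a \<in> carrier K; y \<in> carrier N; z \<in> carrier N\<rbrakk> \<Longrightarrow>
      scal A N a (y \<oplus>\<^bsub>N\<^esub> z) = scal A N a y \<oplus>\<^bsub>N\<^esub> scal A N a z"
    "\<And>a b y. \<lbrakk>a \<in> carrier K; b \<in> carrier K; y \<in> carrier N\<rbrakk> \<Longrightarrow>
      scal A N (a \<otimes> b) y = scal A N a (scal A N b y)"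
    "\<And>y. y \<in> carrier N \<Longrightarrow> scal A N \<one> y = y"
    using kN.smult_l_distr kN.smult_r_distr kN.smult_assoc1 kN.smult_one by simp_all
  have "abelian_group ?H"
  proof (rule abelian_groupI)
    fix f g assume "f \<in> carrier ?H" "g \<in> carrier ?H"
    then show "f \<oplus>\<^bsub>?H\<^esub> g \<in> carrier ?H"
      by (auto intro!: lin_mapI simp: cl lin_map_add lin_map_smult N.M.a_ac N.smult_r_distr)
  next
    show "\<zero>\<^bsub>?H\<^esub> \<in> carrier ?H" by (auto intro!: lin_mapI)
  next
    fix f g h assume "f \<in> carrier ?H" "g \<in> carrier ?H" "h \<in> carrier ?H"
    then show "f \<oplus>\<^bsub>?H\<^esub> g \<oplus>\<^bsub>?H\<^esub> h = f \<oplus>\<^bsub>?H\<^esub> (g \<oplus>\<^bsub>?H\<^esub> h)"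
      by (auto intro!: restrict_ext simp: cl N.M.a_assoc)
  next
    fix f g assume "f \<in> carrier ?H" "g \<in> carrier ?H"
    then show "f \<oplus>\<^bsub>?H\<^esub> g = g \<oplus>\<^bsub>?H\<^esub> f"
      by (auto intro!: restrict_ext simp: cl N.M.a_comm)
  next
    fix f assume f: "f \<in> carrier ?H"
    then show "\<zero>\<^bsub>?H\<^esub> \<oplus>\<^bsub>?H\<^esub> f = f"
      by (auto intro!: extensionalityI[of _ "carrier M"] simp: cl)
    have "(\<lambda>x\<in>carrier M. \<ominus>\<^bsub>N\<^esub> f x) \<in> carrier ?H"
      using f by (auto intro!: lin_mapI simp: cl lin_map_add lin_map_smult N.M.minus_add N.smult_r_minus N.M.a_ac)
    moreover have "(\<lambda>x\<in>carrier M. \<ominus>\<^bsub>N\<^esub> f x) \<oplus>\<^bsub>?H\<^esub> f = \<zero>\<^bsub>?H\<^esub>"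
      using f by (auto intro!: restrict_ext simp: cl N.M.l_neg)
    ultimately show "\<exists>g\<in>carrier ?H. g \<oplus>\<^bsub>?H\<^esub> f = \<zero>\<^bsub>?H\<^esub>" by blast
  qed
  then show ?thesis
  proof (intro lmodule.intro lmodule_axioms.intro K.ring_axioms)
    fix a x assume "a \<in> carrier K" "x \<in> carrier ?H"
    then show "a \<odot>\<^bsub>?H\<^esub> x \<in> carrier ?H"
      by (auto intro!: lin_mapI simp: cl lin_map_add lin_map_smult kN scal_smult)
  next
    fix a b x assume "a \<in> carrier K" "b \<in> carrier K" "x \<in> carrier ?H"
    then show "(a \<oplus> b) \<odot>\<^bsub>?H\<^esub> x = a \<odot>\<^bsub>?H\<^esub> x \<oplus>\<^bsub>?H\<^esub> b \<odot>\<^bsub>?H\<^esub> x"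
      "(a \<otimes> b) \<odot>\<^bsub>?H\<^esub> x = a \<odot>\<^bsub>?H\<^esub> (b \<odot>\<^bsub>?H\<^esub> x)"
      by (auto intro!: restrict_ext simp: cl kN)
  next
    fix a x y assume "a \<in> carrier K" "x \<in> carrier ?H" "y \<in> carrier ?H"
    then show "a \<odot>\<^bsub>?H\<^esub> (x \<oplus>\<^bsub>?H\<^esub> y) = a \<odot>\<^bsub>?H\<^esub> x \<oplus>\<^bsub>?H\<^esub> a \<odot>\<^bsub>?H\<^esub> y"
      by (auto intro!: restrict_ext simp: cl kN)
  next
    fix x assume "x \<in> carrier ?H"
    then show "\<one> \<odot>\<^bsub>?H\<^esub> x = x"
      by (auto intro!: extensionalityI[of _ "carrier M"] simp: cl kN)
  qed
qed

end

lemma lin_map_hom_pre: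
  assumes M: "lmodule A M" and M': "lmodule A M'" and d: "lin_map A M' M d"
  shows "lin_map K (hom_space A M N) (hom_space A M' N) (\<lambda>h. compose (carrier M') h d)"
proof (rule lin_mapI)
  fix h assume "h \<in> carrier (hom_space A M N)"
  then show "compose (carrier M') h d \<in> carrier (hom_space A M' N)"
    unfolding compose_def using hom_spaceI[OF M' lin_map_comp[OF d]] by auto
qed (auto simp: compose_def lin_map_closed[OF d] intro!: restrict_ext)

lemma lin_map_hom_post:
  assumes M: "lmodule A M" and d: "lin_map A N N' d"
  shows "lin_map K (hom_space A M N) (hom_space A M N') (compose (carrier M) d)"
proof (rule lin_mapI)
  fix h assume "h \<in> carrier (hom_space A M N)"
  then show "compose (carrier M) d h \<in> carrier (hom_space A M N')"
    unfolding compose_def using hom_spaceI[OF M lin_map_comp[OF _ d]] by auto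
qed (auto simp: compose_def lin_map_closed lin_map_add[OF d] scal_lin_map[OF d] intro!: restrict_ext)

text \<open>Products of vector space generators of \<open>A\<close> with module generators of
  \<open>N\<close> span \<open>N\<close> over \<open>K\<close>.\<close>

lemma fin_gen_kmod:
  fixes N :: "('c, 'n, 'z) module_scheme"
  assumes N: "lmodule A N" and fA: "fin_gen K A" and fN: "fin_gen A N"
  shows "fin_gen K (kmod A N)"
proof -
  interpret N: lmodule A N by (rule N)
  note kN = lmodule_kmod[OF N]
  obtain S where S: "finite S" "S \<subseteq> carrier A"
    "\<And>x. x \<in> carrier A \<Longrightarrow> \<exists>c\<in>S \<rightarrow> carrier K. x = (\<Oplus>\<^bsub>A\<^esub>s\<in>S. c s \<odot>\<^bsub>A\<^esub> s)"
    using fA unfolding fin_gen_def by blast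
  obtain G where G: "finite G" "G \<subseteq> carrier N"
    "\<And>x. x \<in> carrier N \<Longrightarrow> \<exists>c\<in>G \<rightarrow> carrier A. x = (\<Oplus>\<^bsub>N\<^esub>s\<in>G. c s \<odot>\<^bsub>N\<^esub> s)"
    using fN unfolding fin_gen_def by blast
  show ?thesis
  proof (rule fin_genI[OF kN, where S = "(\<lambda>(s, g). s \<odot>\<^bsub>N\<^esub> g) ` (S \<times> G)"])
    fix W assume W: "submodule W K (kmod A N)" and SW: "(\<lambda>(s, g). s \<odot>\<^bsub>N\<^esub> g) ` (S \<times> G) \<subseteq> W"
    have W1: "a \<odot>\<^bsub>N\<^esub> g \<in> W" if a: "a \<in> carrier A" and g: "g \<in> G" for a g
    proof -
      have gN: "g \<in> carrier N" using g G by auto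
      obtain c where c: "c \<in> S \<rightarrow> carrier K" "a = (\<Oplus>\<^bsub>A\<^esub>s\<in>S. c s \<odot>\<^bsub>A\<^esub> s)" using S(3)[OF a] by blast
      have "a \<odot>\<^bsub>N\<^esub> g = (\<Oplus>\<^bsub>N\<^esub>s\<in>S. (c s \<odot>\<^bsub>A\<^esub> s) \<odot>\<^bsub>N\<^esub> g)"
        unfolding c(2) using c(1) S gN by (intro N.finsum_smult_left) auto
      also have "\<dots> = (\<Oplus>\<^bsub>N\<^esub>s\<in>S. scal A N (c s) (s \<odot>\<^bsub>N\<^esub> g))"
        using c(1) S gN by (intro N.M.finsum_cong') (auto intro!: smult_scal[OF N] scal_closed[OF N])
      also have "\<dots> \<in> W"
        using submodule_finsum[OF kN W, of "\<lambda>s. scal A N (c s) (s \<odot>\<^bsub>N\<^esub> g)" S]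
          submodule_smult[OF kN W] SW g c(1) by (auto simp: Pi_iff image_subset_iff)
      finally show ?thesis .
    qed
    show "carrier (kmod A N) \<subseteq> W"
    proof
      fix x assume "x \<in> carrier (kmod A N)"
      then obtain c where c: "c \<in> G \<rightarrow> carrier A" "x = (\<Oplus>\<^bsub>N\<^esub>s\<in>G. c s \<odot>\<^bsub>N\<^esub> s)" using G(3)[of x] by auto
      show "x \<in> W" unfolding c(2)
        using submodule_finsum[OF kN W, of "\<lambda>s. c s \<odot>\<^bsub>N\<^esub> s" G] c(1) W1 by (auto simp: Pi_iff)
    qed
  qed (use S G in auto)
qed

end

subsection \<open>Finitely generated projective modules\<close>

text \<open>The dual basis criterion for finitely generated projective modules. The generators
  \<open>x i\<close> may satisfy relations; the functionals \<open>f i\<close> select one linear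
  presentation of every element.\<close>

definition proj_basis :: "('r, 'y) ring_scheme \<Rightarrow> ('r, 'm, 'z) module_scheme \<Rightarrow> 'i set \<Rightarrow> ('i \<Rightarrow> 'm)
    \<Rightarrow> ('i \<Rightarrow> 'm \<Rightarrow> 'r) \<Rightarrow> bool" where
  "proj_basis R P I x f \<longleftrightarrow> finite I \<and> x \<in> I \<rightarrow> carrier P \<and>
     (\<forall>i\<in>I. lin_map R P (self_module R) (f i)) \<and>
     (\<forall>p\<in>carrier P. p = (\<Oplus>\<^bsub>P\<^esub>i\<in>I. f i p \<odot>\<^bsub>P\<^esub> x i))"

lemma proj_basisD:
  assumes "proj_basis R P I x f"
  shows "finite I" "\<And>i. i \<in> I \<Longrightarrow> x i \<in> carrier P" "\<And>i. i \<in> I \<Longrightarrow> lin_map R P (self_module R) (f i)"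
    "\<And>i p. i \<in> I \<Longrightarrow> p \<in> carrier P \<Longrightarrow> f i p \<in> carrier R"
    "\<And>p. p \<in> carrier P \<Longrightarrow> p = (\<Oplus>\<^bsub>P\<^esub>i\<in>I. f i p \<odot>\<^bsub>P\<^esub> x i)"
  using assms lin_map_closed[of R P "self_module R"] unfolding proj_basis_def self_module_simps by blast+

lemma hom_expand:
  assumes P: "lmodule R P" and N: "lmodule R N" and b: "proj_basis R P I x f"
    and \<phi>: "lin_map R P N \<phi>" and p: "p \<in> carrier P"
  shows "\<phi> p = (\<Oplus>\<^bsub>N\<^esub>i\<in>I. f i p \<odot>\<^bsub>N\<^esub> \<phi> (x i))"
proof -
  interpret P: lmodule R P by (rule P)
  interpret N: lmodule R N by (rule N)
  note b' = proj_basisD[OF b]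
  have "\<phi> p = (\<Oplus>\<^bsub>N\<^esub>i\<in>I. \<phi> (f i p \<odot>\<^bsub>P\<^esub> x i))"
    using lin_map_finsum[OF P N \<phi>, of "\<lambda>i. f i p \<odot>\<^bsub>P\<^esub> x i" I] b'(2) b'(4)[OF _ p]
    by (subst b'(5)[OF p]) auto
  also have "\<dots> = (\<Oplus>\<^bsub>N\<^esub>i\<in>I. f i p \<odot>\<^bsub>N\<^esub> \<phi> (x i))"
    using lin_map_smult[OF \<phi>] b'(2) b'(4)[OF _ p] lin_map_closed[OF \<phi>] by (intro N.M.finsum_cong') auto
  finally show ?thesis .
qed

lemma free_module_simps [simp]:
  "p \<in> carrier (free_module R S) \<longleftrightarrow> (\<forall>s. p s \<in> carrier R) \<and> (\<forall>s. s \<notin> S \<longrightarrow> p s = \<zero>\<^bsub>R\<^esub>) \<and> finite {s. p s \<noteq> \<zero>\<^bsub>R\<^esub>}"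
  "zero (free_module R S) = (\<lambda>s. \<zero>\<^bsub>R\<^esub>)" "add (free_module R S) = (\<lambda>p q s. p s \<oplus>\<^bsub>R\<^esub> q s)"
  "smult (free_module R S) = (\<lambda>r p s. r \<otimes>\<^bsub>R\<^esub> p s)"
  by (simp_all add: free_module_def)

lemma lmodule_free_module:
  assumes "ring R" shows "lmodule R (free_module R S)"
proof -
  interpret ring R by fact
  let ?F = "free_module R S"
  have fin_add: "finite {s. p s \<oplus>\<^bsub>R\<^esub> q s \<noteq> \<zero>\<^bsub>R\<^esub>}"
    if "finite {s. p s \<noteq> \<zero>\<^bsub>R\<^esub>}" "finite {s. q s \<noteq> \<zero>\<^bsub>R\<^esub>}" for p q
    by (rule finite_subset[OF _ finite_UnI[OF that]]) auto
  have fin_smult: "finite {s. r \<otimes>\<^bsub>R\<^esub> p s \<noteq> \<zero>\<^bsub>R\<^esub>}"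
    if "finite {s. p s \<noteq> \<zero>\<^bsub>R\<^esub>}" "r \<in> carrier R" for p r
    by (rule finite_subset[OF _ that(1)]) (use that(2) in auto)
  have fin_minus: "finite {s. \<ominus>\<^bsub>R\<^esub> p s \<noteq> \<zero>\<^bsub>R\<^esub>}" if "finite {s. p s \<noteq> \<zero>\<^bsub>R\<^esub>}" for p
    by (rule finite_subset[OF _ that(1)]) auto
  have "abelian_group ?F"
  proof (rule abelian_groupI)
    fix x assume "x \<in> carrier ?F"
    then show "\<exists>y\<in>carrier ?F. y \<oplus>\<^bsub>?F\<^esub> x = \<zero>\<^bsub>?F\<^esub>"
      by (intro bexI[of _ "\<lambda>s. \<ominus>\<^bsub>R\<^esub> x s"]) (auto simp: l_neg fin_minus)
  qed (auto simp: fin_add a_ac)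
  then show ?thesis
    by (intro lmodule.intro lmodule_axioms.intro ring_axioms)
      (auto simp: fin_smult fin_add l_distr r_distr m_assoc)
qed

lemma lin_map_eval:
  "lin_map R (free_module R S) (self_module R) (\<lambda>p. p s)"
  by (rule lin_mapI) auto

lemma basis_elt_closed: "ring R \<Longrightarrow> s \<in> S \<Longrightarrow> basis_elt R s \<in> carrier (free_module R S)"
  by (auto simp: basis_elt_def intro: ring.ring_simprules)

lemma free_module_expand:
  assumes "ring R" "q \<in> carrier (free_module R S)" "finite J" "J \<subseteq> S" "\<And>s. s \<notin> J \<Longrightarrow> q s = \<zero>\<^bsub>R\<^esub>"
  shows "q = (\<Oplus>\<^bsub>free_module R S\<^esub>s\<in>J. q s \<odot>\<^bsub>free_module R S\<^esub> basis_elt R s)"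
proof
  interpret ring R by fact
  let ?F = "free_module R S"
  interpret F: lmodule R ?F by (rule lmodule_free_module) fact
  fix t
  have b: "basis_elt R s \<in> carrier ?F" if "s \<in> J" for s
    using that assms(4) by (intro basis_elt_closed) (auto simp: ring_axioms)
  have qc: "q s \<in> carrier R" for s using assms(2) by simp
  have "(\<Oplus>\<^bsub>?F\<^esub>s\<in>J. q s \<odot>\<^bsub>?F\<^esub> basis_elt R s) t = (\<Oplus>\<^bsub>R\<^esub>s\<in>J. (q s \<odot>\<^bsub>?F\<^esub> basis_elt R s) t)"
    using lin_map_finsum[OF F.lmodule_axioms lmodule_self_module[OF ring_axioms] lin_map_eval[of R S t],
        of "\<lambda>s. q s \<odot>\<^bsub>?F\<^esub> basis_elt R s" J] b qc F.smult_closed by (simp add: Pi_iff del: free_module_simps)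
  also have "\<dots> = (\<Oplus>\<^bsub>R\<^esub>s\<in>J. if t = s then q s else \<zero>\<^bsub>R\<^esub>)"
    using qc by (intro finsum_cong') (auto simp: basis_elt_def)
  also have "\<dots> = q t"
  proof (cases "t \<in> J")
    case True then show ?thesis using qc assms(3) by (intro finsum_singleton) auto
  next
    case False then show ?thesis using assms(5) by (auto intro!: add.finprod_one_eqI)
  qed
  finally show "q t = (\<Oplus>\<^bsub>?F\<^esub>s\<in>J. q s \<odot>\<^bsub>?F\<^esub> basis_elt R s) t" ..
qed

text \<open>The finitely many generators of \<open>P\<close> have a finite common support
  \<open>J\<close> in the free module, so \<open>P\<close> already embeds into the vectors supported
  on \<open>J\<close>. The retraction applied to the basis elements of \<open>J\<close> gives the
  generators, and the coordinates at \<open>J\<close> give the functionals.\<close>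

lemma proj_basis_exists:
  fixes P :: "('r, 'm) module"
  assumes P: "projective R P" and fg: "fin_gen R P"
  obtains I :: "'m set" and x f where "proj_basis R P I x f"
proof -
  interpret P: lmodule R P using P by (simp add: projective_def)
  obtain S :: "'m set" and i p where i: "lin_map R P (free_module R S) i"
    and p: "lin_map R (free_module R S) P p" and pi: "\<And>x. x \<in> carrier P \<Longrightarrow> p (i x) = x"
    using P by (auto simp: projective_def)
  let ?F = "free_module R S"
  note F = lmodule_free_module[OF P.R.ring_axioms, of S]
  interpret F: lmodule R ?F by (rule F)
  obtain G where G: "finite G" "G \<subseteq> carrier P"
    "\<And>x. x \<in> carrier P \<Longrightarrow> \<exists>c\<in>G \<rightarrow> carrier R. x = (\<Oplus>\<^bsub>P\<^esub>s\<in>G. c s \<odot>\<^bsub>P\<^esub> s)"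
    using fg unfolding fin_gen_def by blast
  have iF: "i x \<in> carrier ?F" if "x \<in> carrier P" for x using lin_map_closed[OF i that] .
  define J where "J = (\<Union>g\<in>G. {s. i g s \<noteq> \<zero>\<^bsub>R\<^esub>})"
  have supp: "finite {s. i g s \<noteq> \<zero>\<^bsub>R\<^esub>}" "{s. i g s \<noteq> \<zero>\<^bsub>R\<^esub>} \<subseteq> S" if "g \<in> G" for g
    using iF[of g] G(2) that by auto
  have fJ: "finite J" unfolding J_def by (rule finite_UN_I[OF G(1) supp(1)])
  have JS: "J \<subseteq> S" unfolding J_def by (rule UN_least[OF supp(2)])
  define W where "W = {q \<in> carrier ?F. \<forall>t. t \<notin> J \<longrightarrow> q t = \<zero>\<^bsub>R\<^esub>}"
  have W: "submodule W R ?F"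
    using F.M.a_closed F.smult_closed F.M.zero_closed
    by (intro submoduleI'[OF F]) (auto simp: W_def simp del: free_module_simps(1))
  have iW: "i x \<in> W" if x: "x \<in> carrier P" for x
  proof -
    obtain c where c: "c \<in> G \<rightarrow> carrier R" "x = (\<Oplus>\<^bsub>P\<^esub>s\<in>G. c s \<odot>\<^bsub>P\<^esub> s)" using G(3)[OF x] by blast
    have "i x = (\<Oplus>\<^bsub>?F\<^esub>s\<in>G. i (c s \<odot>\<^bsub>P\<^esub> s))" unfolding c(2)
      using c(1) G by (intro lin_map_finsum[OF P.lmodule_axioms F i]) auto
    also have "\<dots> \<in> W"
    proof (rule submodule_finsum[OF F W], rule Pi_I)
      fix s assume s: "s \<in> G"
      have "i s \<in> W" using s iF G unfolding W_def J_def by auto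
      moreover have "c s \<in> carrier R" "s \<in> carrier P" using s c(1) G(2) by auto
      ultimately show "i (c s \<odot>\<^bsub>P\<^esub> s) \<in> W"
        using lin_map_smult[OF i, of "c s" s] submodule_smult[OF F W, of "c s" "i s"] by simp
    qed
    finally show ?thesis .
  qed
  have "proj_basis R P J (\<lambda>s. p (basis_elt R s)) (\<lambda>s x. i x s)"
    unfolding proj_basis_def
  proof (intro conjI ballI fJ)
    have b: "basis_elt R s \<in> carrier ?F" if "s \<in> J" for s
      using that JS by (intro basis_elt_closed P.R.ring_axioms) auto
    show "(\<lambda>s. p (basis_elt R s)) \<in> J \<rightarrow> carrier P"
      using lin_map_closed[OF p b] by auto
    fix s show "lin_map R P (self_module R) (\<lambda>x. i x s)"
      by (rule lin_map_comp[OF i lin_map_eval])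
  next
    fix x assume x: "x \<in> carrier P"
    have b: "basis_elt R s \<in> carrier ?F" if "s \<in> J" for s
      using that JS by (intro basis_elt_closed P.R.ring_axioms) auto
    have ic: "i x s \<in> carrier R" for s using iF[OF x] by simp
    have z: "i x s = \<zero>\<^bsub>R\<^esub>" if "s \<notin> J" for s using iW[OF x] that by (simp add: W_def)
    have "x = p (i x)" using pi[OF x] ..
    also have "\<dots> = p (\<Oplus>\<^bsub>?F\<^esub>s\<in>J. i x s \<odot>\<^bsub>?F\<^esub> basis_elt R s)"
      by (rule arg_cong[OF free_module_expand[OF P.R.ring_axioms iF[OF x] fJ JS z]])
    also have "\<dots> = (\<Oplus>\<^bsub>P\<^esub>s\<in>J. p (i x s \<odot>\<^bsub>?F\<^esub> basis_elt R s))"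
      using F.smult_closed[OF ic b] by (intro lin_map_finsum[OF F P.lmodule_axioms p] Pi_I)
    also have "\<dots> = (\<Oplus>\<^bsub>P\<^esub>s\<in>J. i x s \<odot>\<^bsub>P\<^esub> p (basis_elt R s))"
      using P.smult_closed[OF ic lin_map_closed[OF p b]]
      by (intro P.M.finsum_cong' lin_map_smult[OF p ic b] refl Pi_I)
    finally show "x = (\<Oplus>\<^bsub>P\<^esub>s\<in>J. i x s \<odot>\<^bsub>P\<^esub> p (basis_elt R s))" .
  qed
  then show thesis by (rule that)
qed

text \<open>For the twisted action the old coordinates are only semilinear; composing them with the
  inverse \<open>s'\<close> makes them linear again.\<close>

lemma proj_basis_rtwist:
  assumes lP: "lmodule R P" and P: "proj_basis R P I x f" and s: "s \<in> ring_hom R R" "s' \<in> ring_hom R R"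
    "\<And>a. a \<in> carrier R \<Longrightarrow> s (s' a) = a" "\<And>a. a \<in> carrier R \<Longrightarrow> s' (s a) = a"
  shows "proj_basis R (rtwist s P) I x (\<lambda>i p. s' (f i p))"
proof -
  interpret lmodule R P by fact
  have f: "lin_map R P (self_module R) (f i)" if "i \<in> I" for i using P that by (simp add: proj_basis_def)
  have fc: "f i p \<in> carrier R" if "i \<in> I" "p \<in> carrier P" for i p using lin_map_closed[OF f that(2)] that by simp
  have "lin_map R (rtwist s P) (self_module R) (\<lambda>p. s' (f i p))" if i: "i \<in> I" for i
    using fc[OF i] lin_map_add[OF f[OF i]] lin_map_smult[OF f[OF i]] ring_hom_closed[OF s(1)]
      ring_hom_closed[OF s(2)] ring_hom_add[OF s(2)] ring_hom_mult[OF s(2)] s(4)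
    by (intro lin_mapI) auto
  moreover have "p = (\<Oplus>\<^bsub>P\<^esub>i\<in>I. s (s' (f i p)) \<odot>\<^bsub>P\<^esub> x i)" if p: "p \<in> carrier P" for p
  proof -
    have x: "x i \<in> carrier P" if "i \<in> I" for i using P that by (auto simp: proj_basis_def)
    have "(\<Oplus>\<^bsub>P\<^esub>i\<in>I. s (s' (f i p)) \<odot>\<^bsub>P\<^esub> x i) = (\<Oplus>\<^bsub>P\<^esub>i\<in>I. f i p \<odot>\<^bsub>P\<^esub> x i)"
      using fc[OF _ p] x s(3) by (intro M.finsum_cong') auto
    also have "\<dots> = p" using P p unfolding proj_basis_def by metis
    finally show ?thesis ..
  qed
  ultimately show ?thesis using P unfolding proj_basis_def by (intro conjI ballI) auto
qed

subsection \<open>Duality for complexes of projective modules\<close>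

text \<open>The enveloping algebra and Tate homology are defined for records without extension fields.\<close>

locale k_alg = k_algebra K A for K :: "'k ring" (structure) and A :: "('k, 'g) module" (structure)

lemma (in k_alg) algebra_autD:
  assumes "algebra_aut K A s"
  shows aut_hom: "s \<in> ring_hom A A" and aut_lin: "lin_map K A A s"
    and aut_inv_hom: "inv_into (carrier A) s \<in> ring_hom A A"
    and aut_inv: "\<And>a. a \<in> carrier A \<Longrightarrow> s (inv_into (carrier A) s a) = a"
      "\<And>a. a \<in> carrier A \<Longrightarrow> inv_into (carrier A) s (s a) = a"
    and aut_unit: "\<And>c. c \<in> carrier K \<Longrightarrow> s (c \<odot>\<^bsub>A\<^esub> \<one>\<^bsub>A\<^esub>) = c \<odot>\<^bsub>A\<^esub> \<one>\<^bsub>A\<^esub>"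
proof -
  have iso: "s \<in> ring_iso A A" using assms by (simp add: algebra_aut_def)
  show "s \<in> ring_hom A A" using iso by (simp add: ring_iso_def)
  show lin: "lin_map K A A s" using assms by (simp add: algebra_aut_def)
  show "inv_into (carrier A) s \<in> ring_hom A A"
    using ring_iso_set_sym[OF A.ring_axioms iso] by (simp add: ring_iso_def)
  have bij: "bij_betw s (carrier A) (carrier A)" using iso by (simp add: ring_iso_def)
  show "\<And>a. a \<in> carrier A \<Longrightarrow> s (inv_into (carrier A) s a) = a"
    using bij by (auto simp: bij_betw_def intro: f_inv_into_f)
  show "\<And>a. a \<in> carrier A \<Longrightarrow> inv_into (carrier A) s (s a) = a"
    using bij by (auto simp: bij_betw_def)
  show "\<And>c. c \<in> carrier K \<Longrightarrow> s (c \<odot>\<^bsub>A\<^esub> \<one>\<^bsub>A\<^esub>) = c \<odot>\<^bsub>A\<^esub> \<one>\<^bsub>A\<^esub>"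
    using lin_map_smult[OF lin, of _ "\<one>\<^bsub>A\<^esub>"] ring_hom_one[OF \<open>s \<in> ring_hom A A\<close>] by simp
qed

lemma (in k_alg) scal_rtwist:
  "\<lbrakk>algebra_aut K A s; c \<in> carrier K\<rbrakk> \<Longrightarrow> scal A (rtwist s M) c x = scal A M c x"
  by (simp add: scal_def aut_unit)


text \<open>The form \<open>t\<close> takes the place of the Frobenius isomorphism:
  \<open>t_nondeg\<close> and \<open>t_repr\<close> say that sending \<open>a\<close> to the
  functional \<open>t (a y)\<close> of \<open>y\<close> is a bijection from \<open>A\<close> onto
  its dual. The algebra is kept general because the form is needed on the enveloping
  algebra.\<close>

locale frobenius_form = k_alg +
  fixes t :: "'g \<Rightarrow> 'k" and \<mu> :: "'g \<Rightarrow> 'g"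
  assumes t: "functional K A t" and \<mu>: "algebra_aut K A \<mu>"
    and t_comm: "\<lbrakk>x \<in> carrier A; y \<in> carrier A\<rbrakk> \<Longrightarrow> t (x \<otimes>\<^bsub>A\<^esub> y) = t (\<mu> y \<otimes>\<^bsub>A\<^esub> x)"
    and t_nondeg: "\<lbrakk>x \<in> carrier A; \<And>y. y \<in> carrier A \<Longrightarrow> t (x \<otimes>\<^bsub>A\<^esub> y) = \<zero>\<^bsub>K\<^esub>\<rbrakk> \<Longrightarrow> x = \<zero>\<^bsub>A\<^esub>"
    and t_repr: "functional K A \<xi> \<Longrightarrow> \<exists>a\<in>carrier A. \<forall>y\<in>carrier A. \<xi> y = t (a \<otimes>\<^bsub>A\<^esub> y)"
begin

lemma t_closed [simp, intro]: "x \<in> carrier A \<Longrightarrow> t x \<in> carrier K"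
  using lin_map_closed[OF t] by simp

lemma t_add: "\<lbrakk>x \<in> carrier A; y \<in> carrier A\<rbrakk> \<Longrightarrow> t (x \<oplus>\<^bsub>A\<^esub> y) = t x \<oplus> t y"
  using lin_map_add[OF t] by simp

lemma t_smult: "\<lbrakk>c \<in> carrier K; y \<in> carrier A\<rbrakk> \<Longrightarrow> t (c \<odot>\<^bsub>A\<^esub> y) = c \<otimes> t y"
  using lin_map_smult[OF t] by simp

lemma t_finsum: "f \<in> I \<rightarrow> carrier A \<Longrightarrow> t (\<Oplus>\<^bsub>A\<^esub>i\<in>I. f i) = (\<Oplus>i\<in>I. t (f i))"
  using lin_map_finsum[OF lmodule_K lmodule_self_module[OF K.ring_axioms] t] by simp

lemma \<mu>_closed [simp, intro]: "x \<in> carrier A \<Longrightarrow> \<mu> x \<in> carrier A"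
  using lin_map_closed[OF aut_lin[OF \<mu>]] .

lemma t_unique:
  assumes "x \<in> carrier A" "y \<in> carrier A" "\<And>z. z \<in> carrier A \<Longrightarrow> t (x \<otimes>\<^bsub>A\<^esub> z) = t (y \<otimes>\<^bsub>A\<^esub> z)"
  shows "x = y"
proof -
  interpret AA: lmodule A "self_module A" by (rule lmodule_self)
  have "t ((x \<ominus>\<^bsub>A\<^esub> y) \<otimes>\<^bsub>A\<^esub> z) = \<zero>" if z: "z \<in> carrier A" for z
  proof -
    have "t (x \<otimes>\<^bsub>A\<^esub> z) = t ((x \<ominus>\<^bsub>A\<^esub> y) \<otimes>\<^bsub>A\<^esub> z \<oplus>\<^bsub>A\<^esub> y \<otimes>\<^bsub>A\<^esub> z)"
      using AA.diff_add_cancel[of x y] assms(1,2) z by (simp flip: A.l_distr)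
    then have "t (y \<otimes>\<^bsub>A\<^esub> z) = t ((x \<ominus>\<^bsub>A\<^esub> y) \<otimes>\<^bsub>A\<^esub> z) \<oplus> t (y \<otimes>\<^bsub>A\<^esub> z)"
      using assms z by (simp add: t_add)
    then show ?thesis using assms(1,2) z by (metis A.minus_closed A.m_closed K.add.r_cancel_one' t_closed)
  qed
  then have "x \<ominus>\<^bsub>A\<^esub> y = \<zero>\<^bsub>A\<^esub>" using assms by (intro t_nondeg) auto
  then show ?thesis using assms by (simp add: A.minus_eq_zero_iff)
qed

text \<open>The trace of an endomorphism \<open>k\<close>, semilinear over \<mu>, of a projective
  module, read through \<open>t\<close>. By \<open>tr_comm\<close> with \<open>d\<close> the
  identity, it does not depend on the dual basis.\<close>

definition tr :: "'i set \<Rightarrow> ('i \<Rightarrow> 'm) \<Rightarrow> ('i \<Rightarrow> 'm \<Rightarrow> 'g) \<Rightarrow> ('m \<Rightarrow> 'm) \<Rightarrow> 'k" where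
  "tr I x f k = (\<Oplus>i\<in>I. t (f i (k (x i))))"

text \<open>Expanding both composites in the dual bases gives the same double sum. Where
  \<open>k\<close> meets an expansion, its semilinearity produces a coefficient under \<mu> on the
  left; \<open>t_comm\<close> brings it to the right and removes \<mu>.\<close>

lemma tr_comm:
  assumes P: "lmodule A P" and Q: "lmodule A Q"
    and bP: "proj_basis A P I x f" and bQ: "proj_basis A Q J y h"
    and d: "lin_map A P Q d" and k: "lin_map A Q (rtwist \<mu> P) k"
  shows "tr I x f (\<lambda>p. k (d p)) = tr J y h (\<lambda>q. d (k q))"
proof -
  interpret P: lmodule A P by fact
  interpret Q: lmodule A Q by fact
  interpret mP: lmodule A "rtwist \<mu> P" by (rule P.lmodule_rtwist[OF aut_hom[OF \<mu>]])
  have fI: "finite I" "finite J" and x: "\<And>i. i \<in> I \<Longrightarrow> x i \<in> carrier P" and y: "\<And>i. i \<in> J \<Longrightarrow> y i \<in> carrier Q"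
    and f: "\<And>i. i \<in> I \<Longrightarrow> lin_map A P (self_module A) (f i)"
    and h: "\<And>i. i \<in> J \<Longrightarrow> lin_map A Q (self_module A) (h i)"
    using bP bQ by (auto simp: proj_basis_def)
  have fc: "f i p \<in> carrier A" if "i \<in> I" "p \<in> carrier P" for i p using lin_map_closed[OF f that(2)] that by simp
  have hc: "h i p \<in> carrier A" if "i \<in> J" "p \<in> carrier Q" for i p using lin_map_closed[OF h that(2)] that by simp
  have kc: "k q \<in> carrier P" if "q \<in> carrier Q" for q using lin_map_closed[OF k that] by simp
  have dc: "d q \<in> carrier Q" if "q \<in> carrier P" for q using lin_map_closed[OF d that] .
  have 1: "t (f i (k (d (x i)))) = (\<Oplus>j\<in>J. t (f i (k (y j)) \<otimes>\<^bsub>A\<^esub> h j (d (x i))))" if i: "i \<in> I" for i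
  proof -
    have dx: "d (x i) = (\<Oplus>\<^bsub>Q\<^esub>j\<in>J. h j (d (x i)) \<odot>\<^bsub>Q\<^esub> y j)"
      using bQ dc[OF x[OF i]] unfolding proj_basis_def by blast
    have L: "lin_map A Q (rtwist \<mu> (self_module A)) (\<lambda>q. f i (k q))"
      by (rule lin_map_comp[OF k lin_map_rtwist[OF f[OF i] aut_hom[OF \<mu>]]])
    interpret S: lmodule A "rtwist \<mu> (self_module A)"
      by (rule lmodule.lmodule_rtwist[OF lmodule_self aut_hom[OF \<mu>]])
    have "f i (k (d (x i))) = (\<Oplus>\<^bsub>A\<^esub>j\<in>J. f i (k (h j (d (x i)) \<odot>\<^bsub>Q\<^esub> y j)))"
      using lin_map_finsum[OF Q S.lmodule_axioms L, of "\<lambda>j. h j (d (x i)) \<odot>\<^bsub>Q\<^esub> y j" J] hc y x[OF i] dc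
      by (subst dx) (auto simp: Pi_iff)
    also have "\<dots> = (\<Oplus>\<^bsub>A\<^esub>j\<in>J. \<mu> (h j (d (x i))) \<otimes>\<^bsub>A\<^esub> f i (k (y j)))"
      using hc y x[OF i] dc lin_map_smult[OF L] fc[OF i] kc by (intro A.finsum_cong') auto
    finally have "t (f i (k (d (x i)))) = (\<Oplus>j\<in>J. t (\<mu> (h j (d (x i))) \<otimes>\<^bsub>A\<^esub> f i (k (y j))))"
      using hc y x[OF i] dc fc[OF i] kc by (simp add: t_finsum Pi_iff)
    also have "\<dots> = (\<Oplus>j\<in>J. t (f i (k (y j)) \<otimes>\<^bsub>A\<^esub> h j (d (x i))))"
      using hc y x[OF i] dc fc[OF i] kc by (intro K.finsum_cong') (auto simp: t_comm)
    finally show ?thesis .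
  qed
  have 2: "t (h j (d (k (y j)))) = (\<Oplus>i\<in>I. t (f i (k (y j)) \<otimes>\<^bsub>A\<^esub> h j (d (x i))))" if j: "j \<in> J" for j
  proof -
    have kx: "k (y j) = (\<Oplus>\<^bsub>P\<^esub>i\<in>I. f i (k (y j)) \<odot>\<^bsub>P\<^esub> x i)"
      using bP kc[OF y[OF j]] unfolding proj_basis_def by blast
    have L: "lin_map A P (self_module A) (\<lambda>q. h j (d q))"
      by (rule lin_map_comp[OF d h[OF j]])
    have "h j (d (k (y j))) = (\<Oplus>\<^bsub>A\<^esub>i\<in>I. h j (d (f i (k (y j)) \<odot>\<^bsub>P\<^esub> x i)))"
      using lin_map_finsum[OF P lmodule_self L, of "\<lambda>i. f i (k (y j)) \<odot>\<^bsub>P\<^esub> x i" I] fc x y[OF j] kc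
      by (subst kx) (auto simp: Pi_iff)
    also have "\<dots> = (\<Oplus>\<^bsub>A\<^esub>i\<in>I. f i (k (y j)) \<otimes>\<^bsub>A\<^esub> h j (d (x i)))"
      using hc[OF j] y[OF j] x dc lin_map_smult[OF L] fc kc by (intro A.finsum_cong') auto
    finally show ?thesis
      using hc[OF j] y[OF j] x dc fc kc by (simp add: t_finsum Pi_iff)
  qed
  have "tr I x f (\<lambda>p. k (d p)) = (\<Oplus>i\<in>I. \<Oplus>j\<in>J. t (f i (k (y j)) \<otimes>\<^bsub>A\<^esub> h j (d (x i))))"
    unfolding tr_def using 1 hc y x dc fc kc by (intro K.finsum_cong') auto
  also have "\<dots> = (\<Oplus>j\<in>J. \<Oplus>i\<in>I. t (f i (k (y j)) \<otimes>\<^bsub>A\<^esub> h j (d (x i))))"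
    using hc y x dc fc kc fI by (intro K.finsum_swap) auto
  also have "\<dots> = tr J y h (\<lambda>q. d (k q))"
    unfolding tr_def using 2 hc y x dc fc kc by (intro K.finsum_cong') auto
  finally show ?thesis .
qed

section \<open>Nondegeneracy of the trace pairing\<close>

context
  fixes P :: "('g, 'm, 'z) module_scheme" and N :: "('g, 'n, 'w) module_scheme"
    and I :: "'i set" and x :: "'i \<Rightarrow> 'm" and f :: "'i \<Rightarrow> 'm \<Rightarrow> 'g"
  assumes P: "lmodule A P" and N: "lmodule A N" and bP: "proj_basis A P I x f"
begin

interpretation P: lmodule A P by (rule P)
interpretation N: lmodule A N by (rule N)

lemma bP': "finite I" "\<And>i. i \<in> I \<Longrightarrow> x i \<in> carrier P"
  "\<And>i. i \<in> I \<Longrightarrow> lin_map A P (self_module A) (f i)"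
  "\<And>p. p \<in> carrier P \<Longrightarrow> p = (\<Oplus>\<^bsub>P\<^esub>i\<in>I. f i p \<odot>\<^bsub>P\<^esub> x i)"
  using bP unfolding proj_basis_def by blast+

lemma f_closed: "\<lbrakk>i \<in> I; p \<in> carrier P\<rbrakk> \<Longrightarrow> f i p \<in> carrier A"
  using lin_map_closed[OF bP'(3)] by simp

text \<open>\<open>G n\<close> is the element of \<open>A\<close> that represents \<open>l\<close>
  on the multiples of \<open>n\<close> through the form. Uniqueness makes \<open>G\<close> additive
  and semilinear over \<mu>, and multiplying \<open>G n\<close> into \<open>q\<close> gives the map
  whose trace measures \<open>l (\<phi> q)\<close>.\<close>

lemma tr_left:
  assumes l: "functional K (kmod A N) l" and q: "q \<in> carrier P"
  obtains g where "lin_map A N (rtwist \<mu> P) g" "\<And>\<phi>. lin_map A P N \<phi> \<Longrightarrow> tr I x f (\<lambda>p. g (\<phi> p)) = l (\<phi> q)"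
proof -
  have lfun: "functional K A (\<lambda>a. l (a \<odot>\<^bsub>N\<^esub> n))" if n: "n \<in> carrier N" for n
    using lin_map_closed[OF l] lin_map_add[OF l] lin_map_smult[OF l] n
    by (intro lin_mapI) (auto simp: N.smult_l_distr smult_scal[OF N])
  define G where "G = (\<lambda>n. SOME a. a \<in> carrier A \<and> (\<forall>y\<in>carrier A. l (y \<odot>\<^bsub>N\<^esub> n) = t (a \<otimes>\<^bsub>A\<^esub> y)))"
  have "G n \<in> carrier A \<and> (\<forall>y\<in>carrier A. l (y \<odot>\<^bsub>N\<^esub> n) = t (G n \<otimes>\<^bsub>A\<^esub> y))" if n: "n \<in> carrier N" for n
    unfolding G_def by (rule someI_ex) (use t_repr[OF lfun[OF n]] in blast)
  then have G: "\<And>n. n \<in> carrier N \<Longrightarrow> G n \<in> carrier A"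
    "\<And>n y. n \<in> carrier N \<Longrightarrow> y \<in> carrier A \<Longrightarrow> t (G n \<otimes>\<^bsub>A\<^esub> y) = l (y \<odot>\<^bsub>N\<^esub> n)"
    by simp_all
  have G_add: "G (m \<oplus>\<^bsub>N\<^esub> n) = G m \<oplus>\<^bsub>A\<^esub> G n" if "m \<in> carrier N" "n \<in> carrier N" for m n
    using that G lin_map_add[OF l] by (intro t_unique) (auto simp: A.l_distr t_add N.smult_r_distr)
  have G_smult: "G (r \<odot>\<^bsub>N\<^esub> n) = \<mu> r \<otimes>\<^bsub>A\<^esub> G n" if "r \<in> carrier A" "n \<in> carrier N" for r n
  proof (rule t_unique)
    fix z assume z: "z \<in> carrier A"
    have "t (\<mu> r \<otimes>\<^bsub>A\<^esub> G n \<otimes>\<^bsub>A\<^esub> z) = t ((G n \<otimes>\<^bsub>A\<^esub> z) \<otimes>\<^bsub>A\<^esub> r)"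
      using that z G(1) t_comm[of "G n \<otimes>\<^bsub>A\<^esub> z" r] by (simp add: A.m_assoc)
    also have "\<dots> = t (G n \<otimes>\<^bsub>A\<^esub> (z \<otimes>\<^bsub>A\<^esub> r))" using that z G(1) by (simp add: A.m_assoc)
    also have "\<dots> = l (z \<odot>\<^bsub>N\<^esub> (r \<odot>\<^bsub>N\<^esub> n))" using that z G(2) by (simp add: N.smult_assoc1)
    finally show "t (G (r \<odot>\<^bsub>N\<^esub> n) \<otimes>\<^bsub>A\<^esub> z) = t (\<mu> r \<otimes>\<^bsub>A\<^esub> G n \<otimes>\<^bsub>A\<^esub> z)" using that z G(2) by simp
  qed (use that G in auto)
  show thesis
  proof (rule that[of "\<lambda>n. G n \<odot>\<^bsub>P\<^esub> q"])
    show "lin_map A N (rtwist \<mu> P) (\<lambda>n. G n \<odot>\<^bsub>P\<^esub> q)"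
      using G q by (intro lin_mapI) (auto simp: G_add G_smult P.smult_l_distr P.smult_assoc1)
    fix \<phi> assume \<phi>: "lin_map A P N \<phi>"
    have \<phi>x: "\<phi> (x i) \<in> carrier N" if "i \<in> I" for i using lin_map_closed[OF \<phi> bP'(2)[OF that]] .
    have "l (\<phi> q) = (\<Oplus>i\<in>I. l (f i q \<odot>\<^bsub>N\<^esub> \<phi> (x i)))"
      using lin_map_finsum[OF lmodule_kmod[OF N] lmodule_self_module[OF K.ring_axioms] l, of "\<lambda>i. f i q \<odot>\<^bsub>N\<^esub> \<phi> (x i)" I]
        f_closed q \<phi>x by (subst hom_expand[OF P N bP \<phi> q]) auto
    also have "\<dots> = tr I x f (\<lambda>p. G (\<phi> p) \<odot>\<^bsub>P\<^esub> q)"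
      unfolding tr_def using f_closed q \<phi>x G lin_map_smult[OF bP'(3)]
      by (intro K.finsum_cong') auto
    finally show "tr I x f (\<lambda>p. G (\<phi> p) \<odot>\<^bsub>P\<^esub> q) = l (\<phi> q)" ..
  qed
qed

text \<open>The test map sends \<open>p\<close> to \<open>h p\<close> times \<open>n\<close>, where
  \<open>h\<close> is a coordinate of \<open>P\<close> not vanishing at \<open>g n\<close>,
  multiplied by an \<open>r\<close> at which \<open>t\<close> detects it. For such a rank one map
  the trace collapses to \<open>t (h (g n))\<close>.\<close>

lemma tr_right:
  assumes g: "lin_map A N (rtwist \<mu> P) g" and n: "n \<in> carrier N" "g n \<noteq> \<zero>\<^bsub>P\<^esub>"
  obtains \<phi> where "lin_map A P N \<phi>" "tr I x f (\<lambda>p. g (\<phi> p)) \<noteq> \<zero>"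
proof -
  have gc: "g m \<in> carrier P" if "m \<in> carrier N" for m using lin_map_closed[OF g that] by simp
  have "\<exists>i\<in>I. f i (g n) \<noteq> \<zero>\<^bsub>A\<^esub>"
  proof (rule ccontr)
    assume "\<not> ?thesis"
    then have "(\<Oplus>\<^bsub>P\<^esub>i\<in>I. f i (g n) \<odot>\<^bsub>P\<^esub> x i) = \<zero>\<^bsub>P\<^esub>"
      using bP'(2) by (intro P.M.add.finprod_one_eqI) auto
    then show False using bP'(4)[OF gc[OF n(1)]] n(2) by simp
  qed
  then obtain i where i: "i \<in> I" "f i (g n) \<noteq> \<zero>\<^bsub>A\<^esub>" by blast
  then obtain r where r: "r \<in> carrier A" "t (f i (g n) \<otimes>\<^bsub>A\<^esub> r) \<noteq> \<zero>"
    using t_nondeg[of "f i (g n)"] f_closed[OF i(1) gc[OF n(1)]] by blast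
  define h where "h = (\<lambda>p. f i p \<otimes>\<^bsub>A\<^esub> r)"
  have h: "lin_map A P (self_module A) h"
    unfolding h_def using f_closed[OF i(1)] lin_map_add[OF bP'(3)[OF i(1)]] lin_map_smult[OF bP'(3)[OF i(1)]] r
    by (intro lin_mapI) (auto simp: A.l_distr A.m_assoc)
  have hc: "h p \<in> carrier A" if "p \<in> carrier P" for p using lin_map_closed[OF h that] by simp
  have \<phi>: "lin_map A P N (\<lambda>p. h p \<odot>\<^bsub>N\<^esub> n)"
    using hc n lin_map_add[OF h] lin_map_smult[OF h] by (intro lin_mapI) (auto simp: N.smult_l_distr N.smult_assoc1)
  have "tr I x f (\<lambda>p. g (h p \<odot>\<^bsub>N\<^esub> n)) = (\<Oplus>j\<in>I. t (f j (g n) \<otimes>\<^bsub>A\<^esub> h (x j)))"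
    unfolding tr_def
    using hc bP'(2) n gc f_closed lin_map_smult[OF g] lin_map_smult[OF bP'(3)]
    by (intro K.finsum_cong') (auto simp: t_comm)
  also have "\<dots> = t (\<Oplus>\<^bsub>A\<^esub>j\<in>I. f j (g n) \<otimes>\<^bsub>A\<^esub> h (x j))"
    using hc bP'(2) n gc f_closed by (intro t_finsum [symmetric]) auto
  also have "(\<Oplus>\<^bsub>A\<^esub>j\<in>I. f j (g n) \<otimes>\<^bsub>A\<^esub> h (x j)) = (\<Oplus>\<^bsub>A\<^esub>j\<in>I. h (f j (g n) \<odot>\<^bsub>P\<^esub> x j))"
    using hc bP'(2) n gc f_closed lin_map_smult[OF h] by (intro A.finsum_cong') auto
  also have "\<dots> = h (\<Oplus>\<^bsub>P\<^esub>j\<in>I. f j (g n) \<odot>\<^bsub>P\<^esub> x j)"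
    using lin_map_finsum[OF P lmodule_self h, of "\<lambda>j. f j (g n) \<odot>\<^bsub>P\<^esub> x j" I] bP'(2) n gc f_closed by auto
  also have "\<dots> = h (g n)" using bP'(4)[OF gc[OF n(1)]] by simp
  finally have "tr I x f (\<lambda>p. g (h p \<odot>\<^bsub>N\<^esub> n)) \<noteq> \<zero>" using r by (simp add: h_def)
  with \<phi> show thesis by (rule that)
qed

lemma bilin_tr: "bilin K (hom_space A P N) (hom_space A N (rtwist \<mu> P)) (\<lambda>\<phi> g. tr I x f (\<lambda>p. g (\<phi> p)))"
proof -
  have *: "t (f i (g (\<phi> (x i)))) \<in> carrier K" if "i \<in> I" "lin_map A P N \<phi>" "lin_map A N (rtwist \<mu> P) g" for i \<phi> g
    using that f_closed[OF that(1)] lin_map_closed[OF that(3)] lin_map_closed[OF that(2)] bP'(2) by auto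
  have c1: "\<phi> (x i) \<in> carrier N" if "i \<in> I" "lin_map A P N \<phi>" for i \<phi>
    using lin_map_closed[OF that(2)] bP'(2) that by auto
  have c2: "g n \<in> carrier P" if "lin_map A N (rtwist \<mu> P) g" "n \<in> carrier N" for g n
    using lin_map_closed[OF that] by simp
  have tc: "t (f i (scal A P c p)) = c \<otimes> t (f i p)" if "i \<in> I" "c \<in> carrier K" "p \<in> carrier P" for i c p
    using scal_lin_map[OF bP'(3)[OF that(1)] that(2,3)] f_closed[OF that(1,3)] that(2)
    by (simp add: scal_self_module t_smult)
  have ta: "t (f i (p \<oplus>\<^bsub>P\<^esub> q)) = t (f i p) \<oplus> t (f i q)" if "i \<in> I" "q \<in> carrier P" "p \<in> carrier P" for i q p
    using lin_map_add[OF bP'(3)[OF that(1)] that(3,2)] f_closed[OF that(1)] that(2,3)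
    by (simp add: t_add)
  show ?thesis
    unfolding bilin_def
  proof (intro conjI ballI)
    fix \<phi> assume "\<phi> \<in> carrier (hom_space A P N)"
    then have \<phi>: "lin_map A P N \<phi>" by simp
    show "functional K (hom_space A N (rtwist \<mu> P)) (\<lambda>g. tr I x f (\<lambda>p. g (\<phi> p)))"
    proof (rule lin_mapI)
      fix g assume "g \<in> carrier (hom_space A N (rtwist \<mu> P))"
      then show "tr I x f (\<lambda>p. g (\<phi> p)) \<in> carrier (self_module K)"
        unfolding tr_def using *[OF _ \<phi>] by (auto intro!: K.finsum_closed)
    next
      fix g h assume "g \<in> carrier (hom_space A N (rtwist \<mu> P))" "h \<in> carrier (hom_space A N (rtwist \<mu> P))"
      then have gh: "lin_map A N (rtwist \<mu> P) g" "lin_map A N (rtwist \<mu> P) h" by auto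
      have "tr I x f (\<lambda>p. (g \<oplus>\<^bsub>hom_space A N (rtwist \<mu> P)\<^esub> h) (\<phi> p)) =
        (\<Oplus>i\<in>I. t (f i (g (\<phi> (x i)))) \<oplus> t (f i (h (\<phi> (x i)))))"
        unfolding tr_def using *[OF _ \<phi>] gh c1[OF _ \<phi>] c2
        by (intro K.finsum_cong') (auto simp: ta)
      also have "\<dots> = tr I x f (\<lambda>p. g (\<phi> p)) \<oplus> tr I x f (\<lambda>p. h (\<phi> p))"
        unfolding tr_def using *[OF _ \<phi>] gh by (intro K.finsum_addf) auto
      finally show "tr I x f (\<lambda>p. (g \<oplus>\<^bsub>hom_space A N (rtwist \<mu> P)\<^esub> h) (\<phi> p)) =
         tr I x f (\<lambda>p. g (\<phi> p)) \<oplus>\<^bsub>self_module K\<^esub> tr I x f (\<lambda>p. h (\<phi> p))" by simp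
    next
      fix c g assume c: "c \<in> carrier K" and "g \<in> carrier (hom_space A N (rtwist \<mu> P))"
      then have g: "lin_map A N (rtwist \<mu> P) g" by auto
      have "tr I x f (\<lambda>p. (c \<odot>\<^bsub>hom_space A N (rtwist \<mu> P)\<^esub> g) (\<phi> p)) =
        (\<Oplus>i\<in>I. c \<otimes> t (f i (g (\<phi> (x i)))))"
        unfolding tr_def using *[OF _ \<phi>] g c1[OF _ \<phi>] c2 c
        by (intro K.finsum_cong') (auto simp: tc scal_rtwist[OF \<mu>])
      also have "\<dots> = c \<otimes> tr I x f (\<lambda>p. g (\<phi> p))"
        unfolding tr_def using *[OF _ \<phi>] g c by (intro K.finsum_rdistr [symmetric] bP'(1)) auto
      finally show "tr I x f (\<lambda>p. (c \<odot>\<^bsub>hom_space A N (rtwist \<mu> P)\<^esub> g) (\<phi> p)) =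
         c \<odot>\<^bsub>self_module K\<^esub> tr I x f (\<lambda>p. g (\<phi> p))" by simp
    qed
  next
    fix g assume "g \<in> carrier (hom_space A N (rtwist \<mu> P))"
    then have g: "lin_map A N (rtwist \<mu> P) g" by simp
    show "functional K (hom_space A P N) (\<lambda>\<phi>. tr I x f (\<lambda>p. g (\<phi> p)))"
    proof (rule lin_mapI)
      fix \<phi> assume "\<phi> \<in> carrier (hom_space A P N)"
      then show "tr I x f (\<lambda>p. g (\<phi> p)) \<in> carrier (self_module K)"
        unfolding tr_def using *[OF _ _ g] by (auto intro!: K.finsum_closed)
    next
      fix \<phi> \<psi> assume "\<phi> \<in> carrier (hom_space A P N)" "\<psi> \<in> carrier (hom_space A P N)"
      then have gh: "lin_map A P N \<phi>" "lin_map A P N \<psi>" by auto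
      have "tr I x f (\<lambda>p. g ((\<phi> \<oplus>\<^bsub>hom_space A P N\<^esub> \<psi>) p)) =
        (\<Oplus>i\<in>I. t (f i (g (\<phi> (x i)))) \<oplus> t (f i (g (\<psi> (x i)))))"
        unfolding tr_def using *[OF _ _ g] gh c1 c2[OF g] lin_map_add[OF g] bP'(2)
        by (intro K.finsum_cong') (auto simp: ta)
      also have "\<dots> = tr I x f (\<lambda>p. g (\<phi> p)) \<oplus> tr I x f (\<lambda>p. g (\<psi> p))"
        unfolding tr_def using *[OF _ _ g] gh by (intro K.finsum_addf) auto
      finally show "tr I x f (\<lambda>p. g ((\<phi> \<oplus>\<^bsub>hom_space A P N\<^esub> \<psi>) p)) =
         tr I x f (\<lambda>p. g (\<phi> p)) \<oplus>\<^bsub>self_module K\<^esub> tr I x f (\<lambda>p. g (\<psi> p))" by simp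
    next
      fix c \<phi> assume c: "c \<in> carrier K" and "\<phi> \<in> carrier (hom_space A P N)"
      then have \<phi>: "lin_map A P N \<phi>" by auto
      have "tr I x f (\<lambda>p. g ((c \<odot>\<^bsub>hom_space A P N\<^esub> \<phi>) p)) = (\<Oplus>i\<in>I. c \<otimes> t (f i (g (\<phi> (x i)))))"
        unfolding tr_def using *[OF _ \<phi> g] c1[OF _ \<phi>] c2[OF g] c bP'(2) scal_lin_map[OF g c]
        by (intro K.finsum_cong') (auto simp: tc scal_rtwist[OF \<mu>])
      also have "\<dots> = c \<otimes> tr I x f (\<lambda>p. g (\<phi> p))"
        unfolding tr_def using *[OF _ \<phi>] g c by (intro K.finsum_rdistr [symmetric] bP'(1)) auto
      finally show "tr I x f (\<lambda>p. g ((c \<odot>\<^bsub>hom_space A P N\<^esub> \<phi>) p)) =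
         c \<odot>\<^bsub>self_module K\<^esub> tr I x f (\<lambda>p. g (\<phi> p))" by simp
    qed
  qed
qed

lemma tr_nondeg_right:
  assumes g: "g \<in> carrier (hom_space A N (rtwist \<mu> P))"
    and z: "\<And>\<phi>. \<phi> \<in> carrier (hom_space A P N) \<Longrightarrow> tr I x f (\<lambda>p. g (\<phi> p)) = \<zero>"
  shows "g = \<zero>\<^bsub>hom_space A N (rtwist \<mu> P)\<^esub>"
proof (rule extensionalityI[of _ "carrier N"])
  have gl: "lin_map A N (rtwist \<mu> P) g" using g by simp
  fix n assume n: "n \<in> carrier N"
  have "g n = \<zero>\<^bsub>P\<^esub>"
  proof (rule ccontr)
    assume "g n \<noteq> \<zero>\<^bsub>P\<^esub>"
    then obtain \<phi> where \<phi>: "lin_map A P N \<phi>" "tr I x f (\<lambda>p. g (\<phi> p)) \<noteq> \<zero>"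
      using tr_right[OF gl n] by blast
    \<comment> \<open>Elements of \<open>hom_space\<close> are extensional, so \<phi> has to be
      restricted first; the trace evaluates it only at the \<open>x i\<close> and does not
      change.\<close>
    have "tr I x f (\<lambda>p. g (restrict \<phi> (carrier P) p)) = tr I x f (\<lambda>p. g (\<phi> p))"
      unfolding tr_def using bP'(2) f_closed lin_map_closed[OF gl] lin_map_closed[OF \<phi>(1)]
      by (intro K.finsum_cong') auto
    then show False using z[OF hom_spaceI[OF P \<phi>(1)]] \<phi>(2) by simp
  qed
  then show "g n = \<zero>\<^bsub>hom_space A N (rtwist \<mu> P)\<^esub> n" using n by simp
qed (use g in auto)

context
  assumes fN: "fin_gen K (kmod A N)"
begin

text \<open>The values \<open>\<phi> (x i)\<close> determine \<phi>, and finitely many coordinates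
  of \<open>N\<close> over \<open>K\<close> determine each value. By \<open>tr_left\<close> every
  one of these finitely many measurements is a trace.\<close>

lemma tr_nondeg_left_finite:
  obtains L where "finite L" "L \<subseteq> carrier (hom_space A N (rtwist \<mu> P))"
    "\<And>\<phi>. \<lbrakk>\<phi> \<in> carrier (hom_space A P N); \<And>g. g \<in> L \<Longrightarrow> tr I x f (\<lambda>p. g (\<phi> p)) = \<zero>\<rbrakk>
      \<Longrightarrow> \<phi> = \<zero>\<^bsub>hom_space A P N\<^esub>"
proof -
  obtain S l where S: "finite S" "S \<subseteq> carrier N" "\<And>s. s \<in> S \<Longrightarrow> functional K (kmod A N) (l s)"
    "\<And>n. n \<in> carrier N \<Longrightarrow> n = (\<Oplus>\<^bsub>N\<^esub>s\<in>S. scal A N (l s n) s)"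
    using fin_gen_functionals[OF K.field_axioms lmodule_kmod[OF N] fN] by auto
  have "\<exists>g. lin_map A N (rtwist \<mu> P) g \<and> (\<forall>\<phi>. lin_map A P N \<phi> \<longrightarrow> tr I x f (\<lambda>p. g (\<phi> p)) = l s (\<phi> (x i)))"
    if "s \<in> S" "i \<in> I" for s i
    using tr_left[OF S(3)[OF that(1)] bP'(2)[OF that(2)]] by metis
  then obtain g where g: "\<And>s i. s \<in> S \<Longrightarrow> i \<in> I \<Longrightarrow> lin_map A N (rtwist \<mu> P) (g s i)"
    "\<And>s i \<phi>. s \<in> S \<Longrightarrow> i \<in> I \<Longrightarrow> lin_map A P N \<phi> \<Longrightarrow> tr I x f (\<lambda>p. g s i (\<phi> p)) = l s (\<phi> (x i))"
    by metis
  define L where "L = (\<lambda>(s, i). restrict (g s i) (carrier N)) ` (S \<times> I)"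
  show thesis
  proof (rule that[of L])
    show "finite L" unfolding L_def using S(1) bP'(1) by simp
    show "L \<subseteq> carrier (hom_space A N (rtwist \<mu> P))"
      unfolding L_def using hom_spaceI[OF N g(1)] by auto
    fix \<phi> assume \<phi>: "\<phi> \<in> carrier (hom_space A P N)" and z: "\<And>g. g \<in> L \<Longrightarrow> tr I x f (\<lambda>p. g (\<phi> p)) = \<zero>"
    have \<phi>l: "lin_map A P N \<phi>" using \<phi> by simp
    have \<phi>x: "\<phi> (x i) \<in> carrier N" if "i \<in> I" for i using lin_map_closed[OF \<phi>l bP'(2)[OF that]] .
    have "l s (\<phi> (x i)) = \<zero>" if si: "s \<in> S" "i \<in> I" for s i
    proof -
      have "tr I x f (\<lambda>p. restrict (g s i) (carrier N) (\<phi> p)) = tr I x f (\<lambda>p. g s i (\<phi> p))"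
        unfolding tr_def using bP'(2) f_closed lin_map_closed[OF g(1)[OF si]] \<phi>x
        by (intro K.finsum_cong') auto
      moreover have "restrict (g s i) (carrier N) \<in> L"
        unfolding L_def using si by (intro image_eqI[of _ _ "(s, i)"]) auto
      ultimately show ?thesis using z g(2)[OF si \<phi>l] by metis
    qed
    then have "(\<Oplus>\<^bsub>N\<^esub>s\<in>S. scal A N (l s (\<phi> (x i))) s) = \<zero>\<^bsub>N\<^esub>" if "i \<in> I" for i
      using S(2) that by (intro N.M.add.finprod_one_eqI) (auto simp: scal_def)
    then have x0: "\<phi> (x i) = \<zero>\<^bsub>N\<^esub>" if "i \<in> I" for i
      using S(4)[OF \<phi>x[OF that]] that by simp
    have "\<phi> p = \<zero>\<^bsub>N\<^esub>" if p: "p \<in> carrier P" for p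
      unfolding hom_expand[OF P N bP \<phi>l p] using x0 f_closed p by (intro N.M.add.finprod_one_eqI) auto
    then show "\<phi> = \<zero>\<^bsub>hom_space A P N\<^esub>" using \<phi> by (auto intro!: extensionalityI[of _ "carrier P"])
  qed
qed

lemma tr_dual_bases:
  obtains J e where "J \<subseteq> carrier (hom_space A N (rtwist \<mu> P))"
    "dual_bases K (hom_space A P N) (hom_space A N (rtwist \<mu> P)) (\<lambda>\<phi> g. tr I x f (\<lambda>p. g (\<phi> p))) J e (\<lambda>y. y)"
proof -
  obtain L where L: "finite L" "L \<subseteq> carrier (hom_space A N (rtwist \<mu> P))"
    "\<And>\<phi>. \<lbrakk>\<phi> \<in> carrier (hom_space A P N); \<And>g. g \<in> L \<Longrightarrow> tr I x f (\<lambda>p. g (\<phi> p)) = \<zero>\<rbrakk>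
      \<Longrightarrow> \<phi> = \<zero>\<^bsub>hom_space A P N\<^esub>"
    using tr_nondeg_left_finite by blast
  obtain J e where "J \<subseteq> L"
    "dual_bases K (hom_space A P N) (hom_space A N (rtwist \<mu> P)) (\<lambda>\<phi> g. tr I x f (\<lambda>p. g (\<phi> p))) J e (\<lambda>y. y)"
    by (rule dual_bases_exist[OF K.field_axioms lmodule_hom_space[OF N P]
        lmodule_hom_space[OF P.lmodule_rtwist[OF aut_hom[OF \<mu>]] N] bilin_tr L(1,2) L(3) tr_nondeg_right]) blast+
  then show thesis using L(2) that by blast
qed

end

end

text \<open>Dual bases are taken in degree n. In the neighbouring degrees one-sided nondegeneracy
  enters: for maps out of \<open>N\<close> in degree n - 1, and for maps into \<open>N\<close> in
  degree n + 1.\<close>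

lemma tate_Ext_dual:
  fixes T :: "('g, 't) cplx" and N :: "('g, 'n) module"
  assumes T: "chain_complex A T"
    and bT: "\<And>n. proj_basis A (obj T n) (I n) (x n) (f n)"
    and N: "lmodule A N" and fN: "fin_gen K (kmod A N)"
  shows "isomorphic K (tate_Ext A n T N)
    (homology (hom_space A N (rtwist \<mu> (obj T (n + 1)))) (compose (carrier N) (bd T (n + 1)))
      (hom_space A N (rtwist \<mu> (obj T n))) (compose (carrier N) (bd T n))
      (hom_space A N (rtwist \<mu> (obj T (n - 1)))))"
proof -
  have oT: "lmodule A (obj T m)" and dT: "lin_map A (obj T m) (obj T (m - 1)) (bd T m)"
    and dd: "\<And>x. x \<in> carrier (obj T (m + 1)) \<Longrightarrow> bd T m (bd T (m + 1) x) = \<zero>\<^bsub>obj T (m - 1)\<^esub>" for m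
    using T by (auto simp: chain_complex_def)
  have rT: "lmodule A (rtwist \<mu> (obj T m))" for m
    by (rule lmodule.lmodule_rtwist[OF oT aut_hom[OF \<mu>]])
  have drT: "lin_map A (rtwist \<mu> (obj T m)) (rtwist \<mu> (obj T (m - 1))) (bd T m)" for m
    by (rule lin_map_rtwist[OF dT aut_hom[OF \<mu>]])
  have dT': "lin_map A (obj T (m + 1)) (obj T m) (bd T (m + 1))" for m
    using dT[of "m + 1"] by simp
  have drT': "lin_map A (rtwist \<mu> (obj T (m + 1))) (rtwist \<mu> (obj T m)) (bd T (m + 1))" for m
    using drT[of "m + 1"] by simp
  interpret N: lmodule A N by (rule N)
  have dc: "bd T m y \<in> carrier (obj T (m - 1))" if "y \<in> carrier (obj T m)" for m y
    using lin_map_closed[OF dT that] .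
  have dc': "bd T (m + 1) y \<in> carrier (obj T m)" if "y \<in> carrier (obj T (m + 1))" for m y
    using lin_map_closed[OF dT' that] .
  \<comment> \<open>The differentials of the two complexes are extensional functions that agree with
    plain composites only on carriers. Traces see only carriers, so the two may be exchanged under
    \<open>tr\<close>.\<close>
  have Tr_cong: "tr (I m) (x m) (f m) k = tr (I m) (x m) (f m) k'"
    if "\<And>p. p \<in> carrier (obj T m) \<Longrightarrow> k p = k' p" "\<And>p. p \<in> carrier (obj T m) \<Longrightarrow> k' p \<in> carrier (obj T m)" for m k k'
    unfolding tr_def using bP'[OF oT N bT[of m]] f_closed[OF oT N bT[of m]] that
    by (intro K.finsum_cong') auto
  obtain J e where D: "dual_bases K (hom_space A (obj T n) N) (hom_space A N (rtwist \<mu> (obj T n)))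
      (\<lambda>\<phi> g. tr (I n) (x n) (f n) (\<lambda>p. g (\<phi> p))) J e (\<lambda>y. y)"
    using tr_dual_bases[OF oT N bT fN, of n] by blast
  note bil = bilin_tr[OF oT N bT]
  note SK = lmodule_self_module[OF K.ring_axioms]
  have lin0: "tr (I m) (x m) (f m) (\<lambda>p. \<zero>\<^bsub>hom_space A N (rtwist \<mu> (obj T m))\<^esub> (\<phi> p)) = \<zero>"
    if "\<phi> \<in> carrier (hom_space A (obj T m) N)" for m \<phi>
    using lin_map_zero[OF lmodule_hom_space[OF rT N] SK bilinD(1)[OF bil that]] by simp
  have lin0': "tr (I m) (x m) (f m) (\<lambda>p. g (\<zero>\<^bsub>hom_space A (obj T m) N\<^esub> p)) = \<zero>"
    if "g \<in> carrier (hom_space A N (rtwist \<mu> (obj T m)))" for m g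
    using lin_map_zero[OF lmodule_hom_space[OF N oT] SK bilinD(2)[OF bil that]] by simp
  \<comment> \<open>Cyclicity of the trace, with the boundary as \<open>d\<close> and
    \<open>y\<close> after \<open>u\<close> as \<open>k\<close>: precomposing \<open>u\<close> with
    the boundary is adjoint to postcomposing \<open>y\<close> with it.\<close>
  have adj: "tr (I (m + 1)) (x (m + 1)) (f (m + 1)) (\<lambda>p. y (u (bd T (m + 1) p))) =
      tr (I m) (x m) (f m) (\<lambda>p. bd T (m + 1) (y (u p)))"
    if u: "lin_map A (obj T m) N u" and y: "lin_map A N (rtwist \<mu> (obj T (m + 1))) y" for m u y
    by (rule tr_comm[OF oT oT bT bT dT' lin_map_comp[OF u y]])
  have hb: "hom_cobd T m = (\<lambda>h. compose (carrier (obj T (m + 1))) h (bd T (m + 1)))" for m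
    by (simp add: hom_cobd_def fun_eq_iff)
  have cc: "lin_map K (hom_space A (obj T m) N) (hom_space A (obj T (m + 1)) N) (hom_cobd T m)" for m
    unfolding hb by (rule lin_map_hom_pre[OF oT oT dT'])
  have cc': "lin_map K (hom_space A (obj T (m - 1)) N) (hom_space A (obj T m) N) (hom_cobd T (m - 1))" for m
    using cc[of "m - 1"] by simp
  have fc: "lin_map K (hom_space A N (rtwist \<mu> (obj T m))) (hom_space A N (rtwist \<mu> (obj T (m - 1)))) (compose (carrier N) (bd T m))" for m
    by (rule lin_map_hom_post[OF N drT])
  have fc': "lin_map K (hom_space A N (rtwist \<mu> (obj T (m + 1)))) (hom_space A N (rtwist \<mu> (obj T m))) (compose (carrier N) (bd T (m + 1)))" for m
    using fc[of "m + 1"] by simp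
  show ?thesis
    unfolding tate_Ext_def hom_obj_def
  proof (rule pairing_homology_isomorphic[where
        \<beta>U = "\<lambda>\<phi> g. tr (I (n - 1)) (x (n - 1)) (f (n - 1)) (\<lambda>p. g (\<phi> p))" and
        \<beta>W = "\<lambda>\<phi> g. tr (I (n + 1)) (x (n + 1)) (f (n + 1)) (\<lambda>p. g (\<phi> p))",
        OF K.field_axioms _ _ _ cc' cc _ _ _ _ fc fc' _ D])
    show "\<forall>u\<in>carrier (hom_space A (obj T (n - 1)) N). hom_cobd T n (hom_cobd T (n - 1) u) = \<zero>\<^bsub>hom_space A (obj T (n + 1)) N\<^esub>"
    proof
      fix u assume "u \<in> carrier (hom_space A (obj T (n - 1)) N)"
      then have u: "lin_map A (obj T (n - 1)) N u" by simp
      have "hom_cobd T n (hom_cobd T (n - 1) u) = (\<lambda>y\<in>carrier (obj T (n + 1)). u (bd T n (bd T (n + 1) y)))"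
        unfolding hom_cobd_def compose_def using dc' by (intro restrict_ext) simp
      also have "\<dots> = (\<lambda>y\<in>carrier (obj T (n + 1)). \<zero>\<^bsub>N\<^esub>)"
        using dd lin_map_zero[OF oT N u] by (intro restrict_ext) simp
      finally show "hom_cobd T n (hom_cobd T (n - 1) u) = \<zero>\<^bsub>hom_space A (obj T (n + 1)) N\<^esub>" by simp
    qed
    show "\<forall>u\<in>carrier (hom_space A N (rtwist \<mu> (obj T (n + 1)))). compose (carrier N) (bd T n) (compose (carrier N) (bd T (n + 1)) u)
        = \<zero>\<^bsub>hom_space A N (rtwist \<mu> (obj T (n - 1)))\<^esub>"
    proof
      fix u assume "u \<in> carrier (hom_space A N (rtwist \<mu> (obj T (n + 1))))"
      then have u: "u y \<in> carrier (obj T (n + 1))" if "y \<in> carrier N" for y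
        using lin_map_closed[of A N "rtwist \<mu> (obj T (n + 1))" u y] that by simp
      show "compose (carrier N) (bd T n) (compose (carrier N) (bd T (n + 1)) u) = \<zero>\<^bsub>hom_space A N (rtwist \<mu> (obj T (n - 1)))\<^esub>"
        unfolding compose_def using u dd by (simp cong: restrict_cong)
    qed
    fix u y assume u: "u \<in> carrier (hom_space A (obj T (n - 1)) N)" and y: "y \<in> carrier (hom_space A N (rtwist \<mu> (obj T n)))"
    have uc: "u p \<in> carrier N" if "p \<in> carrier (obj T (n - 1))" for p
      using lin_map_closed[of A "obj T (n - 1)" N u p] that u by simp
    have yc: "y p \<in> carrier (obj T n)" if "p \<in> carrier N" for p
      using lin_map_closed[of A N "rtwist \<mu> (obj T n)" y p] that y by simp
    have "tr (I n) (x n) (f n) (\<lambda>p. y (hom_cobd T (n - 1) u p)) = tr (I n) (x n) (f n) (\<lambda>p. y (u (bd T n p)))"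
      using uc yc dc by (intro Tr_cong) (auto simp: hom_cobd_def compose_def)
    also have "\<dots> = tr (I (n - 1)) (x (n - 1)) (f (n - 1)) (\<lambda>p. bd T n (y (u p)))"
      using adj[of "n - 1" u y] u y by simp
    also have "\<dots> = tr (I (n - 1)) (x (n - 1)) (f (n - 1)) (\<lambda>p. compose (carrier N) (bd T n) y (u p))"
      using uc yc dc by (intro Tr_cong) (auto simp: compose_def)
    finally show "tr (I n) (x n) (f n) (\<lambda>p. y (hom_cobd T (n - 1) u p)) =
        tr (I (n - 1)) (x (n - 1)) (f (n - 1)) (\<lambda>p. compose (carrier N) (bd T n) y (u p))" .
  next
    fix u y assume u: "u \<in> carrier (hom_space A (obj T n) N)" and y: "y \<in> carrier (hom_space A N (rtwist \<mu> (obj T (n + 1))))"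
    have uc: "u p \<in> carrier N" if "p \<in> carrier (obj T n)" for p
      using lin_map_closed[of A "obj T n" N u p] that u by simp
    have yc: "y p \<in> carrier (obj T (n + 1))" if "p \<in> carrier N" for p
      using lin_map_closed[of A N "rtwist \<mu> (obj T (n + 1))" y p] that y by simp
    have "tr (I n) (x n) (f n) (\<lambda>p. compose (carrier N) (bd T (n + 1)) y (u p)) = tr (I n) (x n) (f n) (\<lambda>p. bd T (n + 1) (y (u p)))"
      using uc yc dc' by (intro Tr_cong) (auto simp: compose_def)
    also have "\<dots> = tr (I (n + 1)) (x (n + 1)) (f (n + 1)) (\<lambda>p. y (u (bd T (n + 1) p)))"
      using adj[of n u y] u y by simp
    also have "\<dots> = tr (I (n + 1)) (x (n + 1)) (f (n + 1)) (\<lambda>p. y (hom_cobd T n u p))"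
      using uc yc dc' by (intro Tr_cong) (auto simp: hom_cobd_def compose_def)
    finally show "tr (I n) (x n) (f n) (\<lambda>p. compose (carrier N) (bd T (n + 1)) y (u p)) =
        tr (I (n + 1)) (x (n + 1)) (f (n + 1)) (\<lambda>p. y (hom_cobd T n u p))" .
  next
    fix y assume "y \<in> carrier (hom_space A N (rtwist \<mu> (obj T (n - 1))))"
      and "\<And>u. u \<in> carrier (hom_space A (obj T (n - 1)) N) \<Longrightarrow>
        tr (I (n - 1)) (x (n - 1)) (f (n - 1)) (\<lambda>p. y (u p)) = \<zero>"
    then show "y = \<zero>\<^bsub>hom_space A N (rtwist \<mu> (obj T (n - 1)))\<^esub>" by (rule tr_nondeg_right[OF oT N bT])
  next
    fix u assume u: "u \<in> carrier (hom_space A (obj T (n + 1)) N)"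
      and z: "\<And>y. y \<in> carrier (hom_space A N (rtwist \<mu> (obj T (n + 1)))) \<Longrightarrow>
        tr (I (n + 1)) (x (n + 1)) (f (n + 1)) (\<lambda>p. y (u p)) = \<zero>"
    show "u = \<zero>\<^bsub>hom_space A (obj T (n + 1)) N\<^esub>"
      by (rule tr_nondeg_left_finite[OF oT N bT fN, of "n + 1"]) (use u z in blast)
  qed (use lmodule_hom_space[OF N oT] lmodule_hom_space[OF rT N] lin0 lin0' in auto)
qed

end

subsection \<open>Complete resolutions\<close>

lemma lin_map_diff_fun:
  assumes M: "lmodule R M" and N: "lmodule R N" and f: "lin_map R M N f" and g: "lin_map R M N g"
  shows "lin_map R M N (\<lambda>x. f x \<ominus>\<^bsub>N\<^esub> g x)"
proof -
  interpret M: lmodule R M by (rule M)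
  interpret N: lmodule R N by (rule N)
  show ?thesis
    using lin_map_closed[OF f] lin_map_closed[OF g]
    by (intro lin_mapI)
      (auto simp: lin_map_add[OF f] lin_map_add[OF g] lin_map_smult[OF f] lin_map_smult[OF g] a_minus_def
        N.M.minus_add N.M.a_ac N.smult_r_distr N.smult_r_minus)
qed

lemma lin_map_add_fun:
  assumes M: "lmodule R M" and N: "lmodule R N" and f: "lin_map R M N f" and g: "lin_map R M N g"
  shows "lin_map R M N (\<lambda>x. f x \<oplus>\<^bsub>N\<^esub> g x)"
proof -
  interpret M: lmodule R M by (rule M)
  interpret N: lmodule R N by (rule N)
  show ?thesis
    using lin_map_closed[OF f] lin_map_closed[OF g]
    by (intro lin_mapI)
      (auto simp: lin_map_add[OF f] lin_map_add[OF g] lin_map_smult[OF f] lin_map_smult[OF g]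
        N.M.a_ac N.smult_r_distr)
qed

lemma (in k_algebra) lin_map_scal_fun:
  assumes M: "lmodule A M" and N: "lmodule A N" and f: "lin_map A M N f" and c: "c \<in> carrier K"
  shows "lin_map A M N (\<lambda>x. scal A N c (f x))"
proof -
  interpret M: lmodule A M by (rule M)
  interpret N: lmodule A N by (rule N)
  show ?thesis
    using lin_map_closed[OF f] c scal_smult[OF N c]
    by (intro lin_mapI)
      (auto simp: lin_map_add[OF f] lin_map_smult[OF f] N.smult_r_distr scal_def)
qed

lemma lin_map_comb:
  assumes M: "lmodule R M" and N: "lmodule R N"
    and k: "\<And>i. i \<in> I \<Longrightarrow> lin_map R M (self_module R) (k i)" and y: "\<And>i. i \<in> I \<Longrightarrow> y i \<in> carrier N"
  shows "lin_map R M N (\<lambda>x. \<Oplus>\<^bsub>N\<^esub>i\<in>I. k i x \<odot>\<^bsub>N\<^esub> y i)"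
proof -
  interpret M: lmodule R M by (rule M)
  interpret N: lmodule R N by (rule N)
  have kc: "k i x \<in> carrier R" if "i \<in> I" "x \<in> carrier M" for i x using lin_map_closed[OF k that(2)] that by simp
  show ?thesis
  proof (rule lin_mapI)
    fix x assume "x \<in> carrier M"
    then show "(\<Oplus>\<^bsub>N\<^esub>i\<in>I. k i x \<odot>\<^bsub>N\<^esub> y i) \<in> carrier N" using kc y by (intro N.M.finsum_closed) auto
  next
    fix x z assume xz: "x \<in> carrier M" "z \<in> carrier M"
    have "(\<Oplus>\<^bsub>N\<^esub>i\<in>I. k i (x \<oplus>\<^bsub>M\<^esub> z) \<odot>\<^bsub>N\<^esub> y i) = (\<Oplus>\<^bsub>N\<^esub>i\<in>I. k i x \<odot>\<^bsub>N\<^esub> y i \<oplus>\<^bsub>N\<^esub> k i z \<odot>\<^bsub>N\<^esub> y i)"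
      using kc y xz lin_map_add[OF k] by (intro N.M.finsum_cong') (auto simp: N.smult_l_distr)
    also have "\<dots> = (\<Oplus>\<^bsub>N\<^esub>i\<in>I. k i x \<odot>\<^bsub>N\<^esub> y i) \<oplus>\<^bsub>N\<^esub> (\<Oplus>\<^bsub>N\<^esub>i\<in>I. k i z \<odot>\<^bsub>N\<^esub> y i)"
      using kc y xz by (intro N.M.finsum_addf) auto
    finally show "(\<Oplus>\<^bsub>N\<^esub>i\<in>I. k i (x \<oplus>\<^bsub>M\<^esub> z) \<odot>\<^bsub>N\<^esub> y i) =
      (\<Oplus>\<^bsub>N\<^esub>i\<in>I. k i x \<odot>\<^bsub>N\<^esub> y i) \<oplus>\<^bsub>N\<^esub> (\<Oplus>\<^bsub>N\<^esub>i\<in>I. k i z \<odot>\<^bsub>N\<^esub> y i)" .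
  next
    fix r x assume rx: "r \<in> carrier R" "x \<in> carrier M"
    have "(\<Oplus>\<^bsub>N\<^esub>i\<in>I. k i (r \<odot>\<^bsub>M\<^esub> x) \<odot>\<^bsub>N\<^esub> y i) = (\<Oplus>\<^bsub>N\<^esub>i\<in>I. r \<odot>\<^bsub>N\<^esub> (k i x \<odot>\<^bsub>N\<^esub> y i))"
      using kc y rx lin_map_smult[OF k] by (intro N.M.finsum_cong') (auto simp: N.smult_assoc1)
    also have "\<dots> = r \<odot>\<^bsub>N\<^esub> (\<Oplus>\<^bsub>N\<^esub>i\<in>I. k i x \<odot>\<^bsub>N\<^esub> y i)"
      using kc y rx by (intro N.finsum_smult [symmetric]) auto
    finally show "(\<Oplus>\<^bsub>N\<^esub>i\<in>I. k i (r \<odot>\<^bsub>M\<^esub> x) \<odot>\<^bsub>N\<^esub> y i) = r \<odot>\<^bsub>N\<^esub> (\<Oplus>\<^bsub>N\<^esub>i\<in>I. k i x \<odot>\<^bsub>N\<^esub> y i)" .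
  qed
qed

text \<open>Preimages of the elements \<open>h (x i)\<close> are recombined with the coordinates
  \<open>f i\<close>.\<close>

lemma proj_lift:
  assumes P: "lmodule R P" and M: "lmodule R M" and N: "lmodule R N" and b: "proj_basis R P I x f"
    and d: "lin_map R M N d" and h: "lin_map R P N h" and im: "\<forall>p\<in>carrier P. \<exists>m\<in>carrier M. d m = h p"
  shows "\<exists>k. lin_map R P M k \<and> (\<forall>p\<in>carrier P. d (k p) = h p)"
proof -
  interpret P: lmodule R P by (rule P)
  interpret M: lmodule R M by (rule M)
  interpret N: lmodule R N by (rule N)
  note b' = proj_basisD[OF b]
  have "\<exists>m. m \<in> carrier M \<and> d m = h (x i)" if "i \<in> I" for i using im b'(2)[OF that] by blast
  then obtain m where m: "\<And>i. i \<in> I \<Longrightarrow> m i \<in> carrier M" "\<And>i. i \<in> I \<Longrightarrow> d (m i) = h (x i)"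
    by metis
  have "d (\<Oplus>\<^bsub>M\<^esub>i\<in>I. f i p \<odot>\<^bsub>M\<^esub> m i) = h p" if p: "p \<in> carrier P" for p
  proof -
    have "d (\<Oplus>\<^bsub>M\<^esub>i\<in>I. f i p \<odot>\<^bsub>M\<^esub> m i) = (\<Oplus>\<^bsub>N\<^esub>i\<in>I. d (f i p \<odot>\<^bsub>M\<^esub> m i))"
      using m b'(4)[OF _ p] by (intro lin_map_finsum[OF M N d]) auto
    also have "\<dots> = (\<Oplus>\<^bsub>N\<^esub>i\<in>I. h (f i p \<odot>\<^bsub>P\<^esub> x i))"
      using m b'(4)[OF _ p] b'(2) lin_map_smult[OF d] lin_map_smult[OF h] lin_map_closed[OF h]
      by (intro N.M.finsum_cong') auto
    also have "\<dots> = h (\<Oplus>\<^bsub>P\<^esub>i\<in>I. f i p \<odot>\<^bsub>P\<^esub> x i)"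
      using b'(2) b'(4)[OF _ p] by (intro lin_map_finsum[OF P N h, symmetric]) auto
    also have "\<dots> = h p" by (rule arg_cong[OF b'(5)[OF p, symmetric]])
    finally show ?thesis .
  qed
  moreover have "lin_map R P M (\<lambda>p. \<Oplus>\<^bsub>M\<^esub>i\<in>I. f i p \<odot>\<^bsub>M\<^esub> m i)"
    using b'(3) m(1) by (intro lin_map_comb[OF P M]) auto
  ultimately show ?thesis by (intro exI[of _ "\<lambda>p. \<Oplus>\<^bsub>M\<^esub>i\<in>I. f i p \<odot>\<^bsub>M\<^esub> m i"]) auto
qed

text \<open>A map into \<open>P\<close> is a family of functionals recombined with the
  \<open>x i\<close>, so it extends along \<open>d\<close> once maps into the regular module do. In
  this way acyclicity of \<open>Hom(S, A)\<close> spreads to \<open>Hom(S, P)\<close> for projective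
  \<open>P\<close>.\<close>

lemma proj_extend:
  assumes P: "lmodule R P" and M: "lmodule R M" and M': "lmodule R M'" and b: "proj_basis R P I x f"
    and d: "lin_map R M M' d" and h: "lin_map R M P h"
    and ext: "\<And>g. lin_map R P (self_module R) g \<Longrightarrow>
      \<exists>k. lin_map R M' (self_module R) k \<and> (\<forall>m\<in>carrier M. k (d m) = g (h m))"
  shows "\<exists>k. lin_map R M' P k \<and> (\<forall>m\<in>carrier M. k (d m) = h m)"
proof -
  interpret P: lmodule R P by (rule P)
  note b' = proj_basisD[OF b]
  have "\<exists>k. lin_map R M' (self_module R) k \<and> (\<forall>m\<in>carrier M. k (d m) = f i (h m))" if "i \<in> I" for i
    by (rule ext[OF b'(3)[OF that]])
  then obtain k where k: "\<And>i. i \<in> I \<Longrightarrow> lin_map R M' (self_module R) (k i)"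
    "\<And>i m. i \<in> I \<Longrightarrow> m \<in> carrier M \<Longrightarrow> k i (d m) = f i (h m)" by metis
  have "(\<Oplus>\<^bsub>P\<^esub>i\<in>I. k i (d m) \<odot>\<^bsub>P\<^esub> x i) = h m" if m: "m \<in> carrier M" for m
  proof -
    have hm: "h m \<in> carrier P" using lin_map_closed[OF h m] .
    have "(\<Oplus>\<^bsub>P\<^esub>i\<in>I. k i (d m) \<odot>\<^bsub>P\<^esub> x i) = (\<Oplus>\<^bsub>P\<^esub>i\<in>I. f i (h m) \<odot>\<^bsub>P\<^esub> x i)"
      using b'(2) b'(4)[OF _ hm] k(2)[OF _ m] by (intro P.M.finsum_cong') auto
    also have "\<dots> = h m" by (rule b'(5)[OF hm, symmetric])
    finally show ?thesis .
  qed
  moreover have "lin_map R M' P (\<lambda>m. \<Oplus>\<^bsub>P\<^esub>i\<in>I. k i m \<odot>\<^bsub>P\<^esub> x i)"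
    using k(1) b'(2) by (intro lin_map_comb[OF M' P]) auto
  ultimately show ?thesis by (intro exI[of _ "\<lambda>m. \<Oplus>\<^bsub>P\<^esub>i\<in>I. k i m \<odot>\<^bsub>P\<^esub> x i"]) auto
qed

lemma chain_complexD:
  assumes "chain_complex R C"
  shows "lmodule R (obj C n)" "lin_map R (obj C n) (obj C (n - 1)) (bd C n)"
    "lin_map R (obj C (n + 1)) (obj C n) (bd C (n + 1))"
    "x \<in> carrier (obj C (n + 1)) \<Longrightarrow> bd C n (bd C (n + 1) x) = \<zero>\<^bsub>obj C (n - 1)\<^esub>"
    "x \<in> carrier (obj C n) \<Longrightarrow> bd C (n - 1) (bd C n x) = \<zero>\<^bsub>obj C (n - 2)\<^esub>"
proof -
  have *: "lmodule R (obj C n)" "lin_map R (obj C n) (obj C (n - 1)) (bd C n)"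
    "\<forall>x\<in>carrier (obj C (n + 1)). bd C n (bd C (n + 1) x) = \<zero>\<^bsub>obj C (n - 1)\<^esub>" for n
    using assms by (auto simp: chain_complex_def)
  show "lmodule R (obj C n)" "lin_map R (obj C n) (obj C (n - 1)) (bd C n)" by (rule *)+
  show "lin_map R (obj C (n + 1)) (obj C n) (bd C (n + 1))" using *(2)[of "n + 1"] by simp
  show "x \<in> carrier (obj C (n + 1)) \<Longrightarrow> bd C n (bd C (n + 1) x) = \<zero>\<^bsub>obj C (n - 1)\<^esub>" using *(3) by blast
  show "x \<in> carrier (obj C n) \<Longrightarrow> bd C (n - 1) (bd C n x) = \<zero>\<^bsub>obj C (n - 2)\<^esub>" using *(3)[of "n - 1"] by simp
qed

section \<open>What completeness of a resolution provides\<close>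

context k_alg
begin

lemma complete_resolution_exact:
  assumes T: "complete_resolution A M T" and x: "x \<in> carrier (obj T n)" "bd T n x = \<zero>\<^bsub>obj T (n - 1)\<^esub>"
  shows "\<exists>y\<in>carrier (obj T (n + 1)). bd T (n + 1) y = x"
proof -
  have "exact_at T n" using T by (simp add: complete_resolution_def)
  moreover have "x \<in> a_kernel (obj T n) (obj T (n - 1)) (bd T n)" using x by (simp add: a_kernel_def')
  ultimately show ?thesis unfolding exact_at_def by auto
qed

text \<open>Acyclicity of \<open>Hom(T, A)\<close>, freed from the extensional functions of
  \<open>hom_space\<close>: the given \<open>h\<close> is restricted to the carrier before the
  hypothesis on \<open>T\<close> applies to it.\<close>

lemma complete_resolution_extend:
  assumes T: "complete_resolution A M T" and h: "lin_map A (obj T n) (self_module A) h"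
    and z: "\<forall>x\<in>carrier (obj T (n + 1)). h (bd T (n + 1) x) = \<zero>\<^bsub>A\<^esub>"
  shows "\<exists>k. lin_map A (obj T (n - 1)) (self_module A) k \<and> (\<forall>x\<in>carrier (obj T n). k (bd T n x) = h x)"
proof -
  have C: "chain_complex A T"
    and ex: "a_kernel (hom_obj A T (self_module A) n) (hom_obj A T (self_module A) (n + 1)) (hom_cobd T n)
          = hom_cobd T (n - 1) ` carrier (hom_obj A T (self_module A) (n - 1))"
    using T by (simp_all add: complete_resolution_def)
  note C' = chain_complexD[OF C]
  define h' where "h' = restrict h (carrier (obj T n))"
  have h': "h' \<in> carrier (hom_obj A T (self_module A) n)"
    unfolding h'_def hom_obj_def by (rule hom_spaceI[OF C'(1) h])
  have "hom_cobd T n h' = \<zero>\<^bsub>hom_obj A T (self_module A) (n + 1)\<^esub>"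
    unfolding hom_cobd_def hom_obj_def compose_def
    using z lin_map_closed[OF C'(3)] by (simp add: h'_def cong: restrict_cong)
  with h' have "h' \<in> a_kernel (hom_obj A T (self_module A) n) (hom_obj A T (self_module A) (n + 1)) (hom_cobd T n)"
    by (simp add: a_kernel_def')
  then obtain k where k: "k \<in> carrier (hom_obj A T (self_module A) (n - 1))" "h' = hom_cobd T (n - 1) k"
    unfolding ex by blast
  have "k (bd T n x) = h x" if "x \<in> carrier (obj T n)" for x
    using fun_cong[OF k(2), of x] that by (simp add: h'_def hom_cobd_def compose_def)
  with k(1) show ?thesis by (auto simp: hom_obj_def)
qed

text \<open>The augmentation of the projective resolution, moved to \<open>T\<close> along the
  bijections in degrees 0 and 1. It packages everything that the later arguments take from that
  resolution.\<close>

lemma complete_resolution_augmentation: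
  fixes T :: "('g, 't) cplx" and M :: "('g, 'm) module"
  assumes T: "complete_resolution A M T"
  obtains \<epsilon> where "lin_map A (obj T 0) M \<epsilon>" "\<epsilon> ` carrier (obj T 0) = carrier M"
    "\<And>x. x \<in> carrier (obj T 0) \<Longrightarrow> \<epsilon> x = \<zero>\<^bsub>M\<^esub> \<longleftrightarrow> x \<in> bd T 1 ` carrier (obj T 1)"
proof -
  obtain P :: "('g, 't) cplx" and \<epsilon> f where P: "proj_resolution A M P \<epsilon>" and f: "chain_map A T P f"
    and bij: "\<forall>n\<ge>0. bij_betw (f n) (carrier (obj T n)) (carrier (obj P n))"
    using T unfolding complete_resolution_def by blast
  have fl: "lin_map A (obj T n) (obj P n) (f n)"
    and fb: "x \<in> carrier (obj T n) \<Longrightarrow> f (n - 1) (bd T n x) = bd P n (f n x)" for n x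
    using f by (auto simp: chain_map_def)
  have C: "chain_complex A T" using T by (simp add: complete_resolution_def)
  have e: "lin_map A (obj P 0) M \<epsilon>" "\<epsilon> ` carrier (obj P 0) = carrier M"
    "a_kernel (obj P 0) M \<epsilon> = bd P 1 ` carrier (obj P 1)"
    using P by (auto simp: proj_resolution_def)
  have f0: "f 0 ` carrier (obj T 0) = carrier (obj P 0)" "inj_on (f 0) (carrier (obj T 0))"
    "f 1 ` carrier (obj T 1) = carrier (obj P 1)"
    using bij[rule_format, of 0] bij[rule_format, of 1] by (auto simp: bij_betw_def)
  have b1: "bd T 1 x \<in> carrier (obj T 0)" if "x \<in> carrier (obj T 1)" for x
    using lin_map_closed[OF chain_complexD(2)[OF C, of 1] that] by simp
  show thesis
  proof (rule that[of "\<lambda>x. \<epsilon> (f 0 x)"])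
    show "lin_map A (obj T 0) M (\<lambda>x. \<epsilon> (f 0 x))" by (rule lin_map_comp[OF fl e(1)])
    show "(\<lambda>x. \<epsilon> (f 0 x)) ` carrier (obj T 0) = carrier M"
      unfolding e(2)[symmetric] f0(1)[symmetric] by (simp add: image_image)
    fix x assume x: "x \<in> carrier (obj T 0)"
    have fx: "f 0 x \<in> carrier (obj P 0)" using lin_map_closed[OF fl x] .
    have "\<epsilon> (f 0 x) = \<zero>\<^bsub>M\<^esub> \<longleftrightarrow> f 0 x \<in> bd P 1 ` f 1 ` carrier (obj T 1)"
      unfolding f0(3) e(3)[symmetric] using fx by (simp add: a_kernel_def')
    also have "\<dots> \<longleftrightarrow> f 0 x \<in> f 0 ` bd T 1 ` carrier (obj T 1)"
      using fb[of _ 1] by (auto simp: image_iff)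
    also have "\<dots> \<longleftrightarrow> x \<in> bd T 1 ` carrier (obj T 1)"
      using x b1 f0(2) by (auto simp: inj_on_def)
    finally show "\<epsilon> (f 0 x) = \<zero>\<^bsub>M\<^esub> \<longleftrightarrow> x \<in> bd T 1 ` carrier (obj T 1)" .
  qed
qed

lemma complete_resolution_bases:
  fixes T :: "('g, 't) cplx"
  assumes T: "complete_resolution A M T"
  obtains I :: "int \<Rightarrow> 't set" and x f where "\<And>n. proj_basis A (obj T n) (I n) (x n) (f n)"
proof -
  have "\<exists>I :: 't set. \<exists>x f. proj_basis A (obj T n) I x f" for n
  proof -
    have "projective A (obj T n)" "fin_gen A (obj T n)" using T by (auto simp: complete_resolution_def)
    then show ?thesis using proj_basis_exists by metis
  qed
  then show thesis using that by metis
qed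

end

lemma (in k_alg) tate_Ext_complex:
  assumes S: "chain_complex A S" and X: "lmodule A X"
  shows "lin_map K (hom_space A (obj S p) X) (hom_space A (obj S (p + 1)) X) (hom_cobd S p)"
    "lin_map K (hom_space A (obj S (p - 1)) X) (hom_space A (obj S p) X) (hom_cobd S (p - 1))"
    "\<forall>u\<in>carrier (hom_space A (obj S (p - 1)) X). hom_cobd S p (hom_cobd S (p - 1) u) = \<zero>\<^bsub>hom_space A (obj S (p + 1)) X\<^esub>"
proof -
  note S' = chain_complexD[OF S]
  have hb: "hom_cobd S p = (\<lambda>h. compose (carrier (obj S (p + 1))) h (bd S (p + 1)))" for p :: int
    by (simp add: hom_cobd_def fun_eq_iff)
  have cc: "lin_map K (hom_space A (obj S p) X) (hom_space A (obj S (p + 1)) X) (hom_cobd S p)" for p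
    unfolding hb by (rule lin_map_hom_pre[OF S'(1) S'(1) S'(3)])
  then show "lin_map K (hom_space A (obj S p) X) (hom_space A (obj S (p + 1)) X) (hom_cobd S p)" .
  show "lin_map K (hom_space A (obj S (p - 1)) X) (hom_space A (obj S p) X) (hom_cobd S (p - 1))"
    using cc[of "p - 1"] by simp
  show "\<forall>u\<in>carrier (hom_space A (obj S (p - 1)) X). hom_cobd S p (hom_cobd S (p - 1) u) = \<zero>\<^bsub>hom_space A (obj S (p + 1)) X\<^esub>"
  proof
    fix u assume "u \<in> carrier (hom_space A (obj S (p - 1)) X)"
    then have u: "lin_map A (obj S (p - 1)) X u" by simp
    have "hom_cobd S p (hom_cobd S (p - 1) u) = (\<lambda>y\<in>carrier (obj S (p + 1)). u (bd S p (bd S (p + 1) y)))"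
      unfolding hom_cobd_def compose_def using lin_map_closed[OF S'(3)] by (intro restrict_ext) simp
    also have "\<dots> = (\<lambda>y\<in>carrier (obj S (p + 1)). \<zero>\<^bsub>X\<^esub>)"
      using S'(4) lin_map_zero[OF S'(1) X u] by (intro restrict_ext) simp
    finally show "hom_cobd S p (hom_cobd S (p - 1) u) = \<zero>\<^bsub>hom_space A (obj S (p + 1)) X\<^esub>" by simp
  qed
qed

lemma (in k_alg) lmodule_tate_Ext:
  assumes S: "chain_complex A S" and X: "lmodule A X"
  shows "lmodule K (tate_Ext A m S X)"
  unfolding tate_Ext_def hom_obj_def
  using lmodule_hom_space[OF X chain_complexD(1)[OF S]] tate_Ext_complex[OF S X]
  by (intro lmodule_homology)

subsection \<open>Balancing\<close>

definition ctwist :: "('g \<Rightarrow> 'g) \<Rightarrow> ('g, 't) cplx \<Rightarrow> ('g, 't) cplx" where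
  "ctwist s T = \<lparr>obj = \<lambda>n. rtwist s (obj T n), bd = bd T\<rparr>"

lemma ctwist_simps [simp]: "obj (ctwist s T) n = rtwist s (obj T n)" "bd (ctwist s T) = bd T"
  by (simp_all add: ctwist_def)

lemma chain_complex_ctwist:
  assumes "chain_complex R T" "s \<in> ring_hom R R" shows "chain_complex R (ctwist s T)"
  using chain_complexD[OF assms(1)] assms(2)
  by (auto simp: chain_complex_def intro: lmodule.lmodule_rtwist lin_map_rtwist)

text \<open>
  All rows and columns of the bicomplex \<open>Hom(S\<^sub>p, I\<^sub>q)\<close> are exact.  Then the groups \<open>diag p q\<close> of
  elements killed by both differentials, modulo images of the composite of the two differentials,
  only depend on the difference of \<open>p\<close> and \<open>q\<close>, and they compute the cohomology along both edges.
\<close>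

locale exact_bicomplex = k_alg K A for K :: "'k ring" (structure) and A :: "('k, 'g) module" (structure) +
  fixes S :: "('g, 's) cplx" and I :: "('g, 'i) cplx"
  assumes S: "chain_complex A S" and I: "chain_complex A I"
    and lift: "\<lbrakk>lin_map A (obj S p) (obj I q) h; \<forall>x\<in>carrier (obj S p). bd I q (h x) = \<zero>\<^bsub>obj I (q - 1)\<^esub>\<rbrakk> \<Longrightarrow>
      \<exists>k. lin_map A (obj S p) (obj I (q + 1)) k \<and> (\<forall>x\<in>carrier (obj S p). bd I (q + 1) (k x) = h x)"
    and extend: "\<lbrakk>lin_map A (obj S p) (obj I q) h; \<forall>x\<in>carrier (obj S (p + 1)). h (bd S (p + 1) x) = \<zero>\<^bsub>obj I q\<^esub>\<rbrakk> \<Longrightarrow>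
      \<exists>k. lin_map A (obj S (p - 1)) (obj I q) k \<and> (\<forall>x\<in>carrier (obj S p). k (bd S p x) = h x)"
begin

lemmas S' = chain_complexD[OF S] and I' = chain_complexD[OF I]

definition cyc :: "int \<Rightarrow> int \<Rightarrow> ('s \<Rightarrow> 'i) set" where
  "cyc p q = {h \<in> carrier (hom_space A (obj S p) (obj I q)).
     (\<forall>x\<in>carrier (obj S p). bd I q (h x) = \<zero>\<^bsub>obj I (q - 1)\<^esub>) \<and>
     (\<forall>x\<in>carrier (obj S (p + 1)). h (bd S (p + 1) x) = \<zero>\<^bsub>obj I q\<^esub>)}"

definition bnd :: "int \<Rightarrow> int \<Rightarrow> ('s \<Rightarrow> 'i) set" where
  "bnd p q = (\<lambda>k. compose (carrier (obj S p)) (bd I (q + 1)) (compose (carrier (obj S p)) k (bd S p))) `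
     carrier (hom_space A (obj S (p - 1)) (obj I (q + 1)))"

definition cyc_space :: "int \<Rightarrow> int \<Rightarrow> ('k, 's \<Rightarrow> 'i) module" where
  "cyc_space p q = (hom_space A (obj S p) (obj I q))\<lparr>carrier := cyc p q\<rparr>"

definition diag :: "int \<Rightarrow> int \<Rightarrow> ('k, ('s \<Rightarrow> 'i) set) module" where
  "diag p q = quot_module (cyc_space p q) (bnd p q)"

lemma Sc: "x \<in> carrier (obj S p) \<Longrightarrow> bd S p x \<in> carrier (obj S (p - 1))"
  using lin_map_closed[OF S'(2)] .

lemma Sc': "x \<in> carrier (obj S (p + 1)) \<Longrightarrow> bd S (p + 1) x \<in> carrier (obj S p)"
  using lin_map_closed[OF S'(3)] .

lemma Ic: "x \<in> carrier (obj I p) \<Longrightarrow> bd I p x \<in> carrier (obj I (p - 1))"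
  using lin_map_closed[OF I'(2)] .

lemma Ic': "x \<in> carrier (obj I (p + 1)) \<Longrightarrow> bd I (p + 1) x \<in> carrier (obj I p)"
  using lin_map_closed[OF I'(3)] .

lemma bd_I_zero: "bd I p \<zero>\<^bsub>obj I p\<^esub> = \<zero>\<^bsub>obj I (p - 1)\<^esub>"
  using lin_map_zero[OF I'(1) I'(1) I'(2)] .

lemma bd_I_zero': "bd I (p + 1) \<zero>\<^bsub>obj I (p + 1)\<^esub> = \<zero>\<^bsub>obj I p\<^esub>"
  using bd_I_zero[of "p + 1"] by simp

lemma bnd_iff:
  assumes "h \<in> cyc p q"
  shows "h \<in> bnd p q \<longleftrightarrow> (\<exists>k. lin_map A (obj S (p - 1)) (obj I (q + 1)) k \<and>
    (\<forall>x\<in>carrier (obj S p). h x = bd I (q + 1) (k (bd S p x))))"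
proof
  assume "h \<in> bnd p q"
  then show "\<exists>k. lin_map A (obj S (p - 1)) (obj I (q + 1)) k \<and>
    (\<forall>x\<in>carrier (obj S p). h x = bd I (q + 1) (k (bd S p x)))"
    unfolding bnd_def by (auto simp: compose_def)
next
  assume "\<exists>k. lin_map A (obj S (p - 1)) (obj I (q + 1)) k \<and>
    (\<forall>x\<in>carrier (obj S p). h x = bd I (q + 1) (k (bd S p x)))"
  then obtain k where k: "lin_map A (obj S (p - 1)) (obj I (q + 1)) k"
    "\<And>x. x \<in> carrier (obj S p) \<Longrightarrow> h x = bd I (q + 1) (k (bd S p x))" by blast
  show "h \<in> bnd p q"
    unfolding bnd_def
  proof (rule image_eqI)
    show "restrict k (carrier (obj S (p - 1))) \<in> carrier (hom_space A (obj S (p - 1)) (obj I (q + 1)))"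
      by (rule hom_spaceI[OF S'(1) k(1)])
    show "h = compose (carrier (obj S p)) (bd I (q + 1))
        (compose (carrier (obj S p)) (restrict k (carrier (obj S (p - 1)))) (bd S p))"
      using assms k(2) Sc by (intro extensionalityI[of _ "carrier (obj S p)"]) (auto simp: cyc_def compose_def)
  qed
qed

lemma lmodule_hom: "lmodule K (hom_space A (obj S p) (obj I q))"
  by (rule lmodule_hom_space[OF I'(1) S'(1)])

lemma cyc_submodule: "submodule (cyc p q) K (hom_space A (obj S p) (obj I q))"
proof -
  interpret H: lmodule K "hom_space A (obj S p) (obj I q)" by (rule lmodule_hom)
  interpret Iq: lmodule A "obj I q" by (rule I'(1))
  interpret Iq1: lmodule A "obj I (q - 1)" by (rule I'(1))
  show ?thesis
  proof (rule submoduleI'[OF lmodule_hom])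
    show "cyc p q \<subseteq> carrier (hom_space A (obj S p) (obj I q))" by (auto simp: cyc_def)
    show "\<zero>\<^bsub>hom_space A (obj S p) (obj I q)\<^esub> \<in> cyc p q"
      using H.M.zero_closed Sc' by (auto simp: cyc_def bd_I_zero)
  next
    fix a b assume ab: "a \<in> cyc p q" "b \<in> cyc p q"
    then have "a \<oplus>\<^bsub>hom_space A (obj S p) (obj I q)\<^esub> b \<in> carrier (hom_space A (obj S p) (obj I q))"
      by (intro H.M.a_closed) (auto simp: cyc_def)
    moreover have "a x \<in> carrier (obj I q)" "b x \<in> carrier (obj I q)" if "x \<in> carrier (obj S p)" for x
      using ab lin_map_closed[of A "obj S p" "obj I q" _ x] that by (auto simp: cyc_def)
    ultimately show "a \<oplus>\<^bsub>hom_space A (obj S p) (obj I q)\<^esub> b \<in> cyc p q"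
      using ab lin_map_add[OF I'(2)[of q]] Sc' by (auto simp: cyc_def)
  next
    fix c a assume a: "c \<in> carrier K" "a \<in> cyc p q"
    then have "c \<odot>\<^bsub>hom_space A (obj S p) (obj I q)\<^esub> a \<in> carrier (hom_space A (obj S p) (obj I q))"
      by (intro H.smult_closed) (auto simp: cyc_def)
    moreover have "a x \<in> carrier (obj I q)" if "x \<in> carrier (obj S p)" for x
      using a lin_map_closed[of A "obj S p" "obj I q" _ x] that by (auto simp: cyc_def)
    moreover have "scal A (obj I m) c \<zero>\<^bsub>obj I m\<^esub> = \<zero>\<^bsub>obj I m\<^esub>" for m
      using a lmodule.smult_r_null[OF I'(1)] by (simp add: scal_def)
    ultimately show "c \<odot>\<^bsub>hom_space A (obj S p) (obj I q)\<^esub> a \<in> cyc p q"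
      using a scal_lin_map[OF I'(2)[of q]] Sc' by (auto simp: cyc_def)
  qed
qed

lemma lmodule_cyc_space: "lmodule K (cyc_space p q)"
  unfolding cyc_space_def by (rule lmodule_submodule[OF lmodule_hom cyc_submodule])

lemma bnd_submodule: "submodule (bnd p q) K (cyc_space p q)"
  unfolding cyc_space_def
proof (rule submodule_restrict[OF lmodule_hom _ cyc_submodule])
  show "submodule (bnd p q) K (hom_space A (obj S p) (obj I q))"
    unfolding bnd_def
    by (rule submodule_image[OF lmodule_hom lmodule_hom
        lin_map_comp[OF lin_map_hom_pre[OF S'(1) S'(1) S'(2)] lin_map_hom_post[OF S'(1) I'(3)]]])
  show "bnd p q \<subseteq> cyc p q"
  proof
    fix h assume "h \<in> bnd p q"
    moreover from this have "h \<in> carrier (hom_space A (obj S p) (obj I q))"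
      using submodule_subset[OF lmodule_hom \<open>submodule (bnd p q) K (hom_space A (obj S p) (obj I q))\<close>] by blast
    ultimately obtain k where k: "lin_map A (obj S (p - 1)) (obj I (q + 1)) k"
      "h = compose (carrier (obj S p)) (bd I (q + 1)) (compose (carrier (obj S p)) k (bd S p))"
      unfolding bnd_def by auto
    have kc: "k x \<in> carrier (obj I (q + 1))" if "x \<in> carrier (obj S (p - 1))" for x
      using lin_map_closed[OF k(1) that] .
    have "bd I q (h x) = \<zero>\<^bsub>obj I (q - 1)\<^esub>" if "x \<in> carrier (obj S p)" for x
      using that I'(4)[OF kc[OF Sc[OF that]]] by (simp add: k(2) compose_def)
    moreover have "h (bd S (p + 1) x) = \<zero>\<^bsub>obj I q\<^esub>" if "x \<in> carrier (obj S (p + 1))" for x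
      using Sc'[OF that] S'(4)[OF that] lin_map_zero[OF S'(1) I'(1) k(1)] bd_I_zero'[of q] by (simp add: k(2) compose_def)
    ultimately show "h \<in> cyc p q"
      using \<open>h \<in> carrier (hom_space A (obj S p) (obj I q))\<close> unfolding cyc_def by blast
  qed
qed

lemma cycD:
  assumes "h \<in> cyc p q"
  shows "lin_map A (obj S p) (obj I q) h" "x \<in> carrier (obj S p) \<Longrightarrow> bd I q (h x) = \<zero>\<^bsub>obj I (q - 1)\<^esub>"
    "x \<in> carrier (obj S (p + 1)) \<Longrightarrow> h (bd S (p + 1) x) = \<zero>\<^bsub>obj I q\<^esub>" "h \<in> extensional (carrier (obj S p))"
  using assms by (auto simp: cyc_def)

lemma cycI:
  assumes "lin_map A (obj S p) (obj I q) h" "\<And>x. x \<in> carrier (obj S p) \<Longrightarrow> bd I q (h x) = \<zero>\<^bsub>obj I (q - 1)\<^esub>"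
    "\<And>x. x \<in> carrier (obj S (p + 1)) \<Longrightarrow> h (bd S (p + 1) x) = \<zero>\<^bsub>obj I q\<^esub>"
  shows "restrict h (carrier (obj S p)) \<in> cyc p q"
  using hom_spaceI[OF S'(1) assms(1)] assms(2,3) Sc' by (auto simp: cyc_def)

text \<open>Two elements correspond when some \<open>k\<close> from degree p - 1 of \<open>S\<close>
  to degree q of \<open>I\<close> has one of them as its differential in \<open>S\<close> and the
  other as its differential in \<open>I\<close>. The hypothesis \<open>extend\<close> yields
  \<open>k\<close> from the first, \<open>lift\<close> yields it from the second, and a different
  choice of \<open>k\<close> alters the opposite end by a boundary.\<close>

lemma diag_step: "isomorphic K (diag p q) (diag (p - 1) (q - 1))"
  unfolding diag_def
proof (rule corr_isomorphic[OF lmodule_cyc_space lmodule_cyc_space bnd_submodule bnd_submodule, where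
      rel = "\<lambda>h h'. \<exists>k. lin_map A (obj S (p - 1)) (obj I q) k \<and> (\<forall>x\<in>carrier (obj S p). h x = k (bd S p x)) \<and>
        (\<forall>x\<in>carrier (obj S (p - 1)). h' x = bd I q (k x))"])
  fix h assume "h \<in> carrier (cyc_space p q)"
  then have h: "h \<in> cyc p q" by (simp add: cyc_space_def)
  note h' = cycD[OF h]
  obtain k where k: "lin_map A (obj S (p - 1)) (obj I q) k" "\<And>x. x \<in> carrier (obj S p) \<Longrightarrow> k (bd S p x) = h x"
    using extend[OF h'(1)] h'(3) by blast
  have kc: "k x \<in> carrier (obj I q)" if "x \<in> carrier (obj S (p - 1))" for x using lin_map_closed[OF k(1) that] .
  have "restrict (\<lambda>x. bd I q (k x)) (carrier (obj S (p - 1))) \<in> cyc (p - 1) (q - 1)"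
    using k(2) h'(2) kc by (intro cycI lin_map_comp[OF k(1) I'(2)]) (auto simp: I'(5))
  then show "\<exists>h'\<in>carrier (cyc_space (p - 1) (q - 1)). \<exists>k. lin_map A (obj S (p - 1)) (obj I q) k \<and>
      (\<forall>x\<in>carrier (obj S p). h x = k (bd S p x)) \<and> (\<forall>x\<in>carrier (obj S (p - 1)). h' x = bd I q (k x))"
    using k by (auto simp: cyc_space_def intro!: bexI[of _ "restrict (\<lambda>x. bd I q (k x)) (carrier (obj S (p - 1)))"] exI[of _ k])
next
  fix h assume "h \<in> carrier (cyc_space (p - 1) (q - 1))"
  then have h: "h \<in> cyc (p - 1) (q - 1)" by (simp add: cyc_space_def)
  note h' = cycD[OF h]
  have "\<exists>k. lin_map A (obj S (p - 1)) (obj I q) k \<and> (\<forall>x\<in>carrier (obj S (p - 1)). bd I q (k x) = h x)"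
    using lift[OF h'(1)] h'(2) by simp
  then obtain k where k: "lin_map A (obj S (p - 1)) (obj I q) k" "\<And>x. x \<in> carrier (obj S (p - 1)) \<Longrightarrow> bd I q (k x) = h x"
    by blast
  have "restrict (\<lambda>x. k (bd S p x)) (carrier (obj S p)) \<in> cyc p q"
    using k(2) h'(3) Sc S'(4) lin_map_zero[OF S'(1) I'(1) k(1)]
    by (intro cycI lin_map_comp[OF S'(2) k(1)]) auto
  then show "\<exists>h'\<in>carrier (cyc_space p q). \<exists>k. lin_map A (obj S (p - 1)) (obj I q) k \<and>
      (\<forall>x\<in>carrier (obj S p). h' x = k (bd S p x)) \<and> (\<forall>x\<in>carrier (obj S (p - 1)). h x = bd I q (k x))"
    using k by (auto simp: cyc_space_def intro!: bexI[of _ "restrict (\<lambda>x. k (bd S p x)) (carrier (obj S p))"] exI[of _ k])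
next
  fix y z y' z'
  assume "y \<in> carrier (cyc_space p q)" "z \<in> carrier (cyc_space p q)"
    "y' \<in> carrier (cyc_space (p - 1) (q - 1))" "z' \<in> carrier (cyc_space (p - 1) (q - 1))"
    and "\<exists>k. lin_map A (obj S (p - 1)) (obj I q) k \<and> (\<forall>x\<in>carrier (obj S p). y x = k (bd S p x)) \<and>
        (\<forall>x\<in>carrier (obj S (p - 1)). y' x = bd I q (k x))"
      "\<exists>k. lin_map A (obj S (p - 1)) (obj I q) k \<and> (\<forall>x\<in>carrier (obj S p). z x = k (bd S p x)) \<and>
        (\<forall>x\<in>carrier (obj S (p - 1)). z' x = bd I q (k x))"
  then obtain k l where k: "lin_map A (obj S (p - 1)) (obj I q) k" "\<And>x. x \<in> carrier (obj S p) \<Longrightarrow> y x = k (bd S p x)"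
      "\<And>x. x \<in> carrier (obj S (p - 1)) \<Longrightarrow> y' x = bd I q (k x)"
    and l: "lin_map A (obj S (p - 1)) (obj I q) l" "\<And>x. x \<in> carrier (obj S p) \<Longrightarrow> z x = l (bd S p x)"
      "\<And>x. x \<in> carrier (obj S (p - 1)) \<Longrightarrow> z' x = bd I q (l x)" by blast
  have c: "k x \<in> carrier (obj I q)" "l x \<in> carrier (obj I q)" if "x \<in> carrier (obj S (p - 1))" for x
    using lin_map_closed[OF k(1) that] lin_map_closed[OF l(1) that] .
  have "lin_map A (obj S (p - 1)) (obj I q) (\<lambda>x. k x \<oplus>\<^bsub>obj I q\<^esub> l x)"
    by (rule lin_map_add_fun[OF S'(1) I'(1) k(1) l(1)])
  then show "\<exists>k. lin_map A (obj S (p - 1)) (obj I q) k \<and>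
      (\<forall>x\<in>carrier (obj S p). (y \<oplus>\<^bsub>cyc_space p q\<^esub> z) x = k (bd S p x)) \<and>
      (\<forall>x\<in>carrier (obj S (p - 1)). (y' \<oplus>\<^bsub>cyc_space (p - 1) (q - 1)\<^esub> z') x = bd I q (k x))"
    using k(2,3) l(2,3) Sc c lin_map_add[OF I'(2)[of q]]
    by (intro exI[of _ "\<lambda>x. k x \<oplus>\<^bsub>obj I q\<^esub> l x"]) (auto simp: cyc_space_def)
next
  fix c z z'
  assume a: "c \<in> carrier K" "z \<in> carrier (cyc_space p q)" "z' \<in> carrier (cyc_space (p - 1) (q - 1))"
    "\<exists>k. lin_map A (obj S (p - 1)) (obj I q) k \<and> (\<forall>x\<in>carrier (obj S p). z x = k (bd S p x)) \<and>
        (\<forall>x\<in>carrier (obj S (p - 1)). z' x = bd I q (k x))"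
  then obtain l where l: "lin_map A (obj S (p - 1)) (obj I q) l" "\<And>x. x \<in> carrier (obj S p) \<Longrightarrow> z x = l (bd S p x)"
      "\<And>x. x \<in> carrier (obj S (p - 1)) \<Longrightarrow> z' x = bd I q (l x)" by blast
  have c: "l x \<in> carrier (obj I q)" if "x \<in> carrier (obj S (p - 1))" for x
    using lin_map_closed[OF l(1) that] .
  have "lin_map A (obj S (p - 1)) (obj I q) (\<lambda>x. scal A (obj I q) c (l x))"
    by (rule lin_map_scal_fun[OF S'(1) I'(1) l(1) a(1)])
  then show "\<exists>k. lin_map A (obj S (p - 1)) (obj I q) k \<and>
      (\<forall>x\<in>carrier (obj S p). (c \<odot>\<^bsub>cyc_space p q\<^esub> z) x = k (bd S p x)) \<and>
      (\<forall>x\<in>carrier (obj S (p - 1)). (c \<odot>\<^bsub>cyc_space (p - 1) (q - 1)\<^esub> z') x = bd I q (k x))"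
    using l(2,3) Sc c a(1) scal_lin_map[OF I'(2)[of q]]
    by (intro exI[of _ "\<lambda>x. scal A (obj I q) c (l x)"]) (auto simp: cyc_space_def)
next
  fix h h'
  assume a: "h \<in> carrier (cyc_space p q)" "h' \<in> carrier (cyc_space (p - 1) (q - 1))"
    "\<exists>k. lin_map A (obj S (p - 1)) (obj I q) k \<and> (\<forall>x\<in>carrier (obj S p). h x = k (bd S p x)) \<and>
        (\<forall>x\<in>carrier (obj S (p - 1)). h' x = bd I q (k x))"
  then obtain k where k: "lin_map A (obj S (p - 1)) (obj I q) k" "\<And>x. x \<in> carrier (obj S p) \<Longrightarrow> h x = k (bd S p x)"
      "\<And>x. x \<in> carrier (obj S (p - 1)) \<Longrightarrow> h' x = bd I q (k x)" by blast
  have hc: "h \<in> cyc p q" and hc': "h' \<in> cyc (p - 1) (q - 1)" using a by (auto simp: cyc_space_def)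
  have kc: "k x \<in> carrier (obj I q)" if "x \<in> carrier (obj S (p - 1))" for x using lin_map_closed[OF k(1) that] .
  interpret Iq: lmodule A "obj I q" by (rule I'(1))
  show "h \<in> bnd p q \<longleftrightarrow> h' \<in> bnd (p - 1) (q - 1)"
  proof
    assume "h \<in> bnd p q"
    then obtain l where l: "lin_map A (obj S (p - 1)) (obj I (q + 1)) l"
      "\<And>x. x \<in> carrier (obj S p) \<Longrightarrow> h x = bd I (q + 1) (l (bd S p x))"
      using bnd_iff[OF hc] by blast
    have lc: "l x \<in> carrier (obj I (q + 1))" if "x \<in> carrier (obj S (p - 1))" for x using lin_map_closed[OF l(1) that] .
    have dl: "lin_map A (obj S (p - 1)) (obj I q) (\<lambda>x. bd I (q + 1) (l x))" by (rule lin_map_comp[OF l(1) I'(3)])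
    \<comment> \<open>If \<open>h\<close> is a boundary through \<open>l\<close>, subtracting the
      differential of \<open>l\<close> from \<open>k\<close> leaves a map that kills the boundaries
      of \<open>S\<close> and hence extends one degree further. The correction does not affect
      \<open>h'\<close>, since two differentials of \<open>I\<close> compose to zero.\<close>
    define m where "m = (\<lambda>x. k x \<ominus>\<^bsub>obj I q\<^esub> bd I (q + 1) (l x))"
    have m: "lin_map A (obj S (p - 1)) (obj I q) m"
      unfolding m_def by (rule lin_map_diff_fun[OF S'(1) I'(1) k(1) dl])
    have "\<forall>x\<in>carrier (obj S (p - 1 + 1)). m (bd S (p - 1 + 1) x) = \<zero>\<^bsub>obj I q\<^esub>"
    proof
      fix x assume "x \<in> carrier (obj S (p - 1 + 1))"
      then have x: "x \<in> carrier (obj S p)" by simp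
      have "k (bd S p x) = bd I (q + 1) (l (bd S p x))" using k(2)[OF x] l(2)[OF x] by simp
      then show "m (bd S (p - 1 + 1) x) = \<zero>\<^bsub>obj I q\<^esub>"
        using Ic'[OF lc[OF Sc[OF x]]] Iq.diff_eq_zero by (simp add: m_def)
    qed
    then obtain m' where m': "lin_map A (obj S (p - 1 - 1)) (obj I q) m'"
      "\<And>x. x \<in> carrier (obj S (p - 1)) \<Longrightarrow> m' (bd S (p - 1) x) = m x"
      using extend[OF m] by blast
    have "h' x = bd I q (m' (bd S (p - 1) x))" if x: "x \<in> carrier (obj S (p - 1))" for x
    proof -
      interpret J: lmodule A "obj I (q - 1)" by (rule I'(1))
      have "bd I q (m x) = bd I q (k x) \<ominus>\<^bsub>obj I (q - 1)\<^esub> bd I q (bd I (q + 1) (l x))"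
        unfolding m_def using kc[OF x] Ic'[OF lc[OF x]] by (intro lin_map_diff[OF I'(1) I'(1) I'(2)])
      also have "\<dots> = bd I q (k x)" using I'(4)[OF lc[OF x]] Ic[OF kc[OF x]] by (simp add: a_minus_def)
      finally show ?thesis using m'(2)[OF x] k(3)[OF x] by simp
    qed
    then show "h' \<in> bnd (p - 1) (q - 1)" using bnd_iff[OF hc'] m'(1) by auto
  next
    assume "h' \<in> bnd (p - 1) (q - 1)"
    then obtain l where l: "lin_map A (obj S (p - 1 - 1)) (obj I q) l"
      "\<And>x. x \<in> carrier (obj S (p - 1)) \<Longrightarrow> h' x = bd I q (l (bd S (p - 1) x))"
      using bnd_iff[OF hc'] by auto
    have lc: "l x \<in> carrier (obj I q)" if "x \<in> carrier (obj S (p - 1 - 1))" for x using lin_map_closed[OF l(1) that] .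
    have ld: "lin_map A (obj S (p - 1)) (obj I q) (\<lambda>x. l (bd S (p - 1) x))" by (rule lin_map_comp[OF S'(2) l(1)])
    \<comment> \<open>The mirror image: removing from \<open>k\<close> the part that comes from
      degree p - 2 of \<open>S\<close> leaves a map into the cycles of \<open>I\<close>, which
      lifts. The removed part is invisible to \<open>h\<close>, since two differentials of
      \<open>S\<close> compose to zero.\<close>
    define m where "m = (\<lambda>x. k x \<ominus>\<^bsub>obj I q\<^esub> l (bd S (p - 1) x))"
    have m: "lin_map A (obj S (p - 1)) (obj I q) m"
      unfolding m_def by (rule lin_map_diff_fun[OF S'(1) I'(1) k(1) ld])
    have "\<forall>x\<in>carrier (obj S (p - 1)). bd I q (m x) = \<zero>\<^bsub>obj I (q - 1)\<^esub>"
    proof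
      fix x assume x: "x \<in> carrier (obj S (p - 1))"
      interpret J: lmodule A "obj I (q - 1)" by (rule I'(1))
      have "bd I q (m x) = bd I q (k x) \<ominus>\<^bsub>obj I (q - 1)\<^esub> bd I q (l (bd S (p - 1) x))"
        unfolding m_def using kc[OF x] lc[OF Sc[OF x]] by (intro lin_map_diff[OF I'(1) I'(1) I'(2)])
      also have "\<dots> = \<zero>\<^bsub>obj I (q - 1)\<^esub>"
        using k(3)[OF x] l(2)[OF x] Ic[OF kc[OF x]] J.diff_eq_zero by simp
      finally show "bd I q (m x) = \<zero>\<^bsub>obj I (q - 1)\<^esub>" .
    qed
    then obtain m' where m': "lin_map A (obj S (p - 1)) (obj I (q + 1)) m'"
      "\<And>x. x \<in> carrier (obj S (p - 1)) \<Longrightarrow> bd I (q + 1) (m' x) = m x"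
      using lift[OF m] by blast
    have "h x = bd I (q + 1) (m' (bd S p x))" if x: "x \<in> carrier (obj S p)" for x
    proof -
      have "bd S (p - 1) (bd S p x) = \<zero>\<^bsub>obj S (p - 1 - 1)\<^esub>" using S'(5)[OF x] by simp
      then have "l (bd S (p - 1) (bd S p x)) = \<zero>\<^bsub>obj I q\<^esub>" using lin_map_zero[OF S'(1) I'(1) l(1)] by simp
      then show ?thesis using m'(2)[OF Sc[OF x]] k(2)[OF x] kc[OF Sc[OF x]] by (simp add: m_def a_minus_def)
    qed
    then show "h \<in> bnd p q" using bnd_iff[OF hc] m'(1) by auto
  qed
qed

lemma diag_shift: "isomorphic K (diag p q) (diag (p - int n) (q - int n))"
proof (induction n)
  case 0
  have "lin_iso K (diag p q) (diag p q) (\<lambda>x. x)" by (auto simp: lin_iso_def lin_map_def bij_betw_def)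
  then show ?case by (auto simp: isomorphic_def)
next
  case (Suc n)
  have "isomorphic K (diag (p - int n) (q - int n)) (diag (p - int (Suc n)) (q - int (Suc n)))"
    using diag_step[of "p - int n" "q - int n"] by (simp add: algebra_simps)
  then show ?case by (rule isomorphic_trans[OF Suc])
qed

text \<open>Downward shifts iterate \<open>diag_step\<close>; upward shifts are inverse to downward
  ones.\<close>

lemma diag_invariant: "isomorphic K (diag p q) (diag (p + m) (q + m))"
proof (cases "m \<le> 0")
  case True
  then show ?thesis using diag_shift[of p q "nat (- m)"] by simp
next
  case False
  have lm: "lmodule K (diag i j)" for i j
    unfolding diag_def by (rule lmodule_quot[OF lmodule_cyc_space bnd_submodule])
  have "isomorphic K (diag (p + m) (q + m)) (diag p q)"
    using False diag_shift[of "p + m" "q + m" "nat m"] by simp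
  then show ?thesis by (rule isomorphic_sym[OF lm lm])
qed

text \<open>Here \<open>e\<close> is an augmentation of \<open>S\<close>, linear up to the twist \<open>r\<close>.\<close>

context
  fixes N :: "('g, 'n) module" and J :: "('g, 'i) cplx" and r :: "'g \<Rightarrow> 'g" and e :: "'s \<Rightarrow> 'n"
  assumes N: "lmodule A N" and J: "chain_complex A J" and IJ: "I = ctwist r J"
    and r: "r \<in> ring_hom A A" "\<And>a. a \<in> carrier A \<Longrightarrow> \<exists>b\<in>carrier A. r b = a"
    and e: "\<And>x. x \<in> carrier (obj S 0) \<Longrightarrow> e x \<in> carrier N"
      "\<And>x y. \<lbrakk>x \<in> carrier (obj S 0); y \<in> carrier (obj S 0)\<rbrakk> \<Longrightarrow> e (x \<oplus>\<^bsub>obj S 0\<^esub> y) = e x \<oplus>\<^bsub>N\<^esub> e y"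
      "\<And>a x. \<lbrakk>a \<in> carrier A; x \<in> carrier (obj S 0)\<rbrakk> \<Longrightarrow> e (a \<odot>\<^bsub>obj S 0\<^esub> x) = r a \<odot>\<^bsub>N\<^esub> e x"
      "e ` carrier (obj S 0) = carrier N"
      "\<And>x. x \<in> carrier (obj S 0) \<Longrightarrow> e x = \<zero>\<^bsub>N\<^esub> \<longleftrightarrow> x \<in> bd S 1 ` carrier (obj S 1)"
begin

interpretation N: lmodule A N by (rule N)

lemma I_J: "carrier (obj I q) = carrier (obj J q)" "zero (obj I q) = zero (obj J q)" "add (obj I q) = add (obj J q)"
  "a \<odot>\<^bsub>obj I q\<^esub> x = r a \<odot>\<^bsub>obj J q\<^esub> x" "bd I = bd J"
  by (simp_all add: IJ)

lemma e_lin: "lin_map A (obj S 0) (rtwist r N) e"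
  using e by (intro lin_mapI) auto

lemma e_bd: "x \<in> carrier (obj S 1) \<Longrightarrow> e (bd S 1 x) = \<zero>\<^bsub>N\<^esub>"
  using e(5)[of "bd S 1 x"] lin_map_closed[OF S'(2)[of 1], of x] by auto

lemma left_pull: "lin_map A N (obj J q) g \<Longrightarrow> lin_map A (obj S 0) (obj I q) (\<lambda>x. g (e x))"
  using lin_map_comp[OF e_lin lin_map_rtwist[OF _ r(1)]] by (simp add: IJ)

text \<open>By exactness at degree 0, \<open>h x\<close> depends only on \<open>e x\<close>. As
  \<open>e\<close> is linear only up to \<open>r\<close>, compatibility of the factor with a scalar
  \<open>a\<close> is tested on a preimage of \<open>a\<close> under \<open>r\<close>.\<close>

lemma left_factor:
  assumes h: "lin_map A (obj S 0) (obj I q) h" and z: "\<And>x. x \<in> carrier (obj S 1) \<Longrightarrow> h (bd S 1 x) = \<zero>\<^bsub>obj I q\<^esub>"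
  shows "\<exists>g. lin_map A N (obj J q) g \<and> (\<forall>x\<in>carrier (obj S 0). g (e x) = h x)"
proof -
  interpret S0: lmodule A "obj S 0" by (rule S'(1))
  interpret Iq: lmodule A "obj I q" by (rule I'(1))
  have wd: "h x = h y" if "x \<in> carrier (obj S 0)" "y \<in> carrier (obj S 0)" "e x = e y" for x y
  proof -
    have "e (x \<ominus>\<^bsub>obj S 0\<^esub> y) = e x \<ominus>\<^bsub>N\<^esub> e y"
      using lin_map_diff[OF S'(1) N.lmodule_rtwist[OF r(1)] e_lin that(1,2)] by (simp add: a_minus_def)
    then have "e (x \<ominus>\<^bsub>obj S 0\<^esub> y) = \<zero>\<^bsub>N\<^esub>" using that e(1) N.diff_eq_zero by simp
    then have "h (x \<ominus>\<^bsub>obj S 0\<^esub> y) = \<zero>\<^bsub>obj I q\<^esub>" using e(5) that z by auto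
    then have "h x \<ominus>\<^bsub>obj I q\<^esub> h y = \<zero>\<^bsub>obj I q\<^esub>" using lin_map_diff[OF S'(1) I'(1) h that(1,2)] by simp
    then show ?thesis using Iq.diff_eq_zero lin_map_closed[OF h] that by simp
  qed
  define g where "g = (\<lambda>n. h (inv_into (carrier (obj S 0)) e n))"
  have sec: "inv_into (carrier (obj S 0)) e n \<in> carrier (obj S 0)" "e (inv_into (carrier (obj S 0)) e n) = n"
    if "n \<in> carrier N" for n
    using that e(4) by (auto intro: inv_into_into f_inv_into_f)
  have ge: "g (e x) = h x" if "x \<in> carrier (obj S 0)" for x
    unfolding g_def using that sec[OF e(1)[OF that]] by (intro wd) auto
  have surj: "\<exists>x\<in>carrier (obj S 0). n = e x" if "n \<in> carrier N" for n using that e(4) by auto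
  have "lin_map A N (obj J q) g"
  proof (rule lin_mapI)
    fix n assume "n \<in> carrier N"
    then obtain x where "x \<in> carrier (obj S 0)" "n = e x" using surj by metis
    then show "g n \<in> carrier (obj J q)" using ge lin_map_closed[OF h] I_J(1) by simp
  next
    fix n n' assume "n \<in> carrier N" "n' \<in> carrier N"
    then obtain x y where x: "x \<in> carrier (obj S 0)" "n = e x" "y \<in> carrier (obj S 0)" "n' = e y"
      using surj by metis
    have "g (n \<oplus>\<^bsub>N\<^esub> n') = g (e (x \<oplus>\<^bsub>obj S 0\<^esub> y))" using x e(2) by simp
    also have "\<dots> = h x \<oplus>\<^bsub>obj I q\<^esub> h y" using x ge lin_map_add[OF h] by simp
    finally show "g (n \<oplus>\<^bsub>N\<^esub> n') = g n \<oplus>\<^bsub>obj J q\<^esub> g n'" using x ge I_J by simp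
  next
    fix a n assume "a \<in> carrier A" "n \<in> carrier N"
    then obtain b x where b: "b \<in> carrier A" "r b = a" and x: "x \<in> carrier (obj S 0)" "n = e x"
      using surj r(2) by metis
    have "g (a \<odot>\<^bsub>N\<^esub> n) = g (e (b \<odot>\<^bsub>obj S 0\<^esub> x))" using x b e(3) by simp
    also have "\<dots> = b \<odot>\<^bsub>obj I q\<^esub> h x" using x b ge lin_map_smult[OF h] by simp
    finally show "g (a \<odot>\<^bsub>N\<^esub> n) = a \<odot>\<^bsub>obj J q\<^esub> g n" using x b ge I_J by simp
  qed
  with ge show ?thesis by blast
qed

text \<open>A map out of degree 0 of \<open>S\<close> that kills boundaries is the same as a map out
  of \<open>N\<close>, by composition with \<open>e\<close>. The hypothesis \<open>rK\<close> keeps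
  the twist from disturbing the scalars of the ground field.\<close>

lemma diag_left_edge:
  assumes rK: "\<And>c. c \<in> carrier K \<Longrightarrow> r (c \<odot>\<^bsub>A\<^esub> \<one>\<^bsub>A\<^esub>) = c \<odot>\<^bsub>A\<^esub> \<one>\<^bsub>A\<^esub>"
  shows "isomorphic K (homology (hom_space A N (obj J (n + 1))) (compose (carrier N) (bd J (n + 1)))
      (hom_space A N (obj J n)) (compose (carrier N) (bd J n)) (hom_space A N (obj J (n - 1)))) (diag 0 n)"
proof -
  note J' = chain_complexD[OF J]
  let ?V = "hom_space A N (obj J n)"
  let ?Z = "a_kernel ?V (hom_space A N (obj J (n - 1))) (compose (carrier N) (bd J n))"
  have post: "lin_map K (hom_space A N (obj J (n + 1))) ?V (compose (carrier N) (bd J (n + 1)))"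
    "lin_map K ?V (hom_space A N (obj J (n - 1))) (compose (carrier N) (bd J n))"
    by (rule lin_map_hom_post[OF N J'(3)], rule lin_map_hom_post[OF N J'(2)])
  have dd: "\<forall>u\<in>carrier (hom_space A N (obj J (n + 1))).
      compose (carrier N) (bd J n) (compose (carrier N) (bd J (n + 1)) u) = \<zero>\<^bsub>hom_space A N (obj J (n - 1))\<^esub>"
  proof
    fix u assume "u \<in> carrier (hom_space A N (obj J (n + 1)))"
    then have u: "u y \<in> carrier (obj J (n + 1))" if "y \<in> carrier N" for y
      using lin_map_closed[of A N "obj J (n + 1)" u y] that by simp
    show "compose (carrier N) (bd J n) (compose (carrier N) (bd J (n + 1)) u) = \<zero>\<^bsub>hom_space A N (obj J (n - 1))\<^esub>"
      unfolding compose_def using u J'(4) by (simp cong: restrict_cong)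
  qed
  have lV: "lmodule K (hom_space A N (obj J q))" for q by (rule lmodule_hom_space[OF J'(1) N])
  note H = homology_submodules[where f = "compose (carrier N) (bd J (n + 1))" and g = "compose (carrier N) (bd J n)",
      OF lV[of "n + 1"] lV[of n] lV[of "n - 1"] post dd]
  have Z: "g \<in> ?Z \<longleftrightarrow> g \<in> extensional (carrier N) \<and> lin_map A N (obj J n) g \<and>
      (\<forall>x\<in>carrier N. bd J n (g x) = \<zero>\<^bsub>obj J (n - 1)\<^esub>)" for g
    by (auto simp: a_kernel_def' compose_def fun_eq_iff restrict_def)
  show ?thesis
    unfolding homology_def diag_def
  proof (rule corr_isomorphic[OF H(2) lmodule_cyc_space H(3) bnd_submodule, where
        rel = "\<lambda>g h. \<forall>x\<in>carrier (obj S 0). h x = g (e x)"])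
    fix g assume "g \<in> carrier (?V\<lparr>carrier := ?Z\<rparr>)"
    then have g: "lin_map A N (obj J n) g" "\<And>x. x \<in> carrier N \<Longrightarrow> bd J n (g x) = \<zero>\<^bsub>obj J (n - 1)\<^esub>"
      using Z by auto
    have "restrict (\<lambda>x. g (e x)) (carrier (obj S 0)) \<in> cyc 0 n"
      using g(2) e(1) e_bd lin_map_zero[OF N J'(1) g(1)] by (intro cycI left_pull[OF g(1)]) (auto simp: I_J)
    then show "\<exists>h\<in>carrier (cyc_space 0 n). \<forall>x\<in>carrier (obj S 0). h x = g (e x)"
      by (intro bexI[of _ "restrict (\<lambda>x. g (e x)) (carrier (obj S 0))"]) (auto simp: cyc_space_def)
  next
    fix h assume "h \<in> carrier (cyc_space 0 n)"
    then have h: "h \<in> cyc 0 n" by (simp add: cyc_space_def)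
    obtain g where g: "lin_map A N (obj J n) g" "\<And>x. x \<in> carrier (obj S 0) \<Longrightarrow> g (e x) = h x"
      using left_factor[OF cycD(1)[OF h]] cycD(3)[OF h] by auto
    have "bd J n (g y) = \<zero>\<^bsub>obj J (n - 1)\<^esub>" if y: "y \<in> carrier N" for y
    proof -
      obtain x where "x \<in> carrier (obj S 0)" "y = e x" using y e(4) by auto
      then show ?thesis using g(2) cycD(2)[OF h] by (simp add: I_J)
    qed
    then have "restrict g (carrier N) \<in> ?Z" using hom_spaceI[OF N g(1)] by (simp add: Z)
    then show "\<exists>g\<in>carrier (?V\<lparr>carrier := ?Z\<rparr>). \<forall>x\<in>carrier (obj S 0). h x = g (e x)"
      using g(2) e(1) by (intro bexI[of _ "restrict g (carrier N)"]) auto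
  next
    fix g h :: "'n \<Rightarrow> 'i" and g' h' :: "'s \<Rightarrow> 'i"
    assume "\<forall>x\<in>carrier (obj S 0). g' x = g (e x)" "\<forall>x\<in>carrier (obj S 0). h' x = h (e x)"
    then show "\<forall>x\<in>carrier (obj S 0). (g' \<oplus>\<^bsub>cyc_space 0 n\<^esub> h') x = (g \<oplus>\<^bsub>?V\<lparr>carrier := ?Z\<rparr>\<^esub> h) (e x)"
      using e(1) by (simp add: cyc_space_def I_J)
  next
    fix c and g :: "'n \<Rightarrow> 'i" and g' :: "'s \<Rightarrow> 'i"
    assume "c \<in> carrier K" "\<forall>x\<in>carrier (obj S 0). g' x = g (e x)"
    then show "\<forall>x\<in>carrier (obj S 0). (c \<odot>\<^bsub>cyc_space 0 n\<^esub> g') x = (c \<odot>\<^bsub>?V\<lparr>carrier := ?Z\<rparr>\<^esub> g) (e x)"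
      using e(1) rK by (simp add: cyc_space_def scal_def I_J)
  next
    fix g h assume a: "g \<in> carrier (?V\<lparr>carrier := ?Z\<rparr>)" "h \<in> carrier (cyc_space 0 n)"
      "\<forall>x\<in>carrier (obj S 0). h x = g (e x)"
    have h: "h \<in> cyc 0 n" using a by (simp add: cyc_space_def)
    show "g \<in> compose (carrier N) (bd J (n + 1)) ` carrier (hom_space A N (obj J (n + 1))) \<longleftrightarrow> h \<in> bnd 0 n"
    proof
      assume "g \<in> compose (carrier N) (bd J (n + 1)) ` carrier (hom_space A N (obj J (n + 1)))"
      then obtain g' where g': "lin_map A N (obj J (n + 1)) g'" "g = compose (carrier N) (bd J (n + 1)) g'" by auto
      \<comment> \<open>A primitive of \<open>g\<close>, composed with \<open>e\<close>, kills the
        boundaries from degree 1 and so extends along the differential out of degree 0; this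
        exhibits \<open>h\<close> as an image of both differentials.\<close>
      have "\<forall>x\<in>carrier (obj S (0 + 1)). g' (e (bd S (0 + 1) x)) = \<zero>\<^bsub>obj I (n + 1)\<^esub>"
        using e_bd lin_map_zero[OF N J'(1) g'(1)] by (simp add: I_J)
      then obtain k where k: "lin_map A (obj S (0 - 1)) (obj I (n + 1)) k"
        "\<And>x. x \<in> carrier (obj S 0) \<Longrightarrow> k (bd S 0 x) = g' (e x)"
        using extend[OF left_pull[OF g'(1)]] by blast
      have "h x = bd I (n + 1) (k (bd S 0 x))" if "x \<in> carrier (obj S 0)" for x
        using a(3) that k(2) g'(2) e(1) by (simp add: compose_def I_J)
      then show "h \<in> bnd 0 n" using bnd_iff[OF h] k(1) by auto
    next
      assume "h \<in> bnd 0 n"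
      then obtain k where k: "lin_map A (obj S (0 - 1)) (obj I (n + 1)) k"
        "\<And>x. x \<in> carrier (obj S 0) \<Longrightarrow> h x = bd I (n + 1) (k (bd S 0 x))"
        using bnd_iff[OF h] by auto
      \<comment> \<open>In the other direction, \<open>k\<close> after the differential of
        \<open>S\<close> kills the boundaries from degree 1 and hence descends along
        \<open>e\<close> to a primitive of \<open>g\<close>.\<close>
      have "k (bd S 0 (bd S 1 x)) = \<zero>\<^bsub>obj I (n + 1)\<^esub>" if "x \<in> carrier (obj S 1)" for x
        using S'(4)[of x 0] that lin_map_zero[OF S'(1) I'(1) k(1)] by simp
      then obtain g' where g': "lin_map A N (obj J (n + 1)) g'" "\<And>x. x \<in> carrier (obj S 0) \<Longrightarrow> g' (e x) = k (bd S 0 x)"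
        using left_factor[OF lin_map_comp[OF S'(2) k(1)]] by blast
      have "g y = bd J (n + 1) (g' y)" if y: "y \<in> carrier N" for y
      proof -
        obtain x where "x \<in> carrier (obj S 0)" "y = e x" using y e(4) by auto
        then show ?thesis using g'(2) k(2) a(3) by (simp add: I_J)
      qed
      then have "g = compose (carrier N) (bd J (n + 1)) (restrict g' (carrier N))"
        using a(1) Z by (intro extensionalityI[of _ "carrier N"]) (auto simp: compose_def)
      then show "g \<in> compose (carrier N) (bd J (n + 1)) ` carrier (hom_space A N (obj J (n + 1)))"
        using hom_spaceI[OF N g'(1)] by (rule image_eqI)
    qed
  qed
qed

end

text \<open>\<open>X\<close> is placed in the bicomplex as the kernel of the differential that
  leaves degree q of \<open>I\<close>, so cocycles with values in \<open>X\<close> are maps to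
  \<open>I\<close> killed by both differentials. Boundaries are compared by lifting along the
  differential that enters degree q.\<close>

lemma diag_right_edge:
  fixes X :: "('g, 'x) module"
  assumes X: "lmodule A X" and i: "lin_map A X (obj I q) i" "inj_on i (carrier X)"
    and im: "\<And>x. x \<in> carrier X \<Longrightarrow> bd I q (i x) = \<zero>\<^bsub>obj I (q - 1)\<^esub>"
      "\<And>y. \<lbrakk>y \<in> carrier (obj I q); bd I q y = \<zero>\<^bsub>obj I (q - 1)\<^esub>\<rbrakk> \<Longrightarrow> \<exists>x\<in>carrier X. i x = y"
  shows "isomorphic K (tate_Ext A m S X) (diag m q)"
proof -
  interpret X: lmodule A X by (rule X)
  have inj: "x = y" if "i x = i y" "x \<in> carrier X" "y \<in> carrier X" for x y
    using that i(2) by (auto simp: inj_on_def)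
  \<comment> \<open>Values in the kernel have unique preimages under \<open>i\<close>, so linearity
    of the factor is inherited through injectivity.\<close>
  have factor: "\<exists>f. lin_map A (obj S p) X f \<and> (\<forall>x\<in>carrier (obj S p). i (f x) = h x)"
    if h: "lin_map A (obj S p) (obj I q) h" and z: "\<And>x. x \<in> carrier (obj S p) \<Longrightarrow> bd I q (h x) = \<zero>\<^bsub>obj I (q - 1)\<^esub>" for p h
  proof -
    interpret Sp: lmodule A "obj S p" by (rule S'(1))
    have "\<exists>y. y \<in> carrier X \<and> i y = h x" if "x \<in> carrier (obj S p)" for x
      using im(2)[OF lin_map_closed[OF h that] z[OF that]] by blast
    then obtain f where f: "\<And>x. x \<in> carrier (obj S p) \<Longrightarrow> f x \<in> carrier X" "\<And>x. x \<in> carrier (obj S p) \<Longrightarrow> i (f x) = h x"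
      by metis
    have "lin_map A (obj S p) X f"
      by (rule lin_mapI; (rule inj)?)
        (auto simp: f lin_map_add[OF h] lin_map_smult[OF h] lin_map_add[OF i(1)] lin_map_smult[OF i(1)])
    with f show ?thesis by blast
  qed
  let ?V = "hom_space A (obj S m) X"
  let ?Z = "a_kernel ?V (hom_space A (obj S (m + 1)) X) (hom_cobd S m)"
  have lV: "lmodule K (hom_space A (obj S p) X)" for p by (rule lmodule_hom_space[OF X S'(1)])
  note H = homology_submodules[where f = "hom_cobd S (m - 1)" and g = "hom_cobd S m", OF lV[of "m - 1"] lV[of m] lV[of "m + 1"] tate_Ext_complex(2)[OF S X, of m]
      tate_Ext_complex(1)[OF S X, of m] tate_Ext_complex(3)[OF S X, of m]]
  have Z: "g \<in> ?Z \<longleftrightarrow> g \<in> extensional (carrier (obj S m)) \<and> lin_map A (obj S m) X g \<and>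
      (\<forall>x\<in>carrier (obj S (m + 1)). g (bd S (m + 1) x) = \<zero>\<^bsub>X\<^esub>)" for g
    by (auto simp: a_kernel_def' compose_def fun_eq_iff restrict_def hom_cobd_def)
  have i0: "i \<zero>\<^bsub>X\<^esub> = \<zero>\<^bsub>obj I q\<^esub>" by (rule lin_map_zero[OF X I'(1) i(1)])
  show ?thesis
    unfolding tate_Ext_def homology_def diag_def hom_obj_def
  proof (rule corr_isomorphic[OF H(2) lmodule_cyc_space H(3) bnd_submodule, where
        rel = "\<lambda>f h. \<forall>x\<in>carrier (obj S m). h x = i (f x)"])
    fix f assume "f \<in> carrier (?V\<lparr>carrier := ?Z\<rparr>)"
    then have f: "lin_map A (obj S m) X f" "\<And>x. x \<in> carrier (obj S (m + 1)) \<Longrightarrow> f (bd S (m + 1) x) = \<zero>\<^bsub>X\<^esub>"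
      using Z by auto
    have "restrict (\<lambda>x. i (f x)) (carrier (obj S m)) \<in> cyc m q"
      using f(2) i0 im(1)[OF lin_map_closed[OF f(1)]] by (intro cycI lin_map_comp[OF f(1) i(1)]) auto
    then show "\<exists>h\<in>carrier (cyc_space m q). \<forall>x\<in>carrier (obj S m). h x = i (f x)"
      by (intro bexI[of _ "restrict (\<lambda>x. i (f x)) (carrier (obj S m))"]) (auto simp: cyc_space_def)
  next
    fix h assume "h \<in> carrier (cyc_space m q)"
    then have h: "h \<in> cyc m q" by (simp add: cyc_space_def)
    obtain f where f: "lin_map A (obj S m) X f" "\<And>x. x \<in> carrier (obj S m) \<Longrightarrow> i (f x) = h x"
      using factor[OF cycD(1,2)[OF h]] by blast
    have "f (bd S (m + 1) x) = \<zero>\<^bsub>X\<^esub>" if "x \<in> carrier (obj S (m + 1))" for x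
      using f(2)[OF Sc'[OF that]] cycD(3)[OF h that] i0 lin_map_closed[OF f(1) Sc'[OF that]]
      by (intro inj) auto
    then have "restrict f (carrier (obj S m)) \<in> ?Z" using hom_spaceI[OF S'(1) f(1)] Sc' by (simp add: Z)
    then show "\<exists>f\<in>carrier (?V\<lparr>carrier := ?Z\<rparr>). \<forall>x\<in>carrier (obj S m). h x = i (f x)"
      using f(2) by (intro bexI[of _ "restrict f (carrier (obj S m))"]) auto
  next
    fix g h g' h'
    assume "g \<in> carrier (?V\<lparr>carrier := ?Z\<rparr>)" "h \<in> carrier (?V\<lparr>carrier := ?Z\<rparr>)"
      "\<forall>x\<in>carrier (obj S m). g' x = i (g x)" "\<forall>x\<in>carrier (obj S m). h' x = i (h x)"
    then show "\<forall>x\<in>carrier (obj S m). (g' \<oplus>\<^bsub>cyc_space m q\<^esub> h') x = i ((g \<oplus>\<^bsub>?V\<lparr>carrier := ?Z\<rparr>\<^esub> h) x)"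
      using lin_map_add[OF i(1)] lin_map_closed[of A "obj S m" X] by (auto simp: cyc_space_def Z)
  next
    fix c g g' assume "c \<in> carrier K" "g \<in> carrier (?V\<lparr>carrier := ?Z\<rparr>)" "\<forall>x\<in>carrier (obj S m). g' x = i (g x)"
    then show "\<forall>x\<in>carrier (obj S m). (c \<odot>\<^bsub>cyc_space m q\<^esub> g') x = i ((c \<odot>\<^bsub>?V\<lparr>carrier := ?Z\<rparr>\<^esub> g) x)"
      using scal_lin_map[OF i(1)] lin_map_closed[of A "obj S m" X] by (auto simp: cyc_space_def Z)
  next
    fix f h assume a: "f \<in> carrier (?V\<lparr>carrier := ?Z\<rparr>)" "h \<in> carrier (cyc_space m q)"
      "\<forall>x\<in>carrier (obj S m). h x = i (f x)"
    have h: "h \<in> cyc m q" using a by (simp add: cyc_space_def)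
    have fl: "lin_map A (obj S m) X f" "f \<in> extensional (carrier (obj S m))" using a(1) Z by auto
    show "f \<in> hom_cobd S (m - 1) ` carrier (hom_space A (obj S (m - 1)) X) \<longleftrightarrow> h \<in> bnd m q"
    proof
      assume "f \<in> hom_cobd S (m - 1) ` carrier (hom_space A (obj S (m - 1)) X)"
      then obtain f' where f': "lin_map A (obj S (m - 1)) X f'" "f = hom_cobd S (m - 1) f'" by auto
      have "\<forall>x\<in>carrier (obj S (m - 1)). bd I q (i (f' x)) = \<zero>\<^bsub>obj I (q - 1)\<^esub>"
        using im(1) lin_map_closed[OF f'(1)] by blast
      then obtain k where k: "lin_map A (obj S (m - 1)) (obj I (q + 1)) k"
        "\<And>x. x \<in> carrier (obj S (m - 1)) \<Longrightarrow> bd I (q + 1) (k x) = i (f' x)"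
        using lift[OF lin_map_comp[OF f'(1) i(1)]] by blast
      have "h x = bd I (q + 1) (k (bd S m x))" if "x \<in> carrier (obj S m)" for x
        using a(3) that k(2) f'(2) Sc by (simp add: compose_def hom_cobd_def)
      then show "h \<in> bnd m q" using bnd_iff[OF h] k(1) by auto
    next
      assume "h \<in> bnd m q"
      then obtain k where k: "lin_map A (obj S (m - 1)) (obj I (q + 1)) k"
        "\<And>x. x \<in> carrier (obj S m) \<Longrightarrow> h x = bd I (q + 1) (k (bd S m x))"
        using bnd_iff[OF h] by auto
      have "bd I q (bd I (q + 1) (k x)) = \<zero>\<^bsub>obj I (q - 1)\<^esub>" if "x \<in> carrier (obj S (m - 1))" for x
        using I'(4)[OF lin_map_closed[OF k(1) that]] .
      then obtain f' where f': "lin_map A (obj S (m - 1)) X f'" "\<And>x. x \<in> carrier (obj S (m - 1)) \<Longrightarrow> i (f' x) = bd I (q + 1) (k x)"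
        using factor[OF lin_map_comp[OF k(1) I'(3)]] by blast
      have "f x = f' (bd S m x)" if "x \<in> carrier (obj S m)" for x
        using f'(2)[OF Sc[OF that]] k(2)[OF that] a(3) that lin_map_closed[OF fl(1) that] lin_map_closed[OF f'(1) Sc[OF that]]
        by (intro inj) auto
      then have "f = hom_cobd S (m - 1) (restrict f' (carrier (obj S (m - 1))))"
        using fl(2) Sc by (intro extensionalityI[of _ "carrier (obj S m)"]) (auto simp: compose_def hom_cobd_def)
      then show "f \<in> hom_cobd S (m - 1) ` carrier (hom_space A (obj S (m - 1)) X)"
        using hom_spaceI[OF S'(1) f'(1)] by (rule image_eqI)
    qed
  qed
qed

end

subsection \<open>Tate duality\<close>

text \<open>The automorphism \<open>r\<close> is carried along because \<open>S\<close> may resolve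
  a twist of \<open>N\<close> rather than \<open>N\<close> itself; with \<open>r\<close> the
  identity this is the usual duality. In the statement on homology, \<open>r\<close> absorbs the
  twist of the dual bimodule, at the price of twisting \<open>M\<close> by \<mu> after
  \<open>r\<close>.\<close>

theorem (in frobenius_form) tate_duality:
  fixes T :: "('g, 't) cplx" and S :: "('g, 's) cplx" and M :: "('g, 'm) module" and N :: "('g, 'n) module"
    and N' :: "('g, 'p) module" and X :: "('g, 'x) module"
  assumes M: "lmodule A M" and N: "lmodule A N" and N': "lmodule A N'" and X: "lmodule A X"
    and fN: "fin_gen K (kmod A N)"
    and T: "complete_resolution A M T" and S: "complete_resolution A N' S"
    and r: "algebra_aut K A r"
    and \<alpha>: "lin_iso A N' (rtwist r N) \<alpha>"
    and \<beta>: "lin_iso A X (rtwist (\<lambda>a. \<mu> (r a)) M) \<beta>"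
  shows "isomorphic K (tate_Ext A n T N) (tate_Ext A (- (n + 1)) S X)"
proof -
  have CT: "chain_complex A T" and CS: "chain_complex A S"
    using T S by (auto simp: complete_resolution_def)
  obtain IT :: "int \<Rightarrow> 't set" and xT fT where bT: "\<And>n. proj_basis A (obj T n) (IT n) (xT n) (fT n)"
    by (rule complete_resolution_bases[OF T]) (rule that)
  obtain IS :: "int \<Rightarrow> 's set" and xS fS where bS: "\<And>n. proj_basis A (obj S n) (IS n) (xS n) (fS n)"
    by (rule complete_resolution_bases[OF S]) (rule that)
  define J where "J = ctwist \<mu> T"
  \<comment> \<open>The twist by \<open>r\<close> matches the one that relates \<open>N'\<close> to
    \<open>N\<close>: linear maps from \<open>S\<close> into \<open>I\<close> are the maps into
    \<open>J\<close> that are semilinear over \<open>r\<close>.\<close>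
  define I where "I = ctwist r J"
  note hr = aut_hom[OF r] and h\<mu> = aut_hom[OF \<mu>]
  have CJ: "chain_complex A J" unfolding J_def by (rule chain_complex_ctwist[OF CT h\<mu>])
  have CI: "chain_complex A I" unfolding I_def by (rule chain_complex_ctwist[OF CJ hr])
  \<comment> \<open>A twist keeps the generators; the coordinates are corrected by the inverses of
    both automorphisms.\<close>
  have bI: "\<exists>f. proj_basis A (obj I q) (IT q) (xT q) f" for q
    unfolding I_def J_def ctwist_simps
    using proj_basis_rtwist[OF _ proj_basis_rtwist[OF _ bT h\<mu> aut_inv_hom[OF \<mu>] aut_inv[OF \<mu>]] hr aut_inv_hom[OF r] aut_inv[OF r]]
      chain_complexD(1)[OF CT] chain_complexD(1)[OF CJ] unfolding J_def by fastforce
  interpret EB: exact_bicomplex K A S I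
  proof
    fix p q h assume h: "lin_map A (obj S p) (obj I q) h" "\<forall>x\<in>carrier (obj S p). bd I q (h x) = \<zero>\<^bsub>obj I (q - 1)\<^esub>"
    show "\<exists>k. lin_map A (obj S p) (obj I (q + 1)) k \<and> (\<forall>x\<in>carrier (obj S p). bd I (q + 1) (k x) = h x)"
    proof (rule proj_lift[OF chain_complexD(1)[OF CS] chain_complexD(1)[OF CI] chain_complexD(1)[OF CI] bS
          chain_complexD(3)[OF CI] h(1)], rule ballI)
      fix x assume x: "x \<in> carrier (obj S p)"
      have "h x \<in> carrier (obj T q)" using lin_map_closed[OF h(1) x] by (simp add: I_def J_def)
      then show "\<exists>m\<in>carrier (obj I (q + 1)). bd I (q + 1) m = h x"
        using complete_resolution_exact[OF T, of "h x" q] h(2) x by (simp add: I_def J_def)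
    qed
  next
    fix p q h assume h: "lin_map A (obj S p) (obj I q) h" "\<forall>x\<in>carrier (obj S (p + 1)). h (bd S (p + 1) x) = \<zero>\<^bsub>obj I q\<^esub>"
    \<comment> \<open>Exactness in the first variable comes from acyclicity of
      \<open>Hom(S, A)\<close>, transported by \<open>proj_extend\<close> to the projective module
      in degree q of \<open>I\<close>.\<close>
    obtain f where f: "proj_basis A (obj I q) (IT q) (xT q) f" using bI by blast
    show "\<exists>k. lin_map A (obj S (p - 1)) (obj I q) k \<and> (\<forall>x\<in>carrier (obj S p). k (bd S p x) = h x)"
    proof (rule proj_extend[OF chain_complexD(1)[OF CI] chain_complexD(1)[OF CS] chain_complexD(1)[OF CS] f
          chain_complexD(2)[OF CS] h(1)])
      fix g assume g: "lin_map A (obj I q) (self_module A) g"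
      have "g \<zero>\<^bsub>obj I q\<^esub> = \<zero>\<^bsub>A\<^esub>" using lin_map_zero[OF chain_complexD(1)[OF CI] lmodule_self g] by simp
      then show "\<exists>k. lin_map A (obj S (p - 1)) (self_module A) k \<and> (\<forall>m\<in>carrier (obj S p). k (bd S p m) = g (h m))"
        using complete_resolution_extend[OF S lin_map_comp[OF h(1) g]] h(2) by simp
    qed
  qed (rule CS, rule CI)
  have ext_dual: "isomorphic K (tate_Ext A n T N)
      (homology (hom_space A N (obj J (n + 1))) (compose (carrier N) (bd J (n + 1)))
        (hom_space A N (obj J n)) (compose (carrier N) (bd J n)) (hom_space A N (obj J (n - 1))))"
    using tate_Ext_dual[OF CT bT N fN, of n] by (simp add: J_def)
  obtain e where e: "lin_map A (obj S 0) N' e" "e ` carrier (obj S 0) = carrier N'"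
    "\<And>x. x \<in> carrier (obj S 0) \<Longrightarrow> e x = \<zero>\<^bsub>N'\<^esub> \<longleftrightarrow> x \<in> bd S 1 ` carrier (obj S 1)"
    using complete_resolution_augmentation[OF S] by blast
  have al: "lin_map A N' (rtwist r N) \<alpha>" and ab: "\<alpha> ` carrier N' = carrier N" "inj_on \<alpha> (carrier N')"
    using \<alpha> by (auto simp: lin_iso_def bij_betw_def)
  have \<alpha>0: "\<alpha> \<zero>\<^bsub>N'\<^esub> = \<zero>\<^bsub>N\<^esub>" using lin_map_zero[OF N' lmodule.lmodule_rtwist[OF N hr] al] by simp
  interpret N': lmodule A N' by (rule N')
  interpret X: lmodule A X by (rule X)
  \<comment> \<open>Composed with \<alpha>, the augmentation of \<open>S\<close> becomes an
    augmentation onto \<open>N\<close> that is linear up to \<open>r\<close>, as the left edge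
    requires.\<close>
  have ea: "lin_map A (obj S 0) (rtwist r N) (\<lambda>x. \<alpha> (e x))" by (rule lin_map_comp[OF e(1) al])
  have left: "isomorphic K (homology (hom_space A N (obj J (n + 1))) (compose (carrier N) (bd J (n + 1)))
        (hom_space A N (obj J n)) (compose (carrier N) (bd J n)) (hom_space A N (obj J (n - 1)))) (EB.diag 0 n)"
  proof (rule EB.diag_left_edge[OF N CJ I_def hr, where e = "\<lambda>x. \<alpha> (e x)"])
    show "\<exists>b\<in>carrier A. r b = a" if "a \<in> carrier A" for a
      using aut_inv(1)[OF r that] ring_hom_closed[OF aut_inv_hom[OF r] that] by blast
    show "(\<lambda>x. \<alpha> (e x)) ` carrier (obj S 0) = carrier N" using e(2) ab(1) by (simp flip: image_image)
    fix x assume x: "x \<in> carrier (obj S 0)"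
    have "\<alpha> (e x) = \<zero>\<^bsub>N\<^esub> \<longleftrightarrow> e x = \<zero>\<^bsub>N'\<^esub>"
      using inj_on_eq_iff[OF ab(2) lin_map_closed[OF e(1) x] N'.M.zero_closed] \<alpha>0 by simp
    then show "\<alpha> (e x) = \<zero>\<^bsub>N\<^esub> \<longleftrightarrow> x \<in> bd S 1 ` carrier (obj S 1)" using e(3)[OF x] by simp
  qed (use lin_map_closed[OF ea] lin_map_add[OF ea] lin_map_smult[OF ea] aut_unit[OF r] in auto)
  obtain d where d: "lin_map A (obj T 0) M d" "d ` carrier (obj T 0) = carrier M"
    "\<And>x. x \<in> carrier (obj T 0) \<Longrightarrow> d x = \<zero>\<^bsub>M\<^esub> \<longleftrightarrow> x \<in> bd T 1 ` carrier (obj T 1)"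
    using complete_resolution_augmentation[OF T] by blast
  note T' = chain_complexD[OF CT]
  interpret M: lmodule A M by (rule M)
  interpret T0: lmodule A "obj T 0" by (rule T'(1))
  interpret T1: lmodule A "obj T (-1)" by (rule T'(1))
  have b0: "lin_map A (obj T 0) (obj T (-1)) (bd T 0)" using T'(2)[of 0] by simp
  \<comment> \<open>The augmentation \<open>d\<close> and the boundary out of degree 0 have the same
    kernel, so \<open>M\<close> can be identified with the image of that boundary in degree
    -1.\<close>
  have wd: "bd T 0 x = bd T 0 y \<longleftrightarrow> d x = d y" if xy: "x \<in> carrier (obj T 0)" "y \<in> carrier (obj T 0)" for x y
  proof -
    have "bd T 0 x = bd T 0 y \<longleftrightarrow> bd T 0 (x \<ominus>\<^bsub>obj T 0\<^esub> y) = \<zero>\<^bsub>obj T (-1)\<^esub>"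
      using lin_map_diff[OF T'(1) T'(1) b0 xy] T1.diff_eq_zero lin_map_closed[OF b0] xy by simp
    also have "\<dots> \<longleftrightarrow> x \<ominus>\<^bsub>obj T 0\<^esub> y \<in> bd T 1 ` carrier (obj T 1)"
    proof
      assume "bd T 0 (x \<ominus>\<^bsub>obj T 0\<^esub> y) = \<zero>\<^bsub>obj T (-1)\<^esub>"
      then show "x \<ominus>\<^bsub>obj T 0\<^esub> y \<in> bd T 1 ` carrier (obj T 1)"
        using complete_resolution_exact[OF T, of "x \<ominus>\<^bsub>obj T 0\<^esub> y" 0] xy by (force simp: image_iff)
    next
      assume "x \<ominus>\<^bsub>obj T 0\<^esub> y \<in> bd T 1 ` carrier (obj T 1)"
      then show "bd T 0 (x \<ominus>\<^bsub>obj T 0\<^esub> y) = \<zero>\<^bsub>obj T (-1)\<^esub>" using T'(4)[of _ 0] by auto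
    qed
    also have "\<dots> \<longleftrightarrow> d (x \<ominus>\<^bsub>obj T 0\<^esub> y) = \<zero>\<^bsub>M\<^esub>" using d(3) xy by simp
    also have "\<dots> \<longleftrightarrow> d x = d y"
      using lin_map_diff[OF T'(1) M d(1) xy] M.diff_eq_zero lin_map_closed[OF d(1)] xy by simp
    finally show ?thesis .
  qed
  have bl: "lin_map A X (rtwist (\<lambda>a. \<mu> (r a)) M) \<beta>" and bb: "\<beta> ` carrier X = carrier M" "inj_on \<beta> (carrier X)"
    using \<beta> by (auto simp: lin_iso_def bij_betw_def)
  \<comment> \<open>The resulting embedding of \<open>X\<close> into degree -1; by \<open>wd\<close>
    the choice of the preimage under \<open>d\<close> has no effect.\<close>
  define i where "i = (\<lambda>x. bd T 0 (inv_into (carrier (obj T 0)) d (\<beta> x)))"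
  have sec: "inv_into (carrier (obj T 0)) d (\<beta> x) \<in> carrier (obj T 0)" "d (inv_into (carrier (obj T 0)) d (\<beta> x)) = \<beta> x"
    if "x \<in> carrier X" for x
  proof -
    have "\<beta> x \<in> d ` carrier (obj T 0)" using that d(2) bb(1) by blast
    then show "inv_into (carrier (obj T 0)) d (\<beta> x) \<in> carrier (obj T 0)"
      "d (inv_into (carrier (obj T 0)) d (\<beta> x)) = \<beta> x" by (rule inv_into_into, rule f_inv_into_f)
  qed
  have iI: "i x = bd T 0 y" if "x \<in> carrier X" "y \<in> carrier (obj T 0)" "d y = \<beta> x" for x y
    unfolding i_def using wd[OF sec(1)[OF that(1)] that(2)] sec(2)[OF that(1)] that(3) by simp
  have iE: "\<exists>y\<in>carrier (obj T 0). d y = \<beta> x \<and> i x = bd T 0 y" if "x \<in> carrier X" for x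
    using sec[OF that] by (auto simp: i_def)
  have rc: "\<mu> (r a) \<in> carrier A" if "a \<in> carrier A" for a using ring_hom_closed[OF hr that] by simp
  \<comment> \<open>In degree -1 the cycles are the image from degree 0, hence the copy of
    \<open>X\<close>; this fixes the second coordinate of the right edge at -1 for every n.\<close>
  have right: "isomorphic K (tate_Ext A (- (n + 1)) S X) (EB.diag (- (n + 1)) (-1))"
  proof (rule EB.diag_right_edge[OF X, where i = i])
    show "lin_map A X (obj I (-1)) i"
    proof (rule lin_mapI)
      fix x assume "x \<in> carrier X"
      then show "i x \<in> carrier (obj I (-1))" using sec(1) lin_map_closed[OF b0] by (simp add: i_def I_def J_def)
    next
      fix x x' assume xx: "x \<in> carrier X" "x' \<in> carrier X"
      then obtain y y' where y: "y \<in> carrier (obj T 0)" "d y = \<beta> x" "i x = bd T 0 y"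
          "y' \<in> carrier (obj T 0)" "d y' = \<beta> x'" "i x' = bd T 0 y'" using iE by metis
      have "i (x \<oplus>\<^bsub>X\<^esub> x') = bd T 0 (y \<oplus>\<^bsub>obj T 0\<^esub> y')"
        using xx y lin_map_add[OF d(1)] lin_map_add[OF bl] by (intro iI) auto
      then show "i (x \<oplus>\<^bsub>X\<^esub> x') = i x \<oplus>\<^bsub>obj I (-1)\<^esub> i x'" using y lin_map_add[OF b0] by (simp add: I_def J_def)
    next
      fix a x assume ax: "a \<in> carrier A" "x \<in> carrier X"
      then obtain y where y: "y \<in> carrier (obj T 0)" "d y = \<beta> x" "i x = bd T 0 y" using iE by metis
      have "i (a \<odot>\<^bsub>X\<^esub> x) = bd T 0 (\<mu> (r a) \<odot>\<^bsub>obj T 0\<^esub> y)"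
        using ax y rc lin_map_smult[OF d(1)] lin_map_smult[OF bl] by (intro iI) auto
      then show "i (a \<odot>\<^bsub>X\<^esub> x) = a \<odot>\<^bsub>obj I (-1)\<^esub> i x" using y ax rc lin_map_smult[OF b0] by (simp add: I_def J_def)
    qed
    show "inj_on i (carrier X)"
    proof (rule inj_onI)
      fix x x' assume xx: "x \<in> carrier X" "x' \<in> carrier X" "i x = i x'"
      then obtain y y' where y: "y \<in> carrier (obj T 0)" "d y = \<beta> x" "i x = bd T 0 y"
          "y' \<in> carrier (obj T 0)" "d y' = \<beta> x'" "i x' = bd T 0 y'" using iE by metis
      then have "\<beta> x = \<beta> x'" using wd[OF y(1,4)] xx by simp
      then show "x = x'" using bb(2) xx by (auto simp: inj_on_def)
    qed
    fix x assume "x \<in> carrier X"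
    then obtain y where "y \<in> carrier (obj T 0)" "i x = bd T 0 y" using iE by metis
    then show "bd I (-1) (i x) = \<zero>\<^bsub>obj I (-1 - 1)\<^esub>" using T'(5)[of y 0] by (simp add: I_def J_def)
  next
    fix z assume "z \<in> carrier (obj I (-1))" "bd I (-1) z = \<zero>\<^bsub>obj I (-1 - 1)\<^esub>"
    then obtain y where y: "y \<in> carrier (obj T 0)" "bd T 0 y = z"
      using complete_resolution_exact[OF T, of z "-1"] by (auto simp: I_def J_def)
    obtain x where x: "x \<in> carrier X" "\<beta> x = d y" using bb(1) lin_map_closed[OF d(1) y(1)] by (metis imageE)
    then show "\<exists>x\<in>carrier X. i x = z" using iI[OF x(1) y(1)] y(2) by auto
  qed
  \<comment> \<open>Both coordinates move by -(n+1), which takes n to -1.\<close>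
  have "isomorphic K (EB.diag 0 n) (EB.diag (- (n + 1)) (-1))"
    using EB.diag_invariant[of 0 n "- (n + 1)"] by simp
  moreover have "isomorphic K (EB.diag (- (n + 1)) (-1)) (tate_Ext A (- (n + 1)) S X)"
  proof (rule isomorphic_sym[OF _ _ right])
    show "lmodule K (EB.diag (- (n + 1)) (-1))"
      unfolding EB.diag_def by (rule lmodule_quot[OF EB.lmodule_cyc_space EB.bnd_submodule])
    show "lmodule K (tate_Ext A (- (n + 1)) S X)"
      by (rule lmodule_tate_Ext[OF CS X])
  qed
  ultimately show ?thesis using ext_dual left by (blast intro: isomorphic_trans)
qed

section \<open>Tensor products\<close>

lemma free_module_val: "p \<in> carrier (free_module R S) \<Longrightarrow> p s \<in> carrier R"
  by simp

lemma free_module_supp: "\<lbrakk>p \<in> carrier (free_module R S); p s \<noteq> \<zero>\<^bsub>R\<^esub>\<rbrakk> \<Longrightarrow> s \<in> S"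
  by (meson free_module_simps(1))

text \<open>Only closure of the actions is assumed. One development then serves tensor products over
  the ground field as well as those of a right with a left module over an algebra.\<close>

locale tensor_pair = K: field K + N: abelian_group N + M: abelian_group M
  for K :: "'k ring" and \<Gamma> :: "('k, 'g) module" and N :: "('g, 'n) module" and M :: "('g, 'm) module" +
  assumes scal_N: "\<lbrakk>c \<in> carrier K; x \<in> carrier N\<rbrakk> \<Longrightarrow> scal \<Gamma> N c x \<in> carrier N"
    and act_N: "\<lbrakk>g \<in> carrier \<Gamma>; x \<in> carrier N\<rbrakk> \<Longrightarrow> g \<odot>\<^bsub>N\<^esub> x \<in> carrier N"
    and act_M: "\<lbrakk>g \<in> carrier \<Gamma>; y \<in> carrier M\<rbrakk> \<Longrightarrow> g \<odot>\<^bsub>M\<^esub> y \<in> carrier M"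
begin

abbreviation "F \<equiv> free_module K (carrier N \<times> carrier M)"
abbreviation "W \<equiv> tensor_ker K \<Gamma> N M"
abbreviation "TT \<equiv> tensor K \<Gamma> N M"
abbreviation "pure \<equiv> pure_tensor K \<Gamma> N M"

lemma lmodule_F: "lmodule K F"
  by (rule lmodule_free_module[OF K.ring_axioms])

sublocale F: lmodule K F
  by (rule lmodule_F)

lemma e_closed [simp]: "\<lbrakk>x \<in> carrier N; y \<in> carrier M\<rbrakk> \<Longrightarrow> basis_elt K (x, y) \<in> carrier F"
  by (rule basis_elt_closed[OF K.ring_axioms]) simp

lemma rels_closed: "tensor_rels K \<Gamma> N M \<subseteq> carrier F"
proof -
  have "x \<oplus>\<^bsub>F\<^esub> y \<in> carrier F" "x \<ominus>\<^bsub>F\<^esub> y \<in> carrier F" if "x \<in> carrier F" "y \<in> carrier F" for x y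
    using that by (rule F.M.a_closed, rule F.M.minus_closed)
  moreover have "c \<odot>\<^bsub>F\<^esub> x \<in> carrier F" if "c \<in> carrier K" "x \<in> carrier F" for c x
    using that by (rule F.smult_closed)
  moreover note e = e_closed
  ultimately show ?thesis
    unfolding tensor_rels_def Let_def using scal_N act_N act_M
    by (auto simp del: free_module_simps e_closed intro!: e N.a_closed M.a_closed)
qed

lemma W_submodule: "submodule W K F"
proof (rule submoduleI'[OF lmodule_F])
  let ?S = "{W. submodule W K F \<and> tensor_rels K \<Gamma> N M \<subseteq> W}"
  have "submodule (carrier F) K F"
    by (rule submoduleI'[OF lmodule_F]) (use F.M.a_closed F.smult_closed F.M.zero_closed in \<open>simp_all del: free_module_simps\<close>)
  \<comment> \<open>The intersection that defines \<open>tensor_ker\<close> must run over a nonempty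
    family in order to stay inside the free module.\<close>
  then have "carrier F \<in> ?S" using rels_closed by simp
  then show "W \<subseteq> carrier F" unfolding tensor_ker_def by blast
  show "\<zero>\<^bsub>F\<^esub> \<in> W" unfolding tensor_ker_def using submodule_zero[OF lmodule_F] by blast
  fix a assume a: "a \<in> W"
  { fix b assume "b \<in> W" with a show "a \<oplus>\<^bsub>F\<^esub> b \<in> W"
      unfolding tensor_ker_def using submodule_add[OF lmodule_F] by blast }
  { fix c assume "c \<in> carrier K" with a show "c \<odot>\<^bsub>F\<^esub> a \<in> W"
      unfolding tensor_ker_def using submodule_smult[OF lmodule_F] by blast }
qed

lemma rels_W: "tensor_rels K \<Gamma> N M \<subseteq> W"
  unfolding tensor_ker_def by blast

lemma W_least: "\<lbrakk>submodule Y K F; tensor_rels K \<Gamma> N M \<subseteq> Y\<rbrakk> \<Longrightarrow> W \<subseteq> Y"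
  unfolding tensor_ker_def by blast

lemma lmodule_tensor: "lmodule K TT"
  unfolding tensor_def by (rule lmodule_quot[OF lmodule_F W_submodule])

sublocale TT: lmodule K TT
  by (rule lmodule_tensor)

lemma lin_map_coset: "lin_map K F TT (\<lambda>p. W +>\<^bsub>F\<^esub> p)"
  unfolding tensor_def by (rule lin_map_proj[OF lmodule_F W_submodule])

lemma pure_closed [simp]: "\<lbrakk>x \<in> carrier N; y \<in> carrier M\<rbrakk> \<Longrightarrow> pure x y \<in> carrier TT"
  unfolding pure_tensor_def by (rule lin_map_closed[OF lin_map_coset e_closed])

lemma coset_rel: "\<lbrakk>p \<in> carrier F; q \<in> carrier F; p \<ominus>\<^bsub>F\<^esub> q \<in> tensor_rels K \<Gamma> N M\<rbrakk> \<Longrightarrow> W +>\<^bsub>F\<^esub> p = W +>\<^bsub>F\<^esub> q"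
  using rels_W by (subst coset_eq_iff[OF lmodule_F W_submodule]) auto

lemma pure_add_left:
  assumes "x \<in> carrier N" "x' \<in> carrier N" "y \<in> carrier M"
  shows "pure (x \<oplus>\<^bsub>N\<^esub> x') y = pure x y \<oplus>\<^bsub>TT\<^esub> pure x' y"
  unfolding pure_tensor_def lin_map_add[OF lin_map_coset e_closed[OF assms(1,3)] e_closed[OF assms(2,3)], symmetric]
  using assms by (intro coset_rel F.M.a_closed e_closed) (auto simp: tensor_rels_def Let_def simp del: free_module_simps)

lemma pure_add_right:
  assumes "x \<in> carrier N" "y \<in> carrier M" "y' \<in> carrier M"
  shows "pure x (y \<oplus>\<^bsub>M\<^esub> y') = pure x y \<oplus>\<^bsub>TT\<^esub> pure x y'"
  unfolding pure_tensor_def lin_map_add[OF lin_map_coset e_closed[OF assms(1,2)] e_closed[OF assms(1,3)], symmetric]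
  using assms by (intro coset_rel F.M.a_closed e_closed) (auto simp: tensor_rels_def Let_def simp del: free_module_simps)

lemma pure_scal:
  assumes "c \<in> carrier K" "x \<in> carrier N" "y \<in> carrier M"
  shows "pure (scal \<Gamma> N c x) y = c \<odot>\<^bsub>TT\<^esub> pure x y"
  unfolding pure_tensor_def lin_map_smult[OF lin_map_coset assms(1) e_closed[OF assms(2,3)], symmetric]
  using assms scal_N by (intro coset_rel F.smult_closed e_closed) (auto simp: tensor_rels_def Let_def simp del: free_module_simps)

lemma pure_act:
  assumes "g \<in> carrier \<Gamma>" "x \<in> carrier N" "y \<in> carrier M"
  shows "pure (g \<odot>\<^bsub>N\<^esub> x) y = pure x (g \<odot>\<^bsub>M\<^esub> y)"
  unfolding pure_tensor_def
  using assms act_N act_M by (intro coset_rel e_closed) (auto simp: tensor_rels_def Let_def simp del: free_module_simps)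

lemma pure_zero_left: "y \<in> carrier M \<Longrightarrow> pure \<zero>\<^bsub>N\<^esub> y = \<zero>\<^bsub>TT\<^esub>"
  using pure_add_left[of "\<zero>\<^bsub>N\<^esub>" "\<zero>\<^bsub>N\<^esub>" y] by (metis N.l_zero N.zero_closed TT.M.add.r_cancel_one' pure_closed)

lemma pure_zero_right: "x \<in> carrier N \<Longrightarrow> pure x \<zero>\<^bsub>M\<^esub> = \<zero>\<^bsub>TT\<^esub>"
  using pure_add_right[of x "\<zero>\<^bsub>M\<^esub>" "\<zero>\<^bsub>M\<^esub>"] by (metis M.l_zero M.zero_closed TT.M.add.r_cancel_one' pure_closed)

text \<open>Scalars are absorbed into the first factor by \<open>pure_scal\<close>, so every tensor
  is a finite sum of pure ones.\<close>

lemma tensor_induct [consumes 1, case_names pure add]: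
  assumes X: "X \<in> carrier TT"
    and p: "\<And>x y. \<lbrakk>x \<in> carrier N; y \<in> carrier M\<rbrakk> \<Longrightarrow> P (pure x y)"
    and a: "\<And>X Y. \<lbrakk>X \<in> carrier TT; Y \<in> carrier TT; P X; P Y\<rbrakk> \<Longrightarrow> P (X \<oplus>\<^bsub>TT\<^esub> Y)"
  shows "P X"
proof -
  obtain q where q: "q \<in> carrier F" "X = W +>\<^bsub>F\<^esub> q"
    using X unfolding tensor_def carrier_quot[OF lmodule_F W_submodule] by blast
  define J where "J = {s. q s \<noteq> \<zero>\<^bsub>K\<^esub>}"
  have J: "finite J" "J \<subseteq> carrier N \<times> carrier M" using q(1) by (auto simp: J_def)
  have qK: "q s \<in> carrier K" for s by (rule free_module_val[OF q(1)])
  have e: "basis_elt K s \<in> carrier F" if "s \<in> J" for s using J(2) that by (intro basis_elt_closed K.ring_axioms) auto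
  have term_closed: "q s \<odot>\<^bsub>F\<^esub> basis_elt K s \<in> carrier F" if "s \<in> J" for s using F.smult_closed[OF qK e[OF that]] .
  have "X = W +>\<^bsub>F\<^esub> (\<Oplus>\<^bsub>F\<^esub>s\<in>J. q s \<odot>\<^bsub>F\<^esub> basis_elt K s)"
    unfolding q(2) by (rule arg_cong[OF free_module_expand[OF K.ring_axioms q(1) J]]) (simp add: J_def)
  also have "\<dots> = (\<Oplus>\<^bsub>TT\<^esub>s\<in>J. W +>\<^bsub>F\<^esub> (q s \<odot>\<^bsub>F\<^esub> basis_elt K s))"
    using term_closed by (intro lin_map_finsum[OF lmodule_F lmodule_tensor lin_map_coset]) blast
  finally have X': "X = (\<Oplus>\<^bsub>TT\<^esub>s\<in>J. W +>\<^bsub>F\<^esub> (q s \<odot>\<^bsub>F\<^esub> basis_elt K s))" .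
  have P1: "P (W +>\<^bsub>F\<^esub> (q s \<odot>\<^bsub>F\<^esub> basis_elt K s))" "W +>\<^bsub>F\<^esub> (q s \<odot>\<^bsub>F\<^esub> basis_elt K s) \<in> carrier TT" if s: "s \<in> J" for s
  proof -
    obtain x y where xy: "s = (x, y)" "x \<in> carrier N" "y \<in> carrier M" using J(2) s by auto
    have "W +>\<^bsub>F\<^esub> (q s \<odot>\<^bsub>F\<^esub> basis_elt K s) = pure (scal \<Gamma> N (q s) x) y"
      using lin_map_smult[OF lin_map_coset qK e[OF s], of s] pure_scal[OF qK xy(2,3), of s]
      by (simp only: pure_tensor_def xy(1))
    then show "P (W +>\<^bsub>F\<^esub> (q s \<odot>\<^bsub>F\<^esub> basis_elt K s))" "W +>\<^bsub>F\<^esub> (q s \<odot>\<^bsub>F\<^esub> basis_elt K s) \<in> carrier TT"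
      using p[OF scal_N[OF qK xy(2)] xy(3)] pure_closed[OF scal_N[OF qK xy(2)] xy(3)] by simp_all
  qed
  have "P (\<Oplus>\<^bsub>TT\<^esub>s\<in>J'. W +>\<^bsub>F\<^esub> (q s \<odot>\<^bsub>F\<^esub> basis_elt K s))" if "finite J'" "J' \<subseteq> J" for J'
    using that
  proof (induction J' rule: finite_induct)
    case empty
    then show ?case using p[OF N.zero_closed M.zero_closed] pure_zero_left[OF M.zero_closed] by simp
  next
    case (insert s J')
    then have "(\<Oplus>\<^bsub>TT\<^esub>s\<in>insert s J'. W +>\<^bsub>F\<^esub> (q s \<odot>\<^bsub>F\<^esub> basis_elt K s)) =
        (W +>\<^bsub>F\<^esub> (q s \<odot>\<^bsub>F\<^esub> basis_elt K s)) \<oplus>\<^bsub>TT\<^esub> (\<Oplus>\<^bsub>TT\<^esub>s\<in>J'. W +>\<^bsub>F\<^esub> (q s \<odot>\<^bsub>F\<^esub> basis_elt K s))"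
      using P1(2) by (intro TT.M.finsum_insert) blast+
    moreover have "(\<Oplus>\<^bsub>TT\<^esub>s\<in>J'. W +>\<^bsub>F\<^esub> (q s \<odot>\<^bsub>F\<^esub> basis_elt K s)) \<in> carrier TT"
      using insert.prems P1(2) by (intro TT.M.finsum_closed) blast
    ultimately show ?case using insert P1[of s] a by simp
  qed
  then show ?thesis using X' J(1) by simp
qed

text \<open>Most identities on the enveloping algebra and on its modules are reduced to pure tensors
  in this form, one variable at a time.\<close>

lemma tensor_map_eqI:
  assumes X: "X \<in> carrier TT" and V: "lmodule K V" and f: "lin_map K TT V f" and g: "lin_map K TT V g"
    and "\<And>x y. \<lbrakk>x \<in> carrier N; y \<in> carrier M\<rbrakk> \<Longrightarrow> f (pure x y) = g (pure x y)"
  shows "f X = g X"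
  using X by (induction rule: tensor_induct) (use assms(5) lin_map_add[OF f] lin_map_add[OF g] in auto)

section \<open>The universal property of the tensor product\<close>

definition balanced :: "('k, 'v, 'z) module_scheme \<Rightarrow> ('n \<Rightarrow> 'm \<Rightarrow> 'v) \<Rightarrow> bool" where
  "balanced V f \<longleftrightarrow> (\<forall>x\<in>carrier N. \<forall>y\<in>carrier M. f x y \<in> carrier V) \<and>
     (\<forall>x\<in>carrier N. \<forall>x'\<in>carrier N. \<forall>y\<in>carrier M. f (x \<oplus>\<^bsub>N\<^esub> x') y = f x y \<oplus>\<^bsub>V\<^esub> f x' y) \<and>
     (\<forall>x\<in>carrier N. \<forall>y\<in>carrier M. \<forall>y'\<in>carrier M. f x (y \<oplus>\<^bsub>M\<^esub> y') = f x y \<oplus>\<^bsub>V\<^esub> f x y') \<and>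
     (\<forall>c\<in>carrier K. \<forall>x\<in>carrier N. \<forall>y\<in>carrier M. f (scal \<Gamma> N c x) y = c \<odot>\<^bsub>V\<^esub> f x y) \<and>
     (\<forall>g\<in>carrier \<Gamma>. \<forall>x\<in>carrier N. \<forall>y\<in>carrier M. f (g \<odot>\<^bsub>N\<^esub> x) y = f x (g \<odot>\<^bsub>M\<^esub> y))"

context
  fixes V :: "('k, 'v, 'z) module_scheme" and f :: "'n \<Rightarrow> 'm \<Rightarrow> 'v"
  assumes V: "lmodule K V" and f: "balanced V f"
begin

interpretation V: lmodule K V by (rule V)

private definition ev :: "('n \<times> 'm \<Rightarrow> 'k) \<Rightarrow> 'v" where
  "ev p = (\<Oplus>\<^bsub>V\<^esub>u\<in>{u. p u \<noteq> \<zero>\<^bsub>K\<^esub>}. p u \<odot>\<^bsub>V\<^esub> (case u of (x, y) \<Rightarrow> f x y))"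

private lemma fc: "u \<in> carrier N \<times> carrier M \<Longrightarrow> (case u of (x, y) \<Rightarrow> f x y) \<in> carrier V"
  using f by (auto simp: balanced_def)

text \<open>The support of a sum can be smaller than the union of the supports. Padding all sums to
  a common finite \<open>J\<close> makes the evaluations comparable.\<close>

private lemma ev_eq:
  assumes p: "p \<in> carrier F" and J: "finite J" "{u. p u \<noteq> \<zero>\<^bsub>K\<^esub>} \<subseteq> J" "J \<subseteq> carrier N \<times> carrier M"
  shows "ev p = (\<Oplus>\<^bsub>V\<^esub>u\<in>J. p u \<odot>\<^bsub>V\<^esub> (case u of (x, y) \<Rightarrow> f x y))"
  unfolding ev_def
proof (rule V.M.add.finprod_mono_neutral_cong_left[OF J(1,2)])
  have pK: "p u \<in> carrier K" for u by (rule free_module_val[OF p])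
  show "p u \<odot>\<^bsub>V\<^esub> (case u of (x, y) \<Rightarrow> f x y) = \<zero>\<^bsub>V\<^esub>" if "u \<in> J - {u. p u \<noteq> \<zero>\<^bsub>K\<^esub>}" for u
    using that J(3) fc[of u] by auto
  show "(\<lambda>u. p u \<odot>\<^bsub>V\<^esub> (case u of (x, y) \<Rightarrow> f x y)) \<in> J \<rightarrow> carrier V"
    using J(3) fc pK by blast
qed simp

private lemma ev_lin: "lin_map K F V ev"
proof (rule lin_mapI)
  fix p assume p: "p \<in> carrier F"
  then have "p u \<in> carrier K" "p u \<noteq> \<zero>\<^bsub>K\<^esub> \<Longrightarrow> u \<in> carrier N \<times> carrier M" for u
    by (rule free_module_val, rule free_module_supp)
  then show "ev p \<in> carrier V" unfolding ev_def using fc by (intro V.M.finsum_closed) blast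
next
  fix p q assume pq: "p \<in> carrier F" "q \<in> carrier F"
  define J where "J = {u. p u \<noteq> \<zero>\<^bsub>K\<^esub>} \<union> {u. q u \<noteq> \<zero>\<^bsub>K\<^esub>}"
  have J: "finite J" "J \<subseteq> carrier N \<times> carrier M" using pq by (auto simp: J_def)
  have K: "p u \<in> carrier K" "q u \<in> carrier K" for u using pq by (auto intro: free_module_val simp del: free_module_simps)
  have fJ: "(case u of (x, y) \<Rightarrow> f x y) \<in> carrier V" if "u \<in> J" for u using fc J(2) that by blast
  have "{u. (p \<oplus>\<^bsub>F\<^esub> q) u \<noteq> \<zero>\<^bsub>K\<^esub>} \<subseteq> J" by (auto simp: J_def)
  then have "ev (p \<oplus>\<^bsub>F\<^esub> q) = (\<Oplus>\<^bsub>V\<^esub>u\<in>J. (p \<oplus>\<^bsub>F\<^esub> q) u \<odot>\<^bsub>V\<^esub> (case u of (x, y) \<Rightarrow> f x y))"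
    by (rule ev_eq[OF F.M.a_closed[OF pq] J(1) _ J(2)])
  also have "\<dots> = (\<Oplus>\<^bsub>V\<^esub>u\<in>J. p u \<odot>\<^bsub>V\<^esub> (case u of (x, y) \<Rightarrow> f x y) \<oplus>\<^bsub>V\<^esub> q u \<odot>\<^bsub>V\<^esub> (case u of (x, y) \<Rightarrow> f x y))"
    using K fJ by (intro V.M.finsum_cong') (auto simp: V.smult_l_distr)
  also have "\<dots> = (\<Oplus>\<^bsub>V\<^esub>u\<in>J. p u \<odot>\<^bsub>V\<^esub> (case u of (x, y) \<Rightarrow> f x y)) \<oplus>\<^bsub>V\<^esub> (\<Oplus>\<^bsub>V\<^esub>u\<in>J. q u \<odot>\<^bsub>V\<^esub> (case u of (x, y) \<Rightarrow> f x y))"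
    using K fJ by (intro V.M.finsum_addf) auto
  also have "\<dots> = ev p \<oplus>\<^bsub>V\<^esub> ev q"
    using ev_eq[OF pq(1) J(1) _ J(2)] ev_eq[OF pq(2) J(1) _ J(2)] by (simp add: J_def)
  finally show "ev (p \<oplus>\<^bsub>F\<^esub> q) = ev p \<oplus>\<^bsub>V\<^esub> ev q" .
next
  fix c p assume c: "c \<in> carrier K" and p: "p \<in> carrier F"
  define J where "J = {u. p u \<noteq> \<zero>\<^bsub>K\<^esub>}"
  have J: "finite J" "J \<subseteq> carrier N \<times> carrier M" using p by (auto simp: J_def)
  have K: "p u \<in> carrier K" for u by (rule free_module_val[OF p])
  have fJ: "(case u of (x, y) \<Rightarrow> f x y) \<in> carrier V" if "u \<in> J" for u using fc J(2) that by blast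
  have "{u. (c \<odot>\<^bsub>F\<^esub> p) u \<noteq> \<zero>\<^bsub>K\<^esub>} \<subseteq> J" using c by (auto simp: J_def)
  then have "ev (c \<odot>\<^bsub>F\<^esub> p) = (\<Oplus>\<^bsub>V\<^esub>u\<in>J. (c \<odot>\<^bsub>F\<^esub> p) u \<odot>\<^bsub>V\<^esub> (case u of (x, y) \<Rightarrow> f x y))"
    by (rule ev_eq[OF F.smult_closed[OF c p] J(1) _ J(2)])
  also have "\<dots> = (\<Oplus>\<^bsub>V\<^esub>u\<in>J. c \<odot>\<^bsub>V\<^esub> (p u \<odot>\<^bsub>V\<^esub> (case u of (x, y) \<Rightarrow> f x y)))"
    using K fJ c by (intro V.M.finsum_cong') (auto simp: V.smult_assoc1)
  also have "\<dots> = c \<odot>\<^bsub>V\<^esub> ev p"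
    unfolding ev_def J_def[symmetric] using K fJ c by (intro V.finsum_smult [symmetric]) auto
  finally show "ev (c \<odot>\<^bsub>F\<^esub> p) = c \<odot>\<^bsub>V\<^esub> ev p" .
qed

private lemma ev_e: "\<lbrakk>x \<in> carrier N; y \<in> carrier M\<rbrakk> \<Longrightarrow> ev (basis_elt K (x, y)) = f x y"
  using fc[of "(x, y)"] K.one_not_zero by (simp add: ev_def basis_elt_def cong: conj_cong)

text \<open>The kernel of \<open>ev\<close> is a subspace that contains the generating relations,
  and \<open>tensor_ker\<close> is the least such subspace.\<close>

private lemma W_ev: "w \<in> W \<Longrightarrow> ev w = \<zero>\<^bsub>V\<^esub>"
proof -
  have "tensor_rels K \<Gamma> N M \<subseteq> a_kernel F V ev"
  proof
    fix r assume r: "r \<in> tensor_rels K \<Gamma> N M"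
    have d: "ev (p \<ominus>\<^bsub>F\<^esub> q) = \<zero>\<^bsub>V\<^esub>" if "p \<in> carrier F" "q \<in> carrier F" "ev p = ev q" for p q
      using lin_map_diff[OF lmodule_F V ev_lin that(1,2)] that(3) lin_map_closed[OF ev_lin that(2)] V.diff_eq_zero by simp
    note f' = f[unfolded balanced_def]
    have "ev r = \<zero>\<^bsub>V\<^esub>"
      using r unfolding tensor_rels_def Let_def
      by (elim UnE CollectE exE conjE; hypsubst; intro d e_closed F.M.a_closed F.smult_closed)
        (use f' in \<open>simp_all add: scal_N act_N act_M ev_e lin_map_add[OF ev_lin e_closed e_closed] lin_map_smult[OF ev_lin _ e_closed]
          del: free_module_simps\<close>)
    then show "r \<in> a_kernel F V ev" using r rels_closed by (auto simp: a_kernel_def' simp del: free_module_simps)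
  qed
  then have "W \<subseteq> a_kernel F V ev" by (rule W_least[OF submodule_kernel[OF lmodule_F V ev_lin]])
  then show "w \<in> W \<Longrightarrow> ev w = \<zero>\<^bsub>V\<^esub>" by (auto simp: a_kernel_def')
qed

text \<open>The representative picked by \<open>SOME\<close> differs from \<open>p\<close> by an
  element of \<open>W\<close>, on which \<open>ev\<close> vanishes.\<close>

private lemma tensor_lift_coset:
  assumes p: "p \<in> carrier F"
  shows "tensor_lift K V (\<lambda>(x, y). f x y) (W +>\<^bsub>F\<^esub> p) = ev p"
proof -
  note WF = submodule_subset[OF lmodule_F W_submodule]
  have "\<zero>\<^bsub>F\<^esub> \<oplus>\<^bsub>F\<^esub> p \<in> W +>\<^bsub>F\<^esub> p"
    unfolding a_r_coset_def' using submodule_zero[OF lmodule_F W_submodule] by blast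
  then have "(SOME q. q \<in> W +>\<^bsub>F\<^esub> p) \<in> W +>\<^bsub>F\<^esub> p" by (rule someI[of "\<lambda>q. q \<in> W +>\<^bsub>F\<^esub> p"])
  then obtain w where w: "w \<in> W" "(SOME q. q \<in> W +>\<^bsub>F\<^esub> p) = w \<oplus>\<^bsub>F\<^esub> p"
    unfolding a_r_coset_def' by blast
  have "w \<in> carrier F" using w(1) WF by blast
  then have "ev (w \<oplus>\<^bsub>F\<^esub> p) = \<zero>\<^bsub>V\<^esub> \<oplus>\<^bsub>V\<^esub> ev p"
    by (simp only: lin_map_add[OF ev_lin _ p] W_ev[OF w(1)])
  then have "ev (w \<oplus>\<^bsub>F\<^esub> p) = ev p" using lin_map_closed[OF ev_lin p] by (simp only: V.M.l_zero)
  moreover have "tensor_lift K V (\<lambda>(x, y). f x y) (W +>\<^bsub>F\<^esub> p) = ev (SOME q. q \<in> W +>\<^bsub>F\<^esub> p)"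
    unfolding tensor_lift_def Let_def ev_def ..
  ultimately show ?thesis by (simp only: w(2))
qed

lemma lift_lin: "lin_map K TT V (tensor_lift K V (\<lambda>(x, y). f x y))"
proof -
  have ex: "\<exists>p. p \<in> carrier F \<and> X = W +>\<^bsub>F\<^esub> p" if "X \<in> carrier TT" for X
    using that unfolding tensor_def carrier_quot[OF lmodule_F W_submodule] by blast
  show ?thesis
  proof (rule lin_mapI)
    fix X assume "X \<in> carrier TT"
    then obtain p where "p \<in> carrier F" "X = W +>\<^bsub>F\<^esub> p" using ex by blast
    then show "tensor_lift K V (\<lambda>(x, y). f x y) X \<in> carrier V" using tensor_lift_coset lin_map_closed[OF ev_lin] by simp
  next
    fix X Y assume "X \<in> carrier TT" "Y \<in> carrier TT"
    then obtain p q where p: "p \<in> carrier F" "X = W +>\<^bsub>F\<^esub> p" "q \<in> carrier F" "Y = W +>\<^bsub>F\<^esub> q" using ex by meson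
    have "X \<oplus>\<^bsub>TT\<^esub> Y = W +>\<^bsub>F\<^esub> (p \<oplus>\<^bsub>F\<^esub> q)" using p lin_map_add[OF lin_map_coset p(1,3)] by simp
    then have "tensor_lift K V (\<lambda>(x, y). f x y) (X \<oplus>\<^bsub>TT\<^esub> Y) = ev (p \<oplus>\<^bsub>F\<^esub> q)"
      using tensor_lift_coset[OF F.M.a_closed[OF p(1,3)]] by (simp only:)
    then show "tensor_lift K V (\<lambda>(x, y). f x y) (X \<oplus>\<^bsub>TT\<^esub> Y) =
        tensor_lift K V (\<lambda>(x, y). f x y) X \<oplus>\<^bsub>V\<^esub> tensor_lift K V (\<lambda>(x, y). f x y) Y"
      by (simp only: p(2,4) tensor_lift_coset[OF p(1)] tensor_lift_coset[OF p(3)] lin_map_add[OF ev_lin p(1,3)])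
  next
    fix c X assume c: "c \<in> carrier K" and "X \<in> carrier TT"
    then obtain p where p: "p \<in> carrier F" "X = W +>\<^bsub>F\<^esub> p" using ex by meson
    have "c \<odot>\<^bsub>TT\<^esub> X = W +>\<^bsub>F\<^esub> (c \<odot>\<^bsub>F\<^esub> p)" using p lin_map_smult[OF lin_map_coset c p(1)] by simp
    then have "tensor_lift K V (\<lambda>(x, y). f x y) (c \<odot>\<^bsub>TT\<^esub> X) = ev (c \<odot>\<^bsub>F\<^esub> p)"
      using tensor_lift_coset[OF F.smult_closed[OF c p(1)]] by (simp only:)
    then show "tensor_lift K V (\<lambda>(x, y). f x y) (c \<odot>\<^bsub>TT\<^esub> X) = c \<odot>\<^bsub>V\<^esub> tensor_lift K V (\<lambda>(x, y). f x y) X"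
      by (simp only: p(2) tensor_lift_coset[OF p(1)] lin_map_smult[OF ev_lin c p(1)])
  qed
qed

lemma lift_pure: "\<lbrakk>x \<in> carrier N; y \<in> carrier M\<rbrakk> \<Longrightarrow> tensor_lift K V (\<lambda>(x, y). f x y) (pure x y) = f x y"
  unfolding pure_tensor_def by (simp only: tensor_lift_coset[OF e_closed] ev_e)

end

end


subsection \<open>Tate homology is dual to Tate cohomology\<close>

text \<open>\<open>N\<close> is a right module in duality with the left module \<open>N'\<close>.\<close>

locale dual_modules = k_alg K A for K :: "'k ring" (structure) and A :: "('k, 'g) module" (structure) +
  fixes N :: "('g, 'n) module" and N' :: "('g, 'd) module" and \<beta> :: "'n \<Rightarrow> 'd \<Rightarrow> 'k"
    and I :: "'i set" and v :: "'i \<Rightarrow> 'n" and w :: "'i \<Rightarrow> 'd"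
  assumes N: "abelian_group N" and act: "\<lbrakk>a \<in> carrier A; x \<in> carrier N\<rbrakk> \<Longrightarrow> a \<odot>\<^bsub>N\<^esub> x \<in> carrier N"
    and kN: "lmodule K (kmod A N)" and N': "lmodule A N'"
    and D: "dual_bases K (kmod A N) (kmod A N') \<beta> I v w"
    and adj: "\<lbrakk>a \<in> carrier A; x \<in> carrier N; y \<in> carrier N'\<rbrakk> \<Longrightarrow> \<beta> (a \<odot>\<^bsub>N\<^esub> x) y = \<beta> x (a \<odot>\<^bsub>N'\<^esub> y)"
begin

interpretation N': lmodule A N' by (rule N')
interpretation kN': lmodule K "kmod A N'" by (rule lmodule_kmod[OF N'])

lemma tensor_pair: "lmodule A P \<Longrightarrow> tensor_pair K A N P"
proof -
  assume P: "lmodule A P"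
  interpret P: lmodule A P by (rule P)
  show "tensor_pair K A N P"
    by (intro tensor_pair.intro tensor_pair_axioms.intro K.field_axioms N P.M.abelian_group_axioms)
      (auto simp: act scal_def)
qed

lemma bil: "bilin K (kmod A N) (kmod A N') \<beta>" and fI: "finite I"
  and v: "i \<in> I \<Longrightarrow> v i \<in> carrier N" and w: "i \<in> I \<Longrightarrow> w i \<in> carrier N'"
  using D by (auto simp: dual_bases_def)

lemma \<beta>_simps:
  "\<lbrakk>x \<in> carrier N; y \<in> carrier N'\<rbrakk> \<Longrightarrow> \<beta> x y \<in> carrier K"
  "\<lbrakk>x \<in> carrier N; x' \<in> carrier N; y \<in> carrier N'\<rbrakk> \<Longrightarrow> \<beta> (x \<oplus>\<^bsub>N\<^esub> x') y = \<beta> x y \<oplus> \<beta> x' y"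
  "\<lbrakk>x \<in> carrier N; y \<in> carrier N'; y' \<in> carrier N'\<rbrakk> \<Longrightarrow> \<beta> x (y \<oplus>\<^bsub>N'\<^esub> y') = \<beta> x y \<oplus> \<beta> x y'"
  "\<lbrakk>c \<in> carrier K; x \<in> carrier N; y \<in> carrier N'\<rbrakk> \<Longrightarrow> \<beta> (scal A N c x) y = c \<otimes> \<beta> x y"
  "\<lbrakk>c \<in> carrier K; x \<in> carrier N; y \<in> carrier N'\<rbrakk> \<Longrightarrow> \<beta> x (scal A N' c y) = c \<otimes> \<beta> x y"
  using lin_map_closed[OF bilinD(1)[OF bil], of x y] lin_map_add[OF bilinD(2)[OF bil], of y x x']
    lin_map_add[OF bilinD(1)[OF bil], of x y y'] lin_map_smult[OF bilinD(2)[OF bil], of y c x]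
    lin_map_smult[OF bilinD(1)[OF bil], of x c y] by simp_all

lemma \<beta>_ext:
  assumes "y \<in> carrier N'" "y' \<in> carrier N'" "\<And>x. x \<in> carrier N \<Longrightarrow> \<beta> x y = \<beta> x y'"
  shows "y = y'"
proof -
  have "\<beta> x (y \<ominus>\<^bsub>N'\<^esub> y') = \<zero>" if "x \<in> carrier N" for x
    using lin_map_diff[OF kN'.lmodule_axioms lmodule_self_module[OF K.ring_axioms] bilinD(1)[OF bil], of x y y']
      assms that \<beta>_simps(1) by (simp add: kmod_def K.minus_eq_zero_iff)
  then have "y \<ominus>\<^bsub>N'\<^esub> y' = \<zero>\<^bsub>N'\<^esub>" using D assms(1,2) v by (simp add: dual_bases_def)
  then show ?thesis using assms(1,2) N'.diff_eq_zero by simp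
qed

text \<open>The pairing behind the adjunction of Hom and tensor product, induced by \<beta>; it will
  exhibit \<open>Hom(P, N')\<close> as the dual of the tensor product of \<open>N\<close> and
  \<open>P\<close>.\<close>

definition pr :: "('n \<times> 'p \<Rightarrow> 'k) set \<Rightarrow> ('p \<Rightarrow> 'd) \<Rightarrow> 'k" where
  "pr X h = tensor_lift K (self_module K) (\<lambda>(b, p). \<beta> b (h p)) X"

section \<open>Perfectness of the pairing for projective modules\<close>

context
  fixes P :: "('g, 'p) module"
  assumes P: "lmodule A P"
begin

interpretation P: lmodule A P by (rule P)
interpretation tensor_pair K A N P by (rule tensor_pair[OF P])

lemma pr_balanced: "lin_map A P N' h \<Longrightarrow> balanced (self_module K) (\<lambda>b p. \<beta> b (h p))"
  unfolding balanced_def using \<beta>_simps lin_map_closed[of A P N' h] lin_map_add[of A P N' h] lin_map_smult[of A P N' h] adj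
  by auto

lemma pr_lin: "lin_map A P N' h \<Longrightarrow> functional K TT (\<lambda>X. pr X h)"
  unfolding pr_def by (rule lift_lin[OF lmodule_self_module[OF K.ring_axioms] pr_balanced])

lemma pr_pure: "\<lbrakk>lin_map A P N' h; b \<in> carrier N; p \<in> carrier P\<rbrakk> \<Longrightarrow> pr (pure b p) h = \<beta> b (h p)"
  unfolding pr_def by (rule lift_pure[OF lmodule_self_module[OF K.ring_axioms] pr_balanced])

lemma pr_closed: "\<lbrakk>lin_map A P N' h; X \<in> carrier TT\<rbrakk> \<Longrightarrow> pr X h \<in> carrier K"
  using lin_map_closed[OF pr_lin] by simp

lemma pr_eqI:
  assumes X: "X \<in> carrier TT" and h: "lin_map A P N' h" "lin_map A P N' h'"
    and "\<And>b p. \<lbrakk>b \<in> carrier N; p \<in> carrier P\<rbrakk> \<Longrightarrow> \<beta> b (h p) = \<beta> b (h' p)"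
  shows "pr X h = pr X h'"
  by (rule tensor_map_eqI[OF X lmodule_self_module[OF K.ring_axioms] pr_lin[OF h(1)] pr_lin[OF h(2)]])
    (simp add: pr_pure h assms(4))

lemma pr_bilin: "bilin K (hom_space A P N') TT (\<lambda>h X. pr X h)"
  unfolding bilin_def
proof (intro conjI ballI)
  fix h assume "h \<in> carrier (hom_space A P N')"
  then show "functional K TT (\<lambda>X. pr X h)" using pr_lin by simp
next
  fix X assume X: "X \<in> carrier TT"
  interpret H: lmodule K "hom_space A P N'" by (rule lmodule_hom_space[OF N' P])
  have hc: "h p \<in> carrier N'" if "lin_map A P N' h" "p \<in> carrier P" for h p using lin_map_closed[OF that] .
  show "functional K (hom_space A P N') (pr X)"
  proof (rule lin_mapI)
    fix h assume "h \<in> carrier (hom_space A P N')"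
    then show "pr X h \<in> carrier (self_module K)" using pr_closed X by simp
  next
    fix h g assume hg: "h \<in> carrier (hom_space A P N')" "g \<in> carrier (hom_space A P N')"
    let ?s = "h \<oplus>\<^bsub>hom_space A P N'\<^esub> g"
    have s: "lin_map A P N' ?s" and h: "lin_map A P N' h" and g: "lin_map A P N' g"
      using H.M.a_closed[OF hg] hg by simp_all
    show "pr X ?s = pr X h \<oplus>\<^bsub>self_module K\<^esub> pr X g"
      using X
    proof (induction rule: tensor_induct)
      case (pure b p)
      then show ?case by (simp add: pr_pure[OF s] pr_pure[OF h] pr_pure[OF g] \<beta>_simps hc[OF h] hc[OF g] del: hom_space_simps(3))
          (simp add: \<beta>_simps hc[OF h] hc[OF g])
    next
      case (add Y Z)
      then show ?case
        using pr_closed[OF h] pr_closed[OF g] lin_map_add[OF pr_lin[OF s]] lin_map_add[OF pr_lin[OF h]] lin_map_add[OF pr_lin[OF g]]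
        by (simp add: K.a_ac del: hom_space_simps)
    qed
  next
    fix c h assume c: "c \<in> carrier K" and h': "h \<in> carrier (hom_space A P N')"
    let ?s = "c \<odot>\<^bsub>hom_space A P N'\<^esub> h"
    have s: "lin_map A P N' ?s" and h: "lin_map A P N' h"
      using H.smult_closed[OF c h'] h' by simp_all
    show "pr X ?s = c \<odot>\<^bsub>self_module K\<^esub> pr X h"
      using X
    proof (induction rule: tensor_induct)
      case (pure b p)
      then show ?case by (simp add: pr_pure[OF s] pr_pure[OF h] del: hom_space_simps(4))
          (simp add: \<beta>_simps hc[OF h] c)
    next
      case (add Y Z)
      then show ?case
        using pr_closed[OF h] lin_map_add[OF pr_lin[OF s]] lin_map_add[OF pr_lin[OF h]] c
        by (simp add: K.r_distr del: hom_space_simps)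
    qed
  qed
qed

lemma pr_sep_hom:
  assumes h: "h \<in> carrier (hom_space A P N')" and z: "\<And>X. X \<in> carrier TT \<Longrightarrow> pr X h = \<zero>"
  shows "h = \<zero>\<^bsub>hom_space A P N'\<^esub>"
proof (rule hom_space_eqI[OF h])
  interpret H: lmodule K "hom_space A P N'" by (rule lmodule_hom_space[OF N' P])
  show "\<zero>\<^bsub>hom_space A P N'\<^esub> \<in> carrier (hom_space A P N')" by (rule H.M.zero_closed)
  fix p assume p: "p \<in> carrier P"
  have hl: "lin_map A P N' h" using h by simp
  have hp: "h p \<in> carrier N'" using lin_map_closed[OF hl p] .
  have "\<beta> b (h p) = \<zero>" if "b \<in> carrier N" for b
    using z[OF pure_closed[OF that p]] pr_pure[OF hl that p] by simp
  then have "h p = \<zero>\<^bsub>N'\<^esub>" using D hp v by (simp add: dual_bases_def)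
  then show "h p = \<zero>\<^bsub>hom_space A P N'\<^esub> p" using p by simp
qed

text \<open>\<open>N'\<close> plays the part of the dual of \<open>N\<close>: \<open>h p\<close> is
  the element that represents \<open>l (pure b p)\<close> as a functional of \<open>b\<close>,
  written out in the dual bases. Moving scalars across the tensor sign makes \<open>h\<close> linear
  over \<open>A\<close>.\<close>

lemma functional_pr:
  assumes l: "functional K TT l"
  obtains h where "lin_map A P N' h" "\<And>X. X \<in> carrier TT \<Longrightarrow> pr X h = l X"
proof -
  note SK = lmodule_self_module[OF K.ring_axioms]
  have lc: "l (pure b p) \<in> carrier K" if "b \<in> carrier N" "p \<in> carrier P" for b p
    using lin_map_closed[OF l pure_closed[OF that]] by simp
  define h where "h = (\<lambda>p. \<Oplus>\<^bsub>N'\<^esub>i\<in>I. scal A N' (l (pure (v i) p)) (w i))"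
  have wc: "scal A N' (l (pure (v i) p)) (w i) \<in> carrier N'" if "i \<in> I" "p \<in> carrier P" for i p
    using lc[OF v[OF that(1)] that(2)] w[OF that(1)] scal_closed[OF N'] by simp
  have hc: "h p \<in> carrier N'" if "p \<in> carrier P" for p
    unfolding h_def using wc that by (intro N'.M.finsum_closed) auto
  have \<beta>h: "\<beta> b (h p) = l (pure b p)" if b: "b \<in> carrier N" and p: "p \<in> carrier P" for b p
  proof -
    have "\<beta> b (h p) = (\<Oplus>i\<in>I. \<beta> b (scal A N' (l (pure (v i) p)) (w i)))"
      unfolding h_def using lin_map_finsum[OF kN'.lmodule_axioms SK bilinD(1)[OF bil], of b "\<lambda>i. scal A N' (l (pure (v i) p)) (w i)" I]
        b wc[OF _ p] by auto
    also have "\<dots> = (\<Oplus>i\<in>I. l (pure (scal A N (\<beta> b (w i)) (v i)) p))"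
    proof (rule K.finsum_cong'[OF refl])
      have sN: "scal A N (\<beta> b (w i)) (v i) \<in> carrier N" if "i \<in> I" for i
        using \<beta>_simps(1)[OF b w[OF that]] v[OF that] scal_N by simp
      show "(\<lambda>i. l (pure (scal A N (\<beta> b (w i)) (v i)) p)) \<in> I \<rightarrow> carrier K"
        using lc[OF sN p] by blast
      fix i assume i: "i \<in> I"
      have "\<beta> b (scal A N' (l (pure (v i) p)) (w i)) = l (pure (v i) p) \<otimes> \<beta> b (w i)"
        by (rule \<beta>_simps(5)[OF lc[OF v[OF i] p] b w[OF i]])
      also have "\<dots> = \<beta> b (w i) \<otimes> l (pure (v i) p)" by (rule K.m_comm[OF lc[OF v[OF i] p] \<beta>_simps(1)[OF b w[OF i]]])
      also have "\<dots> = l (pure (scal A N (\<beta> b (w i)) (v i)) p)"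
        using lin_map_smult[OF l \<beta>_simps(1)[OF b w[OF i]] pure_closed[OF v[OF i] p]]
          pure_scal[OF \<beta>_simps(1)[OF b w[OF i]] v[OF i] p] by simp
      finally show "\<beta> b (scal A N' (l (pure (v i) p)) (w i)) = l (pure (scal A N (\<beta> b (w i)) (v i)) p)" .
    qed
    also have "\<dots> = l (pure (\<Oplus>\<^bsub>kmod A N\<^esub>i\<in>I. scal A N (\<beta> b (w i)) (v i)) p)"
    proof -
      have "lin_map K (kmod A N) TT (\<lambda>x. pure x p)"
        using p by (intro lin_mapI) (auto simp: pure_add_left pure_scal)
      have "(\<lambda>i. scal A N (\<beta> b (w i)) (v i)) \<in> I \<rightarrow> carrier (kmod A N)"
        using \<beta>_simps(1)[OF b w] v scal_N by auto
      from lin_map_finsum[OF kN SK lin_map_comp[OF \<open>lin_map K (kmod A N) TT (\<lambda>x. pure x p)\<close> l] this] show ?thesis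
        by simp
    qed
    also have "(\<Oplus>\<^bsub>kmod A N\<^esub>i\<in>I. scal A N (\<beta> b (w i)) (v i)) = b"
      using dual_bases_expand[OF K.field_axioms kN D, of b] b by simp
    finally show ?thesis .
  qed
  have h: "lin_map A P N' h"
  proof (rule lin_mapI)
    fix p q assume pq: "p \<in> carrier P" "q \<in> carrier P"
    show "h (p \<oplus>\<^bsub>P\<^esub> q) = h p \<oplus>\<^bsub>N'\<^esub> h q"
      using pq hc lin_map_add[OF l] by (intro \<beta>_ext) (auto simp: \<beta>h \<beta>_simps pure_add_right)
  next
    fix a p assume ap: "a \<in> carrier A" "p \<in> carrier P"
    show "h (a \<odot>\<^bsub>P\<^esub> p) = a \<odot>\<^bsub>N'\<^esub> h p"
      using ap hc act by (intro \<beta>_ext) (auto simp: \<beta>h adj[symmetric] pure_act)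
  qed (rule hc)
  moreover have "pr X h = l X" if "X \<in> carrier TT" for X
    by (rule tensor_map_eqI[OF that SK pr_lin[OF h] l]) (simp add: pr_pure[OF h] \<beta>h)
  ultimately show thesis by (rule that)
qed

context
  fixes J :: "'j set" and x :: "'j \<Rightarrow> 'p" and f :: "'j \<Rightarrow> 'p \<Rightarrow> 'g"
  assumes bP: "proj_basis A P J x f"
begin

lemmas bP' = proj_basisD[OF bP]

text \<open>The \<open>x j\<close> generate \<open>P\<close> over \<open>A\<close>; their
  coefficients move across the tensor sign into \<open>N\<close>, which the \<open>v i\<close> span
  over \<open>K\<close>.\<close>

lemma fin_gen_tensor: "fin_gen K TT"
proof (rule fin_genI[OF lmodule_tensor, where S = "(\<lambda>(i, j). pure (v i) (x j)) ` (I \<times> J)"])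
  show "finite ((\<lambda>(i, j). pure (v i) (x j)) ` (I \<times> J))" using fI bP'(1) by simp
  show "(\<lambda>(i, j). pure (v i) (x j)) ` (I \<times> J) \<subseteq> carrier TT" using v bP'(2) by auto
  fix Y assume Y: "submodule Y K TT" and sub: "(\<lambda>(i, j). pure (v i) (x j)) ` (I \<times> J) \<subseteq> Y"
  note Y' = submoduleD[OF lmodule_tensor Y]
  have 1: "pure b (x j) \<in> Y" if b: "b \<in> carrier N" and j: "j \<in> J" for b j
  proof -
    have L: "lin_map K (kmod A N) TT (\<lambda>b. pure b (x j))"
      using bP'(2)[OF j] by (intro lin_mapI) (auto simp: pure_add_left pure_scal)
    have c: "\<beta> b (w i) \<in> carrier K" if "i \<in> I" for i by (rule \<beta>_simps(1)[OF b w[OF that]])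
    have "pure b (x j) = pure (\<Oplus>\<^bsub>kmod A N\<^esub>i\<in>I. scal A N (\<beta> b (w i)) (v i)) (x j)"
      by (rule arg_cong[where f = "\<lambda>b. pure b (x j)"]) (use dual_bases_expand[OF K.field_axioms kN D, of b] b in simp)
    also have "\<dots> = (\<Oplus>\<^bsub>TT\<^esub>i\<in>I. pure (scal A N (\<beta> b (w i)) (v i)) (x j))"
      using c v scal_N by (intro lin_map_finsum[OF kN lmodule_tensor L]) auto
    finally have eq: "pure b (x j) = (\<Oplus>\<^bsub>TT\<^esub>i\<in>I. pure (scal A N (\<beta> b (w i)) (v i)) (x j))" .
    have "pure (v i) (x j) \<in> Y" if "i \<in> I" for i using sub that j by force
    then have "(\<Oplus>\<^bsub>TT\<^esub>i\<in>I. pure (scal A N (\<beta> b (w i)) (v i)) (x j)) \<in> Y"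
      using c v j pure_scal[OF c v bP'(2)[OF j]] by (intro submodule_finsum[OF lmodule_tensor Y]) (auto intro!: Y'(4))
    then show ?thesis unfolding eq .
  qed
  show "carrier TT \<subseteq> Y"
  proof
    fix X assume "X \<in> carrier TT"
    then show "X \<in> Y"
    proof (induction rule: tensor_induct)
      case (pure b p)
      have L: "pure b (\<Oplus>\<^bsub>P\<^esub>j\<in>J'. f j p \<odot>\<^bsub>P\<^esub> x j) = (\<Oplus>\<^bsub>TT\<^esub>j\<in>J'. pure (f j p \<odot>\<^bsub>N\<^esub> b) (x j))" if "finite J'" "J' \<subseteq> J" for J'
        using that
      proof (induction J' rule: finite_induct)
        case empty
        then show ?case using pure_zero_right[OF pure(1)] by simp
      next
        case (insert j J')
        have jc: "f i p \<odot>\<^bsub>P\<^esub> x i \<in> carrier P" "pure (f i p \<odot>\<^bsub>N\<^esub> b) (x i) \<in> carrier TT" if "i \<in> J" for i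
          using that bP'(2) bP'(4)[OF _ pure(2)] act[OF _ pure(1)] by auto
        have "pure b (\<Oplus>\<^bsub>P\<^esub>i\<in>insert j J'. f i p \<odot>\<^bsub>P\<^esub> x i) = pure b (f j p \<odot>\<^bsub>P\<^esub> x j \<oplus>\<^bsub>P\<^esub> (\<Oplus>\<^bsub>P\<^esub>i\<in>J'. f i p \<odot>\<^bsub>P\<^esub> x i))"
          using insert jc by (subst P.M.finsum_insert) auto
        also have "\<dots> = pure b (f j p \<odot>\<^bsub>P\<^esub> x j) \<oplus>\<^bsub>TT\<^esub> pure b (\<Oplus>\<^bsub>P\<^esub>i\<in>J'. f i p \<odot>\<^bsub>P\<^esub> x i)"
          using insert jc pure(1) by (intro pure_add_right P.M.finsum_closed) auto
        also have "\<dots> = pure (f j p \<odot>\<^bsub>N\<^esub> b) (x j) \<oplus>\<^bsub>TT\<^esub> (\<Oplus>\<^bsub>TT\<^esub>i\<in>J'. pure (f i p \<odot>\<^bsub>N\<^esub> b) (x i))"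
          using insert pure bP'(2,4) by (simp add: pure_act)
        also have "\<dots> = (\<Oplus>\<^bsub>TT\<^esub>i\<in>insert j J'. pure (f i p \<odot>\<^bsub>N\<^esub> b) (x i))"
          using insert jc by (subst TT.M.finsum_insert) auto
        finally show ?case .
      qed
      have "pure b p = pure b (\<Oplus>\<^bsub>P\<^esub>j\<in>J. f j p \<odot>\<^bsub>P\<^esub> x j)" by (rule arg_cong[OF bP'(5)[OF pure(2)]])
      also have "\<dots> = (\<Oplus>\<^bsub>TT\<^esub>j\<in>J. pure (f j p \<odot>\<^bsub>N\<^esub> b) (x j))" by (rule L[OF bP'(1) subset_refl])
      also have "\<dots> \<in> Y"
        using 1 act[OF bP'(4)[OF _ pure(2)] pure(1)] by (intro submodule_finsum[OF lmodule_tensor Y]) auto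
      finally show ?case .
    next
      case (add X Z)
      then show ?case using Y'(3) by blast
    qed
  qed
qed

text \<open>Coordinates on the finite-dimensional tensor product are functionals, hence given by
  \<open>pr\<close> according to \<open>functional_pr\<close>. Orthogonality to all \<open>h\<close>
  therefore kills every coordinate of \<open>X\<close>.\<close>

lemma pr_sep_tensor:
  assumes X: "X \<in> carrier TT" and z: "\<And>h. h \<in> carrier (hom_space A P N') \<Longrightarrow> pr X h = \<zero>"
  shows "X = \<zero>\<^bsub>TT\<^esub>"
proof -
  obtain S l where S: "finite S" "S \<subseteq> carrier TT" "\<And>s. s \<in> S \<Longrightarrow> functional K TT (l s)"
    "\<And>X. X \<in> carrier TT \<Longrightarrow> X = (\<Oplus>\<^bsub>TT\<^esub>s\<in>S. l s X \<odot>\<^bsub>TT\<^esub> s)"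
    by (rule fin_gen_functionals[OF K.field_axioms lmodule_tensor fin_gen_tensor]) (rule that)
  have "l s X = \<zero>" if s: "s \<in> S" for s
  proof -
    obtain h where h: "lin_map A P N' h" "\<And>X. X \<in> carrier TT \<Longrightarrow> pr X h = l s X"
      using functional_pr[OF S(3)[OF s]] by blast
    have r: "lin_map A P N' (restrict h (carrier P))" using hom_spaceI[OF P h(1)] by simp
    have "pr X h = pr X (restrict h (carrier P))" by (rule pr_eqI[OF X h(1) r]) simp
    then show ?thesis using z[OF hom_spaceI[OF P h(1)]] h(2)[OF X] by simp
  qed
  then have "(\<Oplus>\<^bsub>TT\<^esub>s\<in>S. l s X \<odot>\<^bsub>TT\<^esub> s) = \<zero>\<^bsub>TT\<^esub>" using S(2) by (intro TT.M.add.finprod_one_eqI) auto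
  then show ?thesis using S(4)[OF X] by simp
qed

lemma pr_dual_bases:
  obtains L e where "L \<subseteq> carrier TT" "dual_bases K TT (hom_space A P N') pr L (\<lambda>y. y) e"
proof -
  let ?L = "(\<lambda>(i, j). pure (v i) (x j)) ` (I \<times> J)"
  have L: "finite ?L" "?L \<subseteq> carrier TT" using fI bP'(1,2) v by auto
  have sep: "h = \<zero>\<^bsub>hom_space A P N'\<^esub>"
    if h: "h \<in> carrier (hom_space A P N')" and z: "\<And>X. X \<in> ?L \<Longrightarrow> pr X h = \<zero>" for h
  proof (rule hom_space_eqI[OF h])
    interpret H: lmodule K "hom_space A P N'" by (rule lmodule_hom_space[OF N' P])
    show "\<zero>\<^bsub>hom_space A P N'\<^esub> \<in> carrier (hom_space A P N')" by (rule H.M.zero_closed)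
    fix p assume p: "p \<in> carrier P"
    have hl: "lin_map A P N' h" using h by simp
    have hx: "h (x j) = \<zero>\<^bsub>N'\<^esub>" if j: "j \<in> J" for j
    proof -
      have "\<beta> (v i) (h (x j)) = \<zero>" if i: "i \<in> I" for i
        using z[of "pure (v i) (x j)"] pr_pure[OF hl v[OF i] bP'(2)[OF j]] i j by force
      then show ?thesis using D lin_map_closed[OF hl bP'(2)[OF j]] by (simp add: dual_bases_def)
    qed
    have "h p = (\<Oplus>\<^bsub>N'\<^esub>j\<in>J. f j p \<odot>\<^bsub>N'\<^esub> h (x j))"
      by (rule hom_expand[OF P N' bP hl p])
    also have "\<dots> = \<zero>\<^bsub>N'\<^esub>" using hx bP'(4)[OF _ p] by (intro N'.M.add.finprod_one_eqI) auto
    finally show "h p = \<zero>\<^bsub>hom_space A P N'\<^esub> p" using p by simp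
  qed
  obtain L e where "L \<subseteq> ?L" "dual_bases K (hom_space A P N') TT (\<lambda>h X. pr X h) L e (\<lambda>y. y)"
    by (rule dual_bases_exist[OF K.field_axioms lmodule_hom_space[OF N' P] lmodule_tensor pr_bilin L sep pr_sep_tensor])
  then show thesis using L(2) dual_bases_sym[of K "hom_space A P N'" TT] that[of L e] by blast
qed

end

end

lemma
  assumes T: "chain_complex A T"
  shows tensor_bd_lin: "lin_map K (tensor_obj K A N T n) (tensor_obj K A N T (n - 1)) (tensor_bd K A N T n)"
    and tensor_bd_pure: "\<lbrakk>b \<in> carrier N; p \<in> carrier (obj T n)\<rbrakk> \<Longrightarrow>
      tensor_bd K A N T n (pure_tensor K A N (obj T n) b p) = pure_tensor K A N (obj T (n - 1)) b (bd T n p)"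
proof -
  note T' = chain_complexD[OF T]
  interpret P: tensor_pair K A N "obj T n" by (rule tensor_pair[OF T'(1)])
  interpret Q: tensor_pair K A N "obj T (n - 1)" by (rule tensor_pair[OF T'(1)])
  have dc: "bd T n p \<in> carrier (obj T (n - 1))" if "p \<in> carrier (obj T n)" for p using lin_map_closed[OF T'(2) that] .
  have "P.balanced (tensor K A N (obj T (n - 1))) (\<lambda>b p. pure_tensor K A N (obj T (n - 1)) b (bd T n p))"
    unfolding P.balanced_def
    using dc Q.pure_closed Q.pure_add_left Q.pure_add_right Q.pure_scal Q.pure_act lin_map_add[OF T'(2)[of n]] lin_map_smult[OF T'(2)[of n]]
    by simp
  note L = P.lift_lin[OF Q.lmodule_tensor this] P.lift_pure[OF Q.lmodule_tensor this]
  have eq: "tensor_bd K A N T n = tensor_lift K (tensor K A N (obj T (n - 1))) (\<lambda>(x, t). pure_tensor K A N (obj T (n - 1)) x (bd T n t))"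
    by (simp add: tensor_bd_def tensor_obj_def fun_eq_iff)
  show "lin_map K (tensor_obj K A N T n) (tensor_obj K A N T (n - 1)) (tensor_bd K A N T n)"
    unfolding eq tensor_obj_def by (rule L(1))
  show "tensor_bd K A N T n (pure_tensor K A N (obj T n) b p) = pure_tensor K A N (obj T (n - 1)) b (bd T n p)"
    if "b \<in> carrier N" "p \<in> carrier (obj T n)"
    unfolding eq by (rule L(2)[OF that])
qed

lemma tensor_bd_bd:
  assumes T: "chain_complex A T" and X: "X \<in> carrier (tensor_obj K A N T (n + 1))"
  shows "tensor_bd K A N T n (tensor_bd K A N T (n + 1) X) = \<zero>\<^bsub>tensor_obj K A N T (n - 1)\<^esub>"
proof -
  note T' = chain_complexD[OF T]
  interpret P: tensor_pair K A N "obj T (n + 1)" by (rule tensor_pair[OF T'(1)])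
  interpret Q: tensor_pair K A N "obj T n" by (rule tensor_pair[OF T'(1)])
  interpret R: tensor_pair K A N "obj T (n - 1)" by (rule tensor_pair[OF T'(1)])
  have l1: "lin_map K (tensor K A N (obj T (n + 1))) (tensor K A N (obj T n)) (tensor_bd K A N T (n + 1))"
    using tensor_bd_lin[OF T, of "n + 1"] by (simp add: tensor_obj_def)
  have l2: "lin_map K (tensor K A N (obj T n)) (tensor K A N (obj T (n - 1))) (tensor_bd K A N T n)"
    using tensor_bd_lin[OF T, of n] by (simp add: tensor_obj_def)
  have p1: "tensor_bd K A N T (n + 1) (pure_tensor K A N (obj T (n + 1)) b p) = pure_tensor K A N (obj T n) b (bd T (n + 1) p)"
    if "b \<in> carrier N" "p \<in> carrier (obj T (n + 1))" for b p
    using tensor_bd_pure[OF T that] by simp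
  from X have "X \<in> carrier (tensor K A N (obj T (n + 1)))" by (simp add: tensor_obj_def)
  then have "tensor_bd K A N T n (tensor_bd K A N T (n + 1) X) = \<zero>\<^bsub>tensor K A N (obj T (n - 1))\<^esub>"
  proof (induction rule: P.tensor_induct)
    case (pure b p)
    then show ?case
      using p1 tensor_bd_pure[OF T pure(1) lin_map_closed[OF T'(3) pure(2)]] T'(4)[OF pure(2)] R.pure_zero_right by simp
  next
    case (add X Y)
    then show ?case
      using lin_map_add[OF l1] lin_map_add[OF l2] lin_map_closed[OF l1] by simp
  qed
  then show ?thesis by (simp add: tensor_obj_def)
qed

lemma lmodule_tate_Tor:
  assumes T: "chain_complex A T"
  shows "lmodule K (tate_Tor K A n N T)"
proof -
  have "lmodule K (tensor_obj K A N T m)" for m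
    unfolding tensor_obj_def using tensor_pair.lmodule_tensor[OF tensor_pair[OF chain_complexD(1)[OF T]]] .
  then show ?thesis
    unfolding tate_Tor_def using tensor_bd_lin[OF T, of "n + 1"] tensor_bd_lin[OF T, of n] tensor_bd_bd[OF T]
    by (intro lmodule_homology) auto
qed

text \<open>The scheme of \<open>tate_Ext_dual\<close> with the pairing \<open>pr\<close>. The
  degree stays the same, since the boundary of the tensor complex and the coboundary of the Hom
  complex are adjoint; finite dimensionality turns the duality into an isomorphism.\<close>

theorem tate_Tor_Ext:
  fixes T :: "('g, 't) cplx"
  assumes T: "complete_resolution A M T"
  shows "isomorphic K (tate_Tor K A n N T) (tate_Ext A n T N')"
proof -
  have CT: "chain_complex A T" using T by (simp add: complete_resolution_def)
  note T' = chain_complexD[OF CT]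
  obtain J :: "int \<Rightarrow> 't set" and x f where bT: "\<And>n. proj_basis A (obj T n) (J n) (x n) (f n)"
    by (rule complete_resolution_bases[OF T]) (rule that)
  note tp = tensor_pair[OF T'(1)]
  note SK = lmodule_self_module[OF K.ring_axioms]
  obtain L e where D': "dual_bases K (tensor K A N (obj T n)) (hom_space A (obj T n) N') pr L (\<lambda>y. y) e"
    using pr_dual_bases[OF T'(1) bT] by metis
  have bd1: "lin_map K (tensor K A N (obj T (m + 1))) (tensor K A N (obj T m)) (tensor_bd K A N T (m + 1))" for m
    using tensor_bd_lin[OF CT, of "m + 1"] by (simp add: tensor_obj_def)
  have bd2: "lin_map K (tensor K A N (obj T m)) (tensor K A N (obj T (m - 1))) (tensor_bd K A N T m)" for m
    using tensor_bd_lin[OF CT, of m] by (simp add: tensor_obj_def)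
  note E = tate_Ext_complex[OF CT N']
  have tl: "lmodule K (tensor K A N (obj T m))" for m by (rule tensor_pair.lmodule_tensor[OF tp])
  have hl: "lmodule K (hom_space A (obj T m) N')" for m by (rule lmodule_hom_space[OF N' T'(1)])
  \<comment> \<open>On a pure tensor of \<open>b\<close> and \<open>p\<close> both sides are
    \<open>\<beta> b\<close> at the value of \<open>h\<close> on the boundary of
    \<open>p\<close>.\<close>
  have adjoint: "pr (tensor_bd K A N T (m + 1) X) h = pr X (hom_cobd T m h)"
    if X: "X \<in> carrier (tensor K A N (obj T (m + 1)))" and h: "h \<in> carrier (hom_space A (obj T m) N')" for m X h
  proof -
    have hl: "lin_map A (obj T m) N' h" using h by simp
    have hh: "lin_map A (obj T (m + 1)) N' (hom_cobd T m h)" using lin_map_closed[OF E(1) h] by simp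
    show ?thesis
    proof (rule tensor_pair.tensor_map_eqI[OF tp X SK lin_map_comp[OF bd1 pr_lin[OF T'(1) hl]] pr_lin[OF T'(1) hh]])
      fix b p assume bp: "b \<in> carrier N" "p \<in> carrier (obj T (m + 1))"
      have "tensor_bd K A N T (m + 1) (pure_tensor K A N (obj T (m + 1)) b p) = pure_tensor K A N (obj T m) b (bd T (m + 1) p)"
        using tensor_bd_pure[OF CT bp] by simp
      then show "pr (tensor_bd K A N T (m + 1) (pure_tensor K A N (obj T (m + 1)) b p)) h
          = pr (pure_tensor K A N (obj T (m + 1)) b p) (hom_cobd T m h)"
        using pr_pure[OF T'(1) hl bp(1) lin_map_closed[OF T'(3) bp(2)]] pr_pure[OF T'(1) hh bp] bp
        by (simp add: hom_cobd_def compose_def)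
    qed
  qed
  have z1: "pr X \<zero>\<^bsub>hom_space A (obj T m) N'\<^esub> = \<zero>" if "X \<in> carrier (tensor K A N (obj T m))" for X m
    using lin_map_zero[OF hl SK bilinD(2)[OF pr_bilin[OF T'(1)] that]] by simp
  have z2: "pr \<zero>\<^bsub>tensor K A N (obj T m)\<^esub> h = \<zero>" if "h \<in> carrier (hom_space A (obj T m) N')" for h m
    using lin_map_zero[OF tl SK bilinD(1)[OF pr_bilin[OF T'(1)] that]] by simp
  show ?thesis
    unfolding tate_Tor_def tate_Ext_def tensor_obj_def hom_obj_def
  proof (rule pairing_homology_isomorphic[where \<beta>U = pr and \<beta>W = pr,
        OF K.field_axioms tl tl tl bd1 bd2 _ hl hl hl E(1) E(2) E(3) D'])
    show "\<forall>u\<in>carrier (tensor K A N (obj T (n + 1))). tensor_bd K A N T n (tensor_bd K A N T (n + 1) u) = \<zero>\<^bsub>tensor K A N (obj T (n - 1))\<^esub>"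
      using tensor_bd_bd[OF CT] by (simp add: tensor_obj_def)
    show "pr (tensor_bd K A N T (n + 1) u) y = pr u (hom_cobd T n y)"
      if "u \<in> carrier (tensor K A N (obj T (n + 1)))" "y \<in> carrier (hom_space A (obj T n) N')" for u y
      by (rule adjoint[OF that])
    show "pr u \<zero>\<^bsub>hom_space A (obj T (n + 1)) N'\<^esub> = \<zero>" if "u \<in> carrier (tensor K A N (obj T (n + 1)))" for u
      by (rule z1[OF that])
    show "pr \<zero>\<^bsub>tensor K A N (obj T (n - 1))\<^esub> y = \<zero>" if "y \<in> carrier (hom_space A (obj T (n - 1)) N')" for y
      by (rule z2[OF that])
    show "pr x (hom_cobd T (n - 1) y) = pr (tensor_bd K A N T n x) y"
      if "x \<in> carrier (tensor K A N (obj T n))" "y \<in> carrier (hom_space A (obj T (n - 1)) N')" for x y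
      using adjoint[of x "n - 1" y] that by simp
    show "y = \<zero>\<^bsub>hom_space A (obj T (n + 1)) N'\<^esub>"
      if "y \<in> carrier (hom_space A (obj T (n + 1)) N')" "\<And>u. u \<in> carrier (tensor K A N (obj T (n + 1))) \<Longrightarrow> pr u y = \<zero>" for y
      by (rule pr_sep_hom[OF T'(1) that])
    show "x = \<zero>\<^bsub>tensor K A N (obj T (n - 1))\<^esub>"
      if "x \<in> carrier (tensor K A N (obj T (n - 1)))" "\<And>y. y \<in> carrier (hom_space A (obj T (n - 1)) N') \<Longrightarrow> pr x y = \<zero>" for x
      by (rule pr_sep_tensor[OF T'(1) bT that])
  qed
qed

end

section \<open>The enveloping algebra\<close>

lemma lmodule_cong_record:
  assumes M: "lmodule R M" and eq: "carrier M = carrier N" "zero M = zero N" "add M = add N"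
    and sm: "\<And>r x. \<lbrakk>r \<in> carrier R; x \<in> carrier M\<rbrakk> \<Longrightarrow> r \<odot>\<^bsub>N\<^esub> x = r \<odot>\<^bsub>M\<^esub> x"
  shows "lmodule R N"
proof -
  interpret lmodule R M by (rule M)
  have "abelian_group N" by (rule abelian_group_cong_record[OF M.abelian_group_axioms eq])
  then show ?thesis
    by (intro lmodule.intro lmodule_axioms.intro R.ring_axioms)
      (simp_all add: sm smult_l_distr smult_r_distr smult_assoc1 flip: eq)
qed

lemma lin_map_smult_comp:
  assumes K: "cring R" and N: "lmodule R N" and f: "lin_map R M N f" and c: "c \<in> carrier R"
  shows "lin_map R M N (\<lambda>x. c \<odot>\<^bsub>N\<^esub> f x)"
proof -
  interpret K: cring R by (rule K)
  interpret N: lmodule R N by (rule N)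
  show ?thesis
    using lin_map_closed[OF f] c
    by (intro lin_mapI)
      (auto simp: lin_map_add[OF f] lin_map_smult[OF f] N.smult_r_distr K.m_comm simp flip: N.smult_assoc1)
qed

lemma fin_gen_cong_record:
  assumes "fin_gen R M" "lmodule R M" "carrier M = carrier N" "zero M = zero N" "add M = add N"
    and sm: "\<And>r x. \<lbrakk>r \<in> carrier R; x \<in> carrier M\<rbrakk> \<Longrightarrow> r \<odot>\<^bsub>N\<^esub> x = r \<odot>\<^bsub>M\<^esub> x"
  shows "fin_gen R N"
proof -
  interpret lmodule R M by fact
  have eq: "(\<Oplus>\<^bsub>M\<^esub>s\<in>S. c s \<odot>\<^bsub>M\<^esub> s) = (\<Oplus>\<^bsub>N\<^esub>s\<in>S. c s \<odot>\<^bsub>N\<^esub> s)"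
    if "c \<in> S \<rightarrow> carrier R" "S \<subseteq> carrier M" for c S
  proof -
    have "(\<Oplus>\<^bsub>M\<^esub>s\<in>S. c s \<odot>\<^bsub>M\<^esub> s) = (\<Oplus>\<^bsub>M\<^esub>s\<in>S. c s \<odot>\<^bsub>N\<^esub> s)"
      using that sm by (intro M.finsum_cong') (auto simp: Pi_iff subset_iff)
    then show ?thesis by (simp add: finsum_cong_record[OF assms(3-5)])
  qed
  obtain S where S: "finite S" "S \<subseteq> carrier M"
    "\<forall>x\<in>carrier M. \<exists>c\<in>S \<rightarrow> carrier R. x = (\<Oplus>\<^bsub>M\<^esub>s\<in>S. c s \<odot>\<^bsub>M\<^esub> s)"
    using assms(1) unfolding fin_gen_def by blast
  have "\<exists>c\<in>S \<rightarrow> carrier R. x = (\<Oplus>\<^bsub>N\<^esub>s\<in>S. c s \<odot>\<^bsub>N\<^esub> s)" if x: "x \<in> carrier N" for x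
  proof -
    obtain c where c: "c \<in> S \<rightarrow> carrier R" "x = (\<Oplus>\<^bsub>M\<^esub>s\<in>S. c s \<odot>\<^bsub>M\<^esub> s)" using S(3) x assms(3) by blast
    then show ?thesis using eq[OF c(1) S(2)] by (intro bexI[of _ c]) auto
  qed
  then show ?thesis unfolding fin_gen_def using S(1,2) assms(3) by blast
qed

context k_alg
begin

abbreviation "E \<equiv> env K A"
abbreviation "pure \<equiv> env_pure K A"

lemma scal_K: "\<lbrakk>c \<in> carrier K; x \<in> carrier A\<rbrakk> \<Longrightarrow> scal (self_module K) A c x = c \<odot>\<^bsub>A\<^esub> x"
  by (simp add: scal_def)

text \<open>With \<open>K\<close> as an algebra over itself, the scalar relation and the balancing
  relation involve the same action, so being balanced amounts to being bilinear.\<close>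

sublocale ES: tensor_pair K "self_module K" A A
  by (intro tensor_pair.intro tensor_pair_axioms.intro K.field_axioms A.abelian_group_axioms)
    (auto simp: scal_K)

lemma env_simps [simp]:
  "carrier E = carrier (env_space K A)" "add E = add (env_space K A)" "zero E = zero (env_space K A)"
  "smult E = smult (env_space K A)" "one E = pure \<one>\<^bsub>A\<^esub> \<one>\<^bsub>A\<^esub>"
  by (simp_all add: env_def)

lemma pure_smult_left: "\<lbrakk>c \<in> carrier K; a \<in> carrier A; b \<in> carrier A\<rbrakk> \<Longrightarrow> pure (c \<odot>\<^bsub>A\<^esub> a) b = c \<odot>\<^bsub>env_space K A\<^esub> pure a b"
  using ES.pure_scal[of c a b] by (simp add: scal_K)

lemma pure_smult_right: "\<lbrakk>c \<in> carrier K; a \<in> carrier A; b \<in> carrier A\<rbrakk> \<Longrightarrow> pure a (c \<odot>\<^bsub>A\<^esub> b) = c \<odot>\<^bsub>env_space K A\<^esub> pure a b"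
  using ES.pure_act[of c a b] pure_smult_left[of c a b] by simp

lemma env_balancedI:
  assumes "\<And>a b. \<lbrakk>a \<in> carrier A; b \<in> carrier A\<rbrakk> \<Longrightarrow> f a b \<in> carrier V"
    and "\<And>a a' b. \<lbrakk>a \<in> carrier A; a' \<in> carrier A; b \<in> carrier A\<rbrakk> \<Longrightarrow> f (a \<oplus>\<^bsub>A\<^esub> a') b = f a b \<oplus>\<^bsub>V\<^esub> f a' b"
    and "\<And>a b b'. \<lbrakk>a \<in> carrier A; b \<in> carrier A; b' \<in> carrier A\<rbrakk> \<Longrightarrow> f a (b \<oplus>\<^bsub>A\<^esub> b') = f a b \<oplus>\<^bsub>V\<^esub> f a b'"
    and "\<And>c a b. \<lbrakk>c \<in> carrier K; a \<in> carrier A; b \<in> carrier A\<rbrakk> \<Longrightarrow> f (c \<odot>\<^bsub>A\<^esub> a) b = c \<odot>\<^bsub>V\<^esub> f a b"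
    and "\<And>c a b. \<lbrakk>c \<in> carrier K; a \<in> carrier A; b \<in> carrier A\<rbrakk> \<Longrightarrow> f a (c \<odot>\<^bsub>A\<^esub> b) = c \<odot>\<^bsub>V\<^esub> f a b"
  shows "ES.balanced V f"
  unfolding ES.balanced_def using assms by (simp add: scal_K)

text \<open>Left multiplication by the pure tensor of \<open>a\<close> and \<open>b\<close>. It is
  the inner one of the two nested lifts that define the product in \<open>env\<close>.\<close>

definition inner :: "'g \<Rightarrow> 'g \<Rightarrow> ('k, 'g) env_elt \<Rightarrow> ('k, 'g) env_elt" where
  "inner a b Y = tensor_lift K (env_space K A) (\<lambda>(c, d). pure (a \<otimes>\<^bsub>A\<^esub> c) (d \<otimes>\<^bsub>A\<^esub> b)) Y"

lemma inner_balanced: "\<lbrakk>a \<in> carrier A; b \<in> carrier A\<rbrakk> \<Longrightarrow>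
    ES.balanced (env_space K A) (\<lambda>c d. pure (a \<otimes>\<^bsub>A\<^esub> c) (d \<otimes>\<^bsub>A\<^esub> b))"
  by (intro env_balancedI)
    (simp_all add: A.l_distr A.r_distr ES.pure_add_left ES.pure_add_right smult_mult_left smult_mult_right
      pure_smult_left pure_smult_right)

lemma inner_lin: "\<lbrakk>a \<in> carrier A; b \<in> carrier A\<rbrakk> \<Longrightarrow> lin_map K (env_space K A) (env_space K A) (inner a b)"
  using ES.lift_lin[OF ES.lmodule_tensor inner_balanced] unfolding inner_def .

lemma inner_pure: "\<lbrakk>a \<in> carrier A; b \<in> carrier A; c \<in> carrier A; d \<in> carrier A\<rbrakk> \<Longrightarrow>
    inner a b (pure c d) = pure (a \<otimes>\<^bsub>A\<^esub> c) (d \<otimes>\<^bsub>A\<^esub> b)"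
  unfolding inner_def by (rule ES.lift_pure[OF ES.lmodule_tensor inner_balanced])

text \<open>Each bilinearity law in \<open>a\<close> and \<open>b\<close> is an equality of linear
  maps in \<open>Y\<close>, so pure \<open>Y\<close> suffice.\<close>

lemma inner_balanced2:
  assumes Y: "Y \<in> carrier (env_space K A)"
  shows "ES.balanced (env_space K A) (\<lambda>a b. inner a b Y)"
proof -
  note S = ES.lmodule_tensor
  show ?thesis
  proof (rule env_balancedI)
    show "inner a b Y \<in> carrier (env_space K A)" if "a \<in> carrier A" "b \<in> carrier A" for a b
      using lin_map_closed[OF inner_lin[OF that] Y] .
    show "inner (a \<oplus>\<^bsub>A\<^esub> a') b Y = inner a b Y \<oplus>\<^bsub>env_space K A\<^esub> inner a' b Y"
      if "a \<in> carrier A" "a' \<in> carrier A" "b \<in> carrier A" for a a' b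
      by (rule ES.tensor_map_eqI[OF Y S inner_lin lin_map_add_fun[OF S S inner_lin inner_lin]])
        (simp_all add: that inner_pure A.l_distr ES.pure_add_left)
    show "inner a (b \<oplus>\<^bsub>A\<^esub> b') Y = inner a b Y \<oplus>\<^bsub>env_space K A\<^esub> inner a b' Y"
      if "a \<in> carrier A" "b' \<in> carrier A" "b \<in> carrier A" for a b' b
      by (rule ES.tensor_map_eqI[OF Y S inner_lin lin_map_add_fun[OF S S inner_lin inner_lin]])
        (simp_all add: that inner_pure A.r_distr ES.pure_add_right)
    show "inner (c \<odot>\<^bsub>A\<^esub> a) b Y = c \<odot>\<^bsub>env_space K A\<^esub> inner a b Y"
      if "c \<in> carrier K" "a \<in> carrier A" "b \<in> carrier A" for c a b
      by (rule ES.tensor_map_eqI[OF Y S inner_lin lin_map_smult_comp[OF K.is_cring S inner_lin]])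
        (simp_all add: that inner_pure smult_mult_left pure_smult_left)
    show "inner a (c \<odot>\<^bsub>A\<^esub> b) Y = c \<odot>\<^bsub>env_space K A\<^esub> inner a b Y"
      if "c \<in> carrier K" "a \<in> carrier A" "b \<in> carrier A" for c a b
      by (rule ES.tensor_map_eqI[OF Y S inner_lin lin_map_smult_comp[OF K.is_cring S inner_lin]])
        (simp_all add: that inner_pure smult_mult_right pure_smult_right)
  qed
qed

lemma env_mult: "X \<otimes>\<^bsub>E\<^esub> Y = tensor_lift K (env_space K A) (\<lambda>(a, b). inner a b Y) X"
  by (simp add: env_def inner_def)

lemma mult_lin_left: "Y \<in> carrier (env_space K A) \<Longrightarrow> lin_map K (env_space K A) (env_space K A) (\<lambda>X. X \<otimes>\<^bsub>E\<^esub> Y)"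
  unfolding env_mult by (rule ES.lift_lin[OF ES.lmodule_tensor inner_balanced2])

lemma pure_mult: "\<lbrakk>a \<in> carrier A; b \<in> carrier A; Y \<in> carrier (env_space K A)\<rbrakk> \<Longrightarrow> pure a b \<otimes>\<^bsub>E\<^esub> Y = inner a b Y"
  unfolding env_mult by (rule ES.lift_pure[OF ES.lmodule_tensor inner_balanced2])

lemma env_mult_closed: "\<lbrakk>X \<in> carrier (env_space K A); Y \<in> carrier (env_space K A)\<rbrakk> \<Longrightarrow> X \<otimes>\<^bsub>E\<^esub> Y \<in> carrier (env_space K A)"
  by (rule lin_map_closed[OF mult_lin_left])

lemma mult_lin_right:
  assumes X: "X \<in> carrier (env_space K A)"
  shows "lin_map K (env_space K A) (env_space K A) (\<lambda>Y. X \<otimes>\<^bsub>E\<^esub> Y)"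
proof (rule lin_mapI)
  note S = ES.lmodule_tensor
  show "X \<otimes>\<^bsub>E\<^esub> Y \<in> carrier (env_space K A)" if "Y \<in> carrier (env_space K A)" for Y
    by (rule env_mult_closed[OF X that])
  show "X \<otimes>\<^bsub>E\<^esub> (Y \<oplus>\<^bsub>env_space K A\<^esub> Z) = X \<otimes>\<^bsub>E\<^esub> Y \<oplus>\<^bsub>env_space K A\<^esub> X \<otimes>\<^bsub>E\<^esub> Z"
    if "Y \<in> carrier (env_space K A)" "Z \<in> carrier (env_space K A)" for Y Z
    by (rule ES.tensor_map_eqI[OF X S mult_lin_left lin_map_add_fun[OF S S mult_lin_left mult_lin_left]])
      (simp_all add: that pure_mult lin_map_add[OF inner_lin])
  show "X \<otimes>\<^bsub>E\<^esub> (c \<odot>\<^bsub>env_space K A\<^esub> Y) = c \<odot>\<^bsub>env_space K A\<^esub> (X \<otimes>\<^bsub>E\<^esub> Y)"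
    if "c \<in> carrier K" "Y \<in> carrier (env_space K A)" for c Y
    by (rule ES.tensor_map_eqI[OF X S mult_lin_left lin_map_smult_comp[OF K.is_cring S mult_lin_left]])
      (simp_all add: that pure_mult lin_map_smult[OF inner_lin])
qed

lemma pure_mult_pure: "\<lbrakk>a \<in> carrier A; b \<in> carrier A; c \<in> carrier A; d \<in> carrier A\<rbrakk> \<Longrightarrow>
    pure a b \<otimes>\<^bsub>E\<^esub> pure c d = pure (a \<otimes>\<^bsub>A\<^esub> c) (d \<otimes>\<^bsub>A\<^esub> b)"
  by (simp add: pure_mult inner_pure)

text \<open>Both sides are linear in each of the three variables; reducing these in turn to pure
  tensors leaves associativity in \<open>A\<close>.\<close>

lemma env_assoc:
  assumes X: "X \<in> carrier (env_space K A)" and Y: "Y \<in> carrier (env_space K A)" and Z: "Z \<in> carrier (env_space K A)"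
  shows "X \<otimes>\<^bsub>E\<^esub> Y \<otimes>\<^bsub>E\<^esub> Z = X \<otimes>\<^bsub>E\<^esub> (Y \<otimes>\<^bsub>E\<^esub> Z)"
proof (rule ES.tensor_map_eqI[OF X ES.lmodule_tensor lin_map_comp[OF mult_lin_left[OF Y] mult_lin_left[OF Z]]
      mult_lin_left[OF env_mult_closed[OF Y Z]]])
  fix a b assume ab: "a \<in> carrier A" "b \<in> carrier A"
  then have p1: "pure a b \<in> carrier (env_space K A)" by simp
  show "pure a b \<otimes>\<^bsub>E\<^esub> Y \<otimes>\<^bsub>E\<^esub> Z = pure a b \<otimes>\<^bsub>E\<^esub> (Y \<otimes>\<^bsub>E\<^esub> Z)"
  proof (rule ES.tensor_map_eqI[OF Y ES.lmodule_tensor lin_map_comp[OF mult_lin_right[OF p1] mult_lin_left[OF Z]]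
        lin_map_comp[OF mult_lin_left[OF Z] mult_lin_right[OF p1]]])
    fix c d assume cd: "c \<in> carrier A" "d \<in> carrier A"
    then have p2: "pure c d \<in> carrier (env_space K A)" by simp
    show "pure a b \<otimes>\<^bsub>E\<^esub> pure c d \<otimes>\<^bsub>E\<^esub> Z = pure a b \<otimes>\<^bsub>E\<^esub> (pure c d \<otimes>\<^bsub>E\<^esub> Z)"
      by (rule ES.tensor_map_eqI[OF Z ES.lmodule_tensor mult_lin_right[OF env_mult_closed[OF p1 p2]]
            lin_map_comp[OF mult_lin_right[OF p2] mult_lin_right[OF p1]]])
        (simp add: ab cd pure_mult_pure A.m_assoc)
  qed
qed

lemma lmodule_env: "lmodule K E"
  by (rule lmodule_cong_record[OF ES.lmodule_tensor]) simp_all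

lemma env_one:
  assumes X: "X \<in> carrier (env_space K A)"
  shows "pure \<one>\<^bsub>A\<^esub> \<one>\<^bsub>A\<^esub> \<otimes>\<^bsub>E\<^esub> X = X" "X \<otimes>\<^bsub>E\<^esub> pure \<one>\<^bsub>A\<^esub> \<one>\<^bsub>A\<^esub> = X"
proof -
  have id: "lin_map K (env_space K A) (env_space K A) (\<lambda>X. X)" by (auto intro: lin_mapI)
  have o: "pure \<one>\<^bsub>A\<^esub> \<one>\<^bsub>A\<^esub> \<in> carrier (env_space K A)" by simp
  show "pure \<one>\<^bsub>A\<^esub> \<one>\<^bsub>A\<^esub> \<otimes>\<^bsub>E\<^esub> X = X"
    by (rule ES.tensor_map_eqI[OF X ES.lmodule_tensor mult_lin_right[OF o] id]) (simp add: pure_mult_pure)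
  show "X \<otimes>\<^bsub>E\<^esub> pure \<one>\<^bsub>A\<^esub> \<one>\<^bsub>A\<^esub> = X"
    by (rule ES.tensor_map_eqI[OF X ES.lmodule_tensor mult_lin_left[OF o] id]) (simp add: pure_mult_pure)
qed

lemma k_alg_env: "k_alg K E"
proof -
  interpret E: lmodule K E by (rule lmodule_env)
  have "ring E"
  proof (rule ringI)
    show "abelian_group E" by (rule E.M.abelian_group_axioms)
    show "monoid E" by (rule monoidI) (simp_all add: env_mult_closed env_assoc env_one)
  qed (simp_all add: lin_map_add[OF mult_lin_left] lin_map_add[OF mult_lin_right])
  moreover have "module K E"
    by (rule moduleI[OF K.is_cring E.M.abelian_group_axioms E.smult_closed E.smult_l_distr E.smult_r_distr
          E.smult_assoc1 E.smult_one])
  moreover have "k_algebra_axioms K E"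
    by (rule k_algebra_axioms.intro) (simp_all add: lin_map_smult[OF mult_lin_left] lin_map_smult[OF mult_lin_right])
  ultimately show ?thesis by (intro k_alg.intro k_algebra.intro K.field_axioms)
qed

lemma fin_gen_env:
  assumes "fin_gen K A"
  shows "fin_gen K E"
proof -
  obtain S l where S: "finite S" "S \<subseteq> carrier A" "\<And>s. s \<in> S \<Longrightarrow> functional K A (l s)"
    "\<And>x. x \<in> carrier A \<Longrightarrow> x = (\<Oplus>\<^bsub>A\<^esub>s\<in>S. l s x \<odot>\<^bsub>A\<^esub> s)"
    by (rule fin_gen_functionals[OF K.field_axioms lmodule_K assms]) (rule that)
  have lc: "l s x \<in> carrier K" if "s \<in> S" "x \<in> carrier A" for s x using lin_map_closed[OF S(3)[OF that(1)] that(2)] by simp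
  show ?thesis
  proof (rule fin_genI[OF lmodule_env, where S = "(\<lambda>(s, s'). pure s s') ` (S \<times> S)"])
    show "(\<lambda>(s, s'). pure s s') ` (S \<times> S) \<subseteq> carrier E" using S(2) by (auto simp: subset_iff)
    fix Y assume Y: "submodule Y K E" and sub: "(\<lambda>(s, s'). pure s s') ` (S \<times> S) \<subseteq> Y"
    interpret E: lmodule K E by (rule lmodule_env)
    have 1: "pure a s \<in> Y" if a: "a \<in> carrier A" and s: "s \<in> S" for a s
    proof -
      have sA: "s \<in> carrier A" using s S(2) by auto
      have L: "lin_map K A E (\<lambda>a. pure a s)"
        using sA by (intro lin_mapI) (auto simp: ES.pure_add_left pure_smult_left)
      have "pure a s = pure (\<Oplus>\<^bsub>A\<^esub>r\<in>S. l r a \<odot>\<^bsub>A\<^esub> r) s" by (rule arg_cong[where f = "\<lambda>a. pure a s", OF S(4)[OF a]])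
      also have "\<dots> = (\<Oplus>\<^bsub>E\<^esub>r\<in>S. pure (l r a \<odot>\<^bsub>A\<^esub> r) s)"
        using lc[OF _ a] S(2) by (intro lin_map_finsum[OF lmodule_K lmodule_env L]) auto
      finally have eq: "pure a s = (\<Oplus>\<^bsub>E\<^esub>r\<in>S. pure (l r a \<odot>\<^bsub>A\<^esub> r) s)" .
      have "pure (l r a \<odot>\<^bsub>A\<^esub> r) s \<in> Y" if r: "r \<in> S" for r
      proof -
        have "pure r s \<in> Y" using sub r s by force
        moreover have "r \<in> carrier A" using r S(2) by auto
        ultimately show ?thesis
          using submodule_smult[OF lmodule_env Y lc[OF r a], of "pure r s"] pure_smult_left[OF lc[OF r a]] sA by simp
      qed
      then show ?thesis unfolding eq by (intro submodule_finsum[OF lmodule_env Y]) auto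
    qed
    have 2: "pure a b \<in> Y" if a: "a \<in> carrier A" and b: "b \<in> carrier A" for a b
    proof -
      have L: "lin_map K A E (\<lambda>b. pure a b)"
        using a by (intro lin_mapI) (auto simp: ES.pure_add_right pure_smult_right)
      have "pure a b = pure a (\<Oplus>\<^bsub>A\<^esub>r\<in>S. l r b \<odot>\<^bsub>A\<^esub> r)" by (rule arg_cong[OF S(4)[OF b]])
      also have "\<dots> = (\<Oplus>\<^bsub>E\<^esub>r\<in>S. pure a (l r b \<odot>\<^bsub>A\<^esub> r))"
        using lc[OF _ b] S(2) by (intro lin_map_finsum[OF lmodule_K lmodule_env L]) auto
      finally have eq: "pure a b = (\<Oplus>\<^bsub>E\<^esub>r\<in>S. pure a (l r b \<odot>\<^bsub>A\<^esub> r))" .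
      have "pure a (l r b \<odot>\<^bsub>A\<^esub> r) \<in> Y" if r: "r \<in> S" for r
      proof -
        have "r \<in> carrier A" using r S(2) by auto
        then show ?thesis
          using submodule_smult[OF lmodule_env Y lc[OF r b] 1[OF a r]] pure_smult_right[OF lc[OF r b] a] by simp
      qed
      then show ?thesis unfolding eq by (intro submodule_finsum[OF lmodule_env Y]) auto
    qed
    show "carrier E \<subseteq> Y"
    proof
      fix X assume "X \<in> carrier E"
      then have "X \<in> carrier (env_space K A)" by simp
      then show "X \<in> Y"
      proof (induction rule: ES.tensor_induct)
        case (pure x y)
        then show ?case by (rule 2)
      next
        case (add X Z)
        then show ?case using submodule_add[OF lmodule_env Y, of X Z] by simp
      qed
    qed
  qed (use S(1) in simp)
qed

text \<open>The map f \<otimes> g. A ring homomorphism of \<open>A\<close> is also one of the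
  opposite algebra, so for automorphisms the second factor calls for no change of
  \<open>g\<close>.\<close>

definition env_map :: "('g \<Rightarrow> 'g) \<Rightarrow> ('g \<Rightarrow> 'g) \<Rightarrow> ('k, 'g) env_elt \<Rightarrow> ('k, 'g) env_elt" where
  "env_map f g = tensor_lift K (env_space K A) (\<lambda>(a, b). pure (f a) (g b))"

context
  fixes f g :: "'g \<Rightarrow> 'g"
  assumes f: "lin_map K A A f" and g: "lin_map K A A g"
begin

lemma env_map_balanced: "ES.balanced (env_space K A) (\<lambda>a b. pure (f a) (g b))"
  using lin_map_closed[OF f] lin_map_closed[OF g] lin_map_add[OF f] lin_map_add[OF g] lin_map_smult[OF f] lin_map_smult[OF g]
  by (intro env_balancedI) (simp_all add: ES.pure_add_left ES.pure_add_right pure_smult_left pure_smult_right)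

lemma env_map_lin: "lin_map K (env_space K A) (env_space K A) (env_map f g)"
  unfolding env_map_def by (rule ES.lift_lin[OF ES.lmodule_tensor env_map_balanced])

lemma env_map_pure: "\<lbrakk>a \<in> carrier A; b \<in> carrier A\<rbrakk> \<Longrightarrow> env_map f g (pure a b) = pure (f a) (g b)"
  unfolding env_map_def by (rule ES.lift_pure[OF ES.lmodule_tensor env_map_balanced])

end

lemma env_map_inverse:
  assumes l: "lin_map K A A f" "lin_map K A A g" "lin_map K A A f'" "lin_map K A A g'"
    and i: "\<And>a. a \<in> carrier A \<Longrightarrow> f (f' a) = a" "\<And>a. a \<in> carrier A \<Longrightarrow> g (g' a) = a"
    and X: "X \<in> carrier (env_space K A)"
  shows "env_map f g (env_map f' g' X) = X"
proof (rule ES.tensor_map_eqI[OF X ES.lmodule_tensor lin_map_comp[OF env_map_lin[OF l(3,4)] env_map_lin[OF l(1,2)]]])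
  show "lin_map K (env_space K A) (env_space K A) (\<lambda>X. X)" by (auto intro: lin_mapI)
qed (simp add: env_map_pure[OF l(1,2)] env_map_pure[OF l(3,4)] lin_map_closed[OF l(3)] lin_map_closed[OF l(4)] i)

lemma aut_inv_aut:
  assumes "algebra_aut K A f" shows "algebra_aut K A (inv_into (carrier A) f)"
proof -
  have iso: "f \<in> ring_iso A A" using assms by (simp add: algebra_aut_def)
  have "lin_map K A A (inv_into (carrier A) f)"
  proof (rule lin_mapI)
    note h = aut_inv_hom[OF assms]
    fix a assume a: "a \<in> carrier A" then show "inv_into (carrier A) f a \<in> carrier A" by (rule ring_hom_closed[OF h])
    fix b assume "b \<in> carrier A" then show "inv_into (carrier A) f (a \<oplus>\<^bsub>A\<^esub> b) = inv_into (carrier A) f a \<oplus>\<^bsub>A\<^esub> inv_into (carrier A) f b"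
      using a by (rule ring_hom_add[OF h, rotated])
  next
    note h = aut_inv_hom[OF assms]
    fix c a assume ca: "c \<in> carrier K" "a \<in> carrier A"
    then have ia: "inv_into (carrier A) f a \<in> carrier A" by (intro ring_hom_closed[OF h])
    have "f (c \<odot>\<^bsub>A\<^esub> inv_into (carrier A) f a) = c \<odot>\<^bsub>A\<^esub> a"
      using lin_map_smult[OF aut_lin[OF assms] ca(1) ia] aut_inv(1)[OF assms ca(2)] by simp
    then show "inv_into (carrier A) f (c \<odot>\<^bsub>A\<^esub> a) = c \<odot>\<^bsub>A\<^esub> inv_into (carrier A) f a"
      using aut_inv(2)[OF assms, of "c \<odot>\<^bsub>A\<^esub> inv_into (carrier A) f a"] ca ia by simp
  qed
  then show ?thesis using ring_iso_set_sym[OF A.ring_axioms iso] by (simp add: algebra_aut_def)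
qed

lemma algebra_aut_id: "algebra_aut K A (\<lambda>a. a)"
  by (auto simp: algebra_aut_def ring_iso_def ring_hom_def bij_betw_def lin_map_def)

text \<open>The inverses of \<open>f\<close> and \<open>g\<close> induce the inverse map, and
  multiplicativity reduces to pure tensors.\<close>

lemma algebra_aut_env_map:
  assumes f: "algebra_aut K A f" and g: "algebra_aut K A g"
  shows "algebra_aut K E (env_map f g)"
proof -
  let ?f' = "inv_into (carrier A) f" and ?g' = "inv_into (carrier A) g"
  note fl = aut_lin[OF f] and gl = aut_lin[OF g] and fl' = aut_lin[OF aut_inv_aut[OF f]] and gl' = aut_lin[OF aut_inv_aut[OF g]]
  note L = env_map_lin[OF fl gl] and L' = env_map_lin[OF fl' gl']
  have "lin_map K E E (env_map f g)" using L by (simp add: lin_map_def)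
  moreover have "bij_betw (env_map f g) (carrier (env_space K A)) (carrier (env_space K A))"
  proof (rule bij_betwI[of _ _ _ "env_map ?f' ?g'"])
    fix X assume X: "X \<in> carrier (env_space K A)"
    show "env_map ?f' ?g' (env_map f g X) = X"
      by (rule env_map_inverse[OF fl' gl' fl gl aut_inv(2)[OF f] aut_inv(2)[OF g] X])
    show "env_map f g (env_map ?f' ?g' X) = X"
      by (rule env_map_inverse[OF fl gl fl' gl' aut_inv(1)[OF f] aut_inv(1)[OF g] X])
  qed (use lin_map_closed[OF L] lin_map_closed[OF L'] in blast)+
  moreover have "env_map f g (X \<otimes>\<^bsub>E\<^esub> Y) = env_map f g X \<otimes>\<^bsub>E\<^esub> env_map f g Y"
    if X: "X \<in> carrier (env_space K A)" and Y: "Y \<in> carrier (env_space K A)" for X Y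
  proof (rule ES.tensor_map_eqI[OF X ES.lmodule_tensor lin_map_comp[OF mult_lin_left[OF Y] L]
        lin_map_comp[OF L mult_lin_left[OF lin_map_closed[OF L Y]]]])
    fix a b assume ab: "a \<in> carrier A" "b \<in> carrier A"
    then have p: "pure a b \<in> carrier (env_space K A)" by simp
    show "env_map f g (pure a b \<otimes>\<^bsub>E\<^esub> Y) = env_map f g (pure a b) \<otimes>\<^bsub>E\<^esub> env_map f g Y"
    proof (rule ES.tensor_map_eqI[OF Y ES.lmodule_tensor lin_map_comp[OF mult_lin_right[OF p] L]
          lin_map_comp[OF L mult_lin_right[OF lin_map_closed[OF L p]]]])
      fix c d assume "c \<in> carrier A" "d \<in> carrier A"
      then show "env_map f g (pure a b \<otimes>\<^bsub>E\<^esub> pure c d) = env_map f g (pure a b) \<otimes>\<^bsub>E\<^esub> env_map f g (pure c d)"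
        using ab ring_hom_mult[OF aut_hom[OF f]] ring_hom_mult[OF aut_hom[OF g]]
        by (simp add: pure_mult_pure env_map_pure[OF fl gl] lin_map_closed[OF fl] lin_map_closed[OF gl])
    qed
  qed
  moreover have "env_map f g (pure \<one>\<^bsub>A\<^esub> \<one>\<^bsub>A\<^esub>) = pure \<one>\<^bsub>A\<^esub> \<one>\<^bsub>A\<^esub>"
    using ring_hom_one[OF aut_hom[OF f]] ring_hom_one[OF aut_hom[OF g]] by (simp add: env_map_pure[OF fl gl])
  ultimately show ?thesis
    using lin_map_closed[OF L] lin_map_add[OF L] by (auto simp: algebra_aut_def ring_iso_def ring_hom_def)
qed

end

subsection \<open>Bimodules as modules over the enveloping algebra\<close>

locale bimod_alg = k_alg K A + bimodule K A B
  for K :: "'k ring" (structure) and A :: "('k, 'g) module" (structure) and B :: "('k, 'g, 'b) bimod" (structure)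
begin

lemma abelian_group_B: "abelian_group B"
  by unfold_locales

lemma lmodule_B: "lmodule K B"
  by (intro lmodule.intro lmodule_axioms.intro)
    (auto simp: K.ring_axioms abelian_group_B B.smult_l_distr B.smult_r_distr B.smult_assoc1)

lemma act_closed: "\<lbrakk>a \<in> carrier A; x \<in> carrier B\<rbrakk> \<Longrightarrow> lact B a x \<in> carrier B"
  "\<lbrakk>a \<in> carrier A; x \<in> carrier B\<rbrakk> \<Longrightarrow> ract B x a \<in> carrier B"
  using lin_map_closed[OF lact_lin] lin_map_closed[OF ract_lin] by blast+

lemma act_add: "\<lbrakk>a \<in> carrier A; x \<in> carrier B; y \<in> carrier B\<rbrakk> \<Longrightarrow> lact B a (x \<oplus>\<^bsub>B\<^esub> y) = lact B a x \<oplus>\<^bsub>B\<^esub> lact B a y"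
  "\<lbrakk>a \<in> carrier A; x \<in> carrier B; y \<in> carrier B\<rbrakk> \<Longrightarrow> ract B (x \<oplus>\<^bsub>B\<^esub> y) a = ract B x a \<oplus>\<^bsub>B\<^esub> ract B y a"
  using lin_map_add[OF lact_lin] lin_map_add[OF ract_lin] by blast+

lemma act_smult: "\<lbrakk>a \<in> carrier A; c \<in> carrier K; x \<in> carrier B\<rbrakk> \<Longrightarrow> lact B a (c \<odot>\<^bsub>B\<^esub> x) = c \<odot>\<^bsub>B\<^esub> lact B a x"
  "\<lbrakk>a \<in> carrier A; c \<in> carrier K; x \<in> carrier B\<rbrakk> \<Longrightarrow> ract B (c \<odot>\<^bsub>B\<^esub> x) a = c \<odot>\<^bsub>B\<^esub> ract B x a"
  using lin_map_smult[OF lact_lin] lin_map_smult[OF ract_lin] by blast+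

lemma left_balanced: "x \<in> carrier B \<Longrightarrow> ES.balanced B (\<lambda>a a'. ract B (lact B a x) a')"
  by (intro env_balancedI) (simp_all add: act_closed act_add act_smult lact_add ract_add lact_smult ract_smult)

lemma right_balanced: "x \<in> carrier B \<Longrightarrow> ES.balanced B (\<lambda>a a'. ract B (lact B a' x) a)"
  by (intro env_balancedI) (simp_all add: act_closed act_add act_smult lact_add ract_add lact_smult ract_smult)

lemma env_left_simps [simp]:
  "carrier (env_left K B) = carrier B" "zero (env_left K B) = zero B" "add (env_left K B) = add B"
  by (simp_all add: env_left_def)

lemma env_right_simps [simp]:
  "carrier (env_right K B) = carrier B" "zero (env_right K B) = zero B" "add (env_right K B) = add B"
  by (simp_all add: env_right_def)

lemma env_left_lin: "x \<in> carrier B \<Longrightarrow> lin_map K (env_space K A) B (\<lambda>X. X \<odot>\<^bsub>env_left K B\<^esub> x)"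
  unfolding env_left_def with_smult_simps by (rule ES.lift_lin[OF lmodule_B left_balanced])

lemma env_right_lin: "x \<in> carrier B \<Longrightarrow> lin_map K (env_space K A) B (\<lambda>X. X \<odot>\<^bsub>env_right K B\<^esub> x)"
  unfolding env_right_def with_smult_simps by (rule ES.lift_lin[OF lmodule_B right_balanced])

lemma env_left_pure: "\<lbrakk>x \<in> carrier B; a \<in> carrier A; a' \<in> carrier A\<rbrakk> \<Longrightarrow>
    pure a a' \<odot>\<^bsub>env_left K B\<^esub> x = ract B (lact B a x) a'"
  unfolding env_left_def with_smult_simps by (rule ES.lift_pure[OF lmodule_B left_balanced])

lemma env_right_pure: "\<lbrakk>x \<in> carrier B; a \<in> carrier A; a' \<in> carrier A\<rbrakk> \<Longrightarrow>
    pure a a' \<odot>\<^bsub>env_right K B\<^esub> x = ract B (lact B a' x) a"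
  unfolding env_right_def with_smult_simps by (rule ES.lift_pure[OF lmodule_B right_balanced])

lemma env_left_lin2:
  assumes X: "X \<in> carrier (env_space K A)"
  shows "lin_map K B B (\<lambda>x. X \<odot>\<^bsub>env_left K B\<^esub> x)"
proof (rule lin_mapI)
  show "X \<odot>\<^bsub>env_left K B\<^esub> x \<in> carrier B" if "x \<in> carrier B" for x by (rule lin_map_closed[OF env_left_lin[OF that] X])
  show "X \<odot>\<^bsub>env_left K B\<^esub> (x \<oplus>\<^bsub>B\<^esub> y) = X \<odot>\<^bsub>env_left K B\<^esub> x \<oplus>\<^bsub>B\<^esub> X \<odot>\<^bsub>env_left K B\<^esub> y"
    if xy: "x \<in> carrier B" "y \<in> carrier B" for x y
    by (rule ES.tensor_map_eqI[OF X lmodule_B env_left_lin lin_map_add_fun[OF ES.lmodule_tensor lmodule_B env_left_lin env_left_lin]])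
      (simp_all add: xy env_left_pure act_add act_closed)
  show "X \<odot>\<^bsub>env_left K B\<^esub> (c \<odot>\<^bsub>B\<^esub> x) = c \<odot>\<^bsub>B\<^esub> (X \<odot>\<^bsub>env_left K B\<^esub> x)"
    if xy: "c \<in> carrier K" "x \<in> carrier B" for c x
    by (rule ES.tensor_map_eqI[OF X lmodule_B env_left_lin lin_map_smult_comp[OF K.is_cring lmodule_B env_left_lin]])
      (simp_all add: xy env_left_pure act_smult act_closed)
qed

text \<open>On pure tensors this is associativity of the two actions and their commutation; the
  reversed product in the second factor fits the right action.\<close>

lemma env_left_assoc:
  assumes X: "X \<in> carrier (env_space K A)" and Y: "Y \<in> carrier (env_space K A)" and x: "x \<in> carrier B"
  shows "(X \<otimes>\<^bsub>E\<^esub> Y) \<odot>\<^bsub>env_left K B\<^esub> x = X \<odot>\<^bsub>env_left K B\<^esub> (Y \<odot>\<^bsub>env_left K B\<^esub> x)"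
proof (rule ES.tensor_map_eqI[OF X lmodule_B lin_map_comp[OF mult_lin_left[OF Y] env_left_lin[OF x]]
      env_left_lin[OF lin_map_closed[OF env_left_lin[OF x] Y]]])
  fix a b assume ab: "a \<in> carrier A" "b \<in> carrier A"
  then have p: "pure a b \<in> carrier (env_space K A)" by simp
  show "(pure a b \<otimes>\<^bsub>E\<^esub> Y) \<odot>\<^bsub>env_left K B\<^esub> x = pure a b \<odot>\<^bsub>env_left K B\<^esub> (Y \<odot>\<^bsub>env_left K B\<^esub> x)"
    by (rule ES.tensor_map_eqI[OF Y lmodule_B lin_map_comp[OF mult_lin_right[OF p] env_left_lin[OF x]]
          lin_map_comp[OF env_left_lin[OF x] env_left_lin2[OF p]]])
      (simp add: ab x pure_mult_pure env_left_pure act_closed lact_mult ract_mult lact_ract)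
qed

lemma lmodule_env_left: "lmodule E (env_left K B)"
proof -
  interpret E: k_alg K E by (rule k_alg_env)
  have "abelian_group (env_left K B)"
    by (rule abelian_group_cong_record[OF abelian_group_B]) simp_all
  then show ?thesis
    by (intro lmodule.intro lmodule_axioms.intro E.A.ring_axioms)
      (simp_all add: lin_map_closed[OF env_left_lin] lin_map_add[OF env_left_lin] lin_map_add[OF env_left_lin2]
        env_left_assoc env_left_pure lact_one ract_one)
qed

lemma scal_env_left: "\<lbrakk>c \<in> carrier K; x \<in> carrier B\<rbrakk> \<Longrightarrow> scal E (env_left K B) c x = c \<odot>\<^bsub>B\<^esub> x"
  by (simp add: scal_def lin_map_smult[OF env_left_lin] env_left_pure lact_one ract_one)

lemma scal_env_right: "\<lbrakk>c \<in> carrier K; x \<in> carrier B\<rbrakk> \<Longrightarrow> scal E (env_right K B) c x = c \<odot>\<^bsub>B\<^esub> x"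
  by (simp add: scal_def lin_map_smult[OF env_right_lin] env_right_pure lact_one ract_one)

text \<open>The enveloping algebra is finite-dimensional, hence so are its finitely generated
  modules.\<close>

lemma fin_gen_B:
  assumes "fin_gen K A" "fin_gen E (env_left K B)"
  shows "fin_gen K B"
proof -
  interpret E: k_alg K E by (rule k_alg_env)
  have "fin_gen K (kmod E (env_left K B))"
    by (rule E.fin_gen_kmod[OF lmodule_env_left fin_gen_env[OF assms(1)] assms(2)])
  then show ?thesis
    by (rule fin_gen_cong_record[OF _ E.lmodule_kmod[OF lmodule_env_left]]) (simp_all add: scal_env_left)
qed

lemma fin_gen_kmod_left:
  assumes "fin_gen K B"
  shows "fin_gen K (kmod E (env_left K B))"
  by (rule fin_gen_cong_record[OF assms lmodule_B]) (simp_all add: scal_env_left)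

lemma bimod_alg_twist:
  assumes f: "algebra_aut K A f" and g: "algebra_aut K A g"
  shows "bimod_alg K A (twist f g B)"
proof -
  have fc: "f a \<in> carrier A" "g a \<in> carrier A" if "a \<in> carrier A" for a
    using lin_map_closed[OF aut_lin[OF f] that] lin_map_closed[OF aut_lin[OF g] that] .
  have eqs: "carrier (twist f g B) = carrier B" "add (twist f g B) = add B" "zero (twist f g B) = zero B"
    "smult (twist f g B) = smult B" "lact (twist f g B) = (\<lambda>a b. lact B (f a) b)" "ract (twist f g B) = (\<lambda>b a. ract B b (g a))"
    by (simp_all add: twist_def)
  have lm: "lin_map K (twist f g B) (twist f g B) h = lin_map K B B h" for h
    by (simp add: lin_map_def eqs)
  have "abelian_group (twist f g B)" by (rule abelian_group_cong_record[OF abelian_group_B]) (simp_all add: eqs)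
  then have "module K (twist f g B)"
    by (intro moduleI K.is_cring) (simp_all add: eqs B.smult_l_distr B.smult_r_distr B.smult_assoc1)
  moreover have "bimodule_axioms K A (twist f g B)"
    by (rule bimodule_axioms.intro)
      (simp_all add: lm eqs fc lact_lin ract_lin lact_add ract_add lact_smult ract_smult lact_mult ract_mult lact_one ract_one lact_ract
        lin_map_add[OF aut_lin[OF f]] lin_map_add[OF aut_lin[OF g]] lin_map_smult[OF aut_lin[OF f]] lin_map_smult[OF aut_lin[OF g]]
        ring_hom_mult[OF aut_hom[OF f]] ring_hom_mult[OF aut_hom[OF g]] ring_hom_one[OF aut_hom[OF f]] ring_hom_one[OF aut_hom[OF g]])
  ultimately show ?thesis by (intro bimod_alg.intro bimodule.intro k_alg_axioms k_algebra_axioms)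
qed

section \<open>The dual bimodule\<close>

lemma dual_simps:
  "f \<in> carrier (dual K B) \<longleftrightarrow> f \<in> extensional (carrier B) \<and> functional K B f"
  "zero (dual K B) = (\<lambda>x\<in>carrier B. \<zero>)" "add (dual K B) = (\<lambda>f g. \<lambda>x\<in>carrier B. f x \<oplus> g x)"
  "c \<in> carrier K \<Longrightarrow> c \<odot>\<^bsub>dual K B\<^esub> f = (\<lambda>x\<in>carrier B. c \<otimes> f x)"
  "lact (dual K B) = (\<lambda>a f. \<lambda>b\<in>carrier B. f (ract B b a))" "ract (dual K B) = (\<lambda>f a. \<lambda>b\<in>carrier B. f (lact B a b))"
proof -
  have "lin_map (self_module K) B (self_module K) f = functional K B f" for f
    by (simp add: lin_map_def)
  then show "f \<in> carrier (dual K B) \<longleftrightarrow> f \<in> extensional (carrier B) \<and> functional K B f"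
    by (simp add: dual_def module.defs bimod.defs)
qed (simp_all add: dual_def module.defs bimod.defs hom_space_def scal_def self_module_def with_smult_def)

lemma dual_functional: "f \<in> carrier (dual K B) \<Longrightarrow> functional K B f"
  by (simp add: dual_simps)

lemma dual_val: "\<lbrakk>f \<in> carrier (dual K B); x \<in> carrier B\<rbrakk> \<Longrightarrow> f x \<in> carrier K"
  using lin_map_closed[OF dual_functional] by simp

lemma dual_eqI: "\<lbrakk>f \<in> carrier (dual K B); g \<in> carrier (dual K B); \<And>x. x \<in> carrier B \<Longrightarrow> f x = g x\<rbrakk> \<Longrightarrow> f = g"
  by (auto simp: dual_simps intro: extensionalityI)

lemma dual_I: "functional K B f \<Longrightarrow> restrict f (carrier B) \<in> carrier (dual K B)"
  using lin_map_cong[OF lmodule_B, of f "restrict f (carrier B)" "self_module K"] by (simp add: dual_simps)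

lemma dual_closed:
  shows dual_add_closed: "\<lbrakk>f \<in> carrier (dual K B); g \<in> carrier (dual K B)\<rbrakk> \<Longrightarrow> f \<oplus>\<^bsub>dual K B\<^esub> g \<in> carrier (dual K B)"
    and dual_smult_closed: "\<lbrakk>c \<in> carrier K; f \<in> carrier (dual K B)\<rbrakk> \<Longrightarrow> c \<odot>\<^bsub>dual K B\<^esub> f \<in> carrier (dual K B)"
    and dual_zero_closed: "\<zero>\<^bsub>dual K B\<^esub> \<in> carrier (dual K B)"
    and dual_lact_closed: "\<lbrakk>a \<in> carrier A; f \<in> carrier (dual K B)\<rbrakk> \<Longrightarrow> lact (dual K B) a f \<in> carrier (dual K B)"
    and dual_ract_closed: "\<lbrakk>a \<in> carrier A; f \<in> carrier (dual K B)\<rbrakk> \<Longrightarrow> ract (dual K B) f a \<in> carrier (dual K B)"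
proof -
  note SK = lmodule_self_module[OF K.ring_axioms]
  show "\<lbrakk>f \<in> carrier (dual K B); g \<in> carrier (dual K B)\<rbrakk> \<Longrightarrow> f \<oplus>\<^bsub>dual K B\<^esub> g \<in> carrier (dual K B)"
    using dual_I[OF lin_map_add_fun[OF lmodule_B SK dual_functional dual_functional, of f g]] by (simp add: dual_simps)
  show "\<lbrakk>c \<in> carrier K; f \<in> carrier (dual K B)\<rbrakk> \<Longrightarrow> c \<odot>\<^bsub>dual K B\<^esub> f \<in> carrier (dual K B)"
    using dual_I[OF lin_map_smult_comp[OF K.is_cring SK dual_functional, of f c]] by (simp add: dual_simps)
  have "functional K B (\<lambda>x. \<zero>)" by (auto intro: lin_mapI)
  then show "\<zero>\<^bsub>dual K B\<^esub> \<in> carrier (dual K B)" using dual_I[of "\<lambda>x. \<zero>"] by (simp add: dual_simps)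
  show "\<lbrakk>a \<in> carrier A; f \<in> carrier (dual K B)\<rbrakk> \<Longrightarrow> lact (dual K B) a f \<in> carrier (dual K B)"
    using dual_I[OF lin_map_comp[OF ract_lin dual_functional, of a f]] by (simp add: dual_simps)
  show "\<lbrakk>a \<in> carrier A; f \<in> carrier (dual K B)\<rbrakk> \<Longrightarrow> ract (dual K B) f a \<in> carrier (dual K B)"
    using dual_I[OF lin_map_comp[OF lact_lin dual_functional, of a f]] by (simp add: dual_simps)
qed

lemma dual_apply:
  "x \<in> carrier B \<Longrightarrow> (f \<oplus>\<^bsub>dual K B\<^esub> g) x = f x \<oplus> g x"
  "\<lbrakk>c \<in> carrier K; x \<in> carrier B\<rbrakk> \<Longrightarrow> (c \<odot>\<^bsub>dual K B\<^esub> f) x = c \<otimes> f x"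
  "x \<in> carrier B \<Longrightarrow> \<zero>\<^bsub>dual K B\<^esub> x = \<zero>"
  "x \<in> carrier B \<Longrightarrow> lact (dual K B) a f x = f (ract B x a)"
  "x \<in> carrier B \<Longrightarrow> ract (dual K B) f a x = f (lact B a x)"
  by (simp_all add: dual_simps)

lemma bimod_alg_dual: "bimod_alg K A (dual K B)"
proof -
  note cl = dual_closed and ap = dual_apply
  have fa: "f (x \<oplus>\<^bsub>B\<^esub> y) = f x \<oplus> f y" if "f \<in> carrier (dual K B)" "x \<in> carrier B" "y \<in> carrier B" for f x y
    using lin_map_add[OF dual_functional[OF that(1)] that(2,3)] by simp
  have fs: "f (c \<odot>\<^bsub>B\<^esub> x) = c \<otimes> f x" if "f \<in> carrier (dual K B)" "c \<in> carrier K" "x \<in> carrier B" for f c x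
    using lin_map_smult[OF dual_functional[OF that(1)] that(2,3)] by simp
  have "abelian_group (dual K B)"
  proof (rule abelian_groupI)
    fix f assume f: "f \<in> carrier (dual K B)"
    have "(\<ominus> \<one>) \<odot>\<^bsub>dual K B\<^esub> f \<oplus>\<^bsub>dual K B\<^esub> f = \<zero>\<^bsub>dual K B\<^esub>"
      using f by (intro dual_eqI cl) (simp_all add: ap dual_val K.l_minus K.l_neg)
    then show "\<exists>g\<in>carrier (dual K B). g \<oplus>\<^bsub>dual K B\<^esub> f = \<zero>\<^bsub>dual K B\<^esub>"
      using cl(2)[of "\<ominus> \<one>" f] f by (intro bexI[of _ "(\<ominus> \<one>) \<odot>\<^bsub>dual K B\<^esub> f"]) auto
  qed ((intro dual_eqI cl; (assumption | simp add: ap dual_val K.a_ac cl)) | (intro cl; assumption))+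
  then have m: "module K (dual K B)"
  proof (rule moduleI[OF K.is_cring])
    show "c \<odot>\<^bsub>dual K B\<^esub> f \<in> carrier (dual K B)" if "c \<in> carrier K" "f \<in> carrier (dual K B)" for c f
      using that by (rule cl)
  qed (intro dual_eqI cl; simp add: ap cl dual_val K.l_distr K.r_distr K.m_assoc)+
  have "bimodule_axioms K A (dual K B)"
  proof (rule bimodule_axioms.intro)
    fix a assume a: "a \<in> carrier A"
    show "lin_map K (dual K B) (dual K B) (lact (dual K B) a)" "lin_map K (dual K B) (dual K B) (\<lambda>b. ract (dual K B) b a)"
      using a by (intro lin_mapI cl dual_eqI; simp add: ap cl act_closed)+
  qed ((intro dual_eqI cl; simp add: ap cl act_closed fa fs lact_add ract_add lact_smult ract_smult lact_mult ract_mult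
        lact_one ract_one lact_ract)+)
  with m show ?thesis by (intro bimod_alg.intro bimodule.intro k_alg_axioms k_algebra_axioms)
qed

end

lemma (in k_alg) bimod_alg_regular: "bimod_alg K A (regular A)"
proof -
  have eqs: "carrier (regular A) = carrier A" "add (regular A) = add A" "zero (regular A) = zero A"
    "smult (regular A) = smult A" "lact (regular A) = mult A" "ract (regular A) = mult A"
    by (simp_all add: regular_def module.defs bimod.defs)
  have "abelian_group (regular A)" by (rule abelian_group_cong_record[OF A.is_abelian_group]) (simp_all add: eqs)
  then have "module K (regular A)"
    by (intro moduleI K.is_cring) (simp_all add: eqs smult_l_distr smult_r_distr smult_assoc1)
  moreover have "bimodule_axioms K A (regular A)"
    by (rule bimodule_axioms.intro)
      (auto simp: eqs A.l_distr A.r_distr A.m_assoc smult_mult_left smult_mult_right intro!: lin_mapI)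
  ultimately show ?thesis by (intro bimod_alg.intro bimodule.intro k_alg_axioms k_algebra_axioms)
qed

lemma regular_simps [simp]:
  "carrier (regular A) = carrier A" "add (regular A) = add A" "zero (regular A) = zero A"
  "smult (regular A) = smult A" "lact (regular A) = mult A" "ract (regular A) = mult A"
  by (simp_all add: regular_def module.defs bimod.defs)

lemma lin_map_finsum_fun:
  assumes M: "lmodule R M" and N: "lmodule R N" and "finite I" and "\<And>i. i \<in> I \<Longrightarrow> lin_map R M N (f i)"
  shows "lin_map R M N (\<lambda>x. \<Oplus>\<^bsub>N\<^esub>i\<in>I. f i x)"
  using assms(3,4)
proof (induction I rule: finite_induct)
  case empty
  interpret M: lmodule R M by (rule M)
  interpret N: lmodule R N by (rule N)
  show ?case by (auto intro: lin_mapI)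
next
  case (insert i I)
  interpret N: lmodule R N by (rule N)
  have "(\<Oplus>\<^bsub>N\<^esub>j\<in>insert i I. f j x) = f i x \<oplus>\<^bsub>N\<^esub> (\<Oplus>\<^bsub>N\<^esub>j\<in>I. f j x)" if "x \<in> carrier M" for x
    using insert lin_map_closed[OF insert.prems] that by (intro N.M.finsum_insert) auto
  then show ?case
    using lin_map_add_fun[OF M N, of "f i" "\<lambda>x. \<Oplus>\<^bsub>N\<^esub>j\<in>I. f j x"] insert
    by (subst lin_map_cong[OF M]) auto
qed

text \<open>Used to turn bimodule maps that are semilinear in the two actions into linear maps over
  the enveloping algebra. Both sides are linear in the acting element, so pure tensors
  decide.\<close>

lemma (in k_alg) env_left_twisted_lin:
  assumes B: "bimod_alg K A B" and C: "bimod_alg K A C"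
    and s: "lin_map K (env_space K A) (env_space K A) s"
      "\<And>a b. \<lbrakk>a \<in> carrier A; b \<in> carrier A\<rbrakk> \<Longrightarrow> s (pure a b) = pure (f a) (g b)"
    and fg: "\<And>a. a \<in> carrier A \<Longrightarrow> f a \<in> carrier A" "\<And>a. a \<in> carrier A \<Longrightarrow> g a \<in> carrier A"
    and h: "lin_map K B C h"
      "\<And>a x b. \<lbrakk>a \<in> carrier A; b \<in> carrier A; x \<in> carrier B\<rbrakk> \<Longrightarrow> h (ract B (lact B a x) b) = ract C (lact C (f a) (h x)) (g b)"
  shows "lin_map E (env_left K B) (rtwist s (env_left K C)) h"
proof -
  interpret B: bimod_alg K A B by (rule B)
  interpret C: bimod_alg K A C by (rule C)
  show ?thesis
  proof (rule lin_mapI)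
    fix X x assume "X \<in> carrier E" and x': "x \<in> carrier (env_left K B)"
    then have X: "X \<in> carrier (env_space K A)" and x: "x \<in> carrier B" by simp_all
    note hx = lin_map_closed[OF h(1) x]
    have "h (X \<odot>\<^bsub>env_left K B\<^esub> x) = s X \<odot>\<^bsub>env_left K C\<^esub> h x"
      by (rule ES.tensor_map_eqI[OF X C.lmodule_B lin_map_comp[OF B.env_left_lin[OF x] h(1)]
            lin_map_comp[OF s(1) C.env_left_lin[OF hx]]])
        (simp add: B.env_left_pure x s(2) C.env_left_pure fg hx h(2))
    then show "h (X \<odot>\<^bsub>env_left K B\<^esub> x) = X \<odot>\<^bsub>rtwist s (env_left K C)\<^esub> h x" by simp
  qed (use lin_map_closed[OF h(1)] lin_map_add[OF h(1)] in auto)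
qed

context bimod_alg
begin

lemma kmod_right: "lmodule K (kmod E (env_right K B))"
  by (rule lmodule_cong_record[OF lmodule_B]) (simp_all add: scal_env_right)

text \<open>For the pure tensor of \<open>a\<close> and \<open>a'\<close> both sides are the value
  of \<xi> at \<open>a' x a\<close>: the right action on \<open>B\<close> and the bimodule structure
  on the dual are made for each other.\<close>

lemma env_adjoint:
  assumes X: "X \<in> carrier (env_space K A)" and x: "x \<in> carrier B" and \<xi>: "\<xi> \<in> carrier (dual K B)"
  shows "\<xi> (X \<odot>\<^bsub>env_right K B\<^esub> x) = (X \<odot>\<^bsub>env_left K (dual K B)\<^esub> \<xi>) x"
proof -
  interpret D: bimod_alg K A "dual K B" by (rule bimod_alg_dual)
  have ev: "functional K (dual K B) (\<lambda>\<xi>. \<xi> x)"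
    using x by (intro lin_mapI) (simp_all add: dual_val dual_apply)
  show ?thesis
    by (rule ES.tensor_map_eqI[OF X lmodule_self_module[OF K.ring_axioms] lin_map_comp[OF env_right_lin[OF x] dual_functional[OF \<xi>]]
          lin_map_comp[OF D.env_left_lin[OF \<xi>] ev]])
      (simp add: env_right_pure D.env_left_pure x \<xi> dual_apply act_closed lact_ract)
qed

text \<open>The coordinate functionals of \<open>B\<close> form a finite separating set in the dual,
  so evaluation is a perfect pairing.\<close>

lemma dual_modules_dual:
  assumes fg: "fin_gen K B"
  obtains J e where "dual_modules K E (env_right K B) (env_left K (dual K B)) (\<lambda>x \<xi>. \<xi> x) (J :: ('b \<Rightarrow> 'k) set) e (\<lambda>y. y)"
proof -
  interpret D: bimod_alg K A "dual K B" by (rule bimod_alg_dual)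
  interpret E: k_alg K E by (rule k_alg_env)
  note kD = E.lmodule_kmod[OF D.lmodule_env_left]
  obtain S l where S: "finite S" "S \<subseteq> carrier B" "\<And>s. s \<in> S \<Longrightarrow> functional K B (l s)"
    "\<And>x. x \<in> carrier B \<Longrightarrow> x = (\<Oplus>\<^bsub>B\<^esub>s\<in>S. l s x \<odot>\<^bsub>B\<^esub> s)"
    by (rule fin_gen_functionals[OF K.field_axioms lmodule_B fg]) (rule that)
  have bil: "bilin K (kmod E (env_right K B)) (kmod E (env_left K (dual K B))) (\<lambda>x \<xi>. \<xi> x)"
    unfolding bilin_def
  proof (intro conjI ballI)
    fix x assume "x \<in> carrier (kmod E (env_right K B))"
    then show "functional K (kmod E (env_left K (dual K B))) (\<lambda>\<xi>. \<xi> x)"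
      by (intro lin_mapI) (simp_all add: dual_val dual_apply D.scal_env_left)
  next
    fix \<xi> assume "\<xi> \<in> carrier (kmod E (env_left K (dual K B)))"
    then have "functional K B \<xi>" by (simp add: dual_functional)
    then show "functional K (kmod E (env_right K B)) \<xi>"
      by (simp add: lin_map_def scal_env_right)
  qed
  let ?L = "(\<lambda>s. restrict (l s) (carrier B)) ` S"
  obtain J e where "dual_bases K (kmod E (env_right K B)) (kmod E (env_left K (dual K B))) (\<lambda>x \<xi>. \<xi> x) J e (\<lambda>y. y)"
  proof (rule dual_bases_exist[OF K.field_axioms kmod_right kD bil, of ?L])
    show "finite ?L" using S(1) by simp
    show "?L \<subseteq> carrier (kmod E (env_left K (dual K B)))" using dual_I[OF S(3)] by auto
    fix x assume "x \<in> carrier (kmod E (env_right K B))" and z: "\<And>y. y \<in> ?L \<Longrightarrow> y x = \<zero>"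
    then have x: "x \<in> carrier B" by simp
    have "l s x = \<zero>" if "s \<in> S" for s using z[of "restrict (l s) (carrier B)"] that x by auto
    then have "(\<Oplus>\<^bsub>B\<^esub>s\<in>S. l s x \<odot>\<^bsub>B\<^esub> s) = \<zero>\<^bsub>B\<^esub>"
      using S(2) by (intro B.M.add.finprod_one_eqI) auto
    then show "x = \<zero>\<^bsub>kmod E (env_right K B)\<^esub>" using S(4)[OF x] by simp
  next
    fix \<xi> assume \<xi>: "\<xi> \<in> carrier (kmod E (env_left K (dual K B)))"
      and "\<And>x. x \<in> carrier (kmod E (env_right K B)) \<Longrightarrow> \<xi> x = \<zero>"
    then show "\<xi> = \<zero>\<^bsub>kmod E (env_left K (dual K B))\<^esub>"
      using dual_zero_closed by (simp add: dual_apply dual_eqI)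
  qed
  then have "dual_modules K E (env_right K B) (env_left K (dual K B)) (\<lambda>x \<xi>. \<xi> x) J e (\<lambda>y. y)"
  proof (intro dual_modules.intro dual_modules_axioms.intro k_alg_env)
    show "abelian_group (env_right K B)"
      by (rule abelian_group_cong_record[OF abelian_group_B]) simp_all
  qed (use kmod_right D.lmodule_env_left env_adjoint lin_map_closed[OF env_right_lin] in \<open>auto\<close>)
  then show thesis by (rule that)
qed

end

section \<open>Frobenius algebras\<close>

locale nakayama_alg = k_alg K A for K :: "'k ring" (structure) and A :: "('k, 'g) module" (structure) +
  fixes \<phi> :: "'g \<Rightarrow> 'g \<Rightarrow> 'k" and \<nu> :: "'g \<Rightarrow> 'g"
  assumes fin_gen_A: "fin_gen K A" and iso: "frobenius_iso K A \<phi>" and aut: "algebra_aut K A \<nu>"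
    and comm: "\<lbrakk>x \<in> carrier A; y \<in> carrier A\<rbrakk> \<Longrightarrow> \<phi> \<one>\<^bsub>A\<^esub> (x \<otimes>\<^bsub>A\<^esub> y) = \<phi> \<one>\<^bsub>A\<^esub> (\<nu> y \<otimes>\<^bsub>A\<^esub> x)"
begin

sublocale R: bimod_alg K A "regular A"
  by (rule bimod_alg_regular)

sublocale DR: bimod_alg K A "dual K (regular A)"
  by (rule R.bimod_alg_dual)

abbreviation "\<nu>' \<equiv> inv_into (carrier A) \<nu>"
abbreviation "p \<equiv> \<phi> \<one>\<^bsub>A\<^esub>"

lemma aut': "algebra_aut K A \<nu>'"
  by (rule aut_inv_aut[OF aut])

lemma \<nu>_closed [simp]: "a \<in> carrier A \<Longrightarrow> \<nu> a \<in> carrier A" "a \<in> carrier A \<Longrightarrow> \<nu>' a \<in> carrier A"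
  by (rule ring_hom_closed[OF aut_hom[OF aut]], assumption, rule ring_hom_closed[OF aut_hom[OF aut']], assumption)

lemma \<nu>_inv [simp]: "a \<in> carrier A \<Longrightarrow> \<nu> (\<nu>' a) = a" "a \<in> carrier A \<Longrightarrow> \<nu>' (\<nu> a) = a"
  by (rule aut_inv[OF aut], assumption)+

lemma \<nu>_mult: "\<lbrakk>a \<in> carrier A; b \<in> carrier A\<rbrakk> \<Longrightarrow> \<nu> (a \<otimes>\<^bsub>A\<^esub> b) = \<nu> a \<otimes>\<^bsub>A\<^esub> \<nu> b"
  "\<lbrakk>a \<in> carrier A; b \<in> carrier A\<rbrakk> \<Longrightarrow> \<nu>' (a \<otimes>\<^bsub>A\<^esub> b) = \<nu>' a \<otimes>\<^bsub>A\<^esub> \<nu>' b"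
  by (rule ring_hom_mult[OF aut_hom[OF aut]], assumption+, rule ring_hom_mult[OF aut_hom[OF aut']], assumption+)

lemma \<phi>_props:
  shows \<phi>_closed: "x \<in> carrier A \<Longrightarrow> \<phi> x \<in> carrier (dual K (regular A))"
    and \<phi>_add: "\<lbrakk>x \<in> carrier A; y \<in> carrier A\<rbrakk> \<Longrightarrow> \<phi> (x \<oplus>\<^bsub>A\<^esub> y) = \<phi> x \<oplus>\<^bsub>dual K (regular A)\<^esub> \<phi> y"
    and \<phi>_act: "\<lbrakk>a \<in> carrier A; x \<in> carrier A\<rbrakk> \<Longrightarrow> \<phi> (a \<otimes>\<^bsub>A\<^esub> x) = lact (dual K (regular A)) a (\<phi> x)"
    and \<phi>_bij: "bij_betw \<phi> (carrier A) (carrier (dual K (regular A)))"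
proof -
  have *: "lin_map A (left_module (regular A)) (left_module (dual K (regular A))) \<phi>"
    and b: "bij_betw \<phi> (carrier (left_module (regular A))) (carrier (left_module (dual K (regular A))))"
    using iso by (auto simp: frobenius_iso_def lin_iso_def)
  show "x \<in> carrier A \<Longrightarrow> \<phi> x \<in> carrier (dual K (regular A))"
    using lin_map_closed[OF *, of x] by (simp add: left_module_def)
  show "\<lbrakk>x \<in> carrier A; y \<in> carrier A\<rbrakk> \<Longrightarrow> \<phi> (x \<oplus>\<^bsub>A\<^esub> y) = \<phi> x \<oplus>\<^bsub>dual K (regular A)\<^esub> \<phi> y"
    using lin_map_add[OF *, of x y] by (simp add: left_module_def)
  show "\<lbrakk>a \<in> carrier A; x \<in> carrier A\<rbrakk> \<Longrightarrow> \<phi> (a \<otimes>\<^bsub>A\<^esub> x) = lact (dual K (regular A)) a (\<phi> x)"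
    using lin_map_smult[OF *, of a x] by (simp add: left_module_def)
  show "bij_betw \<phi> (carrier A) (carrier (dual K (regular A)))"
    using b by (simp add: left_module_def)
qed

text \<open>By left linearity \<open>\<phi> x\<close> is \<open>x\<close> acting on
  \<open>p\<close>, and the left action on the dual precomposes with right multiplication.\<close>

lemma \<phi>_apply: "\<lbrakk>x \<in> carrier A; y \<in> carrier A\<rbrakk> \<Longrightarrow> \<phi> x y = p (y \<otimes>\<^bsub>A\<^esub> x)"
  using \<phi>_act[of x "\<one>\<^bsub>A\<^esub>"] by (simp add: R.dual_apply)

lemma p_functional: "functional K A p"
  using R.dual_functional[OF \<phi>_closed[OF A.one_closed]] by (simp add: lin_map_def)

lemma p_simps:
  "x \<in> carrier A \<Longrightarrow> p x \<in> carrier K"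
  "\<lbrakk>x \<in> carrier A; y \<in> carrier A\<rbrakk> \<Longrightarrow> p (x \<oplus>\<^bsub>A\<^esub> y) = p x \<oplus> p y"
  "\<lbrakk>c \<in> carrier K; x \<in> carrier A\<rbrakk> \<Longrightarrow> p (c \<odot>\<^bsub>A\<^esub> x) = c \<otimes> p x"
  using lin_map_closed[OF p_functional, of x] lin_map_add[OF p_functional, of x y] lin_map_smult[OF p_functional, of c x]
  by simp_all

lemma \<phi>_lin: "lin_map K (regular A) (dual K (regular A)) \<phi>"
proof (rule lin_mapI)
  fix c x assume cx: "c \<in> carrier K" "x \<in> carrier (regular A)"
  show "\<phi> (c \<odot>\<^bsub>regular A\<^esub> x) = c \<odot>\<^bsub>dual K (regular A)\<^esub> \<phi> x"
    using cx \<phi>_closed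
    by (intro R.dual_eqI R.dual_smult_closed) (simp_all add: R.dual_apply \<phi>_apply[of x] \<phi>_apply[of "c \<odot>\<^bsub>A\<^esub> x"] smult_mult_right p_simps)
qed (simp_all add: \<phi>_closed \<phi>_add)

text \<open>Since \<open>p (\<nu> b a) = p (a b)\<close>, right multiplication on \<open>D(A)\<close> corresponds to right
  multiplication on \<open>A\<close> twisted by the inverse of \<open>\<nu>\<close>.\<close>

lemma \<phi>_bimodule:
  assumes "a \<in> carrier A" "b \<in> carrier A" "x \<in> carrier A"
  shows "\<phi> (a \<otimes>\<^bsub>A\<^esub> x \<otimes>\<^bsub>A\<^esub> \<nu>' b) = ract (dual K (regular A)) (lact (dual K (regular A)) a (\<phi> x)) b"
proof (rule R.dual_eqI)
  show "\<phi> (a \<otimes>\<^bsub>A\<^esub> x \<otimes>\<^bsub>A\<^esub> \<nu>' b) \<in> carrier (dual K (regular A))"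
    using assms by (intro \<phi>_closed) simp
  show "ract (dual K (regular A)) (lact (dual K (regular A)) a (\<phi> x)) b \<in> carrier (dual K (regular A))"
    using assms by (intro R.dual_ract_closed R.dual_lact_closed \<phi>_closed)
  fix y assume "y \<in> carrier (regular A)"
  then have y: "y \<in> carrier A" by simp
  have "\<phi> (a \<otimes>\<^bsub>A\<^esub> x \<otimes>\<^bsub>A\<^esub> \<nu>' b) y = p ((y \<otimes>\<^bsub>A\<^esub> a \<otimes>\<^bsub>A\<^esub> x) \<otimes>\<^bsub>A\<^esub> \<nu>' b)"
    using assms y \<phi>_apply[of "a \<otimes>\<^bsub>A\<^esub> x \<otimes>\<^bsub>A\<^esub> \<nu>' b" y] by (simp add: A.m_assoc)
  also have "\<dots> = p (b \<otimes>\<^bsub>A\<^esub> (y \<otimes>\<^bsub>A\<^esub> a \<otimes>\<^bsub>A\<^esub> x))"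
    using assms y by (subst comm) simp_all
  also have "\<dots> = ract (dual K (regular A)) (lact (dual K (regular A)) a (\<phi> x)) b y"
    using assms y by (simp add: R.dual_apply \<phi>_apply[of x] A.m_assoc)
  finally show "\<phi> (a \<otimes>\<^bsub>A\<^esub> x \<otimes>\<^bsub>A\<^esub> \<nu>' b) y = ract (dual K (regular A)) (lact (dual K (regular A)) a (\<phi> x)) b y" .
qed

section \<open>The Frobenius form and its dual bases\<close>

lemma p_nondeg_right:
  assumes x: "x \<in> carrier A" and z: "\<And>y. y \<in> carrier A \<Longrightarrow> p (y \<otimes>\<^bsub>A\<^esub> x) = \<zero>"
  shows "x = \<zero>\<^bsub>A\<^esub>"
proof -
  have "\<phi> x = \<phi> \<zero>\<^bsub>A\<^esub>"
    using x z by (intro R.dual_eqI \<phi>_closed) (simp_all add: lin_map_zero[OF lmodule_K lmodule_self_module[OF K.ring_axioms] p_functional, simplified] \<phi>_apply[of x] \<phi>_apply[of "\<zero>\<^bsub>A\<^esub>"])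
  then show ?thesis using \<phi>_bij x by (auto simp: bij_betw_def inj_on_def)
qed

text \<open>By \<open>comm\<close>, pairing \<open>x\<close> with \<open>\<nu>' y\<close> on the
  right is pairing it with \<open>y\<close> on the left.\<close>

lemma p_nondeg_left:
  assumes x: "x \<in> carrier A" and z: "\<And>y. y \<in> carrier A \<Longrightarrow> p (x \<otimes>\<^bsub>A\<^esub> y) = \<zero>"
  shows "x = \<zero>\<^bsub>A\<^esub>"
proof (rule p_nondeg_right[OF x])
  fix y assume y: "y \<in> carrier A"
  then show "p (y \<otimes>\<^bsub>A\<^esub> x) = \<zero>" using z[of "\<nu>' y"] comm[of x "\<nu>' y"] x by simp
qed

text \<open>A finite spanning set already tests whether \<open>p (x y)\<close> vanishes for all
  \<open>y\<close>, so nondegeneracy on both sides feeds \<open>dual_bases_exist\<close>.\<close>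

lemma p_dual_bases:
  obtains J and e :: "'g \<Rightarrow> 'g" where "dual_bases K A A (\<lambda>x y. p (x \<otimes>\<^bsub>A\<^esub> y)) J e (\<lambda>y. y)"
proof -
  have bil: "bilin K A A (\<lambda>x y. p (x \<otimes>\<^bsub>A\<^esub> y))"
    unfolding bilin_def
    by (intro conjI ballI lin_mapI)
      (simp_all add: p_simps A.l_distr A.r_distr smult_mult_left smult_mult_right)
  obtain S l where S: "finite S" "S \<subseteq> carrier A" "\<And>s. s \<in> S \<Longrightarrow> functional K A (l s)"
    "\<And>x. x \<in> carrier A \<Longrightarrow> x = (\<Oplus>\<^bsub>A\<^esub>s\<in>S. l s x \<odot>\<^bsub>A\<^esub> s)"
    by (rule fin_gen_functionals[OF K.field_axioms lmodule_K fin_gen_A]) (rule that)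
  have sepS: "x = \<zero>\<^bsub>A\<^esub>" if x: "x \<in> carrier A" and z: "\<And>y. y \<in> S \<Longrightarrow> p (x \<otimes>\<^bsub>A\<^esub> y) = \<zero>" for x
  proof (rule p_nondeg_left[OF x])
    fix y assume y: "y \<in> carrier A"
    have lc: "l s y \<in> carrier K" if "s \<in> S" for s using lin_map_closed[OF S(3)[OF that] y] by simp
    have "p (x \<otimes>\<^bsub>A\<^esub> y) = p (x \<otimes>\<^bsub>A\<^esub> (\<Oplus>\<^bsub>A\<^esub>s\<in>S. l s y \<odot>\<^bsub>A\<^esub> s))"
      by (rule arg_cong[OF S(4)[OF y]])
    also have "\<dots> = (\<Oplus>s\<in>S. p (x \<otimes>\<^bsub>A\<^esub> (l s y \<odot>\<^bsub>A\<^esub> s)))"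
      using lin_map_finsum[OF lmodule_K lmodule_self_module[OF K.ring_axioms] bilinD(1)[OF bil x], of "\<lambda>s. l s y \<odot>\<^bsub>A\<^esub> s" S] lc S(2)
      by auto
    also have "\<dots> = \<zero>"
      using lc S(2) x z by (intro K.add.finprod_one_eqI) (simp add: smult_mult_right p_simps subset_iff)
    finally show "p (x \<otimes>\<^bsub>A\<^esub> y) = \<zero>" .
  qed
  obtain J e where "J \<subseteq> S" "dual_bases K A A (\<lambda>x y. p (x \<otimes>\<^bsub>A\<^esub> y)) J e (\<lambda>y. y)"
    by (rule dual_bases_exist[OF K.field_axioms lmodule_K lmodule_K bil S(1,2) sepS p_nondeg_right])
  then show thesis using that by blast
qed

definition tr_env :: "('k, 'g) env_elt \<Rightarrow> 'k" where
  "tr_env = tensor_lift K (self_module K) (\<lambda>(a, b). p a \<otimes> p b)"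

text \<open>With the same form \<open>p\<close>, passing to the opposite algebra inverts the
  Nakayama automorphism: \<open>p (d b)\<close> equals \<open>p (b (\<nu>' d))\<close>. Hence \<nu>'
  in the second factor.\<close>

abbreviation "\<mu> \<equiv> env_map \<nu> \<nu>'"

lemma tr_env_balanced: "ES.balanced (self_module K) (\<lambda>a b. p a \<otimes> p b)"
  by (intro env_balancedI) (simp_all add: p_simps K.l_distr K.r_distr K.m_assoc K.m_lcomm)

lemma tr_env_lin: "functional K (env_space K A) tr_env"
  unfolding tr_env_def by (rule ES.lift_lin[OF lmodule_self_module[OF K.ring_axioms] tr_env_balanced])

lemma tr_env_pure: "\<lbrakk>a \<in> carrier A; b \<in> carrier A\<rbrakk> \<Longrightarrow> tr_env (pure a b) = p a \<otimes> p b"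
  unfolding tr_env_def by (rule ES.lift_pure[OF lmodule_self_module[OF K.ring_axioms] tr_env_balanced])

lemma \<mu>_aut: "algebra_aut K E \<mu>"
  by (rule algebra_aut_env_map[OF aut aut'])

lemma \<mu>_lin: "lin_map K (env_space K A) (env_space K A) \<mu>"
  by (rule env_map_lin[OF aut_lin[OF aut] aut_lin[OF aut']])

lemma \<mu>_pure: "\<lbrakk>a \<in> carrier A; b \<in> carrier A\<rbrakk> \<Longrightarrow> \<mu> (pure a b) = pure (\<nu> a) (\<nu>' b)"
  by (rule env_map_pure[OF aut_lin[OF aut] aut_lin[OF aut']])

lemma tr_env_comm:
  assumes X: "X \<in> carrier (env_space K A)" and Y: "Y \<in> carrier (env_space K A)"
  shows "tr_env (X \<otimes>\<^bsub>E\<^esub> Y) = tr_env (\<mu> Y \<otimes>\<^bsub>E\<^esub> X)"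
proof (rule ES.tensor_map_eqI[OF X lmodule_self_module[OF K.ring_axioms] lin_map_comp[OF mult_lin_left[OF Y] tr_env_lin]
      lin_map_comp[OF mult_lin_right[OF lin_map_closed[OF \<mu>_lin Y]] tr_env_lin]])
  fix a b assume ab: "a \<in> carrier A" "b \<in> carrier A"
  then have q: "pure a b \<in> carrier (env_space K A)" by simp
  show "tr_env (pure a b \<otimes>\<^bsub>E\<^esub> Y) = tr_env (\<mu> Y \<otimes>\<^bsub>E\<^esub> pure a b)"
  proof (rule ES.tensor_map_eqI[OF Y lmodule_self_module[OF K.ring_axioms] lin_map_comp[OF mult_lin_right[OF q] tr_env_lin]
        lin_map_comp[OF lin_map_comp[OF \<mu>_lin mult_lin_left[OF q]] tr_env_lin]])
    fix c d assume cd: "c \<in> carrier A" "d \<in> carrier A"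
    have "p (b \<otimes>\<^bsub>A\<^esub> \<nu>' d) = p (d \<otimes>\<^bsub>A\<^esub> b)" using comm[of b "\<nu>' d"] ab cd by simp
    then show "tr_env (pure a b \<otimes>\<^bsub>E\<^esub> pure c d) = tr_env (\<mu> (pure c d) \<otimes>\<^bsub>E\<^esub> pure a b)"
      using ab cd comm[of a c] by (simp add: \<mu>_pure pure_mult_pure tr_env_pure)
  qed
qed

section \<open>Dual bases of the enveloping algebra\<close>

context
  fixes J :: "'g set" and e :: "'g \<Rightarrow> 'g"
  assumes D: "dual_bases K A A (\<lambda>x y. p (x \<otimes>\<^bsub>A\<^esub> y)) J e (\<lambda>y. y)"
begin

lemma J: "finite J" "j \<in> J \<Longrightarrow> j \<in> carrier A" "j \<in> J \<Longrightarrow> e j \<in> carrier A"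
  using D by (auto simp: dual_bases_def)

lemma expand1: "x \<in> carrier A \<Longrightarrow> (\<Oplus>\<^bsub>A\<^esub>j\<in>J. p (x \<otimes>\<^bsub>A\<^esub> j) \<odot>\<^bsub>A\<^esub> e j) = x"
  by (rule dual_bases_expand[OF K.field_axioms lmodule_K D, symmetric])

lemma expand2: "x \<in> carrier A \<Longrightarrow> (\<Oplus>\<^bsub>A\<^esub>j\<in>J. p (e j \<otimes>\<^bsub>A\<^esub> x) \<odot>\<^bsub>A\<^esub> j) = x"
  by (rule dual_bases_expand[OF K.field_axioms lmodule_K dual_bases_sym[OF D], symmetric])

lemma pure_double_sum:
  assumes c: "\<And>i. i \<in> J \<Longrightarrow> c i \<in> carrier K" "\<And>i. i \<in> J \<Longrightarrow> d i \<in> carrier K"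
    and u: "\<And>i. i \<in> J \<Longrightarrow> u i \<in> carrier A" "\<And>i. i \<in> J \<Longrightarrow> w i \<in> carrier A"
  shows "pure (\<Oplus>\<^bsub>A\<^esub>i\<in>J. c i \<odot>\<^bsub>A\<^esub> u i) (\<Oplus>\<^bsub>A\<^esub>j\<in>J. d j \<odot>\<^bsub>A\<^esub> w j) =
    (\<Oplus>\<^bsub>env_space K A\<^esub>i\<in>J. \<Oplus>\<^bsub>env_space K A\<^esub>j\<in>J. (c i \<otimes> d j) \<odot>\<^bsub>env_space K A\<^esub> pure (u i) (w j))"
proof -
  let ?y = "\<Oplus>\<^bsub>A\<^esub>j\<in>J. d j \<odot>\<^bsub>A\<^esub> w j"
  have y: "?y \<in> carrier A" using c u by (intro A.finsum_closed) auto
  have L: "lin_map K A (env_space K A) (\<lambda>a. pure a ?y)"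
    using y by (intro lin_mapI) (auto simp: ES.pure_add_left pure_smult_left)
  have R: "lin_map K A (env_space K A) (\<lambda>b. pure a b)" if "a \<in> carrier A" for a
    using that by (intro lin_mapI) (auto simp: ES.pure_add_right pure_smult_right)
  have "pure (\<Oplus>\<^bsub>A\<^esub>i\<in>J. c i \<odot>\<^bsub>A\<^esub> u i) ?y = (\<Oplus>\<^bsub>env_space K A\<^esub>i\<in>J. pure (c i \<odot>\<^bsub>A\<^esub> u i) ?y)"
    using c u by (intro lin_map_finsum[OF lmodule_K ES.lmodule_tensor L]) auto
  also have "\<dots> = (\<Oplus>\<^bsub>env_space K A\<^esub>i\<in>J. \<Oplus>\<^bsub>env_space K A\<^esub>j\<in>J. (c i \<otimes> d j) \<odot>\<^bsub>env_space K A\<^esub> pure (u i) (w j))"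
  proof (rule ES.TT.M.finsum_cong'[OF refl])
    show "(\<lambda>i. \<Oplus>\<^bsub>env_space K A\<^esub>j\<in>J. (c i \<otimes> d j) \<odot>\<^bsub>env_space K A\<^esub> pure (u i) (w j)) \<in> J \<rightarrow> carrier (env_space K A)"
      using c u by (auto intro!: ES.TT.M.finsum_closed)
    fix i assume i: "i \<in> J"
    have "pure (c i \<odot>\<^bsub>A\<^esub> u i) ?y = (\<Oplus>\<^bsub>env_space K A\<^esub>j\<in>J. pure (c i \<odot>\<^bsub>A\<^esub> u i) (d j \<odot>\<^bsub>A\<^esub> w j))"
      using c u i by (intro lin_map_finsum[OF lmodule_K ES.lmodule_tensor R]) auto
    also have "\<dots> = (\<Oplus>\<^bsub>env_space K A\<^esub>j\<in>J. (c i \<otimes> d j) \<odot>\<^bsub>env_space K A\<^esub> pure (u i) (w j))"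
      using c u i by (intro ES.TT.M.finsum_cong') (auto simp: pure_smult_left pure_smult_right ES.TT.smult_assoc1[symmetric] K.m_comm)
    finally show "pure (c i \<odot>\<^bsub>A\<^esub> u i) ?y = (\<Oplus>\<^bsub>env_space K A\<^esub>j\<in>J. (c i \<otimes> d j) \<odot>\<^bsub>env_space K A\<^esub> pure (u i) (w j))" .
  qed
  finally show ?thesis .
qed

text \<open>Makes the double sums below linear in \<open>X\<close>, so that the expansions can be
  verified on pure tensors.\<close>

lemma env_expand_lin:
  assumes f: "\<And>i j. \<lbrakk>i \<in> J; j \<in> J\<rbrakk> \<Longrightarrow> functional K (env_space K A) (f i j)"
    and Y: "\<And>i j. \<lbrakk>i \<in> J; j \<in> J\<rbrakk> \<Longrightarrow> Y i j \<in> carrier (env_space K A)"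
  shows "lin_map K (env_space K A) (env_space K A)
    (\<lambda>X. \<Oplus>\<^bsub>env_space K A\<^esub>i\<in>J. \<Oplus>\<^bsub>env_space K A\<^esub>j\<in>J. f i j X \<odot>\<^bsub>env_space K A\<^esub> Y i j)"
  using f Y J(1) by (intro lin_map_finsum_fun[OF ES.lmodule_tensor ES.lmodule_tensor] lin_map_comb[OF ES.lmodule_tensor ES.lmodule_tensor])

lemma id_lin: "lin_map K (env_space K A) (env_space K A) (\<lambda>X. X)"
  by (auto intro: lin_mapI)

text \<open>The elements \<open>pure (e i) j\<close> and \<open>pure i (e j)\<close> are dual for
  \<open>tr_env\<close>. The second factor multiplies in reverse, so there the basis and its dual
  exchange their places.\<close>

lemma env_expand1:
  assumes X: "X \<in> carrier (env_space K A)"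
  shows "(\<Oplus>\<^bsub>env_space K A\<^esub>i\<in>J. \<Oplus>\<^bsub>env_space K A\<^esub>j\<in>J. tr_env (X \<otimes>\<^bsub>E\<^esub> pure i (e j)) \<odot>\<^bsub>env_space K A\<^esub> pure (e i) j) = X"
proof (rule ES.tensor_map_eqI[OF X ES.lmodule_tensor env_expand_lin id_lin])
  show "functional K (env_space K A) (\<lambda>X. tr_env (X \<otimes>\<^bsub>E\<^esub> pure i (e j)))" if "i \<in> J" "j \<in> J" for i j
    using J that by (intro lin_map_comp[OF mult_lin_left tr_env_lin]) simp
  show "pure (e i) j \<in> carrier (env_space K A)" if "i \<in> J" "j \<in> J" for i j using J that by simp
  fix a b assume ab: "a \<in> carrier A" "b \<in> carrier A"
  have "pure a b = pure (\<Oplus>\<^bsub>A\<^esub>i\<in>J. p (a \<otimes>\<^bsub>A\<^esub> i) \<odot>\<^bsub>A\<^esub> e i) (\<Oplus>\<^bsub>A\<^esub>j\<in>J. p (e j \<otimes>\<^bsub>A\<^esub> b) \<odot>\<^bsub>A\<^esub> j)"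
    using ab by (simp add: expand1 expand2)
  also have "\<dots> = (\<Oplus>\<^bsub>env_space K A\<^esub>i\<in>J. \<Oplus>\<^bsub>env_space K A\<^esub>j\<in>J. (p (a \<otimes>\<^bsub>A\<^esub> i) \<otimes> p (e j \<otimes>\<^bsub>A\<^esub> b)) \<odot>\<^bsub>env_space K A\<^esub> pure (e i) j)"
    using J ab p_simps by (intro pure_double_sum) auto
  also have "\<dots> = (\<Oplus>\<^bsub>env_space K A\<^esub>i\<in>J. \<Oplus>\<^bsub>env_space K A\<^esub>j\<in>J. tr_env (pure a b \<otimes>\<^bsub>E\<^esub> pure i (e j)) \<odot>\<^bsub>env_space K A\<^esub> pure (e i) j)"
    using J ab p_simps(1) by (intro ES.TT.M.finsum_cong' refl Pi_I ES.TT.M.finsum_closed) (simp_all add: pure_mult_pure tr_env_pure)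
  finally show "(\<Oplus>\<^bsub>env_space K A\<^esub>i\<in>J. \<Oplus>\<^bsub>env_space K A\<^esub>j\<in>J. tr_env (pure a b \<otimes>\<^bsub>E\<^esub> pure i (e j)) \<odot>\<^bsub>env_space K A\<^esub> pure (e i) j) = pure a b" ..
qed

lemma env_expand2:
  assumes X: "X \<in> carrier (env_space K A)"
  shows "(\<Oplus>\<^bsub>env_space K A\<^esub>i\<in>J. \<Oplus>\<^bsub>env_space K A\<^esub>j\<in>J. tr_env (pure (e i) j \<otimes>\<^bsub>E\<^esub> X) \<odot>\<^bsub>env_space K A\<^esub> pure i (e j)) = X"
proof (rule ES.tensor_map_eqI[OF X ES.lmodule_tensor env_expand_lin id_lin])
  show "functional K (env_space K A) (\<lambda>X. tr_env (pure (e i) j \<otimes>\<^bsub>E\<^esub> X))" if "i \<in> J" "j \<in> J" for i j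
    using J that by (intro lin_map_comp[OF mult_lin_right tr_env_lin]) simp
  show "pure i (e j) \<in> carrier (env_space K A)" if "i \<in> J" "j \<in> J" for i j using J that by simp
  fix a b assume ab: "a \<in> carrier A" "b \<in> carrier A"
  have "pure a b = pure (\<Oplus>\<^bsub>A\<^esub>i\<in>J. p (e i \<otimes>\<^bsub>A\<^esub> a) \<odot>\<^bsub>A\<^esub> i) (\<Oplus>\<^bsub>A\<^esub>j\<in>J. p (b \<otimes>\<^bsub>A\<^esub> j) \<odot>\<^bsub>A\<^esub> e j)"
    using ab by (simp add: expand1 expand2)
  also have "\<dots> = (\<Oplus>\<^bsub>env_space K A\<^esub>i\<in>J. \<Oplus>\<^bsub>env_space K A\<^esub>j\<in>J. (p (e i \<otimes>\<^bsub>A\<^esub> a) \<otimes> p (b \<otimes>\<^bsub>A\<^esub> j)) \<odot>\<^bsub>env_space K A\<^esub> pure i (e j))"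
    using J ab p_simps by (intro pure_double_sum) auto
  also have "\<dots> = (\<Oplus>\<^bsub>env_space K A\<^esub>i\<in>J. \<Oplus>\<^bsub>env_space K A\<^esub>j\<in>J. tr_env (pure (e i) j \<otimes>\<^bsub>E\<^esub> pure a b) \<odot>\<^bsub>env_space K A\<^esub> pure i (e j))"
    using J ab p_simps(1) by (intro ES.TT.M.finsum_cong' refl Pi_I ES.TT.M.finsum_closed) (simp_all add: pure_mult_pure tr_env_pure)
  finally show "(\<Oplus>\<^bsub>env_space K A\<^esub>i\<in>J. \<Oplus>\<^bsub>env_space K A\<^esub>j\<in>J. tr_env (pure (e i) j \<otimes>\<^bsub>E\<^esub> pure a b) \<odot>\<^bsub>env_space K A\<^esub> pure i (e j)) = pure a b" ..
qed

lemma tr_env_nondeg: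
  assumes X: "X \<in> carrier (env_space K A)" and z: "\<And>Y. Y \<in> carrier (env_space K A) \<Longrightarrow> tr_env (X \<otimes>\<^bsub>E\<^esub> Y) = \<zero>"
  shows "X = \<zero>\<^bsub>env_space K A\<^esub>"
proof -
  have "(\<Oplus>\<^bsub>env_space K A\<^esub>i\<in>J. \<Oplus>\<^bsub>env_space K A\<^esub>j\<in>J. tr_env (X \<otimes>\<^bsub>E\<^esub> pure i (e j)) \<odot>\<^bsub>env_space K A\<^esub> pure (e i) j) = \<zero>\<^bsub>env_space K A\<^esub>"
    using J z by (intro ES.TT.M.add.finprod_one_eqI) simp
  then show ?thesis using env_expand1[OF X] by simp
qed

text \<open>The representing element has the values of \<xi> on one dual basis as its coefficients
  in the other; applying \<xi> to the expansion \<open>env_expand2\<close> of \<open>Y\<close>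
  confirms it.\<close>

lemma tr_env_repr:
  assumes \<xi>: "functional K (env_space K A) \<xi>"
  shows "\<exists>X\<in>carrier (env_space K A). \<forall>Y\<in>carrier (env_space K A). \<xi> Y = tr_env (X \<otimes>\<^bsub>E\<^esub> Y)"
proof
  let ?r = "\<lambda>i j. pure i (e j)" and ?l = "\<lambda>i j. pure (e i) j"
  let ?X = "\<Oplus>\<^bsub>env_space K A\<^esub>i\<in>J. \<Oplus>\<^bsub>env_space K A\<^esub>j\<in>J. \<xi> (?r i j) \<odot>\<^bsub>env_space K A\<^esub> ?l i j"
  note SK = lmodule_self_module[OF K.ring_axioms]
  have rc: "?r i j \<in> carrier (env_space K A)" "?l i j \<in> carrier (env_space K A)" if "i \<in> J" "j \<in> J" for i j
    using J that by simp_all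
  have \<xi>c: "\<xi> Z \<in> carrier K" if "Z \<in> carrier (env_space K A)" for Z using lin_map_closed[OF \<xi> that] by simp
  have tc: "tr_env Z \<in> carrier K" if "Z \<in> carrier (env_space K A)" for Z using lin_map_closed[OF tr_env_lin that] by simp
  have dbl: "g (\<Oplus>\<^bsub>env_space K A\<^esub>i\<in>J. \<Oplus>\<^bsub>env_space K A\<^esub>j\<in>J. c i j \<odot>\<^bsub>env_space K A\<^esub> Z i j) = (\<Oplus>i\<in>J. \<Oplus>j\<in>J. c i j \<otimes> g (Z i j))"
    if g: "functional K (env_space K A) g" and c: "\<And>i j. i \<in> J \<Longrightarrow> j \<in> J \<Longrightarrow> c i j \<in> carrier K"
      and Z: "\<And>i j. i \<in> J \<Longrightarrow> j \<in> J \<Longrightarrow> Z i j \<in> carrier (env_space K A)" for g c Z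
  proof -
    have gc: "g Z \<in> carrier K" if "Z \<in> carrier (env_space K A)" for Z using lin_map_closed[OF g that] by simp
    have "g (\<Oplus>\<^bsub>env_space K A\<^esub>i\<in>J. \<Oplus>\<^bsub>env_space K A\<^esub>j\<in>J. c i j \<odot>\<^bsub>env_space K A\<^esub> Z i j) =
        (\<Oplus>i\<in>J. g (\<Oplus>\<^bsub>env_space K A\<^esub>j\<in>J. c i j \<odot>\<^bsub>env_space K A\<^esub> Z i j))"
      using lin_map_finsum[OF ES.lmodule_tensor SK g, of "\<lambda>i. \<Oplus>\<^bsub>env_space K A\<^esub>j\<in>J. c i j \<odot>\<^bsub>env_space K A\<^esub> Z i j" J] c Z
      by (auto intro!: ES.TT.M.finsum_closed)
    also have "\<dots> = (\<Oplus>i\<in>J. \<Oplus>j\<in>J. c i j \<otimes> g (Z i j))"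
    proof (rule K.finsum_cong'[OF refl])
      show "(\<lambda>i. \<Oplus>j\<in>J. c i j \<otimes> g (Z i j)) \<in> J \<rightarrow> carrier K" using c Z gc by (auto intro!: K.finsum_closed)
      fix i assume i: "i \<in> J"
      have "g (\<Oplus>\<^bsub>env_space K A\<^esub>j\<in>J. c i j \<odot>\<^bsub>env_space K A\<^esub> Z i j) = (\<Oplus>j\<in>J. g (c i j \<odot>\<^bsub>env_space K A\<^esub> Z i j))"
        using lin_map_finsum[OF ES.lmodule_tensor SK g, of "\<lambda>j. c i j \<odot>\<^bsub>env_space K A\<^esub> Z i j" J] c Z i by auto
      also have "\<dots> = (\<Oplus>j\<in>J. c i j \<otimes> g (Z i j))"
        using c Z i gc lin_map_smult[OF g] by (intro K.finsum_cong') auto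
      finally show "g (\<Oplus>\<^bsub>env_space K A\<^esub>j\<in>J. c i j \<odot>\<^bsub>env_space K A\<^esub> Z i j) = (\<Oplus>j\<in>J. c i j \<otimes> g (Z i j))" .
    qed
    finally show ?thesis .
  qed
  show X: "?X \<in> carrier (env_space K A)"
    using rc \<xi>c by (auto intro!: ES.TT.M.finsum_closed)
  show "\<forall>Y\<in>carrier (env_space K A). \<xi> Y = tr_env (?X \<otimes>\<^bsub>E\<^esub> Y)"
  proof
    fix Y assume Y: "Y \<in> carrier (env_space K A)"
    have lY: "tr_env (?l i j \<otimes>\<^bsub>E\<^esub> Y) \<in> carrier K" if "i \<in> J" "j \<in> J" for i j
      using tc[OF env_mult_closed[OF rc(2)[OF that] Y]] .
    have "\<xi> Y = \<xi> (\<Oplus>\<^bsub>env_space K A\<^esub>i\<in>J. \<Oplus>\<^bsub>env_space K A\<^esub>j\<in>J. tr_env (?l i j \<otimes>\<^bsub>E\<^esub> Y) \<odot>\<^bsub>env_space K A\<^esub> ?r i j)"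
      using env_expand2[OF Y] by simp
    also have "\<dots> = (\<Oplus>i\<in>J. \<Oplus>j\<in>J. tr_env (?l i j \<otimes>\<^bsub>E\<^esub> Y) \<otimes> \<xi> (?r i j))"
      by (rule dbl[OF \<xi> lY rc(1)])
    also have "\<dots> = (\<Oplus>i\<in>J. \<Oplus>j\<in>J. \<xi> (?r i j) \<otimes> tr_env (?l i j \<otimes>\<^bsub>E\<^esub> Y))"
      using lY rc \<xi>c by (intro K.finsum_cong' refl Pi_I K.finsum_closed) (simp_all add: K.m_comm)
    also have "\<dots> = tr_env (?X \<otimes>\<^bsub>E\<^esub> Y)"
      by (rule dbl[OF lin_map_comp[OF mult_lin_left[OF Y] tr_env_lin] \<xi>c[OF rc(1)] rc(2), symmetric])
    finally show "\<xi> Y = tr_env (?X \<otimes>\<^bsub>E\<^esub> Y)" .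
  qed
qed

end

text \<open>The Frobenius property passes to the enveloping algebra factor by factor, which makes
  \<open>tate_duality\<close> available there.\<close>

lemma frobenius_form_env: "frobenius_form K E tr_env \<mu>"
proof -
  obtain J and e :: "'g \<Rightarrow> 'g" where D: "dual_bases K A A (\<lambda>x y. p (x \<otimes>\<^bsub>A\<^esub> y)) J e (\<lambda>y. y)"
    by (rule p_dual_bases)
  have f: "functional K E h = functional K (env_space K A) h" for h by (simp add: lin_map_def)
  show ?thesis
    by (intro frobenius_form.intro frobenius_form_axioms.intro k_alg_env)
      (simp_all add: f tr_env_lin \<mu>_aut tr_env_nondeg[OF D] tr_env_repr[OF D] tr_env_comm[symmetric])
qed

sublocale FF: frobenius_form K E tr_env \<mu>
  by (rule frobenius_form_env)

lemma \<nu>_sq_aut: "algebra_aut K A (\<nu> \<circ> \<nu>)"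
  using ring_iso_set_trans[of \<nu> A A \<nu> A] lin_map_comp[OF aut_lin[OF aut] aut_lin[OF aut]] aut
  by (simp add: algebra_aut_def comp_def)

text \<open>Tate duality over the enveloping algebra with \<open>r\<close> the identity, as
  \<open>S\<close> resolves \<open>B\<close> itself.\<close>

lemma HH_upper_duality:
  fixes T :: "(('k, 'g) env_elt, 't) cplx" and S :: "(('k, 'g) env_elt, 's) cplx"
  assumes B: "bimod_alg K A B" and fB: "fin_gen K B"
    and T: "bimod_complete_resolution K A (regular A) T" and S: "bimod_complete_resolution K A B S"
  shows "isomorphic K (HH_upper K A n T B)
    (tate_Ext E (- (n + 1)) S (env_left K (twist (\<nu> \<circ> \<nu>) id (regular A))))"
proof -
  interpret B: bimod_alg K A B by (rule B)
  let ?X = "twist (\<nu> \<circ> \<nu>) id (regular A)"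
  interpret X: bimod_alg K A ?X
    using R.bimod_alg_twist[OF \<nu>_sq_aut algebra_aut_id] by (simp add: id_def)
  have "lin_iso E (env_left K B) (rtwist (\<lambda>X. X) (env_left K B)) (\<lambda>x. x)"
    by (auto simp: lin_iso_def lin_map_def bij_betw_def lin_map_closed[OF B.env_left_lin])
  \<comment> \<open>\<nu>' sends the product of \<open>\<nu> (\<nu> a)\<close>, \<open>x\<close> and
    \<open>b\<close> to that of \<open>\<nu> a\<close>, \<open>\<nu>' x\<close> and
    \<open>\<nu>' b\<close>, which is the action twisted by \<mu>. The square arises because
    clearing \<nu>' from the right factor puts a second \<nu> on the left.\<close>
  moreover have "lin_iso E (env_left K ?X) (rtwist (\<lambda>X. \<mu> X) (env_left K (regular A))) \<nu>'"
    unfolding lin_iso_def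
  proof
    show "lin_map E (env_left K ?X) (rtwist (\<lambda>X. \<mu> X) (env_left K (regular A))) \<nu>'"
    proof (rule env_left_twisted_lin[OF X.bimod_alg_axioms R.bimod_alg_axioms \<mu>_lin \<mu>_pure])
      show "lin_map K ?X (regular A) \<nu>'" using aut_lin[OF aut'] by (simp add: lin_map_def twist_def)
    qed (simp_all add: twist_def \<nu>_mult)
    show "bij_betw \<nu>' (carrier (env_left K ?X)) (carrier (rtwist (\<lambda>X. \<mu> X) (env_left K (regular A))))"
      unfolding X.env_left_simps using aut' by (simp add: algebra_aut_def ring_iso_def twist_def)
  qed
  ultimately show ?thesis
    unfolding HH_upper_def
    using FF.tate_duality[OF R.lmodule_env_left B.lmodule_env_left B.lmodule_env_left X.lmodule_env_left
        B.fin_gen_kmod_left[OF fB] _ _ FF.algebra_aut_id] T S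
    by (simp add: bimod_complete_resolution_def)
qed

text \<open>The chain is Tor of \<open>B\<close>, Ext into the dual of \<open>B\<close>, by Tate
  duality Ext of \<open>B'\<close> into the dual of \<open>A\<close>, and back to Tor with
  \<open>A\<close>. The bimodule \<open>B'\<close> is tied to the dual of \<open>B\<close> only
  through \<alpha>, so that the literal twist of the dual and, for \<open>B\<close> equal to
  \<open>A\<close>, the algebra itself can both take its place.\<close>

lemma HH_lower_duality:
  fixes T :: "(('k, 'g) env_elt, 't) cplx" and S :: "(('k, 'g) env_elt, 's) cplx"
    and B :: "('k, 'g, 'b) bimod" and B' :: "('k, 'g, 'c) bimod"
  assumes B: "bimod_alg K A B" and fB: "fin_gen K B" and B': "bimod_alg K A B'"
    and T: "bimod_complete_resolution K A (regular A) T" and S: "bimod_complete_resolution K A B' S"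
    and \<alpha>: "lin_map K B' (dual K B) \<alpha>" "bij_betw \<alpha> (carrier B') (carrier (dual K B))"
      "\<And>a b x. \<lbrakk>a \<in> carrier A; b \<in> carrier A; x \<in> carrier B'\<rbrakk> \<Longrightarrow>
        \<alpha> (ract B' (lact B' a x) b) = ract (dual K B) (lact (dual K B) (\<nu>' a) (\<alpha> x)) b"
  shows "isomorphic K (HH_lower K A n T B) (tate_Tor K E (- (n + 1)) (env_right K (regular A)) S)"
proof -
  interpret B: bimod_alg K A B by (rule B)
  interpret B': bimod_alg K A B' by (rule B')
  interpret DB: bimod_alg K A "dual K B" by (rule B.bimod_alg_dual)
  \<comment> \<open>The twist in the hypothesis on \<alpha>, as an automorphism of the enveloping
    algebra.\<close>
  let ?r = "env_map \<nu>' (\<lambda>a. a)"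
  note lid = aut_lin[OF algebra_aut_id]
  have r: "algebra_aut K E ?r" by (rule algebra_aut_env_map[OF aut' algebra_aut_id])
  have rl: "lin_map K (env_space K A) (env_space K A) ?r" by (rule env_map_lin[OF aut_lin[OF aut'] lid])
  have rp: "?r (pure a b) = pure (\<nu>' a) b" if "a \<in> carrier A" "b \<in> carrier A" for a b
    by (rule env_map_pure[OF aut_lin[OF aut'] lid that])
  have T': "complete_resolution E (env_left K (regular A)) T" and S': "complete_resolution E (env_left K B') S"
    using T S by (simp_all add: bimod_complete_resolution_def)
  obtain J :: "('b \<Rightarrow> 'k) set" and e where "dual_modules K E (env_right K B) (env_left K (dual K B)) (\<lambda>x \<xi>. \<xi> x) J e (\<lambda>y. y)"
    by (rule B.dual_modules_dual[OF fB])
  then have 1: "isomorphic K (tate_Tor K E n (env_right K B) T) (tate_Ext E n T (env_left K (dual K B)))"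
    by (rule dual_modules.tate_Tor_Ext[OF _ T'])
  have fR: "fin_gen K (regular A)" by (rule fin_gen_cong_record[OF fin_gen_A lmodule_K]) simp_all
  obtain J' :: "('g \<Rightarrow> 'k) set" and e' where
    dm: "dual_modules K E (env_right K (regular A)) (env_left K (dual K (regular A))) (\<lambda>x \<xi>. \<xi> x) J' e' (\<lambda>y. y)"
    by (rule R.dual_modules_dual[OF fR])
  have 3: "isomorphic K (tate_Tor K E (- (n + 1)) (env_right K (regular A)) S)
      (tate_Ext E (- (n + 1)) S (env_left K (dual K (regular A))))"
    by (rule dual_modules.tate_Tor_Ext[OF dm S'])
  have CS: "chain_complex E S" using S' by (simp add: complete_resolution_def)
  note 4 = isomorphic_sym[OF dual_modules.lmodule_tate_Tor[OF dm CS] FF.lmodule_tate_Ext[OF CS DR.lmodule_env_left] 3]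
  have fD: "fin_gen K (kmod E (env_left K (dual K B)))"
  proof -
    obtain J :: "('b \<Rightarrow> 'k) set" and e where "dual_modules K E (env_right K B) (env_left K (dual K B)) (\<lambda>x \<xi>. \<xi> x) J e (\<lambda>y. y)"
      by (rule B.dual_modules_dual[OF fB])
    then have "dual_bases K (kmod E (env_right K B)) (kmod E (env_left K (dual K B))) (\<lambda>x \<xi>. \<xi> x) J e (\<lambda>y. y)"
      by (rule dual_modules.D)
    then show ?thesis
      by (rule dual_bases_fin_gen[OF K.field_axioms FF.lmodule_kmod[OF DB.lmodule_env_left] dual_bases_sym])
  qed
  have a: "lin_iso E (env_left K B') (rtwist ?r (env_left K (dual K B))) \<alpha>"
    unfolding lin_iso_def
  proof
    show "lin_map E (env_left K B') (rtwist ?r (env_left K (dual K B))) \<alpha>"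
      by (rule env_left_twisted_lin[OF B' DB.bimod_alg_axioms rl rp]) (simp_all add: \<alpha>)
    show "bij_betw \<alpha> (carrier (env_left K B')) (carrier (rtwist ?r (env_left K (dual K B))))"
      using \<alpha>(2) by simp
  qed
  let ?\<psi> = "inv_into (carrier A) \<phi>"
  have \<psi>: "?\<psi> \<xi> \<in> carrier A" "\<phi> (?\<psi> \<xi>) = \<xi>" if "\<xi> \<in> carrier (dual K (regular A))" for \<xi>
    using that \<phi>_bij by (auto simp: bij_betw_def intro: inv_into_into f_inv_into_f)
  have \<psi>I: "?\<psi> (\<phi> x) = x" if "x \<in> carrier A" for x using \<phi>_bij that by (auto simp: bij_betw_def)
  \<comment> \<open>\<mu> after \<open>?r\<close> is the identity on the left factor and \<nu>' on
    the right one, since \<nu> and \<nu>' cancel on the left. By \<open>\<phi>_bimodule\<close> this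
    is exactly the twist under which the inverse of \<phi> identifies the dual of \<open>A\<close>
    with \<open>A\<close>.\<close>
  have b: "lin_iso E (env_left K (dual K (regular A))) (rtwist (\<lambda>X. \<mu> (?r X)) (env_left K (regular A))) ?\<psi>"
    unfolding lin_iso_def
  proof
    show "lin_map E (env_left K (dual K (regular A))) (rtwist (\<lambda>X. \<mu> (?r X)) (env_left K (regular A))) ?\<psi>"
    proof (rule env_left_twisted_lin[OF DR.bimod_alg_axioms R.bimod_alg_axioms lin_map_comp[OF rl \<mu>_lin], where f = "\<lambda>a. a" and g = \<nu>'])
      show "\<mu> (?r (pure a b)) = pure a (\<nu>' b)" if "a \<in> carrier A" "b \<in> carrier A" for a b
        using that by (simp add: rp \<mu>_pure)
      show "lin_map K (dual K (regular A)) (regular A) ?\<psi>"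
      proof (rule lin_mapI)
        fix \<xi> \<eta> assume x: "\<xi> \<in> carrier (dual K (regular A))" "\<eta> \<in> carrier (dual K (regular A))"
        have "?\<psi> (\<phi> (?\<psi> \<xi> \<oplus>\<^bsub>A\<^esub> ?\<psi> \<eta>)) = ?\<psi> \<xi> \<oplus>\<^bsub>A\<^esub> ?\<psi> \<eta>" using \<psi>(1)[OF x(1)] \<psi>(1)[OF x(2)] by (intro \<psi>I) simp
        then show "?\<psi> (\<xi> \<oplus>\<^bsub>dual K (regular A)\<^esub> \<eta>) = ?\<psi> \<xi> \<oplus>\<^bsub>regular A\<^esub> ?\<psi> \<eta>"
          using \<psi>[OF x(1)] \<psi>[OF x(2)] by (simp add: \<phi>_add)
      next
        fix c \<xi> assume x: "c \<in> carrier K" "\<xi> \<in> carrier (dual K (regular A))"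
        have "?\<psi> (\<phi> (c \<odot>\<^bsub>A\<^esub> ?\<psi> \<xi>)) = c \<odot>\<^bsub>A\<^esub> ?\<psi> \<xi>" using \<psi>(1)[OF x(2)] x(1) by (intro \<psi>I) simp
        then show "?\<psi> (c \<odot>\<^bsub>dual K (regular A)\<^esub> \<xi>) = c \<odot>\<^bsub>regular A\<^esub> ?\<psi> \<xi>"
          using \<psi>[OF x(2)] lin_map_smult[OF \<phi>_lin x(1), of "?\<psi> \<xi>"] by simp
      qed (simp add: \<psi>)
      fix a \<xi> b assume ab: "a \<in> carrier A" "b \<in> carrier A" and x: "\<xi> \<in> carrier (dual K (regular A))"
      have "?\<psi> (\<phi> (a \<otimes>\<^bsub>A\<^esub> ?\<psi> \<xi> \<otimes>\<^bsub>A\<^esub> \<nu>' b)) = a \<otimes>\<^bsub>A\<^esub> ?\<psi> \<xi> \<otimes>\<^bsub>A\<^esub> \<nu>' b"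
        using \<psi>(1)[OF x] ab by (intro \<psi>I) simp
      then show "?\<psi> (ract (dual K (regular A)) (lact (dual K (regular A)) a \<xi>) b) =
          ract (regular A) (lact (regular A) a (?\<psi> \<xi>)) (\<nu>' b)"
        using \<phi>_bimodule[OF ab \<psi>(1)[OF x]] \<psi>(2)[OF x] by simp
    qed simp_all
    show "bij_betw ?\<psi> (carrier (env_left K (dual K (regular A)))) (carrier (rtwist (\<lambda>X. \<mu> (?r X)) (env_left K (regular A))))"
      using bij_betw_inv_into[OF \<phi>_bij] by simp
  qed
  have 2: "isomorphic K (tate_Ext E n T (env_left K (dual K B))) (tate_Ext E (- (n + 1)) S (env_left K (dual K (regular A))))"
    by (rule FF.tate_duality[OF R.lmodule_env_left DB.lmodule_env_left B'.lmodule_env_left DR.lmodule_env_left fD T' S' r a b])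
  show ?thesis
    unfolding HH_lower_def by (rule isomorphic_trans[OF 1 isomorphic_trans[OF 2 4]])
qed

end

theorem theorem3p7:
  fixes K :: "'k ring" and A :: "('k, 'a) module" and B :: "('k, 'a, 'b) bimod"
    and \<nu> :: "'a \<Rightarrow> 'a"
  assumes "field K"
    and "frobenius_algebra K A"
    and "nakayama_automorphism K A \<nu>"
    and "fin_gen_bimodule K A B"
  shows
    "(\<forall>(n :: int) (T :: (('k, 'a) env_elt, 't) cplx) (S :: (('k, 'a) env_elt, 's) cplx).
        bimod_complete_resolution K A (regular A) T \<longrightarrow>
        bimod_complete_resolution K A (twist (inv_into (carrier A) \<nu>) id (dual K B)) S \<longrightarrow>
        isomorphic K (HH_lower K A n T B)
          (tate_Tor K (env K A) (- (n + 1)) (env_right K (regular A)) S)) \<and>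
     (\<forall>(n :: int) (T :: (('k, 'a) env_elt, 't) cplx) (S :: (('k, 'a) env_elt, 's) cplx).
        bimod_complete_resolution K A (regular A) T \<longrightarrow>
        bimod_complete_resolution K A B S \<longrightarrow>
        isomorphic K (HH_upper K A n T B)
          (tate_Ext (env K A) (- (n + 1)) S (env_left K (twist (\<nu> \<circ> \<nu>) id (regular A))))) \<and>
     (\<forall>(n :: int) (T :: (('k, 'a) env_elt, 't) cplx) (S :: (('k, 'a) env_elt, 's) cplx).
        bimod_complete_resolution K A (regular A) T \<longrightarrow>
        bimod_complete_resolution K A (regular A) S \<longrightarrow>
        isomorphic K (HH_lower K A n T (regular A)) (HH_lower K A (- (n + 1)) S (regular A))) \<and>
     (\<forall>(n :: int) (T :: (('k, 'a) env_elt, 't) cplx) (S :: (('k, 'a) env_elt, 's) cplx).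
        bimod_complete_resolution K A (regular A) T \<longrightarrow>
        bimod_complete_resolution K A (regular A) S \<longrightarrow>
        isomorphic K (HH_upper K A n T (regular A))
          (HH_upper K A (- (n + 1)) S (twist (\<nu> \<circ> \<nu>) id (regular A))))"
proof -
  have kA: "k_alg K A" and fA: "fin_gen K A"
    using assms(2) by (auto simp: frobenius_algebra_def k_alg_def)
  obtain \<phi> where \<phi>: "frobenius_iso K A \<phi>"
      "\<forall>l\<in>carrier A. \<forall>x\<in>carrier A. \<phi> \<one>\<^bsub>A\<^esub> (l \<otimes>\<^bsub>A\<^esub> x) = \<phi> \<one>\<^bsub>A\<^esub> (\<nu> x \<otimes>\<^bsub>A\<^esub> l)"
    and \<nu>: "algebra_aut K A \<nu>"
    using assms(3) by (auto simp: nakayama_automorphism_def)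
  interpret nakayama_alg K A \<phi> \<nu>
    using kA fA \<phi> \<nu> by (intro nakayama_alg.intro nakayama_alg_axioms.intro) auto
  have B: "bimod_alg K A B"
    using kA assms(4) by (auto simp: bimod_alg_def fin_gen_bimodule_def)
  interpret B: bimod_alg K A B by (rule B)
  interpret DB: bimod_alg K A "dual K B" by (rule B.bimod_alg_dual)
  have fB: "fin_gen K B"
    using assms(4) by (intro B.fin_gen_B[OF fA]) (simp add: fin_gen_bimodule_def)
  have fR: "fin_gen K (regular A)" by (rule fin_gen_cong_record[OF fA lmodule_K]) simp_all
  have tw: "bimod_alg K A (twist \<nu>' id (dual K B))"
    using DB.bimod_alg_twist[OF aut' algebra_aut_id] by (simp add: id_def)
  show ?thesis
  proof (intro conjI allI impI)
    fix n :: int and T :: "(('k, 'a) env_elt, 't) cplx" and S :: "(('k, 'a) env_elt, 's) cplx"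
    assume T: "bimod_complete_resolution K A (regular A) T"
    { assume S: "bimod_complete_resolution K A (twist \<nu>' id (dual K B)) S"
      \<comment> \<open>A twist leaves the underlying space alone, so \<alpha> is the identity and
        the twist itself is the semilinearity asked of it.\<close>
      show "isomorphic K (HH_lower K A n T B) (tate_Tor K (env K A) (- (n + 1)) (env_right K (regular A)) S)"
        by (rule HH_lower_duality[OF B fB tw T S, where \<alpha> = "\<lambda>x. x"])
          (auto simp: twist_def lin_map_def bij_betw_def) }
    { assume "bimod_complete_resolution K A B S"
      then show "isomorphic K (HH_upper K A n T B)
          (tate_Ext (env K A) (- (n + 1)) S (env_left K (twist (\<nu> \<circ> \<nu>) id (regular A))))"
        by (rule HH_upper_duality[OF B fB T]) }
    assume S: "bimod_complete_resolution K A (regular A) S"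
    show "isomorphic K (HH_upper K A n T (regular A)) (HH_upper K A (- (n + 1)) S (twist (\<nu> \<circ> \<nu>) id (regular A)))"
      using HH_upper_duality[OF R.bimod_alg_axioms fR T S] by (simp add: HH_upper_def)
    \<comment> \<open>For \<open>B\<close> equal to \<open>A\<close> the algebra serves as
      \<open>B'\<close>, with \<phi> after \<nu>' as \<alpha>. Applying \<nu>' to a product
      \<open>a x b\<close> leaves \<open>\<nu>' a\<close> on the left, as required, and
      \<open>\<nu>' b\<close> on the right, which \<open>\<phi>_bimodule\<close> converts into the
      right action of \<open>b\<close>. In this way no twist remains in the homology of
      \<open>A\<close>.\<close>
    have "lin_map K A A \<nu>'" by (rule aut_lin[OF aut'])
    then have "lin_map K (regular A) (regular A) \<nu>'" by (simp add: lin_map_def)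
    note l = lin_map_comp[OF this \<phi>_lin]
    have "bij_betw \<nu>' (carrier A) (carrier A)" using aut' by (simp add: algebra_aut_def ring_iso_def)
    then have b: "bij_betw (\<lambda>x. \<phi> (\<nu>' x)) (carrier (regular A)) (carrier (dual K (regular A)))"
      using bij_betw_trans[OF _ \<phi>_bij, of \<nu>' "carrier A"] by (simp add: comp_def)
    show "isomorphic K (HH_lower K A n T (regular A)) (HH_lower K A (- (n + 1)) S (regular A))"
      unfolding HH_lower_def[of K A "- (n + 1)"]
      by (rule HH_lower_duality[OF R.bimod_alg_axioms fR R.bimod_alg_axioms T S l b])
        (simp add: \<nu>_mult \<phi>_bimodule)
  qed
qed

end
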